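(* Consider the memristive and diffusive Hindmarsh–Rose neural network system and its solution semiflow $\{S(t)\}_{t\ge0}$ described in the context. There exists a constant $D>0$, independent of the initial state, such that for any given bounded set $B \subset G$ there is a finite time $\mathcal{T}_B > 1$ with $$\sup_{g^0 \in B} \left(\sum_{i=1}^m \int_\Omega u_i^4(t,x)\,dx\right) \le D \quad \text{for all } t > \mathcal{T}_B,$$ where $u_i(t,\cdot)$ are the $u$-components of $S(t)g^0$. Consequently, there exists a bounded absorbing set $\widehat{B} \subset G$ for the semiflow $\{S(t)\}_{t\ge0}$.
   Context: Let $m \ge 2$ be an integer and let $\Omega \subset \mathbb{R}^n$, $n \le 3$, be a bounded domain with locally Lipschitz continuous boundary. The parameters $a, b, \eta_1, \eta_2, \alpha, \beta, q, r, \delta, k_1, k_2, P, Q, J_e$ are positive constants, and $u_e, c, \gamma$ are real constants. For $1 \le i \le m$, $t>0$, $x \in \Omega$, the system is $$\partial_t u_i = \eta_1 \Delta u_i + a u_i^2 - b u_i^3 + v_i - w_i + J_e - k_1 (c + \gamma\rho_i + \delta\rho_i^2) u_i + \sum_{j=1}^m P(u_j - u_i),$$ $$\partial_t v_i = \alpha - \beta u_i^2 - v_i, \qquad \partial_t w_i = q(u_i - u_e) - r w_i,$$ $$\partial_t \rho_i = \eta_2 \Delta \rho_i + u_i - k_2 \rho_i + \sum_{j=1}^m Q(\rho_j - \rho_i),$$ with homogeneous Neumann boundary conditions $\partial u_i/\partial\nu = \partial\rho_i/\partial\nu = 0$ on $\partial\Omega$ and initial data $g^0 = \mathrm{col}(u_i^0,v_i^0,w_i^0,\rho_i^0: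 1\le i\le m)$. For each $g^0 \in E = [L^2(\Omega,\mathbb{R}^4)]^m$ this problem has a unique global weak solution $g(t;g^0)$, $t\ge0$, and $S(t)g^0 = g(t;g^0)$ defines the solution semiflow. The Banach space $G = [L^4(\Omega)\times L^2(\Omega,\mathbb{R}^2)\times L^4(\Omega)]^m$ (a subset of $E$ since $\Omega$ is bounded). A bounded set $\widehat B\subset G$ is an absorbing set in $G$ for the semiflow if for every bounded $B\subset G$ there is a finite time $T\ge 0$ with $S(t)B\subset \widehat B$ for all $t>T$. *)

theory Defs
  imports "HOL-Analysis.Analysis"
begin

definition Lp :: "'a::euclidean_space set \<Rightarrow> real \<Rightarrow> ('a \<Rightarrow> real) \<Rightarrow> bool" where
  "Lp \<Omega> p f \<longleftrightarrow> f \<in> borel_measurable (lebesgue_on \<Omega>) \<and>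
      integrable (lebesgue_on \<Omega>) (\<lambda>x. \<bar>f x\<bar> powr p)"

definition Lp_norm :: "'a::euclidean_space set \<Rightarrow> real \<Rightarrow> ('a \<Rightarrow> real) \<Rightarrow> real" where
  "Lp_norm \<Omega> p f = (\<integral>x. \<bar>f x\<bar> powr p \<partial>lebesgue_on \<Omega>) powr (1 / p)"

definition L2_dist :: "'a::euclidean_space set \<Rightarrow> ('a \<Rightarrow> real) \<Rightarrow> ('a \<Rightarrow> real) \<Rightarrow> real" where
  "L2_dist \<Omega> f g = Lp_norm \<Omega> 2 (\<lambda>x. f x - g x)"

definition test_fun :: "'a::euclidean_space set \<Rightarrow> ('a \<Rightarrow> real) \<Rightarrow> bool" where
  "test_fun \<Omega> \<phi> \<longleftrightarrow> (\<forall>x. \<phi> differentiable (at x)) \<and>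
      (\<forall>b. continuous_on UNIV (\<lambda>x. frechet_derivative \<phi> (at x) b)) \<and>
      (\<exists>K. compact K \<and> K \<subseteq> \<Omega> \<and> (\<forall>x. x \<notin> K \<longrightarrow> \<phi> x = 0))"

definition weak_grad :: "'a::euclidean_space set \<Rightarrow> ('a \<Rightarrow> real) \<Rightarrow> ('a \<Rightarrow> 'a) \<Rightarrow> bool" where
  "weak_grad \<Omega> f Df \<longleftrightarrow> (\<forall>b\<in>Basis. Lp \<Omega> 2 (\<lambda>x. Df x \<bullet> b)) \<and>
      (\<forall>\<phi>. test_fun \<Omega> \<phi> \<longrightarrow> (\<forall>b\<in>Basis.
         (\<integral>x. f x * frechet_derivative \<phi> (at x) b \<partial>lebesgue_on \<Omega>) =
         - (\<integral>x. (Df x \<bullet> b) * \<phi> x \<partial>lebesgue_on \<Omega>)))"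

definition H1 :: "'a::euclidean_space set \<Rightarrow> ('a \<Rightarrow> real) \<Rightarrow> bool" where
  "H1 \<Omega> f \<longleftrightarrow> Lp \<Omega> 2 f \<and> (\<exists>Df. weak_grad \<Omega> f Df)"

definition wgrad :: "'a::euclidean_space set \<Rightarrow> ('a \<Rightarrow> real) \<Rightarrow> 'a \<Rightarrow> 'a" where
  "wgrad \<Omega> f = (SOME Df. weak_grad \<Omega> f Df)"

definition lipschitz_boundary :: "'a::euclidean_space set \<Rightarrow> bool" where
  "lipschitz_boundary \<Omega> \<longleftrightarrow> (\<forall>p\<in>frontier \<Omega>. \<exists>e r L h.
      norm e = 1 \<and> r > 0 \<and>
      (\<forall>x y. \<bar>h x - h y\<bar> \<le> L * norm (x - y)) \<and>
      (\<forall>x. h x = h (x - (x \<bullet> e) *\<^sub>R e)) \<and>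
      \<Omega> \<inter> ball p r = {x \<in> ball p r. x \<bullet> e < h x})"

text \<open>A state g = col(u_i, v_i, w_i, rho_i : 1 <= i <= m); only indices 1..m matter.\<close>
record 'a hr_state =
  U :: "nat \<Rightarrow> 'a \<Rightarrow> real"
  V :: "nat \<Rightarrow> 'a \<Rightarrow> real"
  W :: "nat \<Rightarrow> 'a \<Rightarrow> real"
  Rh :: "nat \<Rightarrow> 'a \<Rightarrow> real"

record hr_params =
  hr_a :: real   hr_b :: real   hr_eta1 :: real   hr_eta2 :: real
  hr_alpha :: real   hr_beta :: real   hr_q :: real   hr_r :: real
  hr_delta :: real   hr_k1 :: real   hr_k2 :: real   hr_P :: real
  hr_Q :: real   hr_Je :: real   hr_ue :: real   hr_c :: real   hr_gamma :: real

definition hr_params_ok :: "hr_params \<Rightarrow> bool" where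
  "hr_params_ok p \<longleftrightarrow> hr_a p > 0 \<and> hr_b p > 0 \<and> hr_eta1 p > 0 \<and> hr_eta2 p > 0 \<and>
     hr_alpha p > 0 \<and> hr_beta p > 0 \<and> hr_q p > 0 \<and> hr_r p > 0 \<and> hr_delta p > 0 \<and>
     hr_k1 p > 0 \<and> hr_k2 p > 0 \<and> hr_P p > 0 \<and> hr_Q p > 0 \<and> hr_Je p > 0"

text \<open>Reaction terms (everything except the Laplacians).\<close>
definition F_u :: "hr_params \<Rightarrow> nat \<Rightarrow> 'a hr_state \<Rightarrow> nat \<Rightarrow> 'a \<Rightarrow> real" where
  "F_u p m g i x = hr_a p * (U g i x)^2 - hr_b p * (U g i x)^3 + V g i x - W g i x + hr_Je p
     - hr_k1 p * (hr_c p + hr_gamma p * Rh g i x + hr_delta p * (Rh g i x)^2) * U g i x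
     + (\<Sum>j=1..m. hr_P p * (U g j x - U g i x))"

definition F_v :: "hr_params \<Rightarrow> 'a hr_state \<Rightarrow> nat \<Rightarrow> 'a \<Rightarrow> real" where
  "F_v p g i x = hr_alpha p - hr_beta p * (U g i x)^2 - V g i x"

definition F_w :: "hr_params \<Rightarrow> 'a hr_state \<Rightarrow> nat \<Rightarrow> 'a \<Rightarrow> real" where
  "F_w p g i x = hr_q p * (U g i x - hr_ue p) - hr_r p * W g i x"

definition F_rho :: "hr_params \<Rightarrow> nat \<Rightarrow> 'a hr_state \<Rightarrow> nat \<Rightarrow> 'a \<Rightarrow> real" where
  "F_rho p m g i x = U g i x - hr_k2 p * Rh g i x + (\<Sum>j=1..m. hr_Q p * (Rh g j x - Rh g i x))"

definition in_E :: "'a::euclidean_space set \<Rightarrow> nat \<Rightarrow> 'a hr_state \<Rightarrow> bool" where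
  "in_E \<Omega> m g \<longleftrightarrow> (\<forall>i\<in>{1..m}. Lp \<Omega> 2 (U g i) \<and> Lp \<Omega> 2 (V g i) \<and> Lp \<Omega> 2 (W g i) \<and> Lp \<Omega> 2 (Rh g i))"

definition in_G :: "'a::euclidean_space set \<Rightarrow> nat \<Rightarrow> 'a hr_state \<Rightarrow> bool" where
  "in_G \<Omega> m g \<longleftrightarrow> (\<forall>i\<in>{1..m}. Lp \<Omega> 4 (U g i) \<and> Lp \<Omega> 2 (V g i) \<and> Lp \<Omega> 2 (W g i) \<and> Lp \<Omega> 4 (Rh g i))"

definition G_norm :: "'a::euclidean_space set \<Rightarrow> nat \<Rightarrow> 'a hr_state \<Rightarrow> real" where
  "G_norm \<Omega> m g = (\<Sum>i=1..m. Lp_norm \<Omega> 4 (U g i) + Lp_norm \<Omega> 2 (V g i)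
                              + Lp_norm \<Omega> 2 (W g i) + Lp_norm \<Omega> 4 (Rh g i))"

definition bounded_in_G :: "'a::euclidean_space set \<Rightarrow> nat \<Rightarrow> 'a hr_state set \<Rightarrow> bool" where
  "bounded_in_G \<Omega> m B \<longleftrightarrow> (\<forall>g\<in>B. in_G \<Omega> m g) \<and> (\<exists>C. \<forall>g\<in>B. G_norm \<Omega> m g \<le> C)"

definition absorbing_in_G :: "'a::euclidean_space set \<Rightarrow> nat \<Rightarrow> (real \<Rightarrow> 'a hr_state \<Rightarrow> 'a hr_state)
    \<Rightarrow> 'a hr_state set \<Rightarrow> bool" where
  "absorbing_in_G \<Omega> m S Bh \<longleftrightarrow> bounded_in_G \<Omega> m Bh \<and>
     (\<forall>B. bounded_in_G \<Omega> m B \<longrightarrow> (\<exists>T\<ge>0. \<forall>t>T. \<forall>g\<in>B. S t g \<in> Bh))"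

definition weak_identity :: "'a::euclidean_space set \<Rightarrow> (real \<Rightarrow> 'a \<Rightarrow> real) \<Rightarrow> ('a \<Rightarrow> real)
    \<Rightarrow> (real \<Rightarrow> real) \<Rightarrow> real \<Rightarrow> real \<Rightarrow> bool" where
  "weak_identity \<Omega> f \<psi> rhs s t \<longleftrightarrow> set_integrable lborel {s..t} rhs \<and>
     (\<integral>x. f t x * \<psi> x \<partial>lebesgue_on \<Omega>) - (\<integral>x. f s x * \<psi> x \<partial>lebesgue_on \<Omega>) = (LINT \<tau>:{s..t}|lborel. rhs \<tau>)"

definition test_space :: "'a::euclidean_space set \<Rightarrow> ('a \<Rightarrow> real) \<Rightarrow> bool" where
  "test_space \<Omega> \<psi> \<longleftrightarrow> H1 \<Omega> \<psi> \<and> (\<exists>C. AE x in lebesgue_on \<Omega>. \<bar>\<psi> x\<bar> \<le> C)"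

definition hr_weak_solution :: "'a::euclidean_space set \<Rightarrow> hr_params \<Rightarrow> nat \<Rightarrow> 'a hr_state
    \<Rightarrow> (real \<Rightarrow> 'a hr_state) \<Rightarrow> bool" where
  "hr_weak_solution \<Omega> p m g0 g \<longleftrightarrow>
    \<comment> \<open>initial condition (in L^2)\<close>
    (\<forall>i\<in>{1..m}. L2_dist \<Omega> (U (g 0) i) (U g0 i) = 0 \<and> L2_dist \<Omega> (V (g 0) i) (V g0 i) = 0 \<and>
                 L2_dist \<Omega> (W (g 0) i) (W g0 i) = 0 \<and> L2_dist \<Omega> (Rh (g 0) i) (Rh g0 i) = 0) \<and>
    \<comment> \<open>g in C([0,oo); E)\<close>
    (\<forall>t\<ge>0. in_E \<Omega> m (g t)) \<and>
    (\<forall>i\<in>{1..m}. \<forall>t0\<ge>0.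
        ((\<lambda>t. L2_dist \<Omega> (U (g t) i) (U (g t0) i)) \<longlongrightarrow> 0) (at t0 within {0..}) \<and>
        ((\<lambda>t. L2_dist \<Omega> (V (g t) i) (V (g t0) i)) \<longlongrightarrow> 0) (at t0 within {0..}) \<and>
        ((\<lambda>t. L2_dist \<Omega> (W (g t) i) (W (g t0) i)) \<longlongrightarrow> 0) (at t0 within {0..}) \<and>
        ((\<lambda>t. L2_dist \<Omega> (Rh (g t) i) (Rh (g t0) i)) \<longlongrightarrow> 0) (at t0 within {0..})) \<and>
    \<comment> \<open>u_i, rho_i in L^2(0,T;H^1), u_i in L^4(Omega x (0,T))\<close>
    (\<forall>T>0. \<forall>i\<in>{1..m}.
        (AE t in lebesgue_on {0..T}. H1 \<Omega> (U (g t) i) \<and> H1 \<Omega> (Rh (g t) i) \<and> Lp \<Omega> 4 (U (g t) i)) \<and>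
        set_integrable lborel {0..T} (\<lambda>t. \<integral>x. (norm (wgrad \<Omega> (U (g t) i) x))^2 \<partial>lebesgue_on \<Omega>) \<and>
        set_integrable lborel {0..T} (\<lambda>t. \<integral>x. (norm (wgrad \<Omega> (Rh (g t) i) x))^2 \<partial>lebesgue_on \<Omega>) \<and>
        set_integrable lborel {0..T} (\<lambda>t. \<integral>x. (U (g t) i x)^4 \<partial>lebesgue_on \<Omega>)) \<and>
    \<comment> \<open>the equations in weak form; testing with H^1 functions encodes the Neumann condition\<close>
    (\<forall>i\<in>{1..m}. \<forall>\<psi>. test_space \<Omega> \<psi> \<longrightarrow> (\<forall>s t. 0 \<le> s \<and> s \<le> t \<longrightarrow>
        (AE \<tau> in lebesgue_on {s..t}.
           integrable (lebesgue_on \<Omega>) (\<lambda>x. F_u p m (g \<tau>) i x * \<psi> x) \<and>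
           integrable (lebesgue_on \<Omega>) (\<lambda>x. F_v p (g \<tau>) i x * \<psi> x) \<and>
           integrable (lebesgue_on \<Omega>) (\<lambda>x. F_w p (g \<tau>) i x * \<psi> x) \<and>
           integrable (lebesgue_on \<Omega>) (\<lambda>x. F_rho p m (g \<tau>) i x * \<psi> x)) \<and>
        weak_identity \<Omega> (\<lambda>\<tau>. U (g \<tau>) i) \<psi>
          (\<lambda>\<tau>. - hr_eta1 p * (\<integral>x. wgrad \<Omega> (U (g \<tau>) i) x \<bullet> wgrad \<Omega> \<psi> x \<partial>lebesgue_on \<Omega>)
                + (\<integral>x. F_u p m (g \<tau>) i x * \<psi> x \<partial>lebesgue_on \<Omega>)) s t \<and>
        weak_identity \<Omega> (\<lambda>\<tau>. V (g \<tau>) i) \<psi>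
          (\<lambda>\<tau>. \<integral>x. F_v p (g \<tau>) i x * \<psi> x \<partial>lebesgue_on \<Omega>) s t \<and>
        weak_identity \<Omega> (\<lambda>\<tau>. W (g \<tau>) i) \<psi>
          (\<lambda>\<tau>. \<integral>x. F_w p (g \<tau>) i x * \<psi> x \<partial>lebesgue_on \<Omega>) s t \<and>
        weak_identity \<Omega> (\<lambda>\<tau>. Rh (g \<tau>) i) \<psi>
          (\<lambda>\<tau>. - hr_eta2 p * (\<integral>x. wgrad \<Omega> (Rh (g \<tau>) i) x \<bullet> wgrad \<Omega> \<psi> x \<partial>lebesgue_on \<Omega>)
                + (\<integral>x. F_rho p m (g \<tau>) i x * \<psi> x \<partial>lebesgue_on \<Omega>)) s t))"

end

theory Submission
  imports Defs
begin

text \<open>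
  The Lyapunov functional \<open>Y = \<Sum>\<^sub>i \<integral> u\<^sub>i\<^sup>4 + K (v\<^sub>i\<^sup>2 + w\<^sub>i\<^sup>2) + \<rho>\<^sub>i\<^sup>4\<close> satisfies
  \<open>Y(t) - Y(s) \<le> \<integral>\<^sub>s\<^sup>t (M - \<mu> Y)\<close>: diffusion and coupling contribute with a good sign, the memristive term is
  bounded below because \<open>\<delta> > 0\<close>, and \<open>-b u\<^sup>3 \<cdot> 4 u\<^sup>3\<close> absorbs everything else for \<open>K\<close> large. An integral form
  of Gronwall's lemma then yields the absorbing bound.

  A weak solution may only be tested with bounded \<open>H\<^sup>1\<close> functions that do not depend on time. So for a
  convex \<open>\<Phi>\<close> with bounded derivatives the increment from \<open>t\<close> to \<open>t'\<close> is tested with \<open>\<Phi>'(u(t'))\<close>, for which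
  convexity gives \<open>\<Phi>(u(t')) - \<Phi>(u(t)) \<le> \<Phi>'(u(t')) (u(t') - u(t))\<close>; averaging over the endpoints and
  letting \<open>t' - t\<close> tend to 0 leaves an error that vanishes by \<open>L\<^sup>1\<close>-continuity of translations in time. The chain
  rule for \<open>\<Phi>'(u)\<close> comes from mollification. Finally \<open>\<Phi>\<close> increases to the fourth (or second) power.
\<close>

section \<open>Continuity of translations in \<open>L\<^sup>1\<close>\<close>

text \<open>The definition of a weak solution speaks about each time separately: nothing makes
  \<open>U (g t) i x\<close>, or the gradient \<open>wgrad\<close> chosen by \<open>SOME\<close> at
  every time, measurable in the pair (t, x). Fubini and translations in time need exactly that, so
  continuity in L^2 and mollified derivatives are used to build jointly Borel versions. For v and w
  no spatial regularity is given, so \<Phi>'(v) need not be an admissible test function; their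
  equations are recovered pointwise almost everywhere instead. The constants resolve a feedback
  loop. The v and w equations feed u^4 into the balance of v^2 + w^2, and the u equation returns
  (4/b)(v^2 + w^2). The factor 4/b does not depend on how much damping is demanded from the cubic
  term. So K is fixed by 4/b and r, the demanded u^4 damping L by K, and only an additive constant
  pays for a large L. Hence the bound D depends on the parameters, m and the volume of \<Omega>
  alone.\<close>

lemma integrable_translate:
  fixes f :: "'a::euclidean_space \<Rightarrow> real"
  assumes "integrable lborel f"
  shows "integrable lborel (\<lambda>x. f (x + c))"
proof -
  have "integrable (distr lborel borel ((+) c)) f" using assms by (simp add: lborel_distr_plus)
  then show ?thesis using assms by (subst (asm) integrable_distr_eq) (auto simp: add.commute)
qed

lemma integral_translate:
  fixes f :: "'a::euclidean_space \<Rightarrow> real"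
  assumes [measurable]: "f \<in> borel_measurable borel"
  shows "(\<integral>x. f (x + c) \<partial>lborel) = (\<integral>x. f x \<partial>lborel)"
proof -
  have "(\<integral>x. f x \<partial>(distr lborel borel ((+) c))) = (\<integral>x. f (c + x) \<partial>lborel)"
    by (rule integral_distr) auto
  then show ?thesis by (simp add: lborel_distr_plus add.commute)
qed

text \<open>For values 0 and 1, |a - b| = a + b - 2ab, so only the overlap of S with its translate
  matters. The product converges at every point: inside S openness keeps \<open>x + h n\<close> in S
  eventually, outside S the second factor is 0, so boundary points cause no trouble.\<close>

lemma translation_L1_open:
  fixes h :: "nat \<Rightarrow> 'a::euclidean_space"
  assumes "open S" "emeasure lborel S < \<infinity>" "h \<longlonglongrightarrow> 0"
  shows "(\<lambda>n. \<integral>x. \<bar>indicator S (x + h n) - indicator S x :: real\<bar> \<partial>lborel) \<longlonglongrightarrow> 0"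
proof -
  have [measurable]: "S \<in> sets borel" using assms by auto
  have int: "integrable lborel (indicator S :: 'a \<Rightarrow> real)"
    using assms by (auto simp: integrable_indicator_iff)
  have int2: "integrable lborel (\<lambda>x. indicator S (x + h n) * indicator S x :: real)" for n
    by (rule Bochner_Integration.integrable_bound[OF int]) (auto simp: indicator_def)
  have lim: "(\<lambda>n. \<integral>x. (indicator S (x + h n) * indicator S x :: real) \<partial>lborel) \<longlonglongrightarrow> (\<integral>x. indicator S x \<partial>lborel)"
  proof (rule integral_dominated_convergence[where w="indicator S"])
    show "AE x in lborel. (\<lambda>n. indicator S (x + h n) * indicator S x :: real) \<longlonglongrightarrow> indicator S x"
    proof (rule AE_I2)
      fix x
      show "(\<lambda>n. indicator S (x + h n) * indicator S x :: real) \<longlonglongrightarrow> indicator S x"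
      proof (cases "x \<in> S")
        case True
        have "(\<lambda>n. x + h n) \<longlonglongrightarrow> x + 0" by (intro tendsto_intros assms)
        then have "\<forall>\<^sub>F n in sequentially. x + h n \<in> S"
          using assms(1) True by (simp add: topological_tendstoD)
        then have "\<forall>\<^sub>F n in sequentially. indicator S (x + h n) * indicator S x = (1::real)"
          by eventually_elim (use True in auto)
        then show ?thesis using True by (simp add: tendsto_eventually)
      qed auto
    qed
  qed (use int in \<open>auto simp: indicator_def\<close>)
  have eq: "(\<integral>x. \<bar>indicator S (x + h n) - indicator S x :: real\<bar> \<partial>lborel)
    = 2 * (\<integral>x. indicator S x \<partial>lborel) - 2 * (\<integral>x. (indicator S (x + h n) * indicator S x :: real) \<partial>lborel)" for n
  proof -
    have "(\<integral>x. \<bar>indicator S (x + h n) - indicator S x :: real\<bar> \<partial>lborel)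
      = (\<integral>x. indicator S (x + h n) + indicator S x - 2 * (indicator S (x + h n) * indicator S x :: real) \<partial>lborel)"
      by (rule Bochner_Integration.integral_cong) (auto simp: indicator_def)
    also have "\<dots> = (\<integral>x. indicator S (x + h n) \<partial>lborel) + (\<integral>x. indicator S x \<partial>lborel) - 2 * (\<integral>x. (indicator S (x + h n) * indicator S x :: real) \<partial>lborel)"
      using int integrable_translate[OF int, of "h n"] int2[of n] by simp
    finally show ?thesis using integral_translate[of "indicator S" "h n"] by simp
  qed
  have "(\<lambda>n. 2 * (\<integral>x. indicator S x \<partial>lborel) - 2 * (\<integral>x. (indicator S (x + h n) * indicator S x :: real) \<partial>lborel))
     \<longlonglongrightarrow> 2 * (\<integral>x. indicator S x \<partial>lborel) - 2 * (\<integral>x. indicator S x \<partial>lborel)"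
    by (intro tendsto_intros lim)
  then show ?thesis by (simp add: eq)
qed

text \<open>The property is closed under L^1 limits: in the usual three-term estimate translation
  invariance makes the two outer terms equal, hence both at most e/4.\<close>

lemma translation_L1_approx:
  fixes f :: "'a::euclidean_space \<Rightarrow> real"
  assumes f: "integrable lborel f"
    and approx: "\<And>e. e > 0 \<Longrightarrow> \<exists>g. integrable lborel g \<and> (\<integral>x. \<bar>g x - f x\<bar> \<partial>lborel) \<le> e \<and>
        (\<lambda>n. \<integral>x. \<bar>g (x + h n) - g x\<bar> \<partial>lborel) \<longlonglongrightarrow> 0"
  shows "(\<lambda>n. \<integral>x. \<bar>f (x + h n) - f x\<bar> \<partial>lborel) \<longlonglongrightarrow> 0"
proof (rule LIMSEQ_I)
  fix e :: real assume "e > 0"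
  then obtain g where g: "integrable lborel g" "(\<integral>x. \<bar>g x - f x\<bar> \<partial>lborel) \<le> e/4"
    "(\<lambda>n. \<integral>x. \<bar>g (x + h n) - g x\<bar> \<partial>lborel) \<longlonglongrightarrow> 0"
    using approx[of "e/4"] by auto
  obtain N where N: "\<And>n. n \<ge> N \<Longrightarrow> norm ((\<integral>x. \<bar>g (x + h n) - g x\<bar> \<partial>lborel) - 0) < e/4"
    using LIMSEQ_D[OF g(3), of "e/4"] \<open>e > 0\<close> by auto
  have "(\<integral>x. \<bar>f (x + h n) - f x\<bar> \<partial>lborel) < e" if "n \<ge> N" for n
  proof -
    note I = f g(1) integrable_translate[OF f, of "h n"] integrable_translate[OF g(1), of "h n"]
    have "(\<integral>x. \<bar>f (x + h n) - f x\<bar> \<partial>lborel) \<le>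
      (\<integral>x. \<bar>g (x + h n) - f (x + h n)\<bar> + \<bar>g (x + h n) - g x\<bar> + \<bar>g x - f x\<bar> \<partial>lborel)"
      by (rule integral_mono) (use I in auto)
    also have "\<dots> = (\<integral>x. \<bar>g (x + h n) - f (x + h n)\<bar> \<partial>lborel) + (\<integral>x. \<bar>g (x + h n) - g x\<bar> \<partial>lborel) + (\<integral>x. \<bar>g x - f x\<bar> \<partial>lborel)"
      using I by simp
    also have "(\<integral>x. \<bar>g (x + h n) - f (x + h n)\<bar> \<partial>lborel) = (\<integral>x. \<bar>g x - f x\<bar> \<partial>lborel)"
      by (rule integral_translate[of "\<lambda>x. \<bar>g x - f x\<bar>"]) (use f g(1) in auto)
    finally show ?thesis using N[OF that] g(2) \<open>e > 0\<close> by simp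
  qed
  then show "\<exists>N. \<forall>n\<ge>N. norm ((\<integral>x. \<bar>f (x + h n) - f x\<bar> \<partial>lborel) - 0) < e"
    by (auto intro!: exI[of _ N])
qed

lemma translation_L1:
  fixes f :: "'a::euclidean_space \<Rightarrow> real"
  assumes "integrable lborel f" and h: "h \<longlonglongrightarrow> 0"
  shows "(\<lambda>n. \<integral>x. \<bar>f (x + h n) - f x\<bar> \<partial>lborel) \<longlonglongrightarrow> 0"
  using assms(1)
proof (induction rule: integrable_induct)
  case (base A c)
  have [measurable]: "A \<in> sets borel" using base by auto
  have intA: "integrable lborel (indicator A :: 'a \<Rightarrow> real)"
    using base by (auto simp: integrable_indicator_iff)
  have *: "(\<lambda>n. \<integral>x. \<bar>indicator A (x + h n) - indicator A x :: real\<bar> \<partial>lborel) \<longlonglongrightarrow> 0"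
  proof (rule translation_L1_approx[OF intA])
    fix e :: real assume "e > 0"
    \<comment> \<open>Outer regularity replaces the Borel set A by an open superset, for which the
      openness argument is available.\<close>
    then obtain S where S: "open S" "A \<subseteq> S" "emeasure lborel (S - A) < ennreal e"
      using outer_regular_lborel[of A e] by auto
    have [measurable]: "S \<in> sets borel" using S by auto
    have "emeasure lborel S = emeasure lborel A + emeasure lborel (S - A)"
      using S by (subst plus_emeasure) (auto simp: Un_absorb1)
    then have fin: "emeasure lborel S < \<infinity>" using base S(3)
      by (metis ennreal_add_less_top infinity_ennreal_def less_trans ennreal_less_top)
    have "(\<integral>x. \<bar>indicator S x - indicator A x :: real\<bar> \<partial>lborel) = (\<integral>x. indicator (S - A) x \<partial>lborel)"
      using S by (intro Bochner_Integration.integral_cong) (auto simp: indicator_def)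
    also have "\<dots> \<le> e" using S(3) \<open>e > 0\<close>
      by (simp add: measure_def enn2real_leI)
    finally show "\<exists>g. integrable lborel g \<and> (\<integral>x. \<bar>g x - indicator A x :: real\<bar> \<partial>lborel) \<le> e \<and>
        (\<lambda>n. \<integral>x. \<bar>g (x + h n) - g x\<bar> \<partial>lborel) \<longlonglongrightarrow> 0"
      using translation_L1_open[OF S(1) fin h] fin
      by (intro exI[of _ "indicator S"]) (auto simp: integrable_indicator_iff)
  qed
  have "(\<integral>x. \<bar>indicator A (x + h n) *\<^sub>R c - indicator A x *\<^sub>R c\<bar> \<partial>lborel)
     = (\<integral>x. \<bar>indicator A (x + h n) - indicator A x :: real\<bar> \<partial>lborel) * \<bar>c\<bar>" for n
    by (simp add: left_diff_distrib[symmetric] abs_mult)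
  then show ?case using tendsto_mult_right[OF *, of "\<bar>c\<bar>"] by simp
next
  case (add f g)
  note I = add(1,2) integrable_translate[OF add(1)] integrable_translate[OF add(2)]
  show ?case
  proof (rule tendsto_sandwich[OF _ _ tendsto_const])
    show "\<forall>\<^sub>F n in sequentially. (\<integral>x. \<bar>f (x + h n) + g (x + h n) - (f x + g x)\<bar> \<partial>lborel)
      \<le> (\<integral>x. \<bar>f (x + h n) - f x\<bar> \<partial>lborel) + (\<integral>x. \<bar>g (x + h n) - g x\<bar> \<partial>lborel)"
    proof (rule always_eventually, rule allI)
      fix n
      have "(\<integral>x. \<bar>f (x + h n) + g (x + h n) - (f x + g x)\<bar> \<partial>lborel)
        \<le> (\<integral>x. \<bar>f (x + h n) - f x\<bar> + \<bar>g (x + h n) - g x\<bar> \<partial>lborel)"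
        by (rule integral_mono) (use I in auto)
      then show "(\<integral>x. \<bar>f (x + h n) + g (x + h n) - (f x + g x)\<bar> \<partial>lborel)
      \<le> (\<integral>x. \<bar>f (x + h n) - f x\<bar> \<partial>lborel) + (\<integral>x. \<bar>g (x + h n) - g x\<bar> \<partial>lborel)"
        using I by simp
    qed
    show "(\<lambda>n. (\<integral>x. \<bar>f (x + h n) - f x\<bar> \<partial>lborel) + (\<integral>x. \<bar>g (x + h n) - g x\<bar> \<partial>lborel)) \<longlonglongrightarrow> 0"
      using tendsto_add[OF add(3,4)] by simp
  qed auto
next
  case (lim f s)
  show ?case
  proof (rule translation_L1_approx[OF lim(4)])
    fix e :: real assume "e > 0"
    have "(\<lambda>i. \<integral>x. \<bar>s i x - f x\<bar> \<partial>lborel) \<longlonglongrightarrow> (\<integral>x. 0 \<partial>(lborel :: 'a measure))"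
    proof (rule integral_dominated_convergence[where w="\<lambda>x. 3 * \<bar>f x\<bar>"])
      show "AE x in lborel. (\<lambda>i. \<bar>s i x - f x\<bar>) \<longlonglongrightarrow> 0"
        using lim(2) by (auto intro!: AE_I2 tendsto_rabs_zero simp: LIM_zero)
      show "\<And>i. AE x in lborel. norm \<bar>s i x - f x\<bar> \<le> 3 * \<bar>f x\<bar>"
      proof (rule AE_I2)
        fix i x show "norm \<bar>s i x - f x\<bar> \<le> 3 * \<bar>f x\<bar>" using lim(3)[of x i] by simp
      qed
    qed (use lim(1,4) in auto)
    then obtain i where "(\<integral>x. \<bar>s i x - f x\<bar> \<partial>lborel) < e"
      using order_tendstoD(2)[of _ "0" sequentially e] \<open>e > 0\<close>
      by (auto simp: eventually_sequentially)
    then show "\<exists>g. integrable lborel g \<and> (\<integral>x. \<bar>g x - f x\<bar> \<partial>lborel) \<le> e \<and>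
        (\<lambda>n. \<integral>x. \<bar>g (x + h n) - g x\<bar> \<partial>lborel) \<longlonglongrightarrow> 0"
      using lim(1) lim(5)[of i] by (intro exI[of _ "s i"]) auto
  qed
qed

section \<open>Jointly measurable versions of parametrised L^1 limits\<close>

text \<open>For each s some subsequence of \<open>g k s\<close> converges almost everywhere, but it
  depends on s. Choosing its indices by \<open>LEAST\<close> from conditions measurable in s keeps
  the limit jointly measurable. G is one function, fixed before any s or d, and agrees with the
  limit d at every s where one exists.\<close>

lemma joint_limit:
  fixes g :: "nat \<Rightarrow> 's \<Rightarrow> 'x \<Rightarrow> real"
  assumes N: "sigma_finite_measure N"
    and g[measurable]: "\<And>k. (\<lambda>(s,x). g k s x) \<in> borel_measurable (M \<Otimes>\<^sub>M N)"
  obtains G where "(\<lambda>(s,x). G s x) \<in> borel_measurable (M \<Otimes>\<^sub>M N)"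
    and "\<And>s d. s \<in> space M \<Longrightarrow> d \<in> borel_measurable N \<Longrightarrow>
      (\<lambda>k. \<integral>\<^sup>+x. ennreal \<bar>g k s x - d x\<bar> \<partial>N) \<longlonglongrightarrow> 0 \<Longrightarrow> AE x in N. G s x = d x"
proof -
  interpret sigma_finite_measure N by (rule N)
  \<comment> \<open>A Cauchy condition, because the limit d is not known to depend measurably on
    s.\<close>
  define P where "P j n s \<longleftrightarrow> (\<forall>k\<ge>n. \<forall>l\<ge>n. (\<integral>\<^sup>+x. ennreal \<bar>g k s x - g l s x\<bar> \<partial>N) \<le> ennreal ((1/2)^j))" for j n :: nat and s
  have [measurable]: "Measurable.pred M (P j n)" for j n
    unfolding P_def by measurable
  define i where "i j s = (LEAST n. P j n s)" for j s
  have [measurable]: "i j \<in> measurable M (count_space UNIV)" for j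
    unfolding i_def by measurable
  \<comment> \<open>Where the sequence diverges \<open>lim\<close> has an arbitrary value; G is
    measurable all the same, and nothing is claimed about it there.\<close>
  define G where "G s x = lim (\<lambda>j. g (i j s) s x)" for s x
  \<comment> \<open>A measurable index with countably many values: the functions \<open>g n\<close>
    are glued along the sets where the index equals n.\<close>
  have [measurable]: "(\<lambda>p. g (i j (fst p)) (fst p) (snd p)) \<in> borel_measurable (M \<Otimes>\<^sub>M N)" for j
    by (rule measurable_compose_countable[where f="\<lambda>n p. g n (fst p) (snd p)"]) (use g in \<open>auto simp: split_beta'\<close>)
  have "(\<lambda>(s,x). G s x) \<in> borel_measurable (M \<Otimes>\<^sub>M N)"
    unfolding G_def split_beta' by (rule borel_measurable_lim_metric) simp
  moreover have "AE x in N. G s x = d x"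
    if s: "s \<in> space M" and d[measurable]: "d \<in> borel_measurable N"
      and conv: "(\<lambda>k. \<integral>\<^sup>+x. ennreal \<bar>g k s x - d x\<bar> \<partial>N) \<longlonglongrightarrow> 0" for s d
  proof -
    have [measurable]: "g k s \<in> borel_measurable N" for k
      using measurable_Pair2[OF g s] by simp
    have tri: "(\<integral>\<^sup>+x. ennreal \<bar>a x - c x\<bar> \<partial>N) \<le> (\<integral>\<^sup>+x. ennreal \<bar>a x - b x\<bar> \<partial>N) + (\<integral>\<^sup>+x. ennreal \<bar>b x - c x\<bar> \<partial>N)"
      if [measurable]: "a \<in> borel_measurable N" "b \<in> borel_measurable N" "c \<in> borel_measurable N" for a b c :: "'x \<Rightarrow> real"
    proof -
      have "(\<integral>\<^sup>+x. ennreal \<bar>a x - c x\<bar> \<partial>N) \<le> (\<integral>\<^sup>+x. ennreal \<bar>a x - b x\<bar> + ennreal \<bar>b x - c x\<bar> \<partial>N)"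
        by (intro nn_integral_mono) (auto simp flip: ennreal_plus)
      then show ?thesis by (simp add: nn_integral_add)
    qed
    have ex: "\<exists>n. P j n s" for j
    proof -
      have "\<forall>\<^sub>F k in sequentially. (\<integral>\<^sup>+x. ennreal \<bar>g k s x - d x\<bar> \<partial>N) < ennreal ((1/2)^j/2)"
        using order_tendstoD(2)[OF conv, of "ennreal ((1/2)^j/2)"] by simp
      then obtain n where n: "\<And>k. k \<ge> n \<Longrightarrow> (\<integral>\<^sup>+x. ennreal \<bar>g k s x - d x\<bar> \<partial>N) < ennreal ((1/2)^j/2)"
        by (auto simp: eventually_sequentially)
      have "(\<integral>\<^sup>+x. ennreal \<bar>g k s x - g l s x\<bar> \<partial>N) \<le> ennreal ((1/2)^j)" if "k \<ge> n" "l \<ge> n" for k l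
      proof -
        have "(\<integral>\<^sup>+x. ennreal \<bar>g k s x - g l s x\<bar> \<partial>N) \<le> (\<integral>\<^sup>+x. ennreal \<bar>g k s x - d x\<bar> \<partial>N) + (\<integral>\<^sup>+x. ennreal \<bar>d x - g l s x\<bar> \<partial>N)"
          by (rule tri) auto
        also have "\<dots> \<le> ennreal ((1/2)^j/2) + ennreal ((1/2)^j/2)"
          using n[OF that(1)] n[OF that(2)] by (intro add_mono) (auto simp: abs_minus_commute)
        finally show ?thesis by (simp flip: ennreal_plus)
      qed
      then show ?thesis unfolding P_def by blast
    qed
    have Pi: "P j (i j s) s" for j unfolding i_def using LeastI_ex[OF ex] .
    have le: "(\<integral>\<^sup>+x. ennreal \<bar>g (i j s) s x - d x\<bar> \<partial>N) \<le> ennreal ((1/2)^j)" for j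
    proof -
      have "(\<lambda>l. ennreal ((1/2)^j) + (\<integral>\<^sup>+x. ennreal \<bar>g l s x - d x\<bar> \<partial>N)) \<longlonglongrightarrow> ennreal ((1/2)^j) + 0"
        by (intro tendsto_intros conv)
      moreover have "\<forall>\<^sub>F l in sequentially. (\<integral>\<^sup>+x. ennreal \<bar>g (i j s) s x - d x\<bar> \<partial>N) \<le> ennreal ((1/2)^j) + (\<integral>\<^sup>+x. ennreal \<bar>g l s x - d x\<bar> \<partial>N)"
        using eventually_ge_at_top[of "i j s"]
      proof eventually_elim
        case (elim l)
        have "(\<integral>\<^sup>+x. ennreal \<bar>g (i j s) s x - d x\<bar> \<partial>N) \<le> (\<integral>\<^sup>+x. ennreal \<bar>g (i j s) s x - g l s x\<bar> \<partial>N) + (\<integral>\<^sup>+x. ennreal \<bar>g l s x - d x\<bar> \<partial>N)"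
          by (rule tri) auto
        also have "(\<integral>\<^sup>+x. ennreal \<bar>g (i j s) s x - g l s x\<bar> \<partial>N) \<le> ennreal ((1/2)^j)"
          using Pi[of j] elim unfolding P_def by blast
        finally show ?case by simp
      qed
      ultimately show ?thesis
        by (intro tendsto_lowerbound[where F=sequentially]) auto
    qed
    have "(\<integral>\<^sup>+x. (\<Sum>j. ennreal \<bar>g (i j s) s x - d x\<bar>) \<partial>N) = (\<Sum>j. \<integral>\<^sup>+x. ennreal \<bar>g (i j s) s x - d x\<bar> \<partial>N)"
      by (rule nn_integral_suminf) simp
    also have "\<dots> \<le> (\<Sum>j. ennreal ((1/2)^j))" by (intro suminf_le le) auto
    also have "\<dots> = ennreal (\<Sum>j. (1/2)^j)" by (rule suminf_ennreal2) (auto intro: summable_geometric)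
    finally have "(\<integral>\<^sup>+x. (\<Sum>j. ennreal \<bar>g (i j s) s x - d x\<bar>) \<partial>N) \<noteq> \<infinity>"
      using ennreal_less_top[of "\<Sum>j. (1/2)^j"] by (metis infinity_ennreal_def leD)
    \<comment> \<open>The L^1 errors (1/2)^j are summable, so the sum of the errors is finite almost
      everywhere and its terms tend to 0 there.\<close>
    then have "AE x in N. (\<Sum>j. ennreal \<bar>g (i j s) s x - d x\<bar>) \<noteq> \<infinity>"
      by (intro nn_integral_noteq_infinite) auto
    then show ?thesis
    proof eventually_elim
      case (elim x)
      then have "summable (\<lambda>j. \<bar>g (i j s) s x - d x\<bar>)"
        by (intro summable_suminf_not_top) (auto simp: top_ennreal_def)
      then have "(\<lambda>j. g (i j s) s x) \<longlonglongrightarrow> d x"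
        using summable_LIMSEQ_zero tendsto_rabs_zero_iff LIM_zero_iff by blast
      then show ?case unfolding G_def by (rule limI)
    qed
  qed
  ultimately show ?thesis using that by blast
qed

section \<open>Mollification\<close>

text \<open>Translation invariance makes every difference quotient integrate to 0. The mean value
  theorem bounds the quotients by L and the bounded support confines them to one ball, so dominated
  convergence applies.\<close>

lemma integral_directional_derivative_zero:
  fixes G :: "'a::euclidean_space \<Rightarrow> real"
  assumes [measurable]: "G \<in> borel_measurable borel"
    and der: "\<And>x. ((\<lambda>s. G (x + s *\<^sub>R b)) has_real_derivative Gb x) (at 0)"
    and bd: "\<And>x. \<bar>Gb x\<bar> \<le> L"
    and supp: "bounded K" "\<And>x. x \<notin> K \<Longrightarrow> G x = 0"
    and intG: "integrable lborel G"
  shows "(\<integral>x. Gb x \<partial>lborel) = 0"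
proof -
  define e where "e n = 1 / (real n + 1)" for n
  have e: "e n > 0" "e n \<le> 1" for n by (auto simp: e_def)
  have e0: "e \<longlonglongrightarrow> 0" unfolding e_def using LIMSEQ_Suc[OF lim_1_over_n] by (simp add: add.commute)
  define q where "q n x = (G (x + e n *\<^sub>R b) - G x) / e n" for n x
  have der': "((\<lambda>s. G (x + s *\<^sub>R b)) has_real_derivative Gb (x + s0 *\<^sub>R b)) (at s0)" for x s0
  proof -
    have "((\<lambda>s. G (x + s0 *\<^sub>R b + s *\<^sub>R b)) has_real_derivative Gb (x + s0 *\<^sub>R b)) (at 0)" by (rule der)
    then show ?thesis
      using DERIV_at_within_shift[of "\<lambda>s. G (x + s *\<^sub>R b)" _ s0 0 UNIV]
      by (simp add: scaleR_add_left add.assoc)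
  qed
  have qb: "\<bar>q n x\<bar> \<le> L" for n x
  proof -
    obtain z where "G (x + e n *\<^sub>R b) - G (x + 0 *\<^sub>R b) = (e n - 0) * Gb (x + z *\<^sub>R b)"
      using MVT2[of 0 "e n" "\<lambda>s. G (x + s *\<^sub>R b)" "\<lambda>s. Gb (x + s *\<^sub>R b)"] der' e[of n] by blast
    then have "q n x = Gb (x + z *\<^sub>R b)" using e[of n] by (simp add: q_def)
    then show ?thesis using bd by simp
  qed
  obtain R where R: "R > 0" "\<And>x. x \<in> K \<Longrightarrow> norm x \<le> R" using supp(1) bounded_pos by blast
  \<comment> \<open>The steps \<open>e n\<close> are at most 1, so a quotient at x can reach K only
    within distance norm b.\<close>
  define B where "B = cball (0::'a) (R + norm b)"
  have q0: "q n x = 0" if "x \<notin> B" for n x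
  proof -
    have "norm x > R + norm b" using that by (simp add: B_def)
    moreover have "norm x \<le> norm (x + e n *\<^sub>R b) + norm (e n *\<^sub>R b)"
      by (metis add_diff_cancel_right' norm_triangle_ineq4)
    moreover have "norm (e n *\<^sub>R b) \<le> norm b" using e[of n] by (simp add: mult_left_le_one_le)
    ultimately have "x \<notin> K" "x + e n *\<^sub>R b \<notin> K" using R(2)[of x] R(2)[of "x + e n *\<^sub>R b"] norm_ge_zero[of b] by linarith+
    then show ?thesis using supp by (simp add: q_def)
  qed
  have lim: "(\<lambda>n. q n x) \<longlonglongrightarrow> Gb x" for x
  proof -
    have "((\<lambda>s. (G (x + s *\<^sub>R b) - G x) / s) \<longlongrightarrow> Gb x) (at 0)"
      using der[of x] by (simp add: DERIV_def)
    moreover have "filterlim e (at 0) sequentially"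
      using e0 e by (auto simp: filterlim_at less_imp_neq intro!: always_eventually) (metis less_irrefl)
    ultimately show ?thesis unfolding q_def by (rule filterlim_compose)
  qed
  have [measurable]: "q n \<in> borel_measurable borel" for n unfolding q_def by measurable
  have Gbm: "Gb \<in> borel_measurable borel"
    by (rule borel_measurable_LIMSEQ_metric[of q]) (use lim in auto)
  have "(\<lambda>n. \<integral>x. q n x \<partial>lborel) \<longlonglongrightarrow> (\<integral>x. Gb x \<partial>lborel)"
  proof (rule integral_dominated_convergence[where w="\<lambda>x. L * indicator B x"])
    show "integrable lborel (\<lambda>x. L * indicator B x)"
      unfolding B_def using emeasure_lborel_cball_finite[of "0::'a" "R + norm b"]
      by (intro integrable_mult_right integrable_real_indicator) auto
    show "AE x in lborel. norm (q n x) \<le> L * indicator B x" for n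
      using qb[of n] q0[of _ n] by (auto simp: indicator_def)
  qed (use Gbm lim in auto)
  moreover have "(\<integral>x. q n x \<partial>lborel) = 0" for n
    using intG integrable_translate[OF intG, of "e n *\<^sub>R b"] integral_translate[of G "e n *\<^sub>R b"] by (simp add: q_def)
  ultimately show ?thesis using LIMSEQ_unique tendsto_const by (metis (no_types, lifting) LIMSEQ_const_iff tendsto_cong_limit ext)
qed

section \<open>A C^1 mollifier kernel and its derivative\<close>

text \<open>Squaring the positive part makes the kernel C^1 across the sphere of radius 1/k, and C^1
  is the smoothness that \<open>test_fun\<close> asks for.\<close>

definition bump :: "real \<Rightarrow> 'a::euclidean_space \<Rightarrow> real" where
  "bump k y = (max 0 (1 - k\<^sup>2 * (y \<bullet> y)))\<^sup>2"

text \<open>Only t = 0 needs an argument: the difference quotient there is bounded by |h|.\<close>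

lemma DERIV_max0_square: "((\<lambda>t. (max 0 t)\<^sup>2) has_real_derivative 2 * max 0 t) (at t)" for t :: real
proof (cases "t = 0")
  case True
  have "((\<lambda>h. (max 0 h)\<^sup>2 / h) \<longlongrightarrow> (0::real)) (at 0)"
  proof (rule Lim_null_comparison[where g="\<lambda>h. \<bar>h\<bar>"])
    show "\<forall>\<^sub>F h in at 0. norm ((max 0 h)\<^sup>2 / h) \<le> \<bar>h::real\<bar>"
      by (intro always_eventually) (auto simp: max_def power2_eq_square)
    show "((\<lambda>h. \<bar>h::real\<bar>) \<longlongrightarrow> 0) (at 0)" by (intro tendsto_rabs_zero tendsto_ident_at)
  qed
  then show ?thesis using True by (simp add: DERIV_def)
next
  case False
  show ?thesis
  proof (cases "t > 0")
    case True
    have "((\<lambda>t. t\<^sup>2) has_real_derivative 2 * max 0 t) (at t)"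
      using True by (auto intro!: derivative_eq_intros)
    moreover have "\<forall>\<^sub>F s in nhds t. (max 0 s)\<^sup>2 = s\<^sup>2"
      using eventually_nhds_in_open[of "{0<..}" t] True by (auto elim!: eventually_mono)
    ultimately show ?thesis by (subst DERIV_cong_ev[OF refl _ refl]) auto
  next
    case f: False
    have "\<forall>\<^sub>F s in nhds t. (max 0 s)\<^sup>2 = 0"
      using eventually_nhds_in_open[of "{..<0}" t] False f by (auto elim!: eventually_mono)
    then show ?thesis using f by (subst DERIV_cong_ev[OF refl _ refl, where ?g="\<lambda>_. 0"]) auto
  qed
qed

lemma bump_has_derivative:
  "(bump k has_derivative (\<lambda>v. - (4 * k\<^sup>2 * max 0 (1 - k\<^sup>2 * (y \<bullet> y)) * (y \<bullet> v)))) (at y)"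
proof -
  have "((\<lambda>y. 1 - k\<^sup>2 * (y \<bullet> y)) has_derivative (\<lambda>v. - (k\<^sup>2 * (2 * (y \<bullet> v))))) (at y)"
    by (auto intro!: derivative_eq_intros simp: inner_commute)
  from DERIV_compose_FDERIV[OF DERIV_max0_square this] show ?thesis
    unfolding bump_def by (simp add: algebra_simps)
qed

lemma bump_nonneg: "0 \<le> bump k y" by (simp add: bump_def)
lemma bump_le_1: "bump k y \<le> 1"
  unfolding bump_def by (rule power_le_one) auto
lemma bump_minus: "bump k (- y) = bump k y" by (simp add: bump_def)
lemma bump_outside:
  assumes "k > 0" "norm y \<ge> 1/k" shows "max 0 (1 - k\<^sup>2 * (y \<bullet> y)) = 0"
proof -
  have "1 \<le> k * norm y" using assms by (simp add: field_simps)
  then have "1 \<le> (k * norm y)\<^sup>2" by (simp add: one_le_power)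
  then show ?thesis by (simp add: power_mult_distrib dot_square_norm)
qed
lemma bump_continuous: "continuous_on UNIV (bump k)"
  unfolding bump_def by (intro continuous_intros)

lemma bump_measurable[measurable]: "bump k \<in> borel_measurable borel"
  by (rule borel_measurable_continuous_onI[OF bump_continuous])

lemma bump_integrable: "k > 0 \<Longrightarrow> integrable lborel (bump k :: 'a::euclidean_space \<Rightarrow> real)"
proof (rule Bochner_Integration.integrable_bound[of _ "indicator (cball 0 (1/k)) :: 'a \<Rightarrow> real"])
  assume k: "k > 0"
  show "integrable lborel (indicator (cball 0 (1/k)) :: 'a \<Rightarrow> real)"
    using emeasure_lborel_cball_finite[of "0::'a" "1/k"] by (intro integrable_real_indicator) auto
  show "AE y in lborel. norm (bump k y) \<le> norm (indicator (cball (0::'a) (1/k)) y :: real)"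
  proof (rule AE_I2)
    fix y :: 'a show "norm (bump k y) \<le> norm (indicator (cball (0::'a) (1/k)) y :: real)"
      using bump_outside[OF k, of y] bump_nonneg[of k y] bump_le_1[of k y]
      by (cases "norm y \<le> 1/k") (auto simp: bump_def)
  qed
qed auto

definition bump_mass :: "'a::euclidean_space itself \<Rightarrow> real \<Rightarrow> real" where
  "bump_mass _ k = (\<integral>y. bump k (y::'a) \<partial>lborel)"

text \<open>On the ball of half the radius of the support the kernel is at least 1/4, and that ball
  has positive volume.\<close>

lemma bump_mass_pos:
  assumes k: "k > 0" shows "bump_mass TYPE('a::euclidean_space) k > 0"
proof -
  have "(1/4) * measure lborel (ball (0::'a) (1/(2*k))) = (\<integral>y. (1/4) * indicator (ball (0::'a) (1/(2*k))) y \<partial>lborel)"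
    by simp
  also have "\<dots> \<le> (\<integral>y. bump k (y::'a) \<partial>lborel)"
  proof (rule integral_mono)
    show "integrable lborel (\<lambda>y. (1/4) * indicator (ball (0::'a) (1/(2*k))) y :: real)"
      using emeasure_lborel_ball_finite[of "0::'a" "1/(2*k)"]
      by (intro integrable_mult_right integrable_real_indicator) auto
    show "1 / 4 * indicator (ball (0::'a) (1/(2*k))) y \<le> bump k y" for y
    proof (cases "norm y < 1/(2*k)")
      case True
      then have "k * norm y \<le> 1/2" using k by (simp add: field_simps)
      then have "(k * norm y)\<^sup>2 \<le> (1/2)\<^sup>2" using k by (intro power_mono) auto
      then have "max 0 (1 - k\<^sup>2 * (y \<bullet> y)) \<ge> 1/2"
      proof -
        have "k\<^sup>2 * (y \<bullet> y) = (k * norm y)\<^sup>2" by (simp add: power_mult_distrib dot_square_norm)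
        moreover have "(k * norm y)\<^sup>2 \<le> 1/4" using \<open>(k * norm y)\<^sup>2 \<le> (1/2)\<^sup>2\<close> by (simp add: power2_eq_square)
        ultimately show ?thesis by linarith
      qed
      then have "(max 0 (1 - k\<^sup>2 * (y \<bullet> y)))\<^sup>2 \<ge> (1/2)\<^sup>2" by (rule power_mono) simp
      then show ?thesis using True by (simp add: bump_def power2_eq_square)
    qed (simp add: bump_nonneg)
  qed (rule bump_integrable[OF k])
  finally have *: "(1/4) * measure lborel (ball (0::'a) (1/(2*k))) \<le> bump_mass TYPE('a) k"
    by (simp add: bump_mass_def)
  have "measure lborel (ball (0::'a) (1/(2*k))) > 0"
    using k content_ball_pos[of "1/(2*k)" "0::'a"] by (simp add: measure_completion)
  with * show ?thesis by linarith
qed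

definition moll :: "real \<Rightarrow> 'a::euclidean_space \<Rightarrow> real" where
  "moll k y = bump k y / bump_mass TYPE('a) k"

text \<open>The directional derivative of \<open>moll k\<close> at y, linear in the direction b; see
  \<open>moll_has_derivative\<close>.\<close>

definition dmoll :: "real \<Rightarrow> 'a::euclidean_space \<Rightarrow> 'a \<Rightarrow> real" where
  "dmoll k b y = - (4 * k\<^sup>2 * max 0 (1 - k\<^sup>2 * (y \<bullet> y)) * (y \<bullet> b)) / bump_mass TYPE('a) k"

lemma moll_has_derivative: "(moll k has_derivative (\<lambda>v. dmoll k v y)) (at y)"
  unfolding moll_def dmoll_def divide_inverse
  by (rule has_derivative_mult_left[OF bump_has_derivative])

lemma moll_facts:
  fixes y b :: "'a::euclidean_space"
  assumes "k > 0"
  shows "0 \<le> moll k y" "moll k (-y) = moll k y" "norm y \<ge> 1/k \<Longrightarrow> moll k y = 0"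
    "norm y \<ge> 1/k \<Longrightarrow> dmoll k b y = 0" "integrable lborel (moll k :: 'a \<Rightarrow> real)" "(\<integral>y. moll k (y::'a) \<partial>lborel) = 1"
  using assms bump_mass_pos[OF assms, where ?'a='a] bump_integrable[OF assms, where ?'a='a]
  by (auto simp: moll_def[abs_def] bump_minus bump_outside bump_nonneg bump_def[of k y] dmoll_def bump_mass_def
      intro!: integrable_divide_zero)

lemma moll_measurable[measurable]: "moll k \<in> borel_measurable borel"
  unfolding moll_def by measurable

lemma dmoll_continuous: "continuous_on UNIV (dmoll k b)"
  unfolding dmoll_def by (cases "bump_mass TYPE('a) k = 0") (auto intro!: continuous_intros)

lemma dmoll_measurable[measurable]: "dmoll k b \<in> borel_measurable borel"
  by (rule borel_measurable_continuous_onI[OF dmoll_continuous])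

lemma dmoll_bounded:
  assumes k: "k > 0"
  obtains C where "\<And>y::'a::euclidean_space. \<bar>dmoll k b y\<bar> \<le> C"
proof -
  have "\<bar>dmoll k b y\<bar> \<le> 4 * k\<^sup>2 * 1 * (1/k * norm b) / bump_mass TYPE('a) k" for y :: 'a
  proof (cases "norm y \<ge> 1/k")
    case True
    then show ?thesis using moll_facts(4)[OF k True, of b] bump_mass_pos[OF k, where ?'a='a] k by simp
  next
    case False
    have "\<bar>y \<bullet> b\<bar> \<le> norm y * norm b" by (rule Cauchy_Schwarz_ineq2)
    also have "\<dots> \<le> 1/k * norm b" using False by (intro mult_right_mono) auto
    finally have 1: "\<bar>y \<bullet> b\<bar> \<le> 1/k * norm b" .
    have "\<bar>max 0 (1 - k\<^sup>2 * (y \<bullet> y))\<bar> \<le> 1" by auto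
    then have 2: "\<bar>4 * k\<^sup>2 * max 0 (1 - k\<^sup>2 * (y \<bullet> y)) * (y \<bullet> b)\<bar> \<le> 4 * k\<^sup>2 * 1 * (1/k * norm b)"
      unfolding abs_mult using 1 k by (intro mult_mono) auto
    show ?thesis unfolding dmoll_def abs_divide abs_minus_cancel
      using divide_right_mono[OF 2, of "bump_mass TYPE('a) k"] bump_mass_pos[OF k, where ?'a='a] by simp
  qed
  then show ?thesis by (rule that)
qed

text \<open>Testing a weak identity with these translated kernels turns it into a statement about
  mollifications.\<close>

lemma test_fun_moll:
  assumes k: "k > 0" and x: "cball x (1/k) \<subseteq> \<Omega>"
  shows "test_fun \<Omega> (\<lambda>y. moll k (y - x))"
    and "frechet_derivative (\<lambda>y. moll k (y - x)) (at y) b = dmoll k b (y - x)"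
proof -
  have d: "((\<lambda>y. moll k (y - x)) has_derivative (\<lambda>v. dmoll k v (y - x))) (at y)" for y
  proof -
    have "((\<lambda>y. y - x) has_derivative (\<lambda>v. v)) (at y)" by (auto intro!: derivative_eq_intros)
    from has_derivative_compose[OF this moll_has_derivative] show ?thesis .
  qed
  show fd: "frechet_derivative (\<lambda>y. moll k (y - x)) (at y) b = dmoll k b (y - x)" for y b
    using frechet_derivative_at[OF d[of y]] by metis
  show "test_fun \<Omega> (\<lambda>y. moll k (y - x))"
    unfolding test_fun_def fd
  proof (intro conjI allI exI[of _ "cball x (1/k)"])
    show "(\<lambda>y. moll k (y - x)) differentiable at z" for z using d differentiable_def by blast
    show "continuous_on UNIV (\<lambda>y. dmoll k b (y - x))" for b
      by (rule continuous_on_compose2[OF dmoll_continuous]) (auto intro!: continuous_intros)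
    show "y \<notin> cball x (1/k) \<longrightarrow> moll k (y - x) = 0" for y
      using moll_facts(3)[OF k, of "y - x"] by (auto simp: dist_norm norm_minus_commute)
  qed (use x in auto)
qed

section \<open>Convergence of mollifications in L^1\<close>

definition mollify :: "real \<Rightarrow> ('a::euclidean_space \<Rightarrow> real) \<Rightarrow> 'a \<Rightarrow> real" where
  "mollify k f x = (\<integral>y. moll k (y - x) * f y \<partial>lborel)"

lemma moll_bounded:
  assumes k: "k > 0"
  obtains C where "\<And>y::'a::euclidean_space. \<bar>moll k y\<bar> \<le> C"
proof
  fix y :: 'a
  show "\<bar>moll k y\<bar> \<le> 1 / bump_mass TYPE('a) k"
    using bump_mass_pos[OF k, where ?'a='a] bump_nonneg[of k y] bump_le_1[of k y]
    by (simp add: moll_def divide_right_mono)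
qed

lemma integrable_bounded_mult:
  fixes f g :: "'a \<Rightarrow> real"
  assumes "integrable M f" "g \<in> borel_measurable M" "\<And>x. x \<in> space M \<Longrightarrow> \<bar>g x\<bar> \<le> C"
  shows "integrable M (\<lambda>x. g x * f x)"
proof (rule Bochner_Integration.integrable_bound)
  show "integrable M (\<lambda>x. C * f x)" using assms(1) by simp
  show "AE x in M. norm (g x * f x) \<le> norm (C * f x)"
  proof (rule AE_I2)
    fix x assume "x \<in> space M"
    then have "\<bar>g x\<bar> \<le> \<bar>C\<bar>" using assms(3)[of x] by linarith
    then show "norm (g x * f x) \<le> norm (C * f x)" by (simp add: abs_mult mult_right_mono)
  qed
qed (use assms in measurable)

lemma integrable_moll_mult:
  fixes f :: "'a::euclidean_space \<Rightarrow> real"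
  assumes "k > 0" "integrable lborel f"
  shows "integrable lborel (\<lambda>y. moll k (y - x) * f y)"
proof -
  obtain C where "\<And>y::'a. \<bar>moll k y\<bar> \<le> C" using moll_bounded[OF assms(1)] by blast
  then show ?thesis using assms(2) by (intro integrable_bounded_mult) auto
qed

lemma integrable_dmoll_mult:
  fixes f :: "'a::euclidean_space \<Rightarrow> real"
  assumes "k > 0" "integrable lborel f"
  shows "integrable lborel (\<lambda>y. dmoll k b (y - x) * f y)"
proof -
  obtain C where "\<And>y::'a. \<bar>dmoll k b y\<bar> \<le> C" using dmoll_bounded[OF assms(1)] by blast
  then show ?thesis using assms(2) by (intro integrable_bounded_mult) auto
qed

lemma mollify_measurable[measurable]:
  assumes [measurable]: "f \<in> borel_measurable borel"
  shows "mollify k f \<in> borel_measurable borel"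
  unfolding mollify_def[abs_def] by measurable

text \<open>\<open>mollify k f x - f x\<close> is the average of \<open>f (x + z) - f x\<close> over
  norm z < 1/k with weight \<open>moll k z\<close>. By Tonelli the L^1 error is at most the largest
  translation error over these z, which \<open>translation_L1\<close> makes small. The extended
  integral is used because the mollification is not yet known to be integrable.\<close>

lemma mollify_tendsto_L1:
  fixes f :: "'a::euclidean_space \<Rightarrow> real"
  assumes f: "integrable lborel f"
  shows "(\<lambda>n. \<integral>\<^sup>+x. ennreal \<bar>mollify (real (Suc n)) f x - f x\<bar> \<partial>lborel) \<longlonglongrightarrow> 0"
proof -
  have [measurable]: "f \<in> borel_measurable borel" using f by auto
  \<comment> \<open>Continuity of translations in sequential form is converted into epsilon-delta
    form by contradiction.\<close>
  have small: "\<exists>d>0. \<forall>z. norm z < d \<longrightarrow> (\<integral>x. \<bar>f (x + z) - f x\<bar> \<partial>lborel) \<le> e" if "e > 0" for e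
  proof (rule ccontr)
    assume "\<not> ?thesis"
    then have "\<forall>n. \<exists>z. norm z < 1 / real (Suc n) \<and> (\<integral>x. \<bar>f (x + z) - f x\<bar> \<partial>lborel) > e"
      by (metis not_le of_nat_0_less_iff zero_less_Suc zero_less_divide_1_iff)
    then obtain h where h: "\<And>n. norm (h n) < 1 / real (Suc n)" "\<And>n. (\<integral>x. \<bar>f (x + h n) - f x\<bar> \<partial>lborel) > e"
      by metis
    have "h \<longlonglongrightarrow> 0"
    proof (rule Lim_null_comparison[OF _ LIMSEQ_Suc[OF lim_1_over_n]])
      show "\<forall>\<^sub>F n in sequentially. norm (h n) \<le> 1 / real (Suc n)"
        by (intro always_eventually allI less_imp_le h(1))
    qed
    from translation_L1[OF f this] have "\<forall>\<^sub>F n in sequentially. (\<integral>x. \<bar>f (x + h n) - f x\<bar> \<partial>lborel) < e"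
      using \<open>e > 0\<close> by (rule order_tendstoD(2))
    then show False using h(2) by (auto simp: eventually_sequentially) (metis less_asym order_refl)
  qed
  have bound: "(\<integral>\<^sup>+x. ennreal \<bar>mollify k f x - f x\<bar> \<partial>lborel) \<le> ennreal e"
    if k: "k > 0" and e: "\<And>z. norm z < 1/k \<Longrightarrow> (\<integral>x. \<bar>f (x + z) - f x\<bar> \<partial>lborel) \<le> e" for k e
  proof -
    note mf = moll_facts[OF k]
    have "ennreal \<bar>mollify k f x - f x\<bar> \<le> (\<integral>\<^sup>+z. ennreal (moll k z) * ennreal \<bar>f (x + z) - f x\<bar> \<partial>lborel)" for x
    proof -
      have i1: "integrable lborel (\<lambda>y. moll k (y - x) * f y)" by (rule integrable_moll_mult[OF k f])
      have i2: "integrable lborel (\<lambda>y. moll k (y - x) * f x)"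
        using integrable_translate[OF mf(5), of "-x"] by simp
      have "(\<integral>y. moll k (y - x) \<partial>lborel) = 1"
        using integral_translate[of "moll k" "-x"] mf(6) by simp
      then have "mollify k f x - f x = (\<integral>y. moll k (y - x) * f y - moll k (y - x) * f x \<partial>lborel)"
        using i1 i2 by (simp add: mollify_def)
      also have "\<dots> = (\<integral>z. moll k z * f (z + x) - moll k z * f x \<partial>lborel)"
        using integral_translate[of "\<lambda>y. moll k (y - x) * f y - moll k (y - x) * f x" x] by simp
      finally have eq: "mollify k f x - f x = (\<integral>z. moll k z * (f (x + z) - f x) \<partial>lborel)"
        by (simp add: right_diff_distrib add.commute)
      have "integrable lborel (\<lambda>y. moll k (y - x) * f y - moll k (y - x) * f x)" using i1 i2 by simp
      from integrable_translate[OF this, of x]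
      have "integrable lborel (\<lambda>z. moll k z * (f (x + z) - f x))"
        by (simp add: right_diff_distrib add.commute)
      from integral_norm_bound_ennreal[OF this] show ?thesis
        unfolding eq by (simp add: abs_mult ennreal_mult mf(1))
    qed
    then have "(\<integral>\<^sup>+x. ennreal \<bar>mollify k f x - f x\<bar> \<partial>lborel)
        \<le> (\<integral>\<^sup>+x. \<integral>\<^sup>+z. ennreal (moll k z) * ennreal \<bar>f (x + z) - f x\<bar> \<partial>lborel \<partial>lborel)"
      by (intro nn_integral_mono) auto
    also have "\<dots> = (\<integral>\<^sup>+z. \<integral>\<^sup>+x. ennreal (moll k z) * ennreal \<bar>f (x + z) - f x\<bar> \<partial>lborel \<partial>lborel)"
      by (rule lborel_pair.Fubini'[symmetric]) measurable
    also have "\<dots> = (\<integral>\<^sup>+z. ennreal (moll k z) * (\<integral>\<^sup>+x. ennreal \<bar>f (x + z) - f x\<bar> \<partial>lborel) \<partial>lborel)"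
      by (simp add: nn_integral_cmult)
    also have "\<dots> \<le> (\<integral>\<^sup>+z. ennreal (moll k z) * ennreal e \<partial>(lborel::'a measure))"
    proof (rule nn_integral_mono)
      fix z :: 'a
      show "ennreal (moll k z) * (\<integral>\<^sup>+x. ennreal \<bar>f (x + z) - f x\<bar> \<partial>lborel) \<le> ennreal (moll k z) * ennreal e"
      proof (cases "norm z < 1/k")
        case True
        have "(\<integral>\<^sup>+x. ennreal \<bar>f (x + z) - f x\<bar> \<partial>lborel) = ennreal (\<integral>x. \<bar>f (x + z) - f x\<bar> \<partial>lborel)"
          using f integrable_translate[OF f, of z] by (intro nn_integral_eq_integral) auto
        also have "\<dots> \<le> ennreal e" using e[OF True] by (rule ennreal_leI)
        finally show ?thesis by (rule mult_left_mono) simp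
      next
        case False
        then show ?thesis using mf(3)[of z] by simp
      qed
    qed
    also have "\<dots> = (\<integral>\<^sup>+z. ennreal (moll k z) \<partial>(lborel::'a measure)) * ennreal e"
      by (rule nn_integral_multc) simp
    also have "(\<integral>\<^sup>+z. ennreal (moll k z) \<partial>(lborel::'a measure)) = ennreal 1"
      using mf(5,6,1) by (subst nn_integral_eq_integral) auto
    finally show ?thesis by simp
  qed
  show ?thesis
  proof (rule order_tendstoI)
    fix a :: ennreal assume "0 < a"
    then obtain e :: real where e: "e > 0" "ennreal e < a"
      by (metis dense ennreal_cases ennreal_eq_0_iff ennreal_top_neq_one infinity_ennreal_def less_ennreal.rep_eq
           linorder_not_less not_less_iff_gr_or_eq top.not_eq_extremum zero_less_iff_neq_zero)
    obtain d where d: "d > 0" "\<And>z. norm z < d \<Longrightarrow> (\<integral>x. \<bar>f (x + z) - f x\<bar> \<partial>lborel) \<le> e"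
      using small[OF e(1)] by blast
    obtain n0 where n0: "1 / real (Suc n0) < d" using d(1) nat_approx_posE by blast
    show "\<forall>\<^sub>F n in sequentially. (\<integral>\<^sup>+x. ennreal \<bar>mollify (real (Suc n)) f x - f x\<bar> \<partial>lborel) < a"
      using eventually_ge_at_top[of n0]
    proof eventually_elim
      case (elim n)
      have "1 / real (Suc n) \<le> 1 / real (Suc n0)" using elim by (intro divide_left_mono) auto
      then have "1 / real (Suc n) < d" using n0 by linarith
      then have "(\<integral>\<^sup>+x. ennreal \<bar>mollify (real (Suc n)) f x - f x\<bar> \<partial>lborel) \<le> ennreal e"
        using d(2) by (intro bound) auto
      then show ?case using e(2) by (rule le_less_trans)
    qed
  qed (auto simp: not_less_zero)
qed

section \<open>Exhaustion of the domain and the fundamental lemma\<close>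

text \<open>The index n is matched to the kernel of scale n + 1: centred at a point of
  \<open>shrink \<Omega> n\<close>, its support lies in \<Omega>.\<close>

definition shrink :: "'a::euclidean_space set \<Rightarrow> nat \<Rightarrow> 'a set" where
  "shrink \<Omega> n = {x. infdist x (- \<Omega>) > 1 / real (Suc n)}"

lemma shrink_borel[measurable]: "shrink \<Omega> n \<in> sets borel"
  unfolding shrink_def by (intro borel_open open_Collect_less) (auto intro!: continuous_intros)

lemma shrink_cball: "x \<in> shrink \<Omega> n \<Longrightarrow> cball x (1 / real (Suc n)) \<subseteq> \<Omega>"
proof
  fix y assume x: "x \<in> shrink \<Omega> n" and y: "y \<in> cball x (1 / real (Suc n))"
  show "y \<in> \<Omega>"
  proof (rule ccontr)
    assume "y \<notin> \<Omega>"
    then have "infdist x (- \<Omega>) \<le> dist x y" by (intro infdist_le) auto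
    then show False using x y by (simp add: shrink_def)
  qed
qed

lemma shrink_mono: "n \<le> m \<Longrightarrow> shrink \<Omega> n \<subseteq> shrink \<Omega> m"
proof
  fix x assume a: "n \<le> m" and "x \<in> shrink \<Omega> n"
  have "1 / real (Suc m) \<le> 1 / real (Suc n)" using a by (intro divide_left_mono) auto
  then show "x \<in> shrink \<Omega> m" using \<open>x \<in> shrink \<Omega> n\<close> unfolding shrink_def by auto
qed

lemma compact_subset_shrink:
  assumes \<Omega>: "open \<Omega>" "bounded \<Omega>" and K: "compact K" "K \<subseteq> \<Omega>"
  obtains n where "K \<subseteq> shrink \<Omega> n"
proof (cases "K = {}")
  case True then show ?thesis using that by auto
next
  case False
  \<comment> \<open>\<open>infdist\<close> to the empty set is 0, so the complement has to be
    nonempty for distances to carry information; boundedness of \<Omega> ensures this.\<close>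
  have ne: "- \<Omega> \<noteq> {}" using \<Omega>(2) by (metis Compl_empty_eq double_complement not_bounded_UNIV)
  obtain x where x: "x \<in> K" "\<And>y. y \<in> K \<Longrightarrow> infdist x (- \<Omega>) \<le> infdist y (- \<Omega>)"
    using continuous_attains_inf[OF K(1) False continuous_on_infdist[OF continuous_on_id], of "- \<Omega>"] by blast
  have "x \<notin> - \<Omega>" using x K by auto
  then have "infdist x (- \<Omega>) \<noteq> 0"
    using in_closed_iff_infdist_zero[of "- \<Omega>" x] ne \<Omega>(1) by (auto simp: closed_Compl)
  then have "infdist x (- \<Omega>) > 0" using infdist_nonneg[of x "- \<Omega>"] by linarith
  then obtain n where n: "1 / real (Suc n) < infdist x (- \<Omega>)" using nat_approx_posE by blast
  have "K \<subseteq> shrink \<Omega> n" using n x(2) unfolding shrink_def by force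
  then show ?thesis by (rule that)
qed

lemma in_shrink:
  assumes \<Omega>: "open \<Omega>" "bounded \<Omega>" and "x \<in> \<Omega>"
  shows "\<exists>n. x \<in> shrink \<Omega> n"
  using compact_subset_shrink[OF \<Omega>, of "{x}"] assms(3) by auto

text \<open>The kernel centred at x is a test function once x is in \<open>shrink \<Omega> m\<close>
  and the scale is fine enough, so the mollifications of h vanish there from index m on. Their L^1
  limit h vanishes almost everywhere on each \<open>shrink \<Omega> m\<close>, and countably many of
  these sets cover \<Omega>.\<close>

lemma fundamental_lemma:
  fixes h :: "'a::euclidean_space \<Rightarrow> real"
  assumes \<Omega>: "open \<Omega>" "bounded \<Omega>" and h: "integrable lborel h"
    and orth: "\<And>\<phi>. test_fun \<Omega> \<phi> \<Longrightarrow> (\<integral>x. h x * \<phi> x \<partial>lborel) = 0"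
  shows "AE x in lborel. x \<in> \<Omega> \<longrightarrow> h x = 0"
proof -
  have [measurable]: "h \<in> borel_measurable borel" using h by auto
  have z: "mollify (real (Suc n)) h x = 0" if "x \<in> shrink \<Omega> m" "m \<le> n" for n m x
    using orth[OF test_fun_moll(1)[of "real (Suc n)" x \<Omega>]] shrink_cball[of x \<Omega> n] shrink_mono[OF that(2)] that(1)
    by (auto simp: mollify_def mult.commute)
  have "AE x in lborel. x \<in> shrink \<Omega> m \<longrightarrow> h x = 0" for m
  proof -
    have "(\<integral>\<^sup>+x. ennreal \<bar>h x\<bar> * indicator (shrink \<Omega> m) x \<partial>lborel) \<le> (\<integral>\<^sup>+x. ennreal \<bar>mollify (real (Suc n)) h x - h x\<bar> \<partial>lborel)"
      if "n \<ge> m" for n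
      using z[OF _ that] by (intro nn_integral_mono) (auto simp: indicator_def)
    then have "(\<integral>\<^sup>+x. ennreal \<bar>h x\<bar> * indicator (shrink \<Omega> m) x \<partial>lborel) \<le> 0"
      by (intro tendsto_lowerbound[OF mollify_tendsto_L1[OF h]]) (auto simp: eventually_sequentially)
    then have "(\<integral>\<^sup>+x. ennreal \<bar>h x\<bar> * indicator (shrink \<Omega> m) x \<partial>lborel) = 0" by simp
    then have "AE x in lborel. ennreal \<bar>h x\<bar> * indicator (shrink \<Omega> m) x = 0"
      by (subst (asm) nn_integral_0_iff_AE) auto
    then show ?thesis by eventually_elim (auto simp: indicator_def split: if_splits)
  qed
  then have "AE x in lborel. \<forall>m. x \<in> shrink \<Omega> m \<longrightarrow> h x = 0" by (subst AE_all_countable) simp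
  then show ?thesis by eventually_elim (use in_shrink[OF \<Omega>] in blast)
qed

lemma frechet_derivative_outside:
  assumes "test_fun \<Omega> \<phi>" "compact K" "\<And>x. x \<notin> K \<Longrightarrow> \<phi> x = 0" "x \<notin> K"
  shows "frechet_derivative \<phi> (at x) b = 0"
proof -
  have "(\<phi> has_derivative (\<lambda>v. 0)) (at x)"
    by (rule has_derivative_transform_within_open[of "\<lambda>_. 0" _ _ _ "- K"])
      (use assms in \<open>auto simp: compact_imp_closed open_Compl\<close>)
  then show ?thesis using frechet_derivative_at[of \<phi> "\<lambda>v. 0" x] by metis
qed

lemma test_funE:
  assumes "test_fun \<Omega> \<phi>"
  obtains K C where "compact K" "K \<subseteq> \<Omega>" "\<And>x. x \<notin> K \<Longrightarrow> \<phi> x = 0"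
    "\<And>x b. x \<notin> K \<Longrightarrow> frechet_derivative \<phi> (at x) b = 0"
    "\<And>x. \<bar>\<phi> x\<bar> \<le> C" "\<And>x b. b \<in> Basis \<Longrightarrow> \<bar>frechet_derivative \<phi> (at x) b\<bar> \<le> C"
    "\<phi> \<in> borel_measurable borel" "\<And>b. (\<lambda>x. frechet_derivative \<phi> (at x) b) \<in> borel_measurable borel"
    "continuous_on UNIV \<phi>"
    "\<And>x b. ((\<lambda>s. \<phi> (x + s *\<^sub>R b)) has_real_derivative frechet_derivative \<phi> (at x) b) (at 0)"
proof -
  obtain K where K: "compact K" "K \<subseteq> \<Omega>" "\<And>x. x \<notin> K \<Longrightarrow> \<phi> x = 0"
    using assms unfolding test_fun_def by blast
  note K0 = frechet_derivative_outside[OF assms K(1,3)]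
  have c: "continuous_on UNIV \<phi>"
    using assms unfolding test_fun_def
    by (intro continuous_at_imp_continuous_on ballI differentiable_imp_continuous_within) auto
  have cd: "continuous_on UNIV (\<lambda>x. frechet_derivative \<phi> (at x) b)" for b
    using assms unfolding test_fun_def by blast
  have bdd: "\<exists>C. \<forall>x. \<bar>f x\<bar> \<le> C" if "continuous_on UNIV f" "\<And>x. x \<notin> K \<Longrightarrow> f x = 0" for f :: "'a \<Rightarrow> real"
  proof -
    have "bounded (f ` K)" using K(1) that(1) by (meson compact_continuous_image compact_imp_bounded continuous_on_subset subset_UNIV)
    then obtain C where "C > 0" "\<forall>y\<in>f ` K. norm y \<le> C" using bounded_pos by blast
    then have "\<bar>f x\<bar> \<le> C" for x using that(2)[of x] by (cases "x \<in> K") auto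
    then show ?thesis by blast
  qed
  obtain C0 where C0: "\<And>x. \<bar>\<phi> x\<bar> \<le> C0" using bdd[OF c K(3)] by blast
  have "\<forall>b. \<exists>C. \<forall>x. \<bar>frechet_derivative \<phi> (at x) b\<bar> \<le> C" using bdd[OF cd K0] by blast
  then obtain C1 where C1: "\<And>b x. \<bar>frechet_derivative \<phi> (at x) b\<bar> \<le> C1 b" by metis
  have C1p: "0 \<le> C1 b" for b using C1[of undefined b] by (meson abs_ge_zero order_trans)
  \<comment> \<open>Summing over the finite basis gives one constant for the function and all its
    partial derivatives.\<close>
  define C where "C = C0 + (\<Sum>b\<in>Basis. C1 b)"
  have "0 \<le> (\<Sum>b\<in>Basis. C1 b)" using C1p by (simp add: sum_nonneg)
  moreover have "0 \<le> C0" using C0[of undefined] by (meson abs_ge_zero order_trans)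
  moreover have "C1 b \<le> (\<Sum>b\<in>Basis. C1 b)" if "b \<in> Basis" for b using that C1p by (intro member_le_sum) auto
  ultimately have C: "\<And>x. \<bar>\<phi> x\<bar> \<le> C" "\<And>x b. b \<in> Basis \<Longrightarrow> \<bar>frechet_derivative \<phi> (at x) b\<bar> \<le> C"
    using C0 C1 unfolding C_def by (meson add_increasing2 order_trans add_increasing)+
  have der: "((\<lambda>s. \<phi> (x + s *\<^sub>R b)) has_real_derivative frechet_derivative \<phi> (at x) b) (at 0)" for x b
  proof -
    have d: "(\<phi> has_derivative frechet_derivative \<phi> (at x)) (at x)"
      using assms unfolding test_fun_def by (simp add: frechet_derivative_works)
    have "((\<lambda>s. x + s *\<^sub>R b) has_derivative (\<lambda>s. s *\<^sub>R b)) (at 0)"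
      by (auto intro!: derivative_eq_intros)
    from has_derivative_compose[OF this, of \<phi> "frechet_derivative \<phi> (at x)"] d
    have "((\<lambda>s. \<phi> (x + s *\<^sub>R b)) has_derivative (\<lambda>s. frechet_derivative \<phi> (at x) (s *\<^sub>R b))) (at 0)" by simp
    moreover have "frechet_derivative \<phi> (at x) (s *\<^sub>R b) = frechet_derivative \<phi> (at x) b * s" for s
      using linear_cmul[OF has_derivative_linear[OF d]] by simp
    ultimately show ?thesis by (simp add: has_field_derivative_def)
  qed
  show ?thesis
    by (rule that[OF K K0 C _ _ c der]) (auto intro!: borel_measurable_continuous_onI c cd)
qed

section \<open>Weak derivatives and the chain rule\<close>

text \<open>One direction at a time and for integrable functions on the whole space: the setting in
  which mollification, uniqueness and joint measurability work. \<open>weak_grad_iff\<close> relates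
  it to \<open>weak_grad\<close>.\<close>

definition weak_partial :: "'a::euclidean_space set \<Rightarrow> 'a \<Rightarrow> ('a \<Rightarrow> real) \<Rightarrow> ('a \<Rightarrow> real) \<Rightarrow> bool" where
  "weak_partial \<Omega> b f d \<longleftrightarrow> integrable lborel f \<and> integrable lborel d \<and>
     (\<forall>\<phi>. test_fun \<Omega> \<phi> \<longrightarrow>
        (\<integral>x. f x * frechet_derivative \<phi> (at x) b \<partial>lborel) = - (\<integral>x. d x * \<phi> x \<partial>lborel))"

lemma directional_derivative_shift:
  fixes G :: "'a::real_normed_vector \<Rightarrow> real"
  assumes "\<And>x. ((\<lambda>s. G (x + s *\<^sub>R b)) has_real_derivative Gb x) (at 0)"
  shows "((\<lambda>s. G (x + s *\<^sub>R b)) has_real_derivative Gb (x + s0 *\<^sub>R b)) (at s0)"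
proof -
  have "((\<lambda>s. G (x + s0 *\<^sub>R b + s *\<^sub>R b)) has_real_derivative Gb (x + s0 *\<^sub>R b)) (at 0)" by (rule assms)
  then show ?thesis
    using DERIV_at_within_shift[of "\<lambda>s. G (x + s *\<^sub>R b)" _ s0 0 UNIV]
    by (simp add: scaleR_add_left add.assoc)
qed

lemma directional_lipschitz:
  fixes G :: "'a::real_normed_vector \<Rightarrow> real"
  assumes "\<And>x. ((\<lambda>s. G (x + s *\<^sub>R b)) has_real_derivative Gb x) (at 0)"
    and "\<And>x. \<bar>Gb x\<bar> \<le> L"
  shows "\<bar>G (x + s *\<^sub>R b) - G x\<bar> \<le> L * \<bar>s\<bar>"
  using field_differentiable_bound[of UNIV "\<lambda>s. G (x + s *\<^sub>R b)" "\<lambda>s. Gb (x + s *\<^sub>R b)" L s 0]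
    directional_derivative_shift[of G b Gb x, OF assms(1)] assms(2) by simp

lemma dmoll_uminus: "dmoll k (- b) y = - dmoll k b y"
  by (simp add: dmoll_def)

lemma moll_directional:
  "((\<lambda>s. moll k (x + s *\<^sub>R b)) has_real_derivative dmoll k b x) (at 0)"
proof -
  have "((\<lambda>s. x + s *\<^sub>R b) has_derivative (\<lambda>s. s *\<^sub>R b)) (at 0)"
    by (auto intro!: derivative_eq_intros)
  from has_derivative_compose[OF this, of "moll k" "\<lambda>v. dmoll k v x"] moll_has_derivative[of k x]
  have "((\<lambda>s. moll k (x + s *\<^sub>R b)) has_derivative (\<lambda>s. dmoll k (s *\<^sub>R b) x)) (at 0)" by simp
  moreover have "dmoll k (s *\<^sub>R b) x = dmoll k b x * s" for s by (simp add: dmoll_def)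
  ultimately show ?thesis by (simp add: has_field_derivative_def)
qed

text \<open>Differentiation under the integral: the kernel is Lipschitz along b, so its difference
  quotients are bounded by the same C. The minus sign comes from x entering the kernel as y -
  x.\<close>

lemma mollify_directional:
  fixes f :: "'a::euclidean_space \<Rightarrow> real"
  assumes k: "k > 0" and f: "integrable lborel f"
  shows "((\<lambda>s. mollify k f (x + s *\<^sub>R b)) has_real_derivative - (\<integral>y. dmoll k b (y - x) * f y \<partial>lborel)) (at 0)"
proof -
  have [measurable]: "f \<in> borel_measurable borel" using f by auto
  obtain C where C: "\<And>y::'a. \<bar>dmoll k b y\<bar> \<le> C" using dmoll_bounded[OF k] by blast
  define q where "q h y = (moll k (y - (x + h *\<^sub>R b)) - moll k (y - x)) / h * f y" for h y
  have lip: "\<bar>moll k (y - (x + h *\<^sub>R b)) - moll k (y - x)\<bar> \<le> C * \<bar>h\<bar>" for y h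
    using directional_lipschitz[of "moll k" b "dmoll k b" C "y - x" "- h", OF moll_directional C]
    by (simp add: algebra_simps)
  have "((\<lambda>h. \<integral>y. q h y \<partial>lborel) \<longlongrightarrow> (\<integral>y. - dmoll k b (y - x) * f y \<partial>lborel)) (at 0)"
    unfolding tendsto_at_iff_sequentially
  proof (intro allI impI, unfold o_def)
    fix X :: "nat \<Rightarrow> real" assume X: "\<forall>i. X i \<in> UNIV - {0}" "X \<longlonglongrightarrow> 0"
    show "(\<lambda>i. \<integral>y. q (X i) y \<partial>lborel) \<longlonglongrightarrow> (\<integral>y. - dmoll k b (y - x) * f y \<partial>lborel)"
    proof (rule integral_dominated_convergence[where w="\<lambda>y. C * \<bar>f y\<bar>"])
      show "AE y in lborel. (\<lambda>i. q (X i) y) \<longlonglongrightarrow> - dmoll k b (y - x) * f y"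
      proof (rule AE_I2)
        fix y
        have "((\<lambda>h. (moll k (y - x + h *\<^sub>R (-b)) - moll k (y - x)) / h) \<longlongrightarrow> dmoll k (-b) (y - x)) (at 0)"
          using moll_directional[of k "y - x" "-b"] by (simp add: DERIV_def)
        then have "((\<lambda>h. (moll k (y - (x + h *\<^sub>R b)) - moll k (y - x)) / h) \<longlongrightarrow> - dmoll k b (y - x)) (at 0)"
          by (simp add: dmoll_uminus diff_diff_eq)
        moreover have "filterlim X (at 0) sequentially"
          using X by (auto simp: filterlim_at)
        ultimately have "(\<lambda>i. (moll k (y - (x + X i *\<^sub>R b)) - moll k (y - x)) / X i) \<longlonglongrightarrow> - dmoll k b (y - x)"
          by (rule filterlim_compose)
        then show "(\<lambda>i. q (X i) y) \<longlonglongrightarrow> - dmoll k b (y - x) * f y"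
          unfolding q_def by (rule tendsto_mult_right)
      qed
      show "AE y in lborel. norm (q (X i) y) \<le> C * \<bar>f y\<bar>" for i
      proof (rule AE_I2)
        fix y
        have "X i \<noteq> 0" using X(1) by simp
        then have "\<bar>(moll k (y - (x + X i *\<^sub>R b)) - moll k (y - x)) / X i\<bar> \<le> C"
          using lip[of y "X i"] by (simp add: field_simps)
        then show "norm (q (X i) y) \<le> C * \<bar>f y\<bar>" unfolding q_def real_norm_def abs_mult[of _ "f y"] by (rule mult_right_mono) simp
      qed
    qed (use f in \<open>auto simp: q_def\<close>)
  qed
  moreover have "(\<integral>y. q h y \<partial>lborel) = (mollify k f (x + h *\<^sub>R b) - mollify k f x) / h" for h
  proof -
    have "(\<integral>y. q h y \<partial>lborel) = (\<integral>y. (moll k (y - (x + h *\<^sub>R b)) * f y - moll k (y - x) * f y) / h \<partial>lborel)"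
      by (simp add: q_def algebra_simps diff_divide_distrib)
    then show ?thesis
      using integrable_moll_mult[OF k f, of "x + h *\<^sub>R b"] integrable_moll_mult[OF k f, of x]
      by (simp add: mollify_def)
  qed
  ultimately show ?thesis by (simp add: DERIV_def)
qed

text \<open>The shifted kernel is itself a test function here, so the definition of the weak
  derivative moves the derivative from the kernel to f. Mollification thus commutes with
  differentiation, but only away from the boundary.\<close>

lemma weak_partial_mollify:
  assumes w: "weak_partial \<Omega> b f d" and x: "x \<in> shrink \<Omega> m" "m \<le> n"
  shows "- (\<integral>y. dmoll (real (Suc n)) b (y - x) * f y \<partial>lborel) = mollify (real (Suc n)) d x"
proof -
  have c: "cball x (1 / real (Suc n)) \<subseteq> \<Omega>" using shrink_mono[OF x(2)] x(1) by (intro shrink_cball) auto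
  have k: "real (Suc n) > 0" by simp
  show ?thesis
    using w test_fun_moll(1)[OF k c] test_fun_moll(2)[OF k c]
    unfolding weak_partial_def mollify_def by (auto simp: mult.commute)
qed

text \<open>The product of two test functions has compact support, so its directional derivative
  integrates to 0; the product rule turns this into integration by parts.\<close>

lemma weak_partial_test_fun:
  assumes \<phi>: "test_fun \<Omega> \<phi>" and b: "b \<in> Basis"
  shows "weak_partial \<Omega> b \<phi> (\<lambda>x. frechet_derivative \<phi> (at x) b)"
proof -
  have ib: "integrable lborel f" if "f \<in> borel_measurable borel" "\<And>x. \<bar>f x\<bar> \<le> C" "\<And>x. x \<notin> K \<Longrightarrow> f x = 0" "compact K"
    for f :: "'a \<Rightarrow> real" and C K
  proof (rule Bochner_Integration.integrable_bound[of _ "\<lambda>x. C * indicator K x"])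
    show "integrable lborel (\<lambda>x. C * indicator K x)"
      using emeasure_compact_finite[OF that(4)] that(4)
      by (intro integrable_mult_right integrable_real_indicator) (auto simp: borel_compact)
    show "AE x in lborel. norm (f x) \<le> norm (C * indicator K x)"
      using that(2,3) by (intro AE_I2) (auto simp: indicator_def intro: order_trans[OF _ abs_ge_self])
  qed (use that in auto)
  obtain K C where K: "compact K" "K \<subseteq> \<Omega>" "\<And>x. x \<notin> K \<Longrightarrow> \<phi> x = 0"
    "\<And>x b. x \<notin> K \<Longrightarrow> frechet_derivative \<phi> (at x) b = 0"
    "\<And>x. \<bar>\<phi> x\<bar> \<le> C" "\<And>x b. b \<in> Basis \<Longrightarrow> \<bar>frechet_derivative \<phi> (at x) b\<bar> \<le> C"
    and [measurable]: "\<phi> \<in> borel_measurable borel" "\<And>b. (\<lambda>x. frechet_derivative \<phi> (at x) b) \<in> borel_measurable borel"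
    and d1: "\<And>x b. ((\<lambda>s. \<phi> (x + s *\<^sub>R b)) has_real_derivative frechet_derivative \<phi> (at x) b) (at 0)"
    using test_funE[OF \<phi>] by metis
  show ?thesis unfolding weak_partial_def
  proof (intro conjI allI impI)
    show "integrable lborel \<phi>" by (rule ib[OF _ K(5,3,1)]) simp
    show "integrable lborel (\<lambda>x. frechet_derivative \<phi> (at x) b)" by (rule ib[OF _ K(6) K(4,1)]) (use b in auto)
    fix \<theta> assume \<theta>: "test_fun \<Omega> \<theta>"
    obtain K' C' where K': "compact K'" "K' \<subseteq> \<Omega>" "\<And>x. x \<notin> K' \<Longrightarrow> \<theta> x = 0"
      "\<And>x b. x \<notin> K' \<Longrightarrow> frechet_derivative \<theta> (at x) b = 0"
      "\<And>x. \<bar>\<theta> x\<bar> \<le> C'" "\<And>x b. b \<in> Basis \<Longrightarrow> \<bar>frechet_derivative \<theta> (at x) b\<bar> \<le> C'"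
      and [measurable]: "\<theta> \<in> borel_measurable borel" "\<And>b. (\<lambda>x. frechet_derivative \<theta> (at x) b) \<in> borel_measurable borel"
      and d2: "\<And>x b. ((\<lambda>s. \<theta> (x + s *\<^sub>R b)) has_real_derivative frechet_derivative \<theta> (at x) b) (at 0)"
      using test_funE[OF \<theta>] by metis
    have C0: "0 \<le> C" "0 \<le> C'" using K(5)[of undefined] K'(5)[of undefined] by (meson abs_ge_zero order_trans)+
    have mb: "\<bar>u * v\<bar> \<le> C * C'" if "\<bar>u\<bar> \<le> C" "\<bar>v\<bar> \<le> C'" for u v
      unfolding abs_mult using that C0 by (intro mult_mono) auto
    have "(\<integral>x. frechet_derivative \<phi> (at x) b * \<theta> x + \<phi> x * frechet_derivative \<theta> (at x) b \<partial>lborel) = 0"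
    proof (rule integral_directional_derivative_zero[of "\<lambda>x. \<phi> x * \<theta> x" b _ "2 * (C * C')" K])
      show "((\<lambda>s. \<phi> (x + s *\<^sub>R b) * \<theta> (x + s *\<^sub>R b)) has_real_derivative
          frechet_derivative \<phi> (at x) b * \<theta> x + \<phi> x * frechet_derivative \<theta> (at x) b) (at 0)" for x
        using DERIV_mult[OF d1[of x b] d2[of x b]] by (simp add: algebra_simps)
      show "\<bar>frechet_derivative \<phi> (at x) b * \<theta> x + \<phi> x * frechet_derivative \<theta> (at x) b\<bar> \<le> 2 * (C * C')" for x
        using mb[OF K(6)[OF b, of x] K'(5)[of x]] mb[OF K(5)[of x] K'(6)[OF b, of x]] by linarith
      show "integrable lborel (\<lambda>x. \<phi> x * \<theta> x)"
        by (rule ib[of _ "C * C'" K]) (use K(1,3,5) K'(5) in \<open>auto intro: mb\<close>)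
    qed (use K in \<open>auto simp: compact_imp_bounded\<close>)
    moreover have "integrable lborel (\<lambda>x. frechet_derivative \<phi> (at x) b * \<theta> x)"
      by (rule ib[of _ "C * C'" K]) (use K(1,4,6) K'(5) b in \<open>auto intro: mb\<close>)
    moreover have "integrable lborel (\<lambda>x. \<phi> x * frechet_derivative \<theta> (at x) b)"
      by (rule ib[of _ "C * C'" K]) (use K(1,3,5) K'(6) b in \<open>auto intro: mb\<close>)
    ultimately show "(\<integral>x. \<phi> x * frechet_derivative \<theta> (at x) b \<partial>lborel) = - (\<integral>x. frechet_derivative \<phi> (at x) b * \<theta> x \<partial>lborel)"
      by simp
  qed
qed

text \<open>For the mollified function F n the chain rule is classical. The mollified weak
  derivative D n coincides with the derivative E n of F n only away from the boundary, which
  suffices because \<phi> has compact support in \<Omega>. In the limit F n converges almost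
  everywhere along a subsequence, which passes through the bounded continuous functions \<psi> and
  \<psi>', while D n converges in L^1.\<close>

lemma weak_partial_chain:
  fixes \<Omega> :: "'a::euclidean_space set"
  assumes \<Omega>: "open \<Omega>" "bounded \<Omega>" and w: "weak_partial \<Omega> b f d" and b: "b \<in> Basis"
    and \<psi>: "\<And>t. (\<psi> has_real_derivative \<psi>' t) (at t)" and c': "continuous_on UNIV \<psi>'"
    and L: "\<And>t. \<bar>\<psi>' t\<bar> \<le> L" and B: "\<And>t. \<bar>\<psi> t\<bar> \<le> B" and \<phi>: "test_fun \<Omega> \<phi>"
  shows "(\<integral>x. \<psi> (f x) * frechet_derivative \<phi> (at x) b \<partial>lborel) = - (\<integral>x. \<psi>' (f x) * d x * \<phi> x \<partial>lborel)"
proof -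
  have f: "integrable lborel f" and d: "integrable lborel d" using w by (auto simp: weak_partial_def)
  have [measurable]: "f \<in> borel_measurable borel" "d \<in> borel_measurable borel" using f d by auto
  have c\<psi>: "continuous_on UNIV \<psi>" using \<psi> by (intro continuous_at_imp_continuous_on ballI DERIV_isCont)
  have [measurable]: "\<psi> \<in> borel_measurable borel" "\<psi>' \<in> borel_measurable borel"
    using c\<psi> c' by (auto intro: borel_measurable_continuous_onI)
  obtain K C where K: "compact K" "K \<subseteq> \<Omega>" "\<And>x. x \<notin> K \<Longrightarrow> \<phi> x = 0"
    "\<And>x b. x \<notin> K \<Longrightarrow> frechet_derivative \<phi> (at x) b = 0"
    "\<And>x. \<bar>\<phi> x\<bar> \<le> C" "\<And>x b. b \<in> Basis \<Longrightarrow> \<bar>frechet_derivative \<phi> (at x) b\<bar> \<le> C"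
    and [measurable]: "\<phi> \<in> borel_measurable borel" "\<And>b. (\<lambda>x. frechet_derivative \<phi> (at x) b) \<in> borel_measurable borel"
    and d\<phi>: "\<And>x b. ((\<lambda>s. \<phi> (x + s *\<^sub>R b)) has_real_derivative frechet_derivative \<phi> (at x) b) (at 0)"
    using test_funE[OF \<phi>] by metis
  have C0: "0 \<le> C" using K(5)[of undefined] by (meson abs_ge_zero order_trans)
  have B0: "0 \<le> B" using B[of 0] by (meson abs_ge_zero order_trans)
  have L0: "0 \<le> L" using L[of 0] by (meson abs_ge_zero order_trans)
  have wp: "integrable lborel \<phi>" "integrable lborel (\<lambda>x. frechet_derivative \<phi> (at x) b)"
    using weak_partial_test_fun[OF \<phi> b] by (auto simp: weak_partial_def)
  obtain m where m: "K \<subseteq> shrink \<Omega> m" using compact_subset_shrink[OF \<Omega> K(1,2)] by blast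
  define F where "F n = mollify (real (Suc n)) f" for n
  define D where "D n = mollify (real (Suc n)) d" for n
  \<comment> \<open>The classical derivative of F n along b, valid at every point of the
    space.\<close>
  define E where "E n x = - (\<integral>y. dmoll (real (Suc n)) b (y - x) * f y \<partial>lborel)" for n x
  have [measurable]: "F n \<in> borel_measurable borel" "D n \<in> borel_measurable borel" for n
    unfolding F_def D_def by measurable
  have ED: "E n x = D n x" if "x \<in> K" "m \<le> n" for n x
    using weak_partial_mollify[OF w _ that(2)] m that(1) by (auto simp: E_def D_def)
  have step: "(\<integral>x. \<psi> (F n x) * frechet_derivative \<phi> (at x) b \<partial>lborel) = - (\<integral>x. \<psi>' (F n x) * D n x * \<phi> x \<partial>lborel)"
    and intD: "integrable lborel (\<lambda>x. \<psi>' (F n x) * D n x * \<phi> x)" if "m \<le> n" for n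
  proof -
    have k: "real (Suc n) > 0" by simp
    obtain M where M: "\<And>y::'a. \<bar>dmoll (real (Suc n)) b y\<bar> \<le> M" using dmoll_bounded[OF k] by blast
    have Eb: "\<bar>E n x\<bar> \<le> M * (\<integral>y. \<bar>f y\<bar> \<partial>lborel)" for x
    proof -
      have "\<bar>E n x\<bar> \<le> (\<integral>y. \<bar>dmoll (real (Suc n)) b (y - x) * f y\<bar> \<partial>lborel)"
        unfolding E_def using integral_abs_bound by simp
      also have "\<dots> \<le> (\<integral>y. M * \<bar>f y\<bar> \<partial>lborel)"
        using integrable_abs[OF integrable_dmoll_mult[OF k f, of b x]] f M
        by (intro integral_mono) (auto simp: abs_mult mult_right_mono simp del: of_nat_Suc)
      finally show ?thesis by simp
    qed
    define A where "A = M * (\<integral>y. \<bar>f y\<bar> \<partial>lborel)"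
    have A0: "0 \<le> A" unfolding A_def using Eb[of undefined] by (meson abs_ge_zero order_trans)
    have Em: "E n \<in> borel_measurable borel" unfolding E_def[abs_def] by measurable
    note [measurable] = Em
    have e1: "\<psi>' (F n x) * E n x * \<phi> x = \<psi>' (F n x) * D n x * \<phi> x" for x
      using ED[OF _ that] K(3) by (cases "x \<in> K") auto
    have i1: "integrable lborel (\<lambda>x. \<psi>' (F n x) * E n x * \<phi> x)"
    proof (rule integrable_bounded_mult[OF wp(1)])
      show "\<bar>\<psi>' (F n x) * E n x\<bar> \<le> L * A" for x unfolding abs_mult
        using L Eb L0 A0 by (intro mult_mono) (auto simp: A_def)
    qed simp
    have i2: "integrable lborel (\<lambda>x. \<psi> (F n x) * frechet_derivative \<phi> (at x) b)"
      by (rule integrable_bounded_mult[OF wp(2)]) (use B in auto)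
    have "(\<integral>x. \<psi>' (F n x) * E n x * \<phi> x + \<psi> (F n x) * frechet_derivative \<phi> (at x) b \<partial>lborel) = 0"
    proof (rule integral_directional_derivative_zero[of "\<lambda>x. \<psi> (F n x) * \<phi> x" b _ "L * A * C + B * C" K])
      show "((\<lambda>s. \<psi> (F n (x + s *\<^sub>R b)) * \<phi> (x + s *\<^sub>R b)) has_real_derivative
          \<psi>' (F n x) * E n x * \<phi> x + \<psi> (F n x) * frechet_derivative \<phi> (at x) b) (at 0)" for x
      proof -
        have 1: "((\<lambda>s. F n (x + s *\<^sub>R b)) has_real_derivative E n x) (at 0)"
          unfolding F_def E_def by (rule mollify_directional[OF k f])
        have "((\<lambda>s. \<psi> (F n (x + s *\<^sub>R b))) has_real_derivative \<psi>' (F n x) * E n x) (at 0)"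
          using DERIV_chain2[OF _ 1, of \<psi> "\<psi>' (F n x)"] \<psi>[of "F n x"] by simp
        from DERIV_mult[OF this d\<phi>[of x b]] show ?thesis by (simp add: algebra_simps)
      qed
      show "\<bar>\<psi>' (F n x) * E n x * \<phi> x + \<psi> (F n x) * frechet_derivative \<phi> (at x) b\<bar> \<le> L * A * C + B * C" for x
      proof -
        have "\<bar>\<psi>' (F n x) * E n x * \<phi> x\<bar> \<le> L * A * C" unfolding abs_mult
          using L Eb K(5) L0 A0 C0 by (intro mult_mono) (auto simp: A_def)
        moreover have "\<bar>\<psi> (F n x) * frechet_derivative \<phi> (at x) b\<bar> \<le> B * C" unfolding abs_mult
          using B K(6)[OF b] B0 C0 by (intro mult_mono) auto
        ultimately show ?thesis by linarith
      qed
      show "integrable lborel (\<lambda>x. \<psi> (F n x) * \<phi> x)"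
        by (rule integrable_bounded_mult[OF wp(1)]) (use B in auto)
    qed (use K in \<open>auto simp: compact_imp_bounded\<close>)
    then show "(\<integral>x. \<psi> (F n x) * frechet_derivative \<phi> (at x) b \<partial>lborel) = - (\<integral>x. \<psi>' (F n x) * D n x * \<phi> x \<partial>lborel)"
      using i1 i2 e1 by simp
    show "integrable lborel (\<lambda>x. \<psi>' (F n x) * D n x * \<phi> x)" using i1 e1 by simp
  qed
  \<comment> \<open>An L^1 error below 1 is finite; this yields integrability of the difference for
    all late n.\<close>
  have Fi: "integrable lborel (\<lambda>x. F n x - f x)" if "(\<integral>\<^sup>+x. ennreal \<bar>F n x - f x\<bar> \<partial>lborel) < 1" for n
    using that by (intro integrableI_bounded) (auto intro: less_trans)
  have Di: "integrable lborel (\<lambda>x. D n x - d x)" if "(\<integral>\<^sup>+x. ennreal \<bar>D n x - d x\<bar> \<partial>lborel) < 1" for n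
    using that by (intro integrableI_bounded) (auto intro: less_trans)
  have "\<forall>\<^sub>F n in sequentially. (\<integral>\<^sup>+x. ennreal \<bar>F n x - f x\<bar> \<partial>lborel) < 1 \<and> (\<integral>\<^sup>+x. ennreal \<bar>D n x - d x\<bar> \<partial>lborel) < 1 \<and> m \<le> n"
    using order_tendstoD(2)[OF mollify_tendsto_L1[OF f], of 1] order_tendstoD(2)[OF mollify_tendsto_L1[OF d], of 1]
      eventually_ge_at_top[of m] unfolding F_def D_def by (intro eventually_conj) simp_all
  then obtain N where N: "\<And>n. n \<ge> N \<Longrightarrow> integrable lborel (\<lambda>x. F n x - f x)"
      "\<And>n. n \<ge> N \<Longrightarrow> integrable lborel (\<lambda>x. D n x - d x)" "\<And>n. n \<ge> N \<Longrightarrow> m \<le> n"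
    unfolding eventually_sequentially using Fi Di by meson
  have lim0: "(\<lambda>n. \<integral>x. norm (G n x - g x) \<partial>lborel) \<longlonglongrightarrow> 0"
    if "(\<lambda>n. \<integral>\<^sup>+x. ennreal \<bar>G n x - g x\<bar> \<partial>lborel) \<longlonglongrightarrow> 0" "\<And>n. integrable lborel (\<lambda>x. G n x - g x)"
    for G :: "nat \<Rightarrow> 'a \<Rightarrow> real" and g
  proof -
    have "(\<integral>\<^sup>+x. ennreal \<bar>G n x - g x\<bar> \<partial>lborel) = ennreal (\<integral>x. norm (G n x - g x) \<partial>lborel)" for n
      using that(2)[of n] by (subst nn_integral_eq_integral) auto
    then have "(\<lambda>n. ennreal (\<integral>x. norm (G n x - g x) \<partial>lborel)) \<longlonglongrightarrow> ennreal 0" using that(1) by simp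
    then show ?thesis by (rule tendsto_ennrealD) (auto intro!: always_eventually)
  qed
  have Fl: "(\<lambda>n. \<integral>x. norm (F (n + N) x - f x) \<partial>lborel) \<longlonglongrightarrow> 0"
    using LIMSEQ_ignore_initial_segment[OF mollify_tendsto_L1[OF f], of N]
    by (intro lim0 N) (simp_all add: F_def)
  have Dl: "(\<lambda>n. \<integral>x. norm (D (n + N) x - d x) \<partial>lborel) \<longlonglongrightarrow> 0"
    using LIMSEQ_ignore_initial_segment[OF mollify_tendsto_L1[OF d], of N]
    by (intro lim0 N) (simp_all add: D_def)
  \<comment> \<open>L^1 convergence gives pointwise convergence only along a subsequence; D n still
    converges in L^1 along it.\<close>
  obtain r where r: "strict_mono r" "AE x in lborel. (\<lambda>n. F (r n + N) x - f x) \<longlonglongrightarrow> 0"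
    using tendsto_L1_AE_subseq[OF _ Fl] N(1) by auto
  define s where "s n = r n + N" for n
  have sN: "s n \<ge> N" for n by (simp add: s_def)
  have Fs: "AE x in lborel. (\<lambda>n. F (s n) x) \<longlonglongrightarrow> f x"
    using r(2) by eventually_elim (simp add: s_def LIM_zero_iff)
  have Ds: "(\<lambda>n. \<integral>x. norm (D (s n) x - d x) \<partial>lborel) \<longlonglongrightarrow> 0"
    using LIMSEQ_subseq_LIMSEQ[OF Dl r(1)] by (simp add: o_def s_def)
  have l1: "(\<lambda>n. \<integral>x. \<psi> (F (s n) x) * frechet_derivative \<phi> (at x) b \<partial>lborel) \<longlonglongrightarrow> (\<integral>x. \<psi> (f x) * frechet_derivative \<phi> (at x) b \<partial>lborel)"
  proof (rule integral_dominated_convergence[where w="\<lambda>x. B * \<bar>frechet_derivative \<phi> (at x) b\<bar>"])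
    show "AE x in lborel. (\<lambda>n. \<psi> (F (s n) x) * frechet_derivative \<phi> (at x) b) \<longlonglongrightarrow> \<psi> (f x) * frechet_derivative \<phi> (at x) b"
      using Fs by eventually_elim (intro tendsto_intros isCont_tendsto_compose[of _ \<psi>] DERIV_isCont[OF \<psi>])
  qed (use wp B in \<open>auto simp: abs_mult mult_right_mono\<close>)
  have l2: "(\<lambda>n. \<integral>x. \<psi>' (F (s n) x) * d x * \<phi> x \<partial>lborel) \<longlonglongrightarrow> (\<integral>x. \<psi>' (f x) * d x * \<phi> x \<partial>lborel)"
  proof (rule integral_dominated_convergence[where w="\<lambda>x. L * \<bar>d x\<bar> * C"])
    show "AE x in lborel. (\<lambda>n. \<psi>' (F (s n) x) * d x * \<phi> x) \<longlonglongrightarrow> \<psi>' (f x) * d x * \<phi> x"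
      using Fs by eventually_elim (intro tendsto_intros isCont_tendsto_compose[of _ \<psi>'] continuous_on_interior[OF c'], auto)
    show "AE x in lborel. norm (\<psi>' (F (s n) x) * d x * \<phi> x) \<le> L * \<bar>d x\<bar> * C" for n
      using L K(5) L0 by (intro AE_I2) (auto simp: abs_mult intro!: mult_mono)
  qed (use d in auto)
  \<comment> \<open>Replacing D n by d costs at most their L^1 distance times the bounds L of
    \<psi>' and C of \<phi>, so pointwise convergence of D n never enters.\<close>
  have l3: "(\<lambda>n. (\<integral>x. \<psi>' (F (s n) x) * D (s n) x * \<phi> x \<partial>lborel) - (\<integral>x. \<psi>' (F (s n) x) * d x * \<phi> x \<partial>lborel)) \<longlonglongrightarrow> 0"
  proof (rule Lim_null_comparison)
    show "(\<lambda>n. (\<integral>x. norm (D (s n) x - d x) \<partial>lborel) * (L * C)) \<longlonglongrightarrow> 0"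
      using tendsto_mult_left_zero[OF Ds] by simp
    show "\<forall>\<^sub>F n in sequentially. norm ((\<integral>x. \<psi>' (F (s n) x) * D (s n) x * \<phi> x \<partial>lborel) - (\<integral>x. \<psi>' (F (s n) x) * d x * \<phi> x \<partial>lborel))
       \<le> (\<integral>x. norm (D (s n) x - d x) \<partial>lborel) * (L * C)"
    proof (rule always_eventually, rule allI)
      fix n
      note i0 = N(2)[OF sN[of n]]
      have i1: "integrable lborel (\<lambda>x. \<psi>' (F (s n) x) * d x * \<phi> x)"
      proof -
        have "integrable lborel (\<lambda>x. (\<psi>' (F (s n) x) * \<phi> x) * d x)"
        proof (rule integrable_bounded_mult[OF d])
          show "\<bar>\<psi>' (F (s n) x) * \<phi> x\<bar> \<le> L * C" for x unfolding abs_mult using L K(5) L0 by (intro mult_mono) auto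
        qed simp
        then show ?thesis by (simp add: ac_simps)
      qed
      have "(\<integral>x. \<psi>' (F (s n) x) * D (s n) x * \<phi> x \<partial>lborel) - (\<integral>x. \<psi>' (F (s n) x) * d x * \<phi> x \<partial>lborel)
        = (\<integral>x. \<psi>' (F (s n) x) * D (s n) x * \<phi> x - \<psi>' (F (s n) x) * d x * \<phi> x \<partial>lborel)"
        using intD[OF N(3)[OF sN]] i1 by simp
      also have "norm \<dots> \<le> (\<integral>x. norm (\<psi>' (F (s n) x) * D (s n) x * \<phi> x - \<psi>' (F (s n) x) * d x * \<phi> x) \<partial>lborel)"
        by (rule integral_norm_bound)
      also have "\<dots> \<le> (\<integral>x. norm (D (s n) x - d x) * (L * C) \<partial>lborel)"
      proof (rule integral_mono)
        fix x
        have "norm (\<psi>' (F (s n) x) * D (s n) x * \<phi> x - \<psi>' (F (s n) x) * d x * \<phi> x) = \<bar>D (s n) x - d x\<bar> * (\<bar>\<psi>' (F (s n) x)\<bar> * \<bar>\<phi> x\<bar>)"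
          by (simp add: abs_mult[symmetric] algebra_simps)
        also have "\<dots> \<le> \<bar>D (s n) x - d x\<bar> * (L * C)"
          using L K(5) L0 by (intro mult_left_mono mult_mono) auto
        finally show "norm (\<psi>' (F (s n) x) * D (s n) x * \<phi> x - \<psi>' (F (s n) x) * d x * \<phi> x) \<le> norm (D (s n) x - d x) * (L * C)" by simp
      qed (use intD[OF N(3)[OF sN]] i1 i0 in auto)
      finally show "norm ((\<integral>x. \<psi>' (F (s n) x) * D (s n) x * \<phi> x \<partial>lborel) - (\<integral>x. \<psi>' (F (s n) x) * d x * \<phi> x \<partial>lborel))
       \<le> (\<integral>x. norm (D (s n) x - d x) \<partial>lborel) * (L * C)" by simp
    qed
  qed
  have "(\<lambda>n. - (\<integral>x. \<psi>' (F (s n) x) * D (s n) x * \<phi> x \<partial>lborel)) \<longlonglongrightarrow> - (\<integral>x. \<psi>' (f x) * d x * \<phi> x \<partial>lborel)"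
    using tendsto_minus[OF tendsto_add[OF l3 l2]] by simp
  then have "(\<lambda>n. \<integral>x. \<psi> (F (s n) x) * frechet_derivative \<phi> (at x) b \<partial>lborel) \<longlonglongrightarrow> - (\<integral>x. \<psi>' (f x) * d x * \<phi> x \<partial>lborel)"
    using step[OF N(3)[OF sN]] by simp
  then show ?thesis using l1 LIMSEQ_unique by blast
qed

text \<open>Functions on \<open>\<Omega>\<close> are traded for Borel functions on the whole space, so that product measurability is available.\<close>

definition rep :: "'a::euclidean_space set \<Rightarrow> ('a \<Rightarrow> real) \<Rightarrow> ('a \<Rightarrow> real) \<Rightarrow> bool" where
  "rep \<Omega> f g \<longleftrightarrow> f \<in> borel_measurable (lebesgue_on \<Omega>) \<and> g \<in> borel_measurable borel \<and>
     (\<forall>x. x \<notin> \<Omega> \<longrightarrow> g x = 0) \<and> (AE x in lborel. x \<in> \<Omega> \<longrightarrow> f x = g x)"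

lemma repD:
  assumes "rep \<Omega> f g"
  shows "f \<in> borel_measurable (lebesgue_on \<Omega>)" "g \<in> borel_measurable borel" "\<And>x. x \<notin> \<Omega> \<Longrightarrow> g x = 0"
    "AE x in lborel. x \<in> \<Omega> \<longrightarrow> f x = g x"
  using assms by (auto simp: rep_def)

lemma AE_lebesgue_on_open:
  assumes "open \<Omega>"
  shows "(AE x in lebesgue_on \<Omega>. P x) \<longleftrightarrow> (AE x in lborel. x \<in> \<Omega> \<longrightarrow> P x)"
  using assms by (subst AE_restrict_space_iff) (auto simp: AE_completion_iff)

lemma AE_lebesgue_on_Icc:
  "(AE x in lebesgue_on {a..b::real}. P x) \<longleftrightarrow> (AE x in lborel. x \<in> {a..b} \<longrightarrow> P x)"
  by (subst AE_restrict_space_iff) (auto simp: AE_completion_iff)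

lemma borel_measurable_lebesgue_onI: "g \<in> borel_measurable borel \<Longrightarrow> g \<in> borel_measurable (lebesgue_on \<Omega>)"
  by (intro measurable_restrict_space1 measurable_completion) simp

lemma rep_ex:
  assumes \<Omega>: "open \<Omega>" and f: "f \<in> borel_measurable (lebesgue_on \<Omega>)"
  shows "\<exists>g. rep \<Omega> f g"
proof -
  have "(\<lambda>x. if x \<in> \<Omega> then f x else 0) \<in> borel_measurable lebesgue"
    using f \<Omega> by (intro borel_measurable_if_I) auto
  then obtain g where g: "g \<in> borel_measurable lborel" "AE x in lborel. (if x \<in> \<Omega> then f x else 0) = g x"
    using completion_ex_borel_measurable_real by blast
  have "rep \<Omega> f (\<lambda>x. indicator \<Omega> x * g x)"
    unfolding rep_def
  proof (intro conjI)
    have [measurable]: "\<Omega> \<in> sets borel" "g \<in> borel_measurable borel" using \<Omega> g(1) by auto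
    show "(\<lambda>x. indicator \<Omega> x * g x) \<in> borel_measurable borel" by measurable
    show "AE x in lborel. x \<in> \<Omega> \<longrightarrow> f x = indicator \<Omega> x * g x"
      using g(2) by eventually_elim auto
  qed (use f in auto)
  then show ?thesis by blast
qed

lemma
  assumes \<Omega>: "open \<Omega>" and r: "rep \<Omega> f g"
  shows rep_integral: "(\<integral>x. f x \<partial>lebesgue_on \<Omega>) = (\<integral>x. g x \<partial>lborel)"
    and rep_integrable: "integrable (lebesgue_on \<Omega>) f \<longleftrightarrow> integrable lborel g"
proof -
  note rr = repD[OF r]
  have ae: "AE x in lebesgue_on \<Omega>. f x = g x" using rr(4) \<Omega> by (simp add: AE_lebesgue_on_open)
  have gm: "g \<in> borel_measurable (lebesgue_on \<Omega>)" using rr(2) by (rule borel_measurable_lebesgue_onI)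
  have ind: "(\<lambda>x. indicator \<Omega> x *\<^sub>R g x) = g" using rr(3) by (auto simp: indicator_def fun_eq_iff)
  have S: "\<Omega> \<inter> space lebesgue \<in> sets lebesgue" using \<Omega> by auto
  have "(\<integral>x. f x \<partial>lebesgue_on \<Omega>) = (\<integral>x. g x \<partial>lebesgue_on \<Omega>)"
    by (rule integral_cong_AE[OF rr(1) gm ae])
  also have "\<dots> = (\<integral>x. g x \<partial>lebesgue)"
    by (simp only: integral_restrict_space[OF S] ind)
  also have "\<dots> = (\<integral>x. g x \<partial>lborel)" using rr(2) by (intro integral_completion) auto
  finally show "(\<integral>x. f x \<partial>lebesgue_on \<Omega>) = (\<integral>x. g x \<partial>lborel)" .
  have "integrable (lebesgue_on \<Omega>) f \<longleftrightarrow> integrable (lebesgue_on \<Omega>) g"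
    by (rule integrable_cong_AE[OF rr(1) gm ae])
  also have "\<dots> \<longleftrightarrow> integrable lebesgue g"
    by (simp only: integrable_restrict_space[OF S] ind)
  also have "\<dots> \<longleftrightarrow> integrable lborel g" using rr(2) by (intro integrable_completion) auto
  finally show "integrable (lebesgue_on \<Omega>) f \<longleftrightarrow> integrable lborel g" .
qed

text \<open>The condition \<open>h 0 0 = 0\<close> keeps the representative zero outside \<Omega>; a
  constant therefore needs a cut-off, see \<open>rep_const\<close>.\<close>

lemma rep_combine:
  assumes f: "rep \<Omega> f f'" and g: "rep \<Omega> g g'" and h0: "h 0 0 = 0"
    and h[measurable]: "(\<lambda>(a,b). h a b) \<in> borel_measurable (borel \<Otimes>\<^sub>M borel)"
  shows "rep \<Omega> (\<lambda>x. h (f x) (g x)) (\<lambda>x. h (f' x) (g' x) :: real)"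
proof -
  note [measurable] = repD(1,2)[OF f] repD(1,2)[OF g]
  show ?thesis unfolding rep_def
  proof (intro conjI)
    have "(\<lambda>x. (f x, g x)) \<in> lebesgue_on \<Omega> \<rightarrow>\<^sub>M borel \<Otimes>\<^sub>M borel" by measurable
    from measurable_compose[OF this h] show "(\<lambda>x. h (f x) (g x)) \<in> borel_measurable (lebesgue_on \<Omega>)" by simp
    have "(\<lambda>x. (f' x, g' x)) \<in> borel \<rightarrow>\<^sub>M borel \<Otimes>\<^sub>M borel" by measurable
    from measurable_compose[OF this h] show "(\<lambda>x. h (f' x) (g' x)) \<in> borel_measurable borel" by simp
    show "\<forall>x. x \<notin> \<Omega> \<longrightarrow> h (f' x) (g' x) = 0" using repD(3)[OF f] repD(3)[OF g] h0 by auto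
    show "AE x in lborel. x \<in> \<Omega> \<longrightarrow> h (f x) (g x) = h (f' x) (g' x)"
      using repD(4)[OF f] repD(4)[OF g] by eventually_elim auto
  qed
qed

lemma rep_compose:
  assumes f: "rep \<Omega> f f'" and "h 0 = 0" and [measurable]: "h \<in> borel_measurable borel"
  shows "rep \<Omega> (\<lambda>x. h (f x)) (\<lambda>x. h (f' x) :: real)"
  by (rule rep_combine[OF f f, of "\<lambda>a b. h a"]) (use assms in auto)

lemma rep_diff: "rep \<Omega> f f' \<Longrightarrow> rep \<Omega> g g' \<Longrightarrow> rep \<Omega> (\<lambda>x. f x - g x) (\<lambda>x. f' x - g' x)"
  by (rule rep_combine[where h="\<lambda>a b. a - b"]) auto
lemma rep_add: "rep \<Omega> f f' \<Longrightarrow> rep \<Omega> g g' \<Longrightarrow> rep \<Omega> (\<lambda>x. f x + g x) (\<lambda>x. f' x + g' x)"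
  by (rule rep_combine[where h="\<lambda>a b. a + b"]) auto
lemma rep_mult: "rep \<Omega> f f' \<Longrightarrow> rep \<Omega> g g' \<Longrightarrow> rep \<Omega> (\<lambda>x. f x * g x) (\<lambda>x. f' x * g' x)"
  by (rule rep_combine[where h="\<lambda>a b. a * b"]) auto
lemma rep_power: "rep \<Omega> f f' \<Longrightarrow> n > 0 \<Longrightarrow> rep \<Omega> (\<lambda>x. f x ^ n) (\<lambda>x. f' x ^ n)"
  by (rule rep_compose[where h="\<lambda>a. a ^ n"]) auto
lemma rep_cmult: "rep \<Omega> f f' \<Longrightarrow> rep \<Omega> (\<lambda>x. c * f x) (\<lambda>x. c * f' x)"
  by (rule rep_compose[where h="\<lambda>a. c * a"]) auto
lemma rep_0: "rep \<Omega> (\<lambda>x. 0) (\<lambda>x. 0)"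
  by (simp add: rep_def)
lemma rep_sum: "(\<And>i. i \<in> I \<Longrightarrow> rep \<Omega> (f i) (f' i)) \<Longrightarrow> rep \<Omega> (\<lambda>x. \<Sum>i\<in>I. f i x) (\<lambda>x. \<Sum>i\<in>I. f' i x)"
  by (induction I rule: infinite_finite_induct) (auto intro: rep_add simp: rep_0)
lemma rep_const:
  assumes "open \<Omega>" shows "rep \<Omega> (\<lambda>x. c) (\<lambda>x. c * indicator \<Omega> x)"
  using assms by (auto simp: rep_def)
lemma rep_self:
  "g \<in> borel_measurable borel \<Longrightarrow> (\<And>x. x \<notin> \<Omega> \<Longrightarrow> g x = 0) \<Longrightarrow> rep \<Omega> g g"
  by (simp add: rep_def borel_measurable_lebesgue_onI)
lemma rep_mult_borel:
  assumes "rep \<Omega> f f'" "g \<in> borel_measurable borel"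
  shows "rep \<Omega> (\<lambda>x. f x * g x) (\<lambda>x. f' x * g x)"
proof -
  have [measurable]: "g \<in> borel_measurable (lebesgue_on \<Omega>)" "g \<in> borel_measurable borel"
    using assms(2) by (auto intro: borel_measurable_lebesgue_onI)
  note [measurable] = repD(1,2)[OF assms(1)]
  show ?thesis unfolding rep_def using repD(3,4)[OF assms(1)] by (auto elim: eventually_mono)
qed

lemma abs_le_1_plus_square: "\<bar>y :: real\<bar> \<le> 1 + y\<^sup>2"
proof -
  have "0 \<le> (\<bar>y\<bar> - 1)\<^sup>2" by simp
  then have "2 * \<bar>y\<bar> \<le> 1 + y\<^sup>2" by (simp add: power2_diff)
  then show ?thesis by linarith
qed

lemma integrable_if_square:
  fixes f :: "'a::euclidean_space \<Rightarrow> real"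
  assumes \<Omega>: "open \<Omega>" "bounded \<Omega>" and [measurable]: "f \<in> borel_measurable borel" and 0: "\<And>x. x \<notin> \<Omega> \<Longrightarrow> f x = 0"
    and sq: "integrable lborel (\<lambda>x. (f x)\<^sup>2)"
  shows "integrable lborel f"
proof (rule Bochner_Integration.integrable_bound)
  show "integrable lborel (\<lambda>x. indicator \<Omega> x + (f x)\<^sup>2)"
    using sq \<Omega> emeasure_bounded_finite[OF \<Omega>(2)] by (intro Bochner_Integration.integrable_add integrable_real_indicator) auto
  show "AE x in lborel. norm (f x) \<le> norm (indicator \<Omega> x + (f x)\<^sup>2)"
  proof (rule AE_I2)
    fix x
    have "\<bar>f x\<bar> \<le> 1 + (f x)\<^sup>2" by (rule abs_le_1_plus_square)
    then show "norm (f x) \<le> norm (indicator \<Omega> x + (f x)\<^sup>2)" using 0[of x] by (cases "x \<in> \<Omega>") auto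
  qed
qed simp

lemma abs_powr_2: "\<bar>y :: real\<bar> powr 2 = y\<^sup>2"
  by (cases "y = 0") (auto simp: powr_numeral)
lemma abs_powr_4: "\<bar>y :: real\<bar> powr 4 = y ^ 4"
  by (cases "y = 0") (auto simp: powr_numeral)

lemma Lp_2: "Lp \<Omega> 2 f \<longleftrightarrow> f \<in> borel_measurable (lebesgue_on \<Omega>) \<and> integrable (lebesgue_on \<Omega>) (\<lambda>x. (f x)\<^sup>2)"
  by (simp add: Lp_def abs_powr_2)
lemma Lp_4: "Lp \<Omega> 4 f \<longleftrightarrow> f \<in> borel_measurable (lebesgue_on \<Omega>) \<and> integrable (lebesgue_on \<Omega>) (\<lambda>x. (f x) ^ 4)"
  by (simp add: Lp_def abs_powr_4)

lemma L2_dist_square: "(L2_dist \<Omega> f g)\<^sup>2 = (\<integral>x. (f x - g x)\<^sup>2 \<partial>lebesgue_on \<Omega>)"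
proof -
  have "0 \<le> (\<integral>x. (f x - g x)\<^sup>2 \<partial>lebesgue_on \<Omega>)" by simp
  then show ?thesis unfolding L2_dist_def Lp_norm_def abs_powr_2
    by (simp add: powr_half_sqrt)
qed


text \<open>Cauchy-Schwarz against the indicator of the bounded set \<Omega>. It turns continuity of
  the solution in L^2 into continuity in L^1, the norm in which versions are chosen and translations
  are controlled.\<close>

lemma L1_le_L2_dist:
  assumes \<Omega>: "open \<Omega>" "bounded \<Omega>" and f: "Lp \<Omega> 2 f" "rep \<Omega> f f'" and g: "Lp \<Omega> 2 g" "rep \<Omega> g g'"
  shows "(\<integral>x. \<bar>f' x - g' x\<bar> \<partial>lborel) \<le> sqrt (measure lborel \<Omega>) * L2_dist \<Omega> f g"
proof -
  have [measurable]: "\<Omega> \<in> sets borel" using \<Omega> by auto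
  define h where "h x = f' x - g' x" for x
  have rh: "rep \<Omega> (\<lambda>x. f x - g x) h" unfolding h_def by (rule rep_diff[OF f(2) g(2)])
  note [measurable] = repD(2)[OF rh]
  have sq: "integrable lborel (\<lambda>x. (h x)\<^sup>2)"
  proof (rule Bochner_Integration.integrable_bound)
    have "rep \<Omega> (\<lambda>x. (f x)\<^sup>2) (\<lambda>x. (f' x)\<^sup>2)" "rep \<Omega> (\<lambda>x. (g x)\<^sup>2) (\<lambda>x. (g' x)\<^sup>2)"
      using f(2) g(2) by (auto intro: rep_power)
    then show "integrable lborel (\<lambda>x. 2 * (f' x)\<^sup>2 + 2 * (g' x)\<^sup>2)"
      using f(1) g(1) rep_integrable[OF \<Omega>(1)] by (auto simp: Lp_2)
    have "(h x)\<^sup>2 \<le> 2 * (f' x)\<^sup>2 + 2 * (g' x)\<^sup>2" for x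
      using sum_squares_ge_zero[of "f' x + g' x" 0] by (simp add: h_def power2_eq_square algebra_simps)
    then show "AE x in lborel. norm ((h x)\<^sup>2) \<le> norm (2 * (f' x)\<^sup>2 + 2 * (g' x)\<^sup>2)"
      by (intro AE_I2) simp
  qed simp
  have ih: "integrable lborel h" using repD(2,3)[OF rh] by (intro integrable_if_square[OF \<Omega> _ _ sq]) auto
  have dist: "(L2_dist \<Omega> f g)\<^sup>2 = (\<integral>x. (h x)\<^sup>2 \<partial>lborel)"
    unfolding L2_dist_square by (rule rep_integral[OF \<Omega>(1)]) (rule rep_power[OF rh], simp)
  have "(\<integral>\<^sup>+x. ennreal \<bar>h x\<bar> * indicator \<Omega> x \<partial>lborel)\<^sup>2 \<le> (\<integral>\<^sup>+x. ennreal \<bar>h x\<bar> ^ 2 \<partial>lborel) * (\<integral>\<^sup>+x. (indicator \<Omega> x) ^ 2 \<partial>lborel)"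
    by (rule Cauchy_Schwarz_nn_integral) auto
  also have "(\<integral>\<^sup>+x. ennreal \<bar>h x\<bar> * indicator \<Omega> x \<partial>lborel) = (\<integral>\<^sup>+x. ennreal \<bar>h x\<bar> \<partial>lborel)"
    using repD(3)[OF rh] by (intro nn_integral_cong) (auto simp: indicator_def)
  also have "\<dots> = ennreal (\<integral>x. \<bar>h x\<bar> \<partial>lborel)" using ih by (intro nn_integral_eq_integral) auto
  also have "(\<integral>\<^sup>+x. ennreal \<bar>h x\<bar> ^ 2 \<partial>lborel) = ennreal ((L2_dist \<Omega> f g)\<^sup>2)"
    unfolding dist using sq by (subst nn_integral_eq_integral[symmetric]) (auto simp: ennreal_power)
  also have "(\<integral>\<^sup>+x. (indicator \<Omega> x) ^ 2 \<partial>lborel) = (\<integral>\<^sup>+x. indicator \<Omega> x \<partial>lborel)"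
    by (intro nn_integral_cong) (auto simp: indicator_def)
  also have "\<dots> = ennreal (measure lborel \<Omega>)"
    using emeasure_bounded_finite[OF \<Omega>(2)] by (simp add: emeasure_eq_ennreal_measure)
  finally have "ennreal ((\<integral>x. \<bar>h x\<bar> \<partial>lborel)\<^sup>2) \<le> ennreal ((L2_dist \<Omega> f g)\<^sup>2 * measure lborel \<Omega>)"
    by (simp add: ennreal_power ennreal_mult)
  then have "(\<integral>x. \<bar>h x\<bar> \<partial>lborel)\<^sup>2 \<le> (L2_dist \<Omega> f g)\<^sup>2 * measure lborel \<Omega>"
    by (subst (asm) ennreal_le_iff) auto
  also have "\<dots> = (sqrt (measure lborel \<Omega>) * L2_dist \<Omega> f g)\<^sup>2" by (simp add: power_mult_distrib)
  finally have "(\<integral>x. \<bar>h x\<bar> \<partial>lborel) \<le> sqrt (measure lborel \<Omega>) * L2_dist \<Omega> f g"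
    by (rule power2_le_imp_le) (simp add: L2_dist_def Lp_norm_def)
  then show ?thesis by (simp add: h_def)
qed

lemma rep_Lp_2:
  assumes \<Omega>: "open \<Omega>" "bounded \<Omega>" and f: "Lp \<Omega> 2 f" and r: "rep \<Omega> f f'"
  shows "integrable lborel (\<lambda>x. (f' x)\<^sup>2)" "integrable lborel f'"
proof -
  have r2: "rep \<Omega> (\<lambda>x. (f x)\<^sup>2) (\<lambda>x. (f' x)\<^sup>2)" by (rule rep_power[OF r]) simp
  show sq: "integrable lborel (\<lambda>x. (f' x)\<^sup>2)"
    using f by (simp add: Lp_2 rep_integrable[OF \<Omega>(1) r2])
  show "integrable lborel f'"
    by (rule integrable_if_square[OF \<Omega> repD(2)[OF r] repD(3)[OF r] sq])
qed

section \<open>Jointly measurable versions\<close>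

text \<open>Freezing time at the grid point floor(t (k + 1)) / (k + 1) gives jointly measurable
  functions, glued from countably many sections. By continuity in time they converge in L^1 at every
  t >= 0, and \<open>joint_limit\<close> supplies a joint version of the limit.\<close>

lemma joint_version:
  fixes f :: "real \<Rightarrow> 'a::euclidean_space \<Rightarrow> real"
  assumes \<Omega>: "open \<Omega>" "bounded \<Omega>" and L2: "\<And>t. t \<ge> 0 \<Longrightarrow> Lp \<Omega> 2 (f t)"
    and cont: "\<And>t0. t0 \<ge> 0 \<Longrightarrow> ((\<lambda>t. L2_dist \<Omega> (f t) (f t0)) \<longlongrightarrow> 0) (at t0 within {0..})"
  obtains F where "(\<lambda>(t,x). F t x) \<in> borel_measurable (lborel \<Otimes>\<^sub>M lborel)"
    "\<And>t x. x \<notin> \<Omega> \<Longrightarrow> F t x = 0" "\<And>t. t \<ge> 0 \<Longrightarrow> rep \<Omega> (f t) (F t)"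
    "\<And>t0. t0 \<ge> 0 \<Longrightarrow> ((\<lambda>t. \<integral>x. \<bar>F t x - F t0 x\<bar> \<partial>lborel) \<longlongrightarrow> 0) (at t0 within {0..})"
proof -
  have [measurable]: "\<Omega> \<in> sets borel" using \<Omega> by auto
  have "\<forall>t. \<exists>g. t \<ge> 0 \<longrightarrow> rep \<Omega> (f t) g" using L2 rep_ex[OF \<Omega>(1)] by (auto simp: Lp_2)
  then obtain f' where f': "\<And>t. t \<ge> 0 \<Longrightarrow> rep \<Omega> (f t) (f' t)" by metis
  \<comment> \<open>Stated for any family of representatives, since it is applied to f' and again to
    the final version F.\<close>
  have L1: "((\<lambda>t. \<integral>x. \<bar>g t x - g t0 x\<bar> \<partial>lborel) \<longlongrightarrow> 0) (at t0 within {0..})"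
    if t0: "t0 \<ge> 0" and g: "\<And>t. t \<ge> 0 \<Longrightarrow> rep \<Omega> (f t) (g t)" for t0 g
  proof (rule Lim_null_comparison)
    show "\<forall>\<^sub>F t in at t0 within {0..}. norm (\<integral>x. \<bar>g t x - g t0 x\<bar> \<partial>lborel) \<le> sqrt (measure lborel \<Omega>) * L2_dist \<Omega> (f t) (f t0)"
    proof (unfold eventually_at_filter, intro always_eventually allI impI)
      fix t :: real assume "t \<in> {0..}"
      then have "t \<ge> 0" by simp
      from L1_le_L2_dist[OF \<Omega> L2[OF this] g[OF this] L2[OF t0] g[OF t0]]
      show "norm (\<integral>x. \<bar>g t x - g t0 x\<bar> \<partial>lborel) \<le> sqrt (measure lborel \<Omega>) * L2_dist \<Omega> (f t) (f t0)" by simp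
    qed
    show "((\<lambda>t. sqrt (measure lborel \<Omega>) * L2_dist \<Omega> (f t) (f t0)) \<longlongrightarrow> 0) (at t0 within {0..})"
      by (intro tendsto_mult_right_zero cont[OF t0])
  qed
  define g where "g k t x = (if t < 0 then 0 else f' (max 0 (real_of_int \<lfloor>t * real (Suc k)\<rfloor> / real (Suc k))) x)" for k t x
  have gm: "(\<lambda>(t,x). g k t x) \<in> borel_measurable (lborel \<Otimes>\<^sub>M lborel)" for k
  proof -
    have m1: "(\<lambda>p::real \<times> 'a. if fst p < 0 then 0 else f' (max 0 (real_of_int i / real (Suc k))) (snd p)) \<in> borel_measurable (lborel \<Otimes>\<^sub>M lborel)" for i
    proof -
      have [measurable]: "f' (max 0 (real_of_int i / real (Suc k))) \<in> borel_measurable borel"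
        by (rule repD(2)[OF f']) simp
      show ?thesis by measurable
    qed
    have "(\<lambda>p. if fst p < 0 then 0 else f' (max 0 (real_of_int \<lfloor>fst p * real (Suc k)\<rfloor> / real (Suc k))) (snd p)) \<in> borel_measurable (lborel \<Otimes>\<^sub>M lborel)"
      by (rule measurable_compose_countable[OF m1, of "\<lambda>p. \<lfloor>fst p * real (Suc k)\<rfloor>"]) measurable
    then show ?thesis unfolding g_def split_beta' .
  qed
  obtain G where Gm: "(\<lambda>(t,x). G t x) \<in> borel_measurable (lborel \<Otimes>\<^sub>M lborel)"
    and G: "\<And>t d. t \<in> space lborel \<Longrightarrow> d \<in> borel_measurable lborel \<Longrightarrow>
      (\<lambda>k. \<integral>\<^sup>+x. ennreal \<bar>g k t x - d x\<bar> \<partial>lborel) \<longlonglongrightarrow> 0 \<Longrightarrow> AE x in lborel. G t x = d x"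
  proof (rule joint_limit[where g=g, OF sigma_finite_lborel gm], goal_cases)
    case (1 G)
    show ?case by (rule 1(1)[OF 1(2) 1(3)])
  qed
  have ae: "AE x in lborel. G t x = f' t x" if t: "t \<ge> 0" for t
  proof (rule G)
    show "f' t \<in> borel_measurable lborel" using repD(2)[OF f'[OF t]] by simp
    define s where "s k = real_of_int \<lfloor>t * real (Suc k)\<rfloor> / real (Suc k)" for k
    have s: "s k \<in> {0..}" for k using t by (simp add: s_def)
    have "s \<longlonglongrightarrow> t"
    proof (rule tendsto_sandwich)
      show "(\<lambda>k. t - 1 / real (Suc k)) \<longlonglongrightarrow> t" using tendsto_diff[OF tendsto_const LIMSEQ_Suc[OF lim_1_over_n], of t] by simp
      show "\<forall>\<^sub>F k in sequentially. t - 1 / real (Suc k) \<le> s k"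
      proof (intro always_eventually allI)
        fix k
        have "t * real (Suc k) - 1 \<le> real_of_int \<lfloor>t * real (Suc k)\<rfloor>" by linarith
        then have "(t * real (Suc k) - 1) / real (Suc k) \<le> s k" unfolding s_def by (intro divide_right_mono) auto
        then show "t - 1 / real (Suc k) \<le> s k" by (simp add: diff_divide_distrib del: of_nat_Suc)
      qed
      show "\<forall>\<^sub>F k in sequentially. s k \<le> t"
      proof (intro always_eventually allI)
        fix k
        have "real_of_int \<lfloor>t * real (Suc k)\<rfloor> \<le> t * real (Suc k)" by linarith
        then show "s k \<le> t" unfolding s_def by (simp add: field_simps del: of_nat_Suc)
      qed
    qed auto
    moreover have "continuous (at t within {0..}) (\<lambda>s. \<integral>x. \<bar>f' s x - f' t x\<bar> \<partial>lborel)"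
      using L1[OF t f'] by (simp add: continuous_within)
    ultimately have lim: "(\<lambda>k. \<integral>x. \<bar>f' (s k) x - f' t x\<bar> \<partial>lborel) \<longlonglongrightarrow> 0"
      using s unfolding continuous_within_sequentially by (simp add: o_def)
    have int: "integrable lborel (f' t)" if "t \<ge> 0" for t
      by (rule rep_Lp_2(2)[OF \<Omega> L2[OF that] f'[OF that]])
    have gs: "g k t x = f' (s k) x" for k x
    proof -
      have "g k t x = f' (max 0 (s k)) x" using t by (simp only: g_def s_def not_less[symmetric] if_False)
      moreover have "max 0 (s k) = s k" using s[of k] by simp
      ultimately show ?thesis by (simp only:)
    qed
    have "(\<integral>\<^sup>+x. ennreal \<bar>g k t x - f' t x\<bar> \<partial>lborel) = ennreal (\<integral>x. \<bar>f' (s k) x - f' t x\<bar> \<partial>lborel)" for k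
      unfolding gs using s[of k] by (intro nn_integral_eq_integral integrable_abs Bochner_Integration.integrable_diff int t) auto
    then show "(\<lambda>k. \<integral>\<^sup>+x. ennreal \<bar>g k t x - f' t x\<bar> \<partial>lborel) \<longlonglongrightarrow> 0"
      using tendsto_ennrealI[OF lim] by simp
  qed simp
  have [measurable]: "(\<lambda>p. G (fst p) (snd p)) \<in> borel_measurable (lborel \<Otimes>\<^sub>M lborel)"
    using Gm by (simp add: split_beta')
  \<comment> \<open>\<open>joint_limit\<close> identifies G only almost everywhere; the cut-off
    makes the version vanish at every point outside \<Omega>.\<close>
  define F where "F t x = indicator \<Omega> x * G t x" for t x
  have Fm: "(\<lambda>(t,x). F t x) \<in> borel_measurable (lborel \<Otimes>\<^sub>M lborel)"
    unfolding F_def split_beta' by measurable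
  have rF: "rep \<Omega> (f t) (F t)" if t: "t \<ge> 0" for t
    unfolding rep_def
  proof (intro conjI)
    show "F t \<in> borel_measurable borel" using measurable_Pair2[OF Fm, of t] by simp
    show "AE x in lborel. x \<in> \<Omega> \<longrightarrow> f t x = F t x"
      using ae[OF t] repD(4)[OF f'[OF t]] by eventually_elim (auto simp: F_def)
  qed (use repD(1)[OF f'[OF t]] in \<open>auto simp: F_def\<close>)
  show ?thesis
  proof (rule that)
    show "(\<lambda>(t,x). F t x) \<in> borel_measurable (lborel \<Otimes>\<^sub>M lborel)" by (rule Fm)
    show "F t x = 0" if "x \<notin> \<Omega>" for t x using that by (simp add: F_def)
    show "rep \<Omega> (f t) (F t)" if "t \<ge> 0" for t using that by (rule rF)
    show "((\<lambda>t. \<integral>x. \<bar>F t x - F t0 x\<bar> \<partial>lborel) \<longlongrightarrow> 0) (at t0 within {0..})" if "t0 \<ge> 0" for t0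
      using that rF by (rule L1)
  qed
qed

text \<open>The parametrised integral against the derivative of the kernel is jointly measurable
  whether or not F t has a weak derivative. Where it has one, the integral is its mollification and
  converges to it in L^1. One D thus serves all times at once, independently of any choice of
  gradients.\<close>

lemma joint_weak_partial:
  fixes F :: "real \<Rightarrow> 'a::euclidean_space \<Rightarrow> real"
  assumes \<Omega>: "open \<Omega>" "bounded \<Omega>" and F: "(\<lambda>(t,x). F t x) \<in> borel_measurable (lborel \<Otimes>\<^sub>M lborel)"
  obtains D where "(\<lambda>(t,x). D t x) \<in> borel_measurable (lborel \<Otimes>\<^sub>M lborel)"
    "\<And>t x. x \<notin> \<Omega> \<Longrightarrow> D t x = 0"
    "\<And>t d. weak_partial \<Omega> b (F t) d \<Longrightarrow> (\<And>x. x \<notin> \<Omega> \<Longrightarrow> d x = 0) \<Longrightarrow> AE x in lborel. D t x = d x"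
proof -
  have [measurable]: "\<Omega> \<in> sets borel" using \<Omega> by auto
  \<comment> \<open>The minus sign is that of \<open>weak_partial_mollify\<close>, which holds only
    inside the shrunken set; elsewhere g is set to 0.\<close>
  define g where "g k t x = indicator (shrink \<Omega> k) x * - (\<integral>y. dmoll (real (Suc k)) b (y - x) * F t y \<partial>lborel)" for k t x
  have gm: "(\<lambda>(t,x). g k t x) \<in> borel_measurable (lborel \<Otimes>\<^sub>M lborel)" for k
  proof -
    have [measurable]: "(\<lambda>q. F (fst (fst q)) (snd q)) \<in> borel_measurable ((lborel \<Otimes>\<^sub>M lborel) \<Otimes>\<^sub>M (lborel::'a measure))"
    proof -
      have "(\<lambda>q. (fst (fst q), snd q)) \<in> ((lborel \<Otimes>\<^sub>M lborel) \<Otimes>\<^sub>M (lborel::'a measure)) \<rightarrow>\<^sub>M (lborel \<Otimes>\<^sub>M lborel)"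
        by measurable
      from measurable_compose[OF this F] show ?thesis by simp
    qed
    show ?thesis unfolding g_def split_beta' by measurable
  qed
  obtain G where Gm: "(\<lambda>(t,x). G t x) \<in> borel_measurable (lborel \<Otimes>\<^sub>M lborel)"
    and G: "\<And>t d. t \<in> space lborel \<Longrightarrow> d \<in> borel_measurable lborel \<Longrightarrow>
      (\<lambda>k. \<integral>\<^sup>+x. ennreal \<bar>g k t x - d x\<bar> \<partial>lborel) \<longlonglongrightarrow> 0 \<Longrightarrow> AE x in lborel. G t x = d x"
  proof (rule joint_limit[where g=g, OF sigma_finite_lborel gm], goal_cases)
    case (1 G)
    show ?case by (rule 1(1)[OF 1(2) 1(3)])
  qed
  have ae: "AE x in lborel. G t x = d x" if w: "weak_partial \<Omega> b (F t) d" and d0: "\<And>x. x \<notin> \<Omega> \<Longrightarrow> d x = 0" for t d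
  proof (rule G)
    have d: "integrable lborel d" using w by (simp add: weak_partial_def)
    then show dm: "d \<in> borel_measurable lborel" by simp
    have [measurable]: "d \<in> borel_measurable borel" using d by auto
    have g: "g k t x = indicator (shrink \<Omega> k) x * mollify (real (Suc k)) d x" for k x
      using weak_partial_mollify[OF w, of x k k] by (auto simp: g_def indicator_def)
    \<comment> \<open>The part of \<Omega> on which g was set to 0 shrinks to nothing, and d
      vanishes outside \<Omega>.\<close>
    have l1: "(\<lambda>k. \<integral>x. indicator (\<Omega> - shrink \<Omega> k) x * \<bar>d x\<bar> \<partial>lborel) \<longlonglongrightarrow> (\<integral>x. 0 \<partial>(lborel::'a measure))"
    proof (rule integral_dominated_convergence[where w="\<lambda>x. \<bar>d x\<bar>"])
      show "AE x in lborel. (\<lambda>k. indicator (\<Omega> - shrink \<Omega> k) x * \<bar>d x\<bar>) \<longlonglongrightarrow> 0"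
      proof (rule AE_I2)
        fix x
        have "\<forall>\<^sub>F k in sequentially. indicator (\<Omega> - shrink \<Omega> k) x * \<bar>d x\<bar> = 0"
        proof (cases "x \<in> \<Omega>")
          case True
          then obtain n where "x \<in> shrink \<Omega> n" using in_shrink[OF \<Omega>] by blast
          then show ?thesis using shrink_mono[of n _ \<Omega>]
            unfolding eventually_sequentially by (intro exI[of _ n]) (auto simp: indicator_def)
        qed auto
        then show "(\<lambda>k. indicator (\<Omega> - shrink \<Omega> k) x * \<bar>d x\<bar>) \<longlonglongrightarrow> 0" by (rule tendsto_eventually)
      qed
    qed (use d in \<open>auto simp: indicator_def\<close>)
    have l1': "(\<lambda>k. \<integral>\<^sup>+x. ennreal (indicator (\<Omega> - shrink \<Omega> k) x * \<bar>d x\<bar>) \<partial>lborel) \<longlonglongrightarrow> 0"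
    proof -
      have "(\<integral>\<^sup>+x. ennreal (indicator (\<Omega> - shrink \<Omega> k) x * \<bar>d x\<bar>) \<partial>lborel) = ennreal (\<integral>x. indicator (\<Omega> - shrink \<Omega> k) x * \<bar>d x\<bar> \<partial>lborel)" for k
        using d by (intro nn_integral_eq_integral integrable_bounded_mult[of _ _ _ 1]) (auto simp: indicator_def)
      then show ?thesis using tendsto_ennrealI[OF l1] by simp
    qed
    show "(\<lambda>k. \<integral>\<^sup>+x. ennreal \<bar>g k t x - d x\<bar> \<partial>lborel) \<longlonglongrightarrow> 0"
    proof (rule tendsto_sandwich[OF _ _ tendsto_const])
      show "(\<lambda>k. (\<integral>\<^sup>+x. ennreal \<bar>mollify (real (Suc k)) d x - d x\<bar> \<partial>lborel) + (\<integral>\<^sup>+x. ennreal (indicator (\<Omega> - shrink \<Omega> k) x * \<bar>d x\<bar>) \<partial>lborel)) \<longlonglongrightarrow> 0"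
        using tendsto_add[OF mollify_tendsto_L1[OF d] l1'] by simp
      show "\<forall>\<^sub>F k in sequentially. (\<integral>\<^sup>+x. ennreal \<bar>g k t x - d x\<bar> \<partial>lborel) \<le>
        (\<integral>\<^sup>+x. ennreal \<bar>mollify (real (Suc k)) d x - d x\<bar> \<partial>lborel) + (\<integral>\<^sup>+x. ennreal (indicator (\<Omega> - shrink \<Omega> k) x * \<bar>d x\<bar>) \<partial>lborel)"
      proof (intro always_eventually allI)
        fix k
        have "(\<integral>\<^sup>+x. ennreal \<bar>g k t x - d x\<bar> \<partial>lborel) \<le>
          (\<integral>\<^sup>+x. ennreal \<bar>mollify (real (Suc k)) d x - d x\<bar> + ennreal (indicator (\<Omega> - shrink \<Omega> k) x * \<bar>d x\<bar>) \<partial>lborel)"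
          unfolding g using d0 by (intro nn_integral_mono) (auto simp: indicator_def)
        then show "(\<integral>\<^sup>+x. ennreal \<bar>g k t x - d x\<bar> \<partial>lborel) \<le>
        (\<integral>\<^sup>+x. ennreal \<bar>mollify (real (Suc k)) d x - d x\<bar> \<partial>lborel) + (\<integral>\<^sup>+x. ennreal (indicator (\<Omega> - shrink \<Omega> k) x * \<bar>d x\<bar>) \<partial>lborel)"
          by (subst (asm) nn_integral_add) auto
      qed
    qed auto
  qed simp
  have [measurable]: "(\<lambda>p. G (fst p) (snd p)) \<in> borel_measurable (lborel \<Otimes>\<^sub>M lborel)"
    using Gm by (simp add: split_beta')
  define D where "D t x = indicator \<Omega> x * G t x" for t x
  have Dm: "(\<lambda>(t,x). D t x) \<in> borel_measurable (lborel \<Otimes>\<^sub>M lborel)"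
    unfolding D_def split_beta' by measurable
  show ?thesis
  proof (rule that[OF Dm])
    fix t d assume w: "weak_partial \<Omega> b (F t) d" and d0: "\<And>x. x \<notin> \<Omega> \<Longrightarrow> d x = 0"
    show "AE x in lborel. D t x = d x"
    proof -
      have "AE x in lborel. G t x = d x" by (rule ae[OF w d0])
      then show ?thesis by eventually_elim (use d0 in \<open>auto simp: D_def indicator_def\<close>)
    qed
  qed (simp add: D_def)
qed

section \<open>Energy inequalities for weak solutions\<close>

lemma time_translation_L1:
  fixes G :: "real \<times> 'a::euclidean_space \<Rightarrow> real"
  assumes "integrable lborel G"
  shows "((\<lambda>\<sigma>. \<integral>p. \<bar>G (p + (\<sigma>, 0)) - G p\<bar> \<partial>lborel) \<longlongrightarrow> 0) (at 0)"
  unfolding tendsto_at_iff_sequentially o_def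
proof (intro allI impI)
  fix X :: "nat \<Rightarrow> real" assume "\<forall>i. X i \<in> UNIV - {0}" "X \<longlonglongrightarrow> 0"
  then have "(\<lambda>n. (X n, 0::'a)) \<longlonglongrightarrow> (0, 0)" by (intro tendsto_intros)
  then show "(\<lambda>n. \<integral>p. \<bar>G (p + (X n, 0)) - G p\<bar> \<partial>lborel) \<longlonglongrightarrow> 0"
    by (intro translation_L1[OF assms]) (simp add: zero_prod_def)
qed

text \<open>A signed integral is at most that of its positive part; from there on Tonelli asks for
  measurability only.\<close>

lemma integral_le_nn_integral:
  fixes q :: "'a \<Rightarrow> real"
  assumes "integrable M q"
  shows "ennreal (\<integral>x. q x \<partial>M) \<le> (\<integral>\<^sup>+x. ennreal (q x) \<partial>M)"
proof -
  have "ennreal (\<integral>x. q x \<partial>M) \<le> ennreal (\<integral>x. max 0 (q x) \<partial>M)"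
    using assms by (intro ennreal_leI integral_mono) auto
  also have "\<dots> = (\<integral>\<^sup>+x. ennreal (max 0 (q x)) \<partial>M)"
    using assms by (intro nn_integral_eq_integral[symmetric]) auto
  also have "\<dots> = (\<integral>\<^sup>+x. ennreal (q x) \<partial>M)"
    by (intro nn_integral_cong) (auto simp: max_def ennreal_neg)
  finally show ?thesis .
qed

lemma nn_integral_translate:
  fixes f :: "'a::euclidean_space \<Rightarrow> ennreal"
  assumes [measurable]: "f \<in> borel_measurable borel"
  shows "(\<integral>\<^sup>+x. f (x + c) \<partial>lborel) = (\<integral>\<^sup>+x. f x \<partial>lborel)"
proof -
  have "(\<integral>\<^sup>+x. f x \<partial>(distr lborel borel ((+) c))) = (\<integral>\<^sup>+x. f (c + x) \<partial>lborel)"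
    by (rule nn_integral_distr) auto
  then show ?thesis by (simp add: lborel_distr_plus add.commute)
qed

text \<open>
  The hypothesis on \<open>H\<close> is only available for almost every endpoint \<open>t'\<close>, so it cannot be summed over
  a partition; instead it is averaged over \<open>t'\<close> with the fixed step \<open>t' - t = h\<close>, and \<open>h\<close> tends to 0.
\<close>

lemma integrate_ae_increment_bound:
  fixes H A :: "real \<Rightarrow> real" and g :: "'j \<Rightarrow> real \<Rightarrow> 'a::euclidean_space \<Rightarrow> real"
  assumes sT: "s < T" and H: "continuous_on {s..T} H" and A: "set_integrable lborel {s..T} A"
    and J: "finite J" and g: "\<And>j. j \<in> J \<Longrightarrow> integrable (lborel \<Otimes>\<^sub>M lborel) (\<lambda>(t,x). g j t x)"
    and main: "AE t' in lborel. t' \<in> {s..T} \<longrightarrow> (\<forall>t\<in>{s..t'}. ennreal (H t' - H t - (t' - t) * A t') \<le>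
       (\<integral>\<^sup>+\<tau>. indicator {t..t'} \<tau> * (\<Sum>j\<in>J. \<integral>\<^sup>+x. ennreal \<bar>g j \<tau> x - g j t' x\<bar> \<partial>lborel) \<partial>lborel))"
  shows "H T - H s \<le> (LINT t:{s..T}|lborel. A t)"
proof -
  define H0 where "H0 t = indicator {s..T} t * H t" for t
  define A0 where "A0 t = indicator {s..T} t * A t" for t
  have A0: "integrable lborel A0" using A by (simp add: A0_def[abs_def] set_integrable_def)
  have intA: "(LINT t:{s..T}|lborel. A t) = (\<integral>t. A0 t \<partial>lborel)"
    by (simp add: A0_def set_lebesgue_integral_def)
  have H0: "integrable lborel H0"
    using borel_integrable_atLeastAtMost'[OF H] by (simp add: H0_def[abs_def] set_integrable_def)
  have [measurable]: "H0 \<in> borel_measurable borel" "A0 \<in> borel_measurable borel" using H0 A0 by auto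
  have gm[measurable]: "(\<lambda>p. g j (fst p) (snd p)) \<in> borel_measurable (lborel \<Otimes>\<^sub>M lborel)" if "j \<in> J" for j
    using borel_measurable_integrable[OF g[OF that]] by (simp add: split_beta')
  \<comment> \<open>The L^1 modulus of continuity of the family g under a shift in time. Viewed on
    pairs (t, x) it is a translation in the product space, so it tends to 0 with \<sigma>.\<close>
  define W where "W \<sigma> = (\<Sum>j\<in>J. \<integral>\<^sup>+t. \<integral>\<^sup>+x. ennreal \<bar>g j (t + \<sigma>) x - g j t x\<bar> \<partial>lborel \<partial>lborel)" for \<sigma>
  have Wsmall: "\<exists>d>0. \<forall>\<sigma>. \<bar>\<sigma>\<bar> < d \<longrightarrow> W \<sigma> \<le> ennreal e" if "e > 0" for e
  proof -
    define G where "G j p = g j (fst p) (snd p)" for j p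
    have Gi: "integrable lborel (G j)" if "j \<in> J" for j
      using g[OF that] by (simp add: G_def[abs_def] lborel_prod split_beta')
    have "((\<lambda>\<sigma>. \<Sum>j\<in>J. \<integral>p. \<bar>G j (p + (\<sigma>, 0)) - G j p\<bar> \<partial>lborel) \<longlongrightarrow> (\<Sum>j\<in>J. 0)) (at 0)"
      by (intro tendsto_sum time_translation_L1 Gi)
    then have "((\<lambda>\<sigma>. \<Sum>j\<in>J. \<integral>p. \<bar>G j (p + (\<sigma>, 0)) - G j p\<bar> \<partial>lborel) \<longlongrightarrow> 0) (at 0)" by simp
    from order_tendstoD(2)[OF this \<open>e > 0\<close>]
    obtain d where d: "d > 0" "\<And>\<sigma>. \<sigma> \<noteq> 0 \<Longrightarrow> \<bar>\<sigma>\<bar> < d \<Longrightarrow> (\<Sum>j\<in>J. \<integral>p. \<bar>G j (p + (\<sigma>, 0)) - G j p\<bar> \<partial>lborel) < e"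
      by (auto simp: eventually_at dist_real_def)
    have eq: "W \<sigma> = ennreal (\<Sum>j\<in>J. \<integral>p. \<bar>G j (p + (\<sigma>, 0)) - G j p\<bar> \<partial>lborel)" for \<sigma>
    proof -
      have "(\<integral>\<^sup>+t. \<integral>\<^sup>+x. ennreal \<bar>g j (t + \<sigma>) x - g j t x\<bar> \<partial>lborel \<partial>lborel) = ennreal (\<integral>p. \<bar>G j (p + (\<sigma>, 0)) - G j p\<bar> \<partial>lborel)"
        if j: "j \<in> J" for j
      proof -
        have [measurable]: "G j \<in> borel_measurable borel" using Gi[OF j] by auto
        have "ennreal (\<integral>p. \<bar>G j (p + (\<sigma>, 0)) - G j p\<bar> \<partial>lborel) = (\<integral>\<^sup>+p. ennreal \<bar>G j (p + (\<sigma>, 0)) - G j p\<bar> \<partial>lborel)"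
          using Gi[OF j] integrable_translate[OF Gi[OF j], of "(\<sigma>,0)"] by (intro nn_integral_eq_integral[symmetric]) auto
        also have "\<dots> = (\<integral>\<^sup>+p. ennreal \<bar>G j (p + (\<sigma>, 0)) - G j p\<bar> \<partial>(lborel \<Otimes>\<^sub>M lborel))" by (simp add: lborel_prod)
        also have "\<dots> = (\<integral>\<^sup>+t. \<integral>\<^sup>+x. ennreal \<bar>G j ((t, x) + (\<sigma>, 0)) - G j (t, x)\<bar> \<partial>lborel \<partial>lborel)"
        proof (rule lborel.nn_integral_fst[symmetric])
          have "(\<lambda>p. ennreal \<bar>G j (p + (\<sigma>, 0)) - G j p\<bar>) \<in> borel_measurable lborel" by measurable
          then show "(\<lambda>p. ennreal \<bar>G j (p + (\<sigma>, 0)) - G j p\<bar>) \<in> borel_measurable (lborel \<Otimes>\<^sub>M lborel)" by (simp only: lborel_prod)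
        qed
        finally show ?thesis by (simp add: G_def)
      qed
      then show ?thesis unfolding W_def by (subst sum_ennreal[symmetric]) auto
    qed
    have "W \<sigma> \<le> ennreal e" if "\<bar>\<sigma>\<bar> < d" for \<sigma>
    proof (cases "\<sigma> = 0")
      case True then show ?thesis by (simp add: W_def)
    next
      case False
      then show ?thesis unfolding eq using d(2)[OF False that] by (intro ennreal_leI) simp
    qed
    then show ?thesis using d(1) by blast
  qed
  \<comment> \<open>Four errors of size e: one from the modulus W, one from H near each of T and s,
    and one from A on the initial strip of length k.\<close>
  have final: "H T - H s - (\<integral>t. A0 t \<partial>lborel) \<le> 4 * e" if e: "e > 0" for e
  proof -
    obtain d1 where d1: "d1 > 0" "\<And>\<sigma>. \<bar>\<sigma>\<bar> < d1 \<Longrightarrow> W \<sigma> \<le> ennreal e" using Wsmall[OF e] by blast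
    obtain d2 where d2: "d2 > 0" "\<And>t. t \<in> {s..T} \<Longrightarrow> \<bar>t - T\<bar> < d2 \<Longrightarrow> \<bar>H t - H T\<bar> < e"
      using H sT e unfolding continuous_on_iff by (force simp: dist_real_def)
    obtain d3 where d3: "d3 > 0" "\<And>t. t \<in> {s..T} \<Longrightarrow> \<bar>t - s\<bar> < d3 \<Longrightarrow> \<bar>H t - H s\<bar> < e"
      using H sT e unfolding continuous_on_iff by (force simp: dist_real_def)
    define h where "h n = (T - s) / real (Suc n)" for n
    have h: "h n > 0" "h n \<le> T - s" for n using sT divide_left_mono[of 1 "real (Suc n)" "T - s"] by (auto simp: h_def simp del: of_nat_Suc)
    have h0: "h \<longlonglongrightarrow> 0"
      using tendsto_mult_right_zero[OF LIMSEQ_Suc[OF lim_1_over_n], of "T - s"] by (simp add: h_def[abs_def])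
    have "(\<lambda>n. \<integral>t. indicator {s..<s + h n} t * A0 t \<partial>lborel) \<longlonglongrightarrow> (\<integral>t. 0 \<partial>(lborel::real measure))"
    proof (rule integral_dominated_convergence[where w="\<lambda>t. \<bar>A0 t\<bar>"])
      show "AE t in lborel. (\<lambda>n. indicator {s..<s + h n} t * A0 t) \<longlonglongrightarrow> 0"
        using AE_lborel_singleton[of s]
      proof eventually_elim
        case (elim t)
        have "\<forall>\<^sub>F n in sequentially. indicator {s..<s + h n} t * A0 t = 0"
        proof (cases "t > s")
          case True
          then have "\<forall>\<^sub>F n in sequentially. h n < t - s" using order_tendstoD(2)[OF h0] by simp
          then show ?thesis by eventually_elim (auto simp: indicator_def)
        next
          case False then show ?thesis using elim by (auto simp: indicator_def)
        qed
        then show ?case by (rule tendsto_eventually)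
      qed
    qed (use A0 in \<open>auto simp: indicator_def\<close>)
    then have "(\<lambda>n. \<integral>t. indicator {s..<s + h n} t * A0 t \<partial>lborel) \<longlonglongrightarrow> 0" by simp
    from order_tendstoD(1)[OF this, of "- e"] e
    have "\<forall>\<^sub>F n in sequentially. - e < (\<integral>t. indicator {s..<s + h n} t * A0 t \<partial>lborel)" by simp
    moreover have "\<forall>\<^sub>F n in sequentially. h n < min d1 (min d2 d3)"
      using order_tendstoD(2)[OF h0, of "min d1 (min d2 d3)"] d1 d2 d3 by simp
    ultimately have "\<forall>\<^sub>F n in sequentially. h n < min d1 (min d2 d3) \<and> - e < (\<integral>t. indicator {s..<s + h n} t * A0 t \<partial>lborel)"
      by eventually_elim simp
    then obtain n where n: "h n < d1" "h n < d2" "h n < d3" "- e < (\<integral>t. indicator {s..<s + h n} t * A0 t \<partial>lborel)"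
      by (auto simp: eventually_sequentially)
    define k where "k = h n"
    have k: "0 < k" "k \<le> T - s" "k < d1" "k < d2" "k < d3" using n h by (auto simp: k_def)
    \<comment> \<open>The right endpoints t' for which t' - k is still at least s.\<close>
    define I where "I = {s + k..T}"
    have iH1: "integrable lborel (\<lambda>t. indicator I t * H0 t)"
      by (rule integrable_bounded_mult[OF H0, of _ 1]) (auto simp: I_def indicator_def)
    have iH2: "integrable lborel (\<lambda>t. indicator {s..T - k} t * H0 t)"
      by (rule integrable_bounded_mult[OF H0, of _ 1]) (auto simp: indicator_def)
    have iH2': "integrable lborel (\<lambda>t. indicator I t * H0 (t - k))"
      using integrable_translate[OF iH2, of "- k"] by (simp add: I_def indicator_def algebra_simps)
    have eH2: "(\<integral>t. indicator I t * H0 (t - k) \<partial>lborel) = (\<integral>t. indicator {s..T - k} t * H0 t \<partial>lborel)"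
      using integral_translate[of "\<lambda>t. indicator {s..T - k} t * H0 t" "- k"]
      by (simp add: I_def indicator_def algebra_simps)
    have iA: "integrable lborel (\<lambda>t. indicator I t * A0 t)" "integrable lborel (\<lambda>t. indicator {s..<s + k} t * A0 t)"
      by (auto intro!: integrable_bounded_mult[OF A0, of _ 1] simp: I_def indicator_def)
    \<comment> \<open>The increment over a step of length k ending at t. Its integral is bounded
      above by means of W and evaluated exactly by telescoping.\<close>
    define q where "q t = indicator I t * H0 t - indicator I t * H0 (t - k) - k * (indicator I t * A0 t)" for t
    have iq: "integrable lborel q" unfolding q_def[abs_def] using iH1 iH2' iA by auto
    have up: "(\<integral>t. q t \<partial>lborel) \<le> k * e"
    proof -
      have "ennreal (\<integral>t. q t \<partial>lborel) \<le> (\<integral>\<^sup>+t. ennreal (q t) \<partial>lborel)" by (rule integral_le_nn_integral[OF iq])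
      also have "\<dots> \<le> (\<integral>\<^sup>+t. (\<integral>\<^sup>+\<sigma>. indicator {-k..0} \<sigma> * (\<Sum>j\<in>J. \<integral>\<^sup>+x. ennreal \<bar>g j (t + \<sigma>) x - g j t x\<bar> \<partial>lborel) \<partial>lborel) \<partial>lborel)"
      proof (rule nn_integral_mono_AE, use main in eventually_elim)
        case (elim t)
        show ?case
        proof (cases "t \<in> I")
          case True
          then have t: "t \<in> {s..T}" "t - k \<in> {s..t}" "t - k \<in> {s..T}" using k by (auto simp: I_def)
          have gs: "g j u \<in> borel_measurable borel" if "j \<in> J" for j u
            using measurable_Pair2[OF gm[OF that], of u] by simp
          have ms: "(\<lambda>\<tau>. indicator {t - k..t} \<tau> * (\<Sum>j\<in>J. \<integral>\<^sup>+x. ennreal \<bar>g j \<tau> x - g j t x\<bar> \<partial>lborel)) \<in> borel_measurable borel"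
          proof (intro borel_measurable_times_ennreal borel_measurable_sum)
            fix j assume j: "j \<in> J"
            note [measurable] = gm[OF j] gs[OF j, of t]
            have "(\<lambda>\<tau>. \<integral>\<^sup>+x. ennreal \<bar>g j \<tau> x - g j t x\<bar> \<partial>lborel) \<in> borel_measurable lborel" by measurable
            then show "(\<lambda>\<tau>. \<integral>\<^sup>+x. ennreal \<bar>g j \<tau> x - g j t x\<bar> \<partial>lborel) \<in> borel_measurable borel" by simp
          qed simp
          have "ennreal (q t) = ennreal (H t - H (t - k) - (t - (t - k)) * A t)"
            using True t by (simp add: q_def H0_def A0_def)
          also have "\<dots> \<le> (\<integral>\<^sup>+\<tau>. indicator {t - k..t} \<tau> * (\<Sum>j\<in>J. \<integral>\<^sup>+x. ennreal \<bar>g j \<tau> x - g j t x\<bar> \<partial>lborel) \<partial>lborel)"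
            using elim t by blast
          also have "\<dots> = (\<integral>\<^sup>+\<sigma>. indicator {t - k..t} (\<sigma> + t) * (\<Sum>j\<in>J. \<integral>\<^sup>+x. ennreal \<bar>g j (\<sigma> + t) x - g j t x\<bar> \<partial>lborel) \<partial>lborel)"
            by (rule nn_integral_translate[OF ms, symmetric])
          finally show ?thesis by (simp add: add.commute indicator_def)
        next
          case False then show ?thesis by (simp add: q_def)
        qed
      qed
      also have "\<dots> = (\<integral>\<^sup>+\<sigma>. (\<integral>\<^sup>+t. indicator {-k..0} \<sigma> * (\<Sum>j\<in>J. \<integral>\<^sup>+x. ennreal \<bar>g j (t + \<sigma>) x - g j t x\<bar> \<partial>lborel) \<partial>lborel) \<partial>lborel)"
      \<comment> \<open>With \<tau> = t + \<sigma> substituted, the order of integration is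
        exchanged: the shift \<sigma> becomes the outer variable and the inner integral is W
        \<sigma>.\<close>
      proof (rule lborel_pair.Fubini'[symmetric])
        have "(\<lambda>p. indicator {-k..0} (snd p) * (\<Sum>j\<in>J. \<integral>\<^sup>+x. ennreal \<bar>g j (fst p + snd p) x - g j (fst p) x\<bar> \<partial>lborel))
          \<in> borel_measurable (lborel \<Otimes>\<^sub>M (lborel::real measure))"
        proof (intro borel_measurable_times_ennreal borel_measurable_sum)
          fix j assume j: "j \<in> J"
          have 1: "(\<lambda>q. g j (fst (fst q) + snd (fst q)) (snd q)) \<in> borel_measurable ((lborel \<Otimes>\<^sub>M lborel) \<Otimes>\<^sub>M (lborel::'a measure))"
          proof -
            have "(\<lambda>q. (fst (fst q) + snd (fst q), snd q)) \<in> ((lborel \<Otimes>\<^sub>M lborel) \<Otimes>\<^sub>M (lborel::'a measure)) \<rightarrow>\<^sub>M ((lborel::real measure) \<Otimes>\<^sub>M lborel)"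
              by measurable
            from measurable_compose[OF this gm[OF j]] show ?thesis by simp
          qed
          have 2: "(\<lambda>q. g j (fst (fst q)) (snd q)) \<in> borel_measurable ((lborel \<Otimes>\<^sub>M (lborel::real measure)) \<Otimes>\<^sub>M (lborel::'a measure))"
          proof -
            have "(\<lambda>q. (fst (fst q), snd q)) \<in> ((lborel \<Otimes>\<^sub>M (lborel::real measure)) \<Otimes>\<^sub>M (lborel::'a measure)) \<rightarrow>\<^sub>M ((lborel::real measure) \<Otimes>\<^sub>M lborel)"
              by measurable
            from measurable_compose[OF this gm[OF j]] show ?thesis by simp
          qed
          note [measurable] = 1 2
          show "(\<lambda>p. \<integral>\<^sup>+x. ennreal \<bar>g j (fst p + snd p) x - g j (fst p) x\<bar> \<partial>lborel) \<in> borel_measurable (lborel \<Otimes>\<^sub>M (lborel::real measure))"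
            by measurable
        qed measurable
        then show "(\<lambda>(t, \<sigma>). indicator {-k..0} \<sigma> * (\<Sum>j\<in>J. \<integral>\<^sup>+x. ennreal \<bar>g j (t + \<sigma>) x - g j t x\<bar> \<partial>lborel))
          \<in> borel_measurable (lborel \<Otimes>\<^sub>M (lborel::real measure))" by (simp add: split_beta')
      qed
      also have "\<dots> = (\<integral>\<^sup>+\<sigma>. indicator {-k..0} \<sigma> * W \<sigma> \<partial>lborel)"
      proof (rule nn_integral_cong)
        fix \<sigma> :: real
        have m: "(\<lambda>t. \<integral>\<^sup>+x. ennreal \<bar>g j (t + \<sigma>) x - g j t x\<bar> \<partial>lborel) \<in> borel_measurable lborel" if j: "j \<in> J" for j
        proof -
          have 1: "(\<lambda>q. g j (fst q + \<sigma>) (snd q)) \<in> borel_measurable (lborel \<Otimes>\<^sub>M (lborel::'a measure))"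
          proof -
            have "(\<lambda>q. (fst q + \<sigma>, snd q)) \<in> (lborel \<Otimes>\<^sub>M (lborel::'a measure)) \<rightarrow>\<^sub>M ((lborel::real measure) \<Otimes>\<^sub>M lborel)"
              by measurable
            from measurable_compose[OF this gm[OF j]] show ?thesis by simp
          qed
          note [measurable] = 1 gm[OF j]
          show ?thesis by measurable
        qed
        show "(\<integral>\<^sup>+t. indicator {-k..0} \<sigma> * (\<Sum>j\<in>J. \<integral>\<^sup>+x. ennreal \<bar>g j (t + \<sigma>) x - g j t x\<bar> \<partial>lborel) \<partial>lborel) = indicator {-k..0} \<sigma> * W \<sigma>"
          using m by (subst nn_integral_cmult) (auto simp: W_def nn_integral_sum intro!: borel_measurable_sum)
      qed
      also have "\<dots> \<le> (\<integral>\<^sup>+\<sigma>. indicator {-k..0} \<sigma> * ennreal e \<partial>lborel)"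
        using d1(2) k by (intro nn_integral_mono) (auto simp: indicator_def)
      also have "\<dots> = ennreal k * ennreal e"
        using k by (subst nn_integral_multc) auto
      finally have "ennreal (\<integral>t. q t \<partial>lborel) \<le> ennreal (k * e)" using k e by (simp add: ennreal_mult)
      then show ?thesis using k e by (subst (asm) ennreal_le_iff) auto
    qed
    have iT: "integrable lborel (\<lambda>t. indicator {T - k<..T} t * H0 t)" and iS: "integrable lborel (\<lambda>t. indicator {s..<s + k} t * H0 t)"
      by (auto intro!: integrable_bounded_mult[OF H0, of _ 1] simp: indicator_def)
    \<comment> \<open>The common part of the two ranges cancels, leaving windows of length k at T
      and at s.\<close>
    have "(\<integral>t. indicator I t * H0 t - indicator {s..T - k} t * H0 t \<partial>lborel) = (\<integral>t. indicator {T - k<..T} t * H0 t - indicator {s..<s + k} t * H0 t \<partial>lborel)"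
      by (rule Bochner_Integration.integral_cong) (use k in \<open>auto simp: I_def H0_def indicator_def\<close>)
    then have e1: "(\<integral>t. indicator I t * H0 t \<partial>lborel) - (\<integral>t. indicator {s..T - k} t * H0 t \<partial>lborel)
       = (\<integral>t. indicator {T - k<..T} t * H0 t \<partial>lborel) - (\<integral>t. indicator {s..<s + k} t * H0 t \<partial>lborel)"
      using iH1 iH2 iT iS by simp
    have e2: "(\<integral>t. indicator I t * A0 t \<partial>lborel) = (\<integral>t. A0 t \<partial>lborel) - (\<integral>t. indicator {s..<s + k} t * A0 t \<partial>lborel)"
    proof -
      have "(\<integral>t. A0 t \<partial>lborel) = (\<integral>t. indicator I t * A0 t + indicator {s..<s + k} t * A0 t \<partial>lborel)"
        by (rule Bochner_Integration.integral_cong) (use k in \<open>auto simp: I_def A0_def indicator_def\<close>)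
      then show ?thesis using iA by simp
    qed
    have "(\<integral>t. q t \<partial>lborel) = (\<integral>t. indicator I t * H0 t \<partial>lborel) - (\<integral>t. indicator I t * H0 (t - k) \<partial>lborel) - k * (\<integral>t. indicator I t * A0 t \<partial>lborel)"
      unfolding q_def using iH1 iH2' iA by simp
    then have qe: "(\<integral>t. q t \<partial>lborel) = (\<integral>t. indicator {T - k<..T} t * H0 t \<partial>lborel) - (\<integral>t. indicator {s..<s + k} t * H0 t \<partial>lborel)
       - k * ((\<integral>t. A0 t \<partial>lborel) - (\<integral>t. indicator {s..<s + k} t * A0 t \<partial>lborel))"
      using e1 e2 eH2 by simp
    have ind: "integrable lborel (indicator {T - k<..T} :: real \<Rightarrow> real)" "integrable lborel (indicator {s..<s + k} :: real \<Rightarrow> real)"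
      using k by (auto intro!: integrable_real_indicator)
    have lT: "k * (H T - e) \<le> (\<integral>t. indicator {T - k<..T} t * H0 t \<partial>lborel)"
    proof -
      have "k * (H T - e) = (\<integral>t. indicator {T - k<..T} t * (H T - e) \<partial>lborel)" using k by simp
      also have "\<dots> \<le> (\<integral>t. indicator {T - k<..T} t * H0 t \<partial>lborel)"
      proof (rule integral_mono[OF _ iT])
        show "indicator {T - k<..T} t * (H T - e) \<le> indicator {T - k<..T} t * H0 t" for t
        proof (cases "t \<in> {T - k<..T}")
          case True
          then have "t \<in> {s..T}" "\<bar>t - T\<bar> < d2" using k by auto
          from d2(2)[OF this] this(1) show ?thesis using True by (simp add: H0_def)
        qed simp
      qed (use ind in auto)
      finally show ?thesis .
    qed
    have lS: "(\<integral>t. indicator {s..<s + k} t * H0 t \<partial>lborel) \<le> k * (H s + e)"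
    proof -
      have "(\<integral>t. indicator {s..<s + k} t * H0 t \<partial>lborel) \<le> (\<integral>t. indicator {s..<s + k} t * (H s + e) \<partial>lborel)"
      proof (rule integral_mono[OF iS])
        show "indicator {s..<s + k} t * H0 t \<le> indicator {s..<s + k} t * (H s + e)" for t
        proof (cases "t \<in> {s..<s + k}")
          case True
          then have "t \<in> {s..T}" "\<bar>t - s\<bar> < d3" using k by auto
          from d3(2)[OF this] this(1) show ?thesis using True by (simp add: H0_def)
        qed simp
      qed (use ind in auto)
      then show ?thesis using k by simp
    qed
    have "k * (H T - e) - k * (H s + e) - k * ((\<integral>t. A0 t \<partial>lborel) + e) \<le> k * e"
    proof -
      have "k * ((\<integral>t. A0 t \<partial>lborel) - (\<integral>t. indicator {s..<s + k} t * A0 t \<partial>lborel)) \<le> k * ((\<integral>t. A0 t \<partial>lborel) + e)"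
        using n(4) k by (intro mult_left_mono) (auto simp: k_def)
      then show ?thesis using up qe lT lS by linarith
    qed
    then have "k * (H T - H s - (\<integral>t. A0 t \<partial>lborel)) \<le> k * (4 * e)" by (simp add: algebra_simps)
    then show ?thesis using k by simp
  qed
  have "H T - H s - (\<integral>t. A0 t \<partial>lborel) \<le> 0"
  proof (rule field_le_epsilon)
    fix e :: real assume "e > 0"
    then show "H T - H s - (\<integral>t. A0 t \<partial>lborel) \<le> 0 + e" using final[of "e/4"] by simp
  qed
  then show ?thesis by (simp add: intA)
qed

lemma integrable_joint_section:
  fixes F :: "real \<Rightarrow> 'a::euclidean_space \<Rightarrow> real"
  assumes "integrable (lborel \<Otimes>\<^sub>M lborel) (\<lambda>(t,x). indicator {s..T} t * F t x)"
  shows "AE t in lborel. t \<in> {s..T} \<longrightarrow> integrable lborel (F t)"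
  using lborel_pair.AE_integrable_fst'[OF assms] by eventually_elim auto

lemma integrable_joint_mult_section:
  fixes F P :: "real \<Rightarrow> 'a::euclidean_space \<Rightarrow> real"
  assumes F: "integrable (lborel \<Otimes>\<^sub>M lborel) (\<lambda>(t,x). indicator {s..T} t * F t x)"
    and P: "(\<lambda>(t,x). P t x) \<in> borel_measurable (lborel \<Otimes>\<^sub>M lborel)" and C: "\<And>t x. \<bar>P t x\<bar> \<le> C"
  shows "integrable lborel (\<lambda>t. indicator {s..T} t * (\<integral>x. F t x * P t x \<partial>lborel))"
proof -
  have "integrable (lborel \<Otimes>\<^sub>M lborel) (\<lambda>p. (case p of (t,x) \<Rightarrow> P t x) * (case p of (t,x) \<Rightarrow> indicator {s..T} t * F t x))"
    by (rule integrable_bounded_mult[OF F P, where C=C]) (auto simp: C)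
  from lborel_pair.integrable_fst'[OF this]
  have "integrable lborel (\<lambda>t. \<integral>x. P t x * (indicator {s..T} t * F t x) \<partial>lborel)" by simp
  moreover have "(\<integral>x. P t x * (indicator {s..T} t * F t x) \<partial>lborel) = indicator {s..T} t * (\<integral>x. F t x * P t x \<partial>lborel)" for t
    by (cases "t \<in> {s..T}") (auto simp: mult.commute)
  ultimately show ?thesis by simp
qed

text \<open>Reduces the translation error of the gradient term, a product of \<open>L\<^sup>2\<close> functions, to a translation of \<open>D \<bar>D\<bar> \<in> L\<^sup>1\<close>.\<close>

lemma signed_square_diff:
  fixes u v :: real
  shows "\<bar>u - v\<bar> * \<bar>v\<bar> \<le> 2 * \<bar>u * \<bar>u\<bar> - v * \<bar>v\<bar>\<bar>"
proof -
  have double: "a \<le> b \<Longrightarrow> 0 \<le> b \<Longrightarrow> a \<le> 2 * b" for a b :: real by simp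
  have key: "\<bar>u - v\<bar> * v \<le> 2 * \<bar>u * \<bar>u\<bar> - v * v\<bar>" if v: "v \<ge> 0" for u v :: real
  \<comment> \<open>With equal signs the difference factors into u - v and u + v >= v. With opposite
    signs the two signed squares add up instead of cancelling, and their sum dominates the
    product.\<close>
  proof (cases "u \<ge> 0")
    case True
    have "u * \<bar>u\<bar> - v * v = (u - v) * (u + v)" using True by (simp add: algebra_simps)
    then have "\<bar>u * \<bar>u\<bar> - v * v\<bar> = \<bar>u - v\<bar> * (u + v)" using True v by (simp add: abs_mult)
    moreover have "\<bar>u - v\<bar> * v \<le> \<bar>u - v\<bar> * (u + v)" using True by (intro mult_left_mono) auto
    moreover have "0 \<le> \<bar>u - v\<bar> * (u + v)" using True v by simp
    ultimately show ?thesis by (simp only: double)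
  next
    case False
    have "u * \<bar>u\<bar> - v * v = - (u * u + v * v)" using False by (simp add: abs_of_neg)
    then have "\<bar>u * \<bar>u\<bar> - v * v\<bar> = \<bar>u * u + v * v\<bar>" by (simp only: abs_minus_cancel)
    then have "\<bar>u * \<bar>u\<bar> - v * v\<bar> = u * u + v * v" by simp
    moreover have "\<bar>u - v\<bar> * v = v * v + (- u) * v" using False v by (simp add: algebra_simps)
    moreover have "(- u) * v \<le> u * u + v * v"
    proof -
      have "0 \<le> (- u) * v" using False v by (intro mult_nonneg_nonneg) auto
      then show ?thesis using zero_le_square[of "u + v"] by (simp add: algebra_simps)
    qed
    moreover have "0 \<le> u * u" by simp
    moreover have "q + c \<le> 2 * (p + q)" if "c \<le> p + q" "0 \<le> p" for c p q :: real
      using that by argo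
    ultimately show ?thesis by (simp only:)
  qed
  show ?thesis
  proof (cases "v \<ge> 0")
    case True then show ?thesis using key[OF True, of u] by simp
  next
    case False
    have "\<bar>- u - - v\<bar> * - v \<le> 2 * \<bar>- u * \<bar>- u\<bar> - - v * - v\<bar>" using False by (intro key) simp
    moreover have "\<bar>- u - - v\<bar> = \<bar>u - v\<bar>" "\<bar>- u * \<bar>- u\<bar> - - v * - v\<bar> = \<bar>u * \<bar>u\<bar> - v * \<bar>v\<bar>\<bar>" using False by auto
    ultimately show ?thesis using False by simp
  qed
qed

text \<open>At \<tau> = t' the gradient term is - \<eta> \<Phi>''(f) |D|^2, of good sign. For \<tau>
  < t' it pairs D at two different times; once the good part is dropped, a product of D \<tau> - D
  t' with D t' remains, which is controlled by the translation of D |D| in L^1. The hypothesis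
  \<open>weak\<close> is asked for almost every t', which in the parabolic case are the times at
  which \<Phi>'(f t') is admissible.\<close>

lemma energy_inequality:
  fixes f F :: "real \<Rightarrow> 'a::euclidean_space \<Rightarrow> real" and D :: "'a \<Rightarrow> real \<Rightarrow> 'a \<Rightarrow> real"
  assumes sT: "s \<le> T" and \<eta>: "\<eta> \<ge> 0"
    and \<Phi>: "\<And>x. (\<Phi> has_real_derivative \<Phi>' x) (at x)" "\<And>x. (\<Phi>' has_real_derivative \<Phi>'' x) (at x)"
      "continuous_on UNIV \<Phi>''" "\<Phi> 0 = 0" "\<And>x. \<bar>\<Phi>' x\<bar> \<le> C" "\<And>x. 0 \<le> \<Phi>'' x" "\<And>x. \<Phi>'' x \<le> C"
    and fm: "(\<lambda>(t,x). f t x) \<in> borel_measurable (lborel \<Otimes>\<^sub>M lborel)"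
    and fi: "\<And>t. t \<in> {s..T} \<Longrightarrow> integrable lborel (f t)"
    and fc: "\<And>t0. t0 \<in> {s..T} \<Longrightarrow> ((\<lambda>t. \<integral>x. \<bar>f t x - f t0 x\<bar> \<partial>lborel) \<longlongrightarrow> 0) (at t0 within {s..T})"
    and F: "integrable (lborel \<Otimes>\<^sub>M lborel) (\<lambda>(t,x). indicator {s..T} t * F t x)"
    and Dm: "\<And>b. b \<in> Basis \<Longrightarrow> (\<lambda>(t,x). D b t x) \<in> borel_measurable (lborel \<Otimes>\<^sub>M lborel)"
    and D: "\<And>b. b \<in> Basis \<Longrightarrow> integrable (lborel \<Otimes>\<^sub>M lborel) (\<lambda>(t,x). indicator {s..T} t * (D b t x)\<^sup>2)"
    and weak: "AE t' in lborel. t' \<in> {s..T} \<longrightarrow> (\<forall>t\<in>{s..t'}.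
        set_integrable lborel {t..t'} (\<lambda>\<tau>. - \<eta> * (\<Sum>b\<in>Basis. \<integral>x. D b \<tau> x * (\<Phi>'' (f t' x) * D b t' x) \<partial>lborel) + (\<integral>x. F \<tau> x * \<Phi>' (f t' x) \<partial>lborel)) \<and>
        (\<integral>x. (f t' x - f t x) * \<Phi>' (f t' x) \<partial>lborel) =
          (LINT \<tau>:{t..t'}|lborel. - \<eta> * (\<Sum>b\<in>Basis. \<integral>x. D b \<tau> x * (\<Phi>'' (f t' x) * D b t' x) \<partial>lborel) + (\<integral>x. F \<tau> x * \<Phi>' (f t' x) \<partial>lborel)))"
  shows "(\<integral>x. \<Phi> (f T x) \<partial>lborel) - (\<integral>x. \<Phi> (f s x) \<partial>lborel) \<le> (LINT t:{s..T}|lborel. \<integral>x. F t x * \<Phi>' (f t x) \<partial>lborel)"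
proof (cases "s = T")
  case True
  have "(LINT t:{s..T}|lborel. \<integral>x. F t x * \<Phi>' (f t x) \<partial>lborel) = (\<integral>t. 0 \<partial>(lborel::real measure))"
    unfolding set_lebesgue_integral_def
  proof (rule integral_cong_AE)
    have "continuous_on UNIV \<Phi>'" using \<Phi>(2) by (intro continuous_at_imp_continuous_on ballI DERIV_isCont)
    then have "\<Phi>' \<in> borel_measurable borel" by (rule borel_measurable_continuous_onI)
    from measurable_compose[OF fm this]
    have "(\<lambda>(t,x). \<Phi>' (f t x)) \<in> borel_measurable (lborel \<Otimes>\<^sub>M lborel)" by (simp add: split_beta')
    from integrable_joint_mult_section[OF F this \<Phi>(5)]
    have "integrable lborel (\<lambda>t. indicator {s..T} t *\<^sub>R (\<integral>x. F t x * \<Phi>' (f t x) \<partial>lborel))" by simp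
    then show "(\<lambda>t. indicator {s..T} t *\<^sub>R (\<integral>x. F t x * \<Phi>' (f t x) \<partial>lborel)) \<in> borel_measurable lborel"
      by (rule borel_measurable_integrable)
    show "AE t in lborel. indicator {s..T} t *\<^sub>R (\<integral>x. F t x * \<Phi>' (f t x) \<partial>lborel) = 0"
      using AE_lborel_singleton[of s] by eventually_elim (use True in \<open>auto simp: indicator_def\<close>)
  qed simp
  then show ?thesis using True by simp
next
  case False
  then have sT: "s < T" using sT by simp
  have C0: "0 \<le> C" using \<Phi>(5)[of 0] by linarith
  have c\<Phi>': "continuous_on UNIV \<Phi>'" using \<Phi>(2) by (intro continuous_at_imp_continuous_on ballI DERIV_isCont)
  have c\<Phi>: "continuous_on UNIV \<Phi>" using \<Phi>(1) by (intro continuous_at_imp_continuous_on ballI DERIV_isCont)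
  have [measurable]: "\<Phi> \<in> borel_measurable borel" "\<Phi>' \<in> borel_measurable borel" "\<Phi>'' \<in> borel_measurable borel"
    using c\<Phi> c\<Phi>' \<Phi>(3) by (auto intro: borel_measurable_continuous_onI)
  have lip: "\<bar>\<Phi> a - \<Phi> b\<bar> \<le> C * \<bar>a - b\<bar>" for a b
    using field_differentiable_bound[of UNIV \<Phi> \<Phi>' C a b] \<Phi>(1,5) by simp
  have conv: "\<Phi> a - \<Phi> b \<le> (a - b) * \<Phi>' a" for a b
  proof -
    have "convex_on UNIV \<Phi>" by (rule f''_ge0_imp_convex[of _ _ \<Phi>' \<Phi>'']) (use \<Phi> in auto)
    then have "\<Phi> b - \<Phi> a \<ge> \<Phi>' a * (b - a)"
      by (rule convex_on_imp_above_tangent) (use \<Phi>(1) in auto)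
    then show ?thesis by (simp add: algebra_simps)
  qed
  have [measurable]: "f t \<in> borel_measurable borel" for t using measurable_Pair2[OF fm, of t] by simp
  have \<Phi>i: "integrable lborel (\<lambda>x. \<Phi> (f t x))" if "t \<in> {s..T}" for t
  proof (rule Bochner_Integration.integrable_bound)
    show "integrable lborel (\<lambda>x. C * f t x)" using fi[OF that] by simp
    show "AE x in lborel. norm (\<Phi> (f t x)) \<le> norm (C * f t x)"
      using lip[of _ 0] \<Phi>(4) C0 by (intro AE_I2) (auto simp: abs_mult)
  qed simp
  define H where "H t = (\<integral>x. \<Phi> (f t x) \<partial>lborel)" for t
  define A where "A t = (\<integral>x. F t x * \<Phi>' (f t x) \<partial>lborel)" for t
  have Hc: "continuous_on {s..T} H"
    unfolding continuous_on_def
  proof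
    fix t0 assume t0: "t0 \<in> {s..T}"
    have "((\<lambda>t. H t - H t0) \<longlongrightarrow> 0) (at t0 within {s..T})"
    proof (rule Lim_null_comparison)
      show "((\<lambda>t. C * (\<integral>x. \<bar>f t x - f t0 x\<bar> \<partial>lborel)) \<longlongrightarrow> 0) (at t0 within {s..T})"
        by (intro tendsto_mult_right_zero fc t0)
      show "\<forall>\<^sub>F t in at t0 within {s..T}. norm (H t - H t0) \<le> C * (\<integral>x. \<bar>f t x - f t0 x\<bar> \<partial>lborel)"
      proof (unfold eventually_at_filter, intro always_eventually allI impI)
        fix t assume t: "t \<in> {s..T}"
        have "norm (H t - H t0) = norm (\<integral>x. \<Phi> (f t x) - \<Phi> (f t0 x) \<partial>lborel)"
          using \<Phi>i[OF t] \<Phi>i[OF t0] by (simp add: H_def)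
        also have "\<dots> \<le> (\<integral>x. norm (\<Phi> (f t x) - \<Phi> (f t0 x)) \<partial>lborel)" by (rule integral_norm_bound)
        also have "\<dots> \<le> (\<integral>x. C * \<bar>f t x - f t0 x\<bar> \<partial>lborel)"
          using \<Phi>i[OF t] \<Phi>i[OF t0] fi[OF t] fi[OF t0] lip by (intro integral_mono) auto
        finally show "norm (H t - H t0) \<le> C * (\<integral>x. \<bar>f t x - f t0 x\<bar> \<partial>lborel)" by simp
      qed
    qed
    then show "(H \<longlongrightarrow> H t0) (at t0 within {s..T})" by (simp add: LIM_zero_iff)
  qed
  have Ai: "set_integrable lborel {s..T} A"
  proof -
    from measurable_compose[OF fm \<open>\<Phi>' \<in> borel_measurable borel\<close>]
    have "(\<lambda>(t,x). \<Phi>' (f t x)) \<in> borel_measurable (lborel \<Otimes>\<^sub>M lborel)" by (simp add: split_beta')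
    from integrable_joint_mult_section[OF F this \<Phi>(5)] show ?thesis by (simp add: set_integrable_def A_def)
  qed
  define sq where "sq y = y * \<bar>y\<bar>" for y :: real
  \<comment> \<open>\<open>None\<close> carries the reaction term and \<open>Some b\<close> the
    gradient in direction b. The factors account for the bound C on \<Phi>' and \<Phi>'' and for the
    2 in \<open>signed_square_diff\<close>.\<close>
  define g where "g j t x = indicator {s..T} t * (case j of None \<Rightarrow> C * F t x | Some b \<Rightarrow> 2 * \<eta> * C * sq (D b t x))" for j t x
  define J where "J = insert None (Some ` (Basis :: 'a set))"
  have Dm'[measurable]: "(\<lambda>p. D b (fst p) (snd p)) \<in> borel_measurable (lborel \<Otimes>\<^sub>M lborel)" if "b \<in> Basis" for b
    using Dm[OF that] by (simp add: split_beta')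
  have gi: "integrable (lborel \<Otimes>\<^sub>M lborel) (\<lambda>(t,x). g j t x)" if "j \<in> J" for j
  proof (cases j)
    case None
    then show ?thesis using integrable_mult_right[OF F, of C] by (simp add: g_def split_beta' mult.left_commute)
  next
    case (Some b)
    then have b: "b \<in> Basis" using that by (auto simp: J_def)
    have "integrable (lborel \<Otimes>\<^sub>M lborel) (\<lambda>p. indicator {s..T} (fst p) * sq (D b (fst p) (snd p)))"
    proof (rule Bochner_Integration.integrable_bound[OF D[OF b]])
      show "(\<lambda>p. indicator {s..T} (fst p) * sq (D b (fst p) (snd p))) \<in> borel_measurable (lborel \<Otimes>\<^sub>M lborel)"
        unfolding sq_def using Dm'[OF b] by measurable
    qed (auto simp: sq_def power2_eq_square split_beta' abs_mult)
    from integrable_mult_right[OF this, of "2 * \<eta> * C"] Some show ?thesis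
      by (simp add: g_def split_beta' mult.left_commute)
  qed
  \<comment> \<open>The times with integrable slices; the comparison below needs them both at \<tau>
    and at t'.\<close>
  define good where "good t \<longleftrightarrow> (t \<in> {s..T} \<longrightarrow> integrable lborel (F t) \<and> (\<forall>b\<in>Basis. integrable lborel (\<lambda>x. (D b t x)\<^sup>2)))" for t
  have AEgood: "AE t in lborel. good t"
  proof -
    have "AE t in lborel. \<forall>b\<in>Basis. t \<in> {s..T} \<longrightarrow> integrable lborel (\<lambda>x. (D b t x)\<^sup>2)"
      by (intro AE_finite_allI finite_Basis integrable_joint_section D)
    with integrable_joint_section[OF F] show ?thesis by eventually_elim (auto simp: good_def)
  qed
  have DtM[measurable]: "D b t \<in> borel_measurable borel" if "b \<in> Basis" for b t
    using measurable_Pair2[OF Dm[OF that], of t] by simp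
  have pw: "- \<eta> * (\<Sum>b\<in>Basis. \<integral>x. D b \<tau> x * (\<Phi>'' (f t' x) * D b t' x) \<partial>lborel) + (\<integral>x. F \<tau> x * \<Phi>' (f t' x) \<partial>lborel) - A t'
      \<le> (\<Sum>j\<in>J. \<integral>x. \<bar>g j \<tau> x - g j t' x\<bar> \<partial>lborel)"
    and gint: "\<And>j. j \<in> J \<Longrightarrow> integrable lborel (\<lambda>x. \<bar>g j \<tau> x - g j t' x\<bar>)"
    if t': "t' \<in> {s..T}" "good t'" and \<tau>: "\<tau> \<in> {s..T}" "good \<tau>" for t' \<tau>
  proof -
    have Fi: "integrable lborel (F t')" "integrable lborel (F \<tau>)" using t' \<tau> by (auto simp: good_def)
    have Di: "integrable lborel (\<lambda>x. (D b t' x)\<^sup>2)" "integrable lborel (\<lambda>x. (D b \<tau> x)\<^sup>2)" if "b \<in> Basis" for b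
      using t' \<tau> that by (auto simp: good_def)
    have sqi: "integrable lborel (\<lambda>x. sq (D b t' x))" "integrable lborel (\<lambda>x. sq (D b \<tau> x))" if b: "b \<in> Basis" for b
    proof -
      note [measurable] = DtM[OF b]
      show "integrable lborel (\<lambda>x. sq (D b t' x))"
        by (rule Bochner_Integration.integrable_bound[OF Di(1)[OF b]]) (auto simp: sq_def power2_eq_square abs_mult)
      show "integrable lborel (\<lambda>x. sq (D b \<tau> x))"
        by (rule Bochner_Integration.integrable_bound[OF Di(2)[OF b]]) (auto simp: sq_def power2_eq_square abs_mult)
    qed
    show "integrable lborel (\<lambda>x. \<bar>g j \<tau> x - g j t' x\<bar>)" if "j \<in> J" for j
      using that Fi sqi t' \<tau> by (auto simp: J_def g_def)
    have prod: "integrable lborel (\<lambda>x. D b \<tau> x * (\<Phi>'' (f t' x) * D b t' x))" if b: "b \<in> Basis" for b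
    proof -
      note [measurable] = DtM[OF b]
      have "integrable lborel (\<lambda>x. D b \<tau> x * D b t' x)"
      proof (rule Bochner_Integration.integrable_bound[OF Bochner_Integration.integrable_add[OF Di(2)[OF b] Di(1)[OF b]]])
        have "\<bar>u * v\<bar> \<le> u\<^sup>2 + v\<^sup>2" for u v :: real
        proof -
          have "2 * (\<bar>u\<bar> * \<bar>v\<bar>) \<le> u\<^sup>2 + v\<^sup>2" using zero_le_power2[of "\<bar>u\<bar> - \<bar>v\<bar>"] by (simp add: power2_diff)
          moreover have "0 \<le> \<bar>u\<bar> * \<bar>v\<bar>" by simp
          ultimately show ?thesis unfolding abs_mult by linarith
        qed
        then show "AE x in lborel. norm (D b \<tau> x * D b t' x) \<le> norm ((D b \<tau> x)\<^sup>2 + (D b t' x)\<^sup>2)"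
          by (intro AE_I2) (simp)
      qed simp
      from integrable_bounded_mult[OF this, of "\<lambda>x. \<Phi>'' (f t' x)" C] show ?thesis
        using \<Phi>(6,7) by (simp add: mult.left_commute)
    qed
    have g1: "- (\<eta> * (\<integral>x. D b \<tau> x * (\<Phi>'' (f t' x) * D b t' x) \<partial>lborel)) \<le> (\<integral>x. \<bar>g (Some b) \<tau> x - g (Some b) t' x\<bar> \<partial>lborel)"
      if b: "b \<in> Basis" for b
    proof -
      have "- (\<eta> * (\<integral>x. D b \<tau> x * (\<Phi>'' (f t' x) * D b t' x) \<partial>lborel)) = (\<integral>x. - (\<eta> * (D b \<tau> x * (\<Phi>'' (f t' x) * D b t' x))) \<partial>lborel)"
        by simp
      also have "\<dots> \<le> (\<integral>x. \<bar>2 * \<eta> * C * sq (D b \<tau> x) - 2 * \<eta> * C * sq (D b t' x)\<bar> \<partial>lborel)"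
      proof (rule integral_mono)
        fix x
        define u v k where "u = D b \<tau> x" and "v = D b t' x" and "k = \<Phi>'' (f t' x)"
        have k: "0 \<le> k" "k \<le> C" using \<Phi>(6,7) by (auto simp: k_def)
        \<comment> \<open>Write uv = (u - v)v + v^2 and discard the square: this is where diffusion
          enters with its good sign.\<close>
        have "- (u * (k * v)) \<le> k * (\<bar>u - v\<bar> * \<bar>v\<bar>)"
        proof -
          have "- (u * v) \<le> - ((u - v) * v)" by (simp add: algebra_simps)
          also have "\<dots> \<le> \<bar>u - v\<bar> * \<bar>v\<bar>" by (metis abs_ge_minus_self abs_mult)
          finally have "k * - (u * v) \<le> k * (\<bar>u - v\<bar> * \<bar>v\<bar>)" using k by (intro mult_left_mono)
          then show ?thesis by (simp add: algebra_simps)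
        qed
        also have "\<dots> \<le> C * (2 * \<bar>sq u - sq v\<bar>)"
          using mult_mono[OF k(2) signed_square_diff[of u v] C0] by (simp add: sq_def)
        finally have "\<eta> * - (u * (k * v)) \<le> \<eta> * (C * (2 * \<bar>sq u - sq v\<bar>))" using \<eta> by (rule mult_left_mono)
        also have "\<dots> = \<bar>2 * \<eta> * C * sq u - 2 * \<eta> * C * sq v\<bar>"
          using \<eta> C0 by (simp add: right_diff_distrib[symmetric] abs_mult)
        finally show "- (\<eta> * (D b \<tau> x * (\<Phi>'' (f t' x) * D b t' x))) \<le> \<bar>2 * \<eta> * C * sq (D b \<tau> x) - 2 * \<eta> * C * sq (D b t' x)\<bar>"
          by (simp add: u_def v_def k_def)
      qed (use prod[OF b] sqi[OF b] in auto)
      finally show ?thesis using t' \<tau> by (simp add: g_def)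
    qed
    have F1: "(\<integral>x. F \<tau> x * \<Phi>' (f t' x) \<partial>lborel) - A t' \<le> (\<integral>x. \<bar>g None \<tau> x - g None t' x\<bar> \<partial>lborel)"
    proof -
      have i: "integrable lborel (\<lambda>x. F u x * \<Phi>' (f t' x))" if "integrable lborel (F u)" for u
        using integrable_bounded_mult[OF that, of "\<lambda>x. \<Phi>' (f t' x)" C] \<Phi>(5) by (simp add: mult.commute)
      have "(\<integral>x. F \<tau> x * \<Phi>' (f t' x) \<partial>lborel) - A t' = (\<integral>x. F \<tau> x * \<Phi>' (f t' x) - F t' x * \<Phi>' (f t' x) \<partial>lborel)"
        using i[OF Fi(1)] i[OF Fi(2)] by (simp add: A_def)
      also have "\<dots> \<le> (\<integral>x. \<bar>C * F \<tau> x - C * F t' x\<bar> \<partial>lborel)"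
      proof (rule integral_mono)
        fix x
        have "F \<tau> x * \<Phi>' (f t' x) - F t' x * \<Phi>' (f t' x) \<le> \<bar>\<Phi>' (f t' x)\<bar> * \<bar>F \<tau> x - F t' x\<bar>"
          by (metis abs_ge_self abs_mult left_diff_distrib mult.commute)
        also have "\<dots> \<le> C * \<bar>F \<tau> x - F t' x\<bar>" using \<Phi>(5) by (intro mult_right_mono) auto
        finally show "F \<tau> x * \<Phi>' (f t' x) - F t' x * \<Phi>' (f t' x) \<le> \<bar>C * F \<tau> x - C * F t' x\<bar>"
          using C0 by (simp add: right_diff_distrib[symmetric] abs_mult)
      qed (use i Fi in auto)
      finally show ?thesis using t' \<tau> by (simp add: g_def)
    qed
    have "- \<eta> * (\<Sum>b\<in>Basis. \<integral>x. D b \<tau> x * (\<Phi>'' (f t' x) * D b t' x) \<partial>lborel) = (\<Sum>b\<in>Basis. - (\<eta> * (\<integral>x. D b \<tau> x * (\<Phi>'' (f t' x) * D b t' x) \<partial>lborel)))"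
      by (simp add: sum_distrib_left sum_negf)
    also have "\<dots> \<le> (\<Sum>b\<in>Basis. \<integral>x. \<bar>g (Some b) \<tau> x - g (Some b) t' x\<bar> \<partial>lborel)"
      by (intro sum_mono g1)
    finally show "- \<eta> * (\<Sum>b\<in>Basis. \<integral>x. D b \<tau> x * (\<Phi>'' (f t' x) * D b t' x) \<partial>lborel) + (\<integral>x. F \<tau> x * \<Phi>' (f t' x) \<partial>lborel) - A t'
      \<le> (\<Sum>j\<in>J. \<integral>x. \<bar>g j \<tau> x - g j t' x\<bar> \<partial>lborel)"
      using F1 unfolding J_def by (subst sum.insert) (auto simp: sum.reindex)
  qed
  have "H T - H s \<le> (LINT t:{s..T}|lborel. A t)"
  proof (rule integrate_ae_increment_bound[OF sT Hc Ai _ gi])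
    show "finite J" by (simp add: J_def)
    show "AE t' in lborel. t' \<in> {s..T} \<longrightarrow> (\<forall>t\<in>{s..t'}. ennreal (H t' - H t - (t' - t) * A t') \<le>
       (\<integral>\<^sup>+\<tau>. indicator {t..t'} \<tau> * (\<Sum>j\<in>J. \<integral>\<^sup>+x. ennreal \<bar>g j \<tau> x - g j t' x\<bar> \<partial>lborel) \<partial>lborel))"
      using weak AEgood
    proof (eventually_elim, intro impI ballI)
      fix t' t
      assume elim: "t' \<in> {s..T} \<longrightarrow> (\<forall>t\<in>{s..t'}.
        set_integrable lborel {t..t'} (\<lambda>\<tau>. - \<eta> * (\<Sum>b\<in>Basis. \<integral>x. D b \<tau> x * (\<Phi>'' (f t' x) * D b t' x) \<partial>lborel) + (\<integral>x. F \<tau> x * \<Phi>' (f t' x) \<partial>lborel)) \<and>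
        (\<integral>x. (f t' x - f t x) * \<Phi>' (f t' x) \<partial>lborel) =
          (LINT \<tau>:{t..t'}|lborel. - \<eta> * (\<Sum>b\<in>Basis. \<integral>x. D b \<tau> x * (\<Phi>'' (f t' x) * D b t' x) \<partial>lborel) + (\<integral>x. F \<tau> x * \<Phi>' (f t' x) \<partial>lborel)))"
        "good t'" and t': "t' \<in> {s..T}" and t: "t \<in> {s..t'}"
      define R where "R \<tau> = - \<eta> * (\<Sum>b\<in>Basis. \<integral>x. D b \<tau> x * (\<Phi>'' (f t' x) * D b t' x) \<partial>lborel) + (\<integral>x. F \<tau> x * \<Phi>' (f t' x) \<partial>lborel)" for \<tau>
      have Ri: "set_integrable lborel {t..t'} R" and Re: "(\<integral>x. (f t' x - f t x) * \<Phi>' (f t' x) \<partial>lborel) = (LINT \<tau>:{t..t'}|lborel. R \<tau>)"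
        using elim(1)[rule_format, OF t' t] unfolding R_def[abs_def] by blast+
      have tt: "t \<in> {s..T}" "t \<le> t'" using t t' by auto
      have i1: "integrable lborel (\<lambda>x. (f t' x - f t x) * \<Phi>' (f t' x))"
        using integrable_bounded_mult[of lborel "\<lambda>x. f t' x - f t x" "\<lambda>x. \<Phi>' (f t' x)" C] fi[OF t'] fi[OF tt(1)] \<Phi>(5)
        by (simp add: mult.commute)
      have "H t' - H t = (\<integral>x. \<Phi> (f t' x) - \<Phi> (f t x) \<partial>lborel)" using \<Phi>i[OF t'] \<Phi>i[OF tt(1)] by (simp add: H_def)
      also have "\<dots> \<le> (\<integral>x. (f t' x - f t x) * \<Phi>' (f t' x) \<partial>lborel)"
        using \<Phi>i[OF t'] \<Phi>i[OF tt(1)] i1 conv by (intro integral_mono) auto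
      finally have "H t' - H t \<le> (LINT \<tau>:{t..t'}|lborel. R \<tau>)" by (simp add: Re)
      moreover have "(LINT \<tau>:{t..t'}|lborel. A t') = (t' - t) * A t'" using tt by (simp add: set_lebesgue_integral_def)
      moreover have Ac: "set_integrable lborel {t..t'} (\<lambda>_. A t')"
        using integrable_real_indicator[of "{t..t'}" lborel] by (simp add: set_integrable_def emeasure_lborel_Icc_eq)
      ultimately have "H t' - H t - (t' - t) * A t' \<le> (LINT \<tau>:{t..t'}|lborel. R \<tau> - A t')"
        using set_integral_diff(2)[OF Ri Ac] by simp
      then have "ennreal (H t' - H t - (t' - t) * A t') \<le> ennreal (LINT \<tau>:{t..t'}|lborel. R \<tau> - A t')" by (rule ennreal_leI)
      also have "\<dots> \<le> (\<integral>\<^sup>+\<tau>. ennreal (indicator {t..t'} \<tau> * (R \<tau> - A t')) \<partial>lborel)"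
        using integral_le_nn_integral[OF set_integral_diff(1)[OF Ri Ac, unfolded set_integrable_def]]
        by (simp add: set_lebesgue_integral_def)
      also have "\<dots> \<le> (\<integral>\<^sup>+\<tau>. indicator {t..t'} \<tau> * (\<Sum>j\<in>J. \<integral>\<^sup>+x. ennreal \<bar>g j \<tau> x - g j t' x\<bar> \<partial>lborel) \<partial>lborel)"
      proof (rule nn_integral_mono_AE, use AEgood in eventually_elim)
        case g\<tau>: (elim \<tau>)
        show ?case
        proof (cases "\<tau> \<in> {t..t'}")
          case True
          then have \<tau>: "\<tau> \<in> {s..T}" using t t' by auto
          note gg = gint[OF t' elim(2) \<tau> g\<tau>]
          have "ennreal (R \<tau> - A t') \<le> ennreal (\<Sum>j\<in>J. \<integral>x. \<bar>g j \<tau> x - g j t' x\<bar> \<partial>lborel)"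
            using pw[OF t' elim(2) \<tau> g\<tau>] by (intro ennreal_leI) (simp add: R_def)
          also have "\<dots> = (\<Sum>j\<in>J. ennreal (\<integral>x. \<bar>g j \<tau> x - g j t' x\<bar> \<partial>lborel))" by (subst sum_ennreal) auto
          also have "\<dots> = (\<Sum>j\<in>J. \<integral>\<^sup>+x. ennreal \<bar>g j \<tau> x - g j t' x\<bar> \<partial>lborel)"
            using gg by (intro sum.cong refl nn_integral_eq_integral[symmetric]) auto
          finally show ?thesis using True by simp
        qed simp
      qed
      finally show "ennreal (H t' - H t - (t' - t) * A t') \<le>
       (\<integral>\<^sup>+\<tau>. indicator {t..t'} \<tau> * (\<Sum>j\<in>J. \<integral>\<^sup>+x. ennreal \<bar>g j \<tau> x - g j t' x\<bar> \<partial>lborel) \<partial>lborel)" .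
    qed
  qed
  then show ?thesis by (simp add: H_def A_def)
qed

section \<open>Gradients of weak solutions and the testing of their equations\<close>

lemma integrable_mult_L2:
  fixes f g :: "'a \<Rightarrow> real"
  assumes [measurable]: "f \<in> borel_measurable M" "g \<in> borel_measurable M"
    and f: "integrable M (\<lambda>x. (f x)\<^sup>2)" and g: "integrable M (\<lambda>x. (g x)\<^sup>2)"
  shows "integrable M (\<lambda>x. f x * g x)"
proof (rule Bochner_Integration.integrable_bound[OF Bochner_Integration.integrable_add[OF f g]])
  have "\<bar>u * v\<bar> \<le> u\<^sup>2 + v\<^sup>2" for u v :: real
  proof -
    have "2 * (\<bar>u\<bar> * \<bar>v\<bar>) \<le> u\<^sup>2 + v\<^sup>2" using zero_le_power2[of "\<bar>u\<bar> - \<bar>v\<bar>"] by (simp add: power2_diff)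
    moreover have "0 \<le> \<bar>u\<bar> * \<bar>v\<bar>" by simp
    ultimately show ?thesis unfolding abs_mult by linarith
  qed
  then show "AE x in M. norm (f x * g x) \<le> norm ((f x)\<^sup>2 + (g x)\<^sup>2)" by (intro AE_I2) simp
qed simp

text \<open>The dictionary between gradients on \<Omega> and partial derivatives of Borel versions
  on the whole space.\<close>

lemma weak_grad_iff:
  assumes \<Omega>: "open \<Omega>" "bounded \<Omega>" and f: "Lp \<Omega> 2 f" "rep \<Omega> f f'"
    and D: "\<And>b. b \<in> Basis \<Longrightarrow> Lp \<Omega> 2 (\<lambda>x. Df x \<bullet> b)" "\<And>b. b \<in> Basis \<Longrightarrow> rep \<Omega> (\<lambda>x. Df x \<bullet> b) (d b)"
  shows "weak_grad \<Omega> f Df \<longleftrightarrow> (\<forall>b\<in>Basis. weak_partial \<Omega> b f' (d b))"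
proof -
  have "(\<integral>x. f x * frechet_derivative \<phi> (at x) b \<partial>lebesgue_on \<Omega>) = (\<integral>x. f' x * frechet_derivative \<phi> (at x) b \<partial>lborel)"
    "(\<integral>x. (Df x \<bullet> b) * \<phi> x \<partial>lebesgue_on \<Omega>) = (\<integral>x. d b x * \<phi> x \<partial>lborel)"
    if \<phi>: "test_fun \<Omega> \<phi>" and b: "b \<in> Basis" for \<phi> b
  proof -
    have m: "\<phi> \<in> borel_measurable borel" "(\<lambda>x. frechet_derivative \<phi> (at x) b) \<in> borel_measurable borel"
      using test_funE[OF \<phi>] by blast+
    show "(\<integral>x. f x * frechet_derivative \<phi> (at x) b \<partial>lebesgue_on \<Omega>) = (\<integral>x. f' x * frechet_derivative \<phi> (at x) b \<partial>lborel)"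
      by (rule rep_integral[OF \<Omega>(1) rep_mult_borel[OF f(2) m(2)]])
    show "(\<integral>x. (Df x \<bullet> b) * \<phi> x \<partial>lebesgue_on \<Omega>) = (\<integral>x. d b x * \<phi> x \<partial>lborel)"
      by (rule rep_integral[OF \<Omega>(1) rep_mult_borel[OF D(2)[OF b] m(1)]])
  qed
  moreover have "integrable lborel f'" by (rule rep_Lp_2[OF \<Omega> f])
  moreover have "integrable lborel (d b)" if "b \<in> Basis" for b by (rule rep_Lp_2(2)[OF \<Omega> D(1)[OF that] D(2)[OF that]])
  ultimately show ?thesis unfolding weak_grad_def weak_partial_def using D(1) by auto
qed

text \<open>\<open>wgrad\<close> picks some gradient by \<open>SOME\<close>; uniqueness lets a
  gradient obtained in another way be substituted for it almost everywhere.\<close>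

lemma weak_partial_unique:
  assumes \<Omega>: "open \<Omega>" "bounded \<Omega>" and d: "weak_partial \<Omega> b f d1" "weak_partial \<Omega> b f d2"
  shows "AE x in lborel. x \<in> \<Omega> \<longrightarrow> d1 x = d2 x"
proof -
  have i: "integrable lborel d1" "integrable lborel d2" using d by (auto simp: weak_partial_def)
  have "AE x in lborel. x \<in> \<Omega> \<longrightarrow> d1 x - d2 x = 0"
  proof (rule fundamental_lemma[OF \<Omega>])
    show "integrable lborel (\<lambda>x. d1 x - d2 x)" using i by simp
    fix \<phi> assume \<phi>: "test_fun \<Omega> \<phi>"
    obtain C where C: "\<And>x. \<bar>\<phi> x\<bar> \<le> C" "\<phi> \<in> borel_measurable borel" using test_funE[OF \<phi>] by metis
    have i': "integrable lborel (\<lambda>x. d1 x * \<phi> x)" "integrable lborel (\<lambda>x. d2 x * \<phi> x)"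
      using integrable_bounded_mult[OF i(1), of \<phi> C] integrable_bounded_mult[OF i(2), of \<phi> C] C by (auto simp: mult.commute)
    have "(\<integral>x. d1 x * \<phi> x \<partial>lborel) = (\<integral>x. d2 x * \<phi> x \<partial>lborel)"
      using d \<phi> unfolding weak_partial_def by (metis add.inverse_inverse)
    then show "(\<integral>x. (d1 x - d2 x) * \<phi> x \<partial>lborel) = 0" using i' by (simp add: left_diff_distrib)
  qed
  then show ?thesis by simp
qed

lemma finite_measure_lebesgue_on_bounded:
  "open \<Omega> \<Longrightarrow> bounded \<Omega> \<Longrightarrow> finite_measure (lebesgue_on (\<Omega> :: 'a::euclidean_space set))"
  by (intro finite_measure_lebesgue_on) (simp add: bounded_set_imp_lmeasurable)

lemma Lp_2_bounded:
  assumes \<Omega>: "open \<Omega>" "bounded \<Omega>" and f: "f \<in> borel_measurable (lebesgue_on \<Omega>)" "\<And>x. \<bar>f x\<bar> \<le> C"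
  shows "Lp \<Omega> 2 f"
proof -
  interpret finite_measure "lebesgue_on \<Omega>" by (rule finite_measure_lebesgue_on_bounded[OF \<Omega>])
  have "(f x)\<^sup>2 \<le> C\<^sup>2" for x using f(2)[of x] by (metis abs_ge_zero order_trans power2_abs power_mono)
  then show ?thesis unfolding Lp_2 using f(1) by (auto intro!: integrable_const_bound[of _ "C\<^sup>2"])
qed

text \<open>Lets the equations be tested with localised functions, from which
  \<open>fundamental_lemma\<close> extracts pointwise information.\<close>

lemma test_space_test_fun:
  assumes \<Omega>: "open \<Omega>" "bounded \<Omega>" and \<phi>: "test_fun \<Omega> \<phi>"
  shows "test_space \<Omega> \<phi>"
proof -
  obtain K C where K: "K \<subseteq> \<Omega>" "\<And>x. x \<notin> K \<Longrightarrow> \<phi> x = 0"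
    "\<And>x b. x \<notin> K \<Longrightarrow> frechet_derivative \<phi> (at x) b = 0"
    "\<And>x. \<bar>\<phi> x\<bar> \<le> C" "\<And>x b. b \<in> Basis \<Longrightarrow> \<bar>frechet_derivative \<phi> (at x) b\<bar> \<le> C"
    and m: "\<phi> \<in> borel_measurable borel" "\<And>b. (\<lambda>x. frechet_derivative \<phi> (at x) b) \<in> borel_measurable borel"
    using test_funE[OF \<phi>] by metis
  define Df where "Df x = (\<Sum>b\<in>Basis. frechet_derivative \<phi> (at x) b *\<^sub>R b)" for x
  have Dfb: "(\<lambda>x. Df x \<bullet> b) = (\<lambda>x. frechet_derivative \<phi> (at x) b)" if "b \<in> Basis" for b
    using that by (simp add: Df_def fun_eq_iff)
  have L: "Lp \<Omega> 2 \<phi>" by (rule Lp_2_bounded[OF \<Omega> borel_measurable_lebesgue_onI[OF m(1)] K(4)])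
  have "weak_grad \<Omega> \<phi> Df \<longleftrightarrow> (\<forall>b\<in>Basis. weak_partial \<Omega> b \<phi> (\<lambda>x. frechet_derivative \<phi> (at x) b))"
  proof (rule weak_grad_iff[OF \<Omega> L])
    show "rep \<Omega> \<phi> \<phi>" using K by (intro rep_self m(1)) auto
    fix b :: 'a assume b: "b \<in> Basis"
    show "Lp \<Omega> 2 (\<lambda>x. Df x \<bullet> b)" unfolding Dfb[OF b]
      by (rule Lp_2_bounded[OF \<Omega> borel_measurable_lebesgue_onI[OF m(2)] K(5)[OF b]])
    show "rep \<Omega> (\<lambda>x. Df x \<bullet> b) (\<lambda>x. frechet_derivative \<phi> (at x) b)" unfolding Dfb[OF b]
      using K by (intro rep_self m(2)) auto
  qed
  then have "weak_grad \<Omega> \<phi> Df" using weak_partial_test_fun[OF \<phi>] by blast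
  then show ?thesis using L K(4) unfolding test_space_def H1_def by blast
qed

text \<open>Measurability of f comes from its integrability, that of g is a separate assumption: the
  integrand of a weak identity is known to be measurable in time only because the identity says it
  is integrable.\<close>

lemma set_integral_cong_AE_Icc:
  fixes f g :: "real \<Rightarrow> real"
  assumes f: "set_integrable lborel {a..b} f" and g: "g \<in> borel_measurable borel"
    and eq: "AE t in lborel. t \<in> {a..b} \<longrightarrow> f t = g t"
  shows "set_integrable lborel {a..b} g" "(LINT t:{a..b}|lborel. f t) = (LINT t:{a..b}|lborel. g t)"
proof -
  have fm: "(\<lambda>t. indicator {a..b} t *\<^sub>R f t) \<in> borel_measurable lborel"
    using f unfolding set_integrable_def by (rule borel_measurable_integrable)
  have gm: "(\<lambda>t. indicator {a..b} t *\<^sub>R g t) \<in> borel_measurable lborel" using g by simp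
  have ae: "AE t in lborel. indicator {a..b} t *\<^sub>R f t = indicator {a..b} t *\<^sub>R g t"
    using eq by eventually_elim (auto simp: indicator_def)
  show "set_integrable lborel {a..b} g"
    using f integrable_cong_AE[OF fm gm ae] by (simp add: set_integrable_def)
  show "(LINT t:{a..b}|lborel. f t) = (LINT t:{a..b}|lborel. g t)"
    unfolding set_lebesgue_integral_def by (rule integral_cong_AE[OF fm gm ae])
qed

text \<open>Verifies the hypothesis \<open>weak\<close> of \<open>energy_inequality\<close>: for
  almost every t' the function f t' is in H^1, so \<Phi>'(f t') is bounded and in H^1 by the chain
  rule and may be inserted as test function. The condition \<Phi>' 0 = 0 keeps its representative
  zero outside \<Omega>.\<close>

lemma parabolic_energy:
  fixes f F :: "real \<Rightarrow> 'a::euclidean_space \<Rightarrow> real"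
  assumes \<Omega>: "open \<Omega>" "bounded \<Omega>" and \<eta>: "\<eta> \<ge> 0"
    and f: "\<And>t. t \<ge> 0 \<Longrightarrow> Lp \<Omega> 2 (f t)"
    and fbm: "(\<lambda>(t,x). fb t x) \<in> borel_measurable (lborel \<Otimes>\<^sub>M lborel)"
    and fb: "\<And>t. t \<ge> 0 \<Longrightarrow> rep \<Omega> (f t) (fb t)"
    and fc: "\<And>t0. t0 \<ge> 0 \<Longrightarrow> ((\<lambda>t. \<integral>x. \<bar>fb t x - fb t0 x\<bar> \<partial>lborel) \<longlongrightarrow> 0) (at t0 within {0..})"
    and h1: "\<And>T. T > 0 \<Longrightarrow> AE t in lebesgue_on {0..T}. H1 \<Omega> (f t)"
    and grad: "\<And>T. T > 0 \<Longrightarrow> set_integrable lborel {0..T} (\<lambda>t. \<integral>x. (norm (wgrad \<Omega> (f t) x))\<^sup>2 \<partial>lebesgue_on \<Omega>)"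
    and Fb: "\<And>t. t \<ge> 0 \<Longrightarrow> rep \<Omega> (F t) (Fb t)"
    and Fbi: "\<And>s T. 0 \<le> s \<Longrightarrow> integrable (lborel \<Otimes>\<^sub>M lborel) (\<lambda>(t,x). indicator {s..T} t * Fb t x)"
    and Fbm: "(\<lambda>(t,x). Fb t x) \<in> borel_measurable (lborel \<Otimes>\<^sub>M lborel)"
    and weak: "\<And>\<psi> s t. test_space \<Omega> \<psi> \<Longrightarrow> 0 \<le> s \<Longrightarrow> s \<le> t \<Longrightarrow> weak_identity \<Omega> f \<psi>
       (\<lambda>\<tau>. - \<eta> * (\<integral>x. wgrad \<Omega> (f \<tau>) x \<bullet> wgrad \<Omega> \<psi> x \<partial>lebesgue_on \<Omega>) + (\<integral>x. F \<tau> x * \<psi> x \<partial>lebesgue_on \<Omega>)) s t"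
    and \<Phi>: "\<And>x. (\<Phi> has_real_derivative \<Phi>' x) (at x)" "\<And>x. (\<Phi>' has_real_derivative \<Phi>'' x) (at x)"
      "continuous_on UNIV \<Phi>''" "\<Phi> 0 = 0" "\<And>x. \<bar>\<Phi>' x\<bar> \<le> C" "\<And>x. 0 \<le> \<Phi>'' x" "\<And>x. \<Phi>'' x \<le> C" "\<Phi>' 0 = 0"
    and sT: "0 \<le> s" "s \<le> T"
  shows "(\<integral>x. \<Phi> (fb T x) \<partial>lborel) - (\<integral>x. \<Phi> (fb s x) \<partial>lborel) \<le> (LINT t:{s..T}|lborel. \<integral>x. Fb t x * \<Phi>' (fb t x) \<partial>lborel)"
proof -
  have c\<Phi>': "continuous_on UNIV \<Phi>'" using \<Phi>(2) by (intro continuous_at_imp_continuous_on ballI DERIV_isCont)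
  have [measurable]: "\<Phi>' \<in> borel_measurable borel" "\<Phi>'' \<in> borel_measurable borel"
    using c\<Phi>' \<Phi>(3) by (auto intro: borel_measurable_continuous_onI)
  note fbL2 = rep_Lp_2[OF \<Omega> f fb]
  have "\<exists>D. (\<lambda>(t,x). D t x) \<in> borel_measurable (lborel \<Otimes>\<^sub>M lborel) \<and> (\<forall>t x. x \<notin> \<Omega> \<longrightarrow> D t x = 0) \<and>
    (\<forall>t d. weak_partial \<Omega> b (fb t) d \<longrightarrow> (\<forall>x. x \<notin> \<Omega> \<longrightarrow> d x = 0) \<longrightarrow> (AE x in lborel. D t x = d x))" for b
    by (rule joint_weak_partial[OF \<Omega> fbm, of b]) metis
  then obtain D where Dm: "\<And>b. (\<lambda>(t,x). D b t x) \<in> borel_measurable (lborel \<Otimes>\<^sub>M lborel)"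
    and D0: "\<And>b t x. x \<notin> \<Omega> \<Longrightarrow> D b t x = 0"
    and D: "\<And>b t d. weak_partial \<Omega> b (fb t) d \<Longrightarrow> (\<And>x. x \<notin> \<Omega> \<Longrightarrow> d x = 0) \<Longrightarrow> AE x in lborel. D b t x = d x"
    by metis
  have Dtm: "D b t \<in> borel_measurable borel" for b t using measurable_Pair2[OF Dm, of t] by simp
  \<comment> \<open>The exceptional times form a null set, since the intervals [0, n + 1] are
    countably many and cover all nonnegative times.\<close>
  define good where "good t \<longleftrightarrow> (t \<ge> 0 \<longrightarrow> H1 \<Omega> (f t))" for t
  have AEgood: "AE t in lborel. good t"
  proof -
    have "AE t in lborel. \<forall>n::nat. t \<in> {0..real (Suc n)} \<longrightarrow> H1 \<Omega> (f t)"
    proof (subst AE_all_countable, rule allI)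
      fix n :: nat
      have "AE t in lebesgue_on {0..real (Suc n)}. H1 \<Omega> (f t)" by (rule h1) simp
      then show "AE t in lborel. t \<in> {0..real (Suc n)} \<longrightarrow> H1 \<Omega> (f t)" unfolding AE_lebesgue_on_Icc .
    qed
    then show ?thesis
    proof eventually_elim
      case (elim t)
      obtain n where "t \<le> real n" using real_arch_simple by blast
      then have "t \<le> real (Suc n)" by simp
      then show ?case using elim unfolding good_def by auto
    qed
  qed
  have wg: "weak_grad \<Omega> (f t) (wgrad \<Omega> (f t))" if "good t" "t \<ge> 0" for t
    using that someI_ex[of "weak_grad \<Omega> (f t)"] unfolding good_def H1_def wgrad_def by blast
  have rD: "rep \<Omega> (\<lambda>x. wgrad \<Omega> (f t) x \<bullet> b) (D b t)" and wD: "weak_partial \<Omega> b (fb t) (D b t)"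
    and LD: "Lp \<Omega> 2 (\<lambda>x. wgrad \<Omega> (f t) x \<bullet> b)"
    if g: "good t" "t \<ge> 0" and b: "b \<in> Basis" for t b
  proof -
    have L: "Lp \<Omega> 2 (\<lambda>x. wgrad \<Omega> (f t) x \<bullet> b)" if "b \<in> Basis" for b using wg[OF g] that unfolding weak_grad_def by blast
    then show "Lp \<Omega> 2 (\<lambda>x. wgrad \<Omega> (f t) x \<bullet> b)" using b .
    have "\<forall>b. \<exists>d. b \<in> Basis \<longrightarrow> rep \<Omega> (\<lambda>x. wgrad \<Omega> (f t) x \<bullet> b) d" using L rep_ex[OF \<Omega>(1)] unfolding Lp_2 by blast
    then obtain d where d: "\<And>b. b \<in> Basis \<Longrightarrow> rep \<Omega> (\<lambda>x. wgrad \<Omega> (f t) x \<bullet> b) (d b)" by metis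
    have w: "weak_partial \<Omega> b (fb t) (d b)" using weak_grad_iff[OF \<Omega> f[OF g(2)] fb[OF g(2)] L d] wg[OF g] b by blast
    have ae: "AE x in lborel. D b t x = d b x" by (rule D[OF w]) (rule repD(3)[OF d[OF b]])
    show "rep \<Omega> (\<lambda>x. wgrad \<Omega> (f t) x \<bullet> b) (D b t)" unfolding rep_def
    proof (intro conjI)
      show "AE x in lborel. x \<in> \<Omega> \<longrightarrow> wgrad \<Omega> (f t) x \<bullet> b = D b t x"
        using ae repD(4)[OF d[OF b]] by eventually_elim simp
    qed (use repD(1)[OF d[OF b]] Dtm D0 in auto)
    have dm: "d b \<in> borel_measurable borel" "D b t \<in> borel_measurable borel" using repD(2)[OF d[OF b]] Dtm by auto
    have "integrable lborel (D b t)"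
      using integrable_cong_AE[OF _ _ ae] dm w by (auto simp: weak_partial_def)
    moreover have "(\<integral>x. d b x * \<phi> x \<partial>lborel) = (\<integral>x. D b t x * \<phi> x \<partial>lborel)" if "test_fun \<Omega> \<phi>" for \<phi>
    proof (rule integral_cong_AE)
      have [measurable]: "\<phi> \<in> borel_measurable borel" using test_funE[OF that] by blast
      note [measurable] = dm
      show "(\<lambda>x. d b x * \<phi> x) \<in> borel_measurable lborel" "(\<lambda>x. D b t x * \<phi> x) \<in> borel_measurable lborel" by measurable
      show "AE x in lborel. d b x * \<phi> x = D b t x * \<phi> x" using ae by eventually_elim simp
    qed
    ultimately show "weak_partial \<Omega> b (fb t) (D b t)" using w unfolding weak_partial_def by simp
  qed
  have DL2: "integrable lborel (\<lambda>x. (D b t x)\<^sup>2)" if "good t" "t \<ge> 0" "b \<in> Basis" for t b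
    by (rule rep_Lp_2(1)[OF \<Omega> LD[OF that] rD[OF that]])
  have Dm'[measurable]: "(\<lambda>p. D b (fst p) (snd p)) \<in> borel_measurable (lborel \<Otimes>\<^sub>M lborel)" for b
    using Dm[of b] by (simp add: split_beta')
  have Di: "integrable (lborel \<Otimes>\<^sub>M lborel) (\<lambda>(t,x). indicator {s..T} t * (D b t x)\<^sup>2)" if b: "b \<in> Basis" for b
  proof (rule lborel_pair.Fubini_integrable)
    show "(\<lambda>(t,x). indicator {s..T} t * (D b t x)\<^sup>2) \<in> borel_measurable (lborel \<Otimes>\<^sub>M lborel)"
      unfolding split_beta' by measurable
    show "AE t in lborel. integrable lborel (\<lambda>x. case (t, x) of (t,x) \<Rightarrow> indicator {s..T} t * (D b t x)\<^sup>2)"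
      using AEgood by eventually_elim (use DL2 sT b in \<open>auto simp: indicator_def\<close>)
    \<comment> \<open>The interval is enlarged to T + 1 because \<open>grad\<close> speaks of
      positive T, while T may be 0 here.\<close>
    have gi: "set_integrable lborel {0..T + 1} (\<lambda>t. \<integral>x. (norm (wgrad \<Omega> (f t) x))\<^sup>2 \<partial>lebesgue_on \<Omega>)"
      using sT by (intro grad) auto
    show "integrable lborel (\<lambda>t. \<integral>x. norm (case (t, x) of (t,x) \<Rightarrow> indicator {s..T} t * (D b t x)\<^sup>2) \<partial>lborel)"
    proof (rule Bochner_Integration.integrable_bound[OF gi[unfolded set_integrable_def]])
      show "(\<lambda>t. \<integral>x. norm (case (t, x) of (t,x) \<Rightarrow> indicator {s..T} t * (D b t x)\<^sup>2) \<partial>lborel) \<in> borel_measurable lborel"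
        by measurable
      show "AE t in lborel. norm (\<integral>x. norm (case (t, x) of (t,x) \<Rightarrow> indicator {s..T} t * (D b t x)\<^sup>2) \<partial>lborel)
         \<le> norm (indicator {0..T + 1} t *\<^sub>R (\<integral>x. (norm (wgrad \<Omega> (f t) x))\<^sup>2 \<partial>lebesgue_on \<Omega>))"
        using AEgood
      proof eventually_elim
        case (elim t)
        show ?case
        proof (cases "t \<in> {s..T}")
          case True
          then have t: "t \<ge> 0" "t \<in> {0..T + 1}" using sT by auto
          have "(\<integral>x. (D b t x)\<^sup>2 \<partial>lborel) = (\<integral>x. (wgrad \<Omega> (f t) x \<bullet> b)\<^sup>2 \<partial>lebesgue_on \<Omega>)"
            by (rule rep_integral[symmetric, OF \<Omega>(1) rep_power[OF rD[OF elim t(1) b]]]) simp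
          also have "\<dots> \<le> (\<integral>x. (norm (wgrad \<Omega> (f t) x))\<^sup>2 \<partial>lebesgue_on \<Omega>)"
          proof (rule integral_mono)
            have i: "integrable (lebesgue_on \<Omega>) (\<lambda>x. (wgrad \<Omega> (f t) x \<bullet> b)\<^sup>2)" if "b \<in> Basis" for b
              using LD[OF elim t(1) that] by (simp add: Lp_2)
            then show "integrable (lebesgue_on \<Omega>) (\<lambda>x. (wgrad \<Omega> (f t) x \<bullet> b)\<^sup>2)" using b .
            have "(\<lambda>x. (norm (wgrad \<Omega> (f t) x))\<^sup>2) = (\<lambda>x. \<Sum>b\<in>Basis. (wgrad \<Omega> (f t) x \<bullet> b)\<^sup>2)"
              unfolding power2_norm_eq_inner by (rule ext) (subst euclidean_inner, simp add: power2_eq_square)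
            then show "integrable (lebesgue_on \<Omega>) (\<lambda>x. (norm (wgrad \<Omega> (f t) x))\<^sup>2)" using i by simp
            show "(wgrad \<Omega> (f t) x \<bullet> b)\<^sup>2 \<le> (norm (wgrad \<Omega> (f t) x))\<^sup>2" for x
              using Basis_le_norm[OF b, of "wgrad \<Omega> (f t) x"] by (metis abs_ge_zero power2_abs power_mono)
          qed
          finally show ?thesis using True t by simp
        qed simp
      qed
    qed
  qed
  show ?thesis
  proof (rule energy_inequality[where D=D, OF sT(2) \<eta> \<Phi>(1-7) fbm _ _ Fbi[OF sT(1)] Dm Di])
    show "integrable lborel (fb t)" if "t \<in> {s..T}" for t using that sT by (intro fbL2) auto
    show "((\<lambda>t. \<integral>x. \<bar>fb t x - fb t0 x\<bar> \<partial>lborel) \<longlongrightarrow> 0) (at t0 within {s..T})" if "t0 \<in> {s..T}" for t0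
      using that sT by (intro tendsto_within_subset[OF fc]) auto
    show "AE t' in lborel. t' \<in> {s..T} \<longrightarrow> (\<forall>t\<in>{s..t'}.
        set_integrable lborel {t..t'} (\<lambda>\<tau>. - \<eta> * (\<Sum>b\<in>Basis. \<integral>x. D b \<tau> x * (\<Phi>'' (fb t' x) * D b t' x) \<partial>lborel) + (\<integral>x. Fb \<tau> x * \<Phi>' (fb t' x) \<partial>lborel)) \<and>
        (\<integral>x. (fb t' x - fb t x) * \<Phi>' (fb t' x) \<partial>lborel) =
          (LINT \<tau>:{t..t'}|lborel. - \<eta> * (\<Sum>b\<in>Basis. \<integral>x. D b \<tau> x * (\<Phi>'' (fb t' x) * D b t' x) \<partial>lborel) + (\<integral>x. Fb \<tau> x * \<Phi>' (fb t' x) \<partial>lborel)))"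
      using AEgood
    proof (eventually_elim, intro impI ballI)
      fix t' t assume g': "good t'" and t': "t' \<in> {s..T}" and t: "t \<in> {s..t'}"
      have t'0: "t' \<ge> 0" and t0: "t \<ge> 0" and tt: "t \<le> t'" using t' t sT by auto
      define \<psi> where "\<psi> x = \<Phi>' (f t' x)" for x
      have r\<psi>: "rep \<Omega> \<psi> (\<lambda>x. \<Phi>' (fb t' x))" unfolding \<psi>_def
        by (rule rep_compose[where h=\<Phi>', OF fb[OF t'0] \<Phi>(8)]) measurable
      have L\<psi>: "Lp \<Omega> 2 \<psi>" by (rule Lp_2_bounded[where C=C, OF \<Omega> repD(1)[OF r\<psi>]]) (simp add: \<psi>_def \<Phi>(5))
      have chain: "weak_partial \<Omega> b (\<lambda>x. \<Phi>' (fb t' x)) (\<lambda>x. \<Phi>'' (fb t' x) * D b t' x)" if b: "b \<in> Basis" for b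
        unfolding weak_partial_def
      proof (intro conjI allI impI)
        note [measurable] = repD(2)[OF fb[OF t'0]]
        show "integrable lborel (\<lambda>x. \<Phi>' (fb t' x))" by (rule rep_Lp_2(2)[OF \<Omega> L\<psi> r\<psi>])
        show "integrable lborel (\<lambda>x. \<Phi>'' (fb t' x) * D b t' x)"
        proof (rule integrable_bounded_mult[where C=C])
          show "integrable lborel (D b t')" using wD[OF g' t'0 b] by (simp only: weak_partial_def)
          show "\<bar>\<Phi>'' (fb t' x)\<bar> \<le> C" for x using \<Phi>(6)[of "fb t' x"] \<Phi>(7)[of "fb t' x"] by linarith
        qed measurable
        show "(\<integral>x. \<Phi>' (fb t' x) * frechet_derivative \<phi> (at x) b \<partial>lborel) = - (\<integral>x. \<Phi>'' (fb t' x) * D b t' x * \<phi> x \<partial>lborel)"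
          if "test_fun \<Omega> \<phi>" for \<phi>
          by (rule weak_partial_chain[OF \<Omega> wD[OF g' t'0 b] b \<Phi>(2,3) _ \<Phi>(5) that, of C]) (simp add: \<Phi>(6,7))
      qed
      define D\<psi> where "D\<psi> x = \<Phi>'' (f t' x) *\<^sub>R wgrad \<Omega> (f t') x" for x
      have rr: "rep \<Omega> (\<lambda>x. \<Phi>'' (f t' x) * (wgrad \<Omega> (f t') x \<bullet> b)) (\<lambda>x. \<Phi>'' (fb t' x) * D b t' x)" if b: "b \<in> Basis" for b
        
        by (rule rep_combine[where h="\<lambda>u v. \<Phi>'' u * v", OF fb[OF t'0] rD[OF g' t'0 b]]) auto
      have Lr: "Lp \<Omega> 2 (\<lambda>x. D\<psi> x \<bullet> b)" if b: "b \<in> Basis" for b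
      proof -
        have [measurable]: "f t' \<in> borel_measurable (lebesgue_on \<Omega>)" by (rule repD(1)[OF fb[OF t'0]])
        have "integrable (lebesgue_on \<Omega>) (\<lambda>x. (\<Phi>'' (f t' x))\<^sup>2 * (wgrad \<Omega> (f t') x \<bullet> b)\<^sup>2)"
        proof (rule integrable_bounded_mult[of _ _ _ "C\<^sup>2"])
          show "integrable (lebesgue_on \<Omega>) (\<lambda>x. (wgrad \<Omega> (f t') x \<bullet> b)\<^sup>2)" using LD[OF g' t'0 b] by (simp add: Lp_2)
          show "\<bar>(\<Phi>'' (f t' x))\<^sup>2\<bar> \<le> C\<^sup>2" for x using \<Phi>(6,7) by (simp add: power_mono)
        qed measurable
        then show ?thesis using repD(1)[OF rr[OF b]] by (simp add: Lp_2 D\<psi>_def power_mult_distrib)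
      qed
      have "weak_grad \<Omega> \<psi> D\<psi>"
        using weak_grad_iff[OF \<Omega> L\<psi> r\<psi> Lr, of "\<lambda>b x. \<Phi>'' (fb t' x) * D b t' x"] rr chain by (simp add: D\<psi>_def[abs_def])
      then have wg\<psi>: "weak_grad \<Omega> \<psi> (wgrad \<Omega> \<psi>)" and H1\<psi>: "H1 \<Omega> \<psi>"
        unfolding wgrad_def H1_def using L\<psi> someI[of "weak_grad \<Omega> \<psi>" D\<psi>] by blast+
      have ts: "test_space \<Omega> \<psi>" unfolding test_space_def using H1\<psi> \<Phi>(5) by (auto simp: \<psi>_def)
      \<comment> \<open>The gradient \<open>wgrad \<Omega> \<psi>\<close> of the weak identity need
        not be the D\<psi> of the chain rule; uniqueness makes the two agree almost
        everywhere.\<close>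
      have r\<psi>D: "rep \<Omega> (\<lambda>x. wgrad \<Omega> \<psi> x \<bullet> b) (\<lambda>x. \<Phi>'' (fb t' x) * D b t' x)" if b: "b \<in> Basis" for b
      proof -
        have L: "Lp \<Omega> 2 (\<lambda>x. wgrad \<Omega> \<psi> x \<bullet> b)" if "b \<in> Basis" for b using wg\<psi> that unfolding weak_grad_def by blast
        have "\<forall>b. \<exists>d. b \<in> Basis \<longrightarrow> rep \<Omega> (\<lambda>x. wgrad \<Omega> \<psi> x \<bullet> b) d" using L rep_ex[OF \<Omega>(1)] unfolding Lp_2 by blast
        then obtain d where d: "\<And>b. b \<in> Basis \<Longrightarrow> rep \<Omega> (\<lambda>x. wgrad \<Omega> \<psi> x \<bullet> b) (d b)" by metis
        have w: "weak_partial \<Omega> b (\<lambda>x. \<Phi>' (fb t' x)) (d b)" using weak_grad_iff[OF \<Omega> L\<psi> r\<psi> L d] wg\<psi> b by blast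
        have "AE x in lborel. x \<in> \<Omega> \<longrightarrow> d b x = \<Phi>'' (fb t' x) * D b t' x" by (rule weak_partial_unique[OF \<Omega> w chain[OF b]])
        with repD(4)[OF d[OF b]] have "AE x in lborel. x \<in> \<Omega> \<longrightarrow> wgrad \<Omega> \<psi> x \<bullet> b = \<Phi>'' (fb t' x) * D b t' x"
          by eventually_elim simp
        then show ?thesis using repD(1)[OF d[OF b]] repD(2,3)[OF rr[OF b]] by (simp add: rep_def)
      qed
      define R where "R \<tau> = - \<eta> * (\<Sum>b\<in>Basis. \<integral>x. D b \<tau> x * (\<Phi>'' (fb t' x) * D b t' x) \<partial>lborel) + (\<integral>x. Fb \<tau> x * \<Phi>' (fb t' x) \<partial>lborel)" for \<tau>
      have Rm: "R \<in> borel_measurable borel"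
      proof -
        note [measurable] = repD(2)[OF fb[OF t'0]] Dtm
        have [measurable]: "(\<lambda>p. Fb (fst p) (snd p)) \<in> borel_measurable (lborel \<Otimes>\<^sub>M lborel)" using Fbm by (simp add: split_beta')
        have "R \<in> borel_measurable lborel" unfolding R_def[abs_def] by measurable
        then show ?thesis by simp
      qed
      note W = weak[OF ts t0 tt, unfolded weak_identity_def]
      \<comment> \<open>The integrands agree only at good \<tau>, where \<open>wgrad\<close> really
        is a gradient; almost every \<tau> is enough under the time integral.\<close>
      have ae: "AE \<tau> in lborel. \<tau> \<in> {t..t'} \<longrightarrow> - \<eta> * (\<integral>x. wgrad \<Omega> (f \<tau>) x \<bullet> wgrad \<Omega> \<psi> x \<partial>lebesgue_on \<Omega>) + (\<integral>x. F \<tau> x * \<psi> x \<partial>lebesgue_on \<Omega>) = R \<tau>"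
        using AEgood
      proof (eventually_elim, intro impI)
        fix \<tau> assume g: "good \<tau>" and "\<tau> \<in> {t..t'}"
        then have \<tau>: "\<tau> \<ge> 0" using t0 by auto
        have "(\<integral>x. wgrad \<Omega> (f \<tau>) x \<bullet> wgrad \<Omega> \<psi> x \<partial>lebesgue_on \<Omega>) = (\<integral>x. (\<Sum>b\<in>Basis. (wgrad \<Omega> (f \<tau>) x \<bullet> b) * (wgrad \<Omega> \<psi> x \<bullet> b)) \<partial>lebesgue_on \<Omega>)"
          by (subst euclidean_inner) (rule refl)
        also have "\<dots> = (\<integral>x. (\<Sum>b\<in>Basis. D b \<tau> x * (\<Phi>'' (fb t' x) * D b t' x)) \<partial>lborel)"
          by (rule rep_integral[OF \<Omega>(1)]) (intro rep_sum rep_mult rD g \<tau> r\<psi>D)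
        also have "\<dots> = (\<Sum>b\<in>Basis. \<integral>x. D b \<tau> x * (\<Phi>'' (fb t' x) * D b t' x) \<partial>lborel)"
        proof (rule Bochner_Integration.integral_sum)
          fix b :: 'a assume b: "b \<in> Basis"
          have "Lp \<Omega> 2 (\<lambda>x. wgrad \<Omega> \<psi> x \<bullet> b)" using wg\<psi> b unfolding weak_grad_def by blast
          from rep_Lp_2(1)[OF \<Omega> this r\<psi>D[OF b]]
          show "integrable lborel (\<lambda>x. D b \<tau> x * (\<Phi>'' (fb t' x) * D b t' x))"
            using DL2[OF g \<tau> b] repD(2)[OF r\<psi>D[OF b]] Dtm by (intro integrable_mult_L2) auto
        qed
        finally have "(\<integral>x. wgrad \<Omega> (f \<tau>) x \<bullet> wgrad \<Omega> \<psi> x \<partial>lebesgue_on \<Omega>) = (\<Sum>b\<in>Basis. \<integral>x. D b \<tau> x * (\<Phi>'' (fb t' x) * D b t' x) \<partial>lborel)" .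
        moreover have "(\<integral>x. F \<tau> x * \<psi> x \<partial>lebesgue_on \<Omega>) = (\<integral>x. Fb \<tau> x * \<Phi>' (fb t' x) \<partial>lborel)"
          by (rule rep_integral[OF \<Omega>(1) rep_mult[OF Fb[OF \<tau>] r\<psi>]])
        ultimately show "- \<eta> * (\<integral>x. wgrad \<Omega> (f \<tau>) x \<bullet> wgrad \<Omega> \<psi> x \<partial>lebesgue_on \<Omega>) + (\<integral>x. F \<tau> x * \<psi> x \<partial>lebesgue_on \<Omega>) = R \<tau>"
          by (simp add: R_def)
      qed
      have e1: "(\<integral>x. f u x * \<psi> x \<partial>lebesgue_on \<Omega>) = (\<integral>x. fb u x * \<Phi>' (fb t' x) \<partial>lborel)" if "u \<ge> 0" for u
        by (rule rep_integral[OF \<Omega>(1) rep_mult[OF fb[OF that] r\<psi>]])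
      have i1: "integrable lborel (\<lambda>x. fb u x * \<Phi>' (fb t' x))" if "u \<ge> 0" for u
        using integrable_bounded_mult[OF fbL2(2)[OF that that], of "\<lambda>x. \<Phi>' (fb t' x)" C] \<Phi>(5) repD(2)[OF fb[OF t'0]]
        by (simp add: mult.commute)
      have "(\<integral>x. (fb t' x - fb t x) * \<Phi>' (fb t' x) \<partial>lborel) = (LINT \<tau>:{t..t'}|lborel. R \<tau>)"
        using W e1[OF t'0] e1[OF t0] i1[OF t'0] i1[OF t0] set_integral_cong_AE_Icc(2)[OF _ Rm ae] by (simp add: left_diff_distrib)
      moreover have "set_integrable lborel {t..t'} R" using W by (intro set_integral_cong_AE_Icc(1)[OF _ Rm ae]) simp
      ultimately show "set_integrable lborel {t..t'} (\<lambda>\<tau>. - \<eta> * (\<Sum>b\<in>Basis. \<integral>x. D b \<tau> x * (\<Phi>'' (fb t' x) * D b t' x) \<partial>lborel) + (\<integral>x. Fb \<tau> x * \<Phi>' (fb t' x) \<partial>lborel)) \<and>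
        (\<integral>x. (fb t' x - fb t x) * \<Phi>' (fb t' x) \<partial>lborel) =
          (LINT \<tau>:{t..t'}|lborel. - \<eta> * (\<Sum>b\<in>Basis. \<integral>x. D b \<tau> x * (\<Phi>'' (fb t' x) * D b t' x) \<partial>lborel) + (\<integral>x. Fb \<tau> x * \<Phi>' (fb t' x) \<partial>lborel))"
        by (simp add: R_def[abs_def])
    qed
  qed
qed

text \<open>Here f t' is not assumed to have a gradient, so \<Phi>'(f t') need not lie in
  \<open>test_space\<close>. Testing with C^1 functions instead and applying
  \<open>fundamental_lemma\<close> writes f t' - f t as a time integral of F for almost every x, and
  this identity may be multiplied by any bounded measurable function of x. What remains is the
  instance \<eta> = 0, D = 0 of \<open>energy_inequality\<close>.\<close>

lemma ode_energy:
  fixes f F :: "real \<Rightarrow> 'a::euclidean_space \<Rightarrow> real"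
  assumes \<Omega>: "open \<Omega>" "bounded \<Omega>"
    and f: "\<And>t. t \<ge> 0 \<Longrightarrow> Lp \<Omega> 2 (f t)"
    and fbm: "(\<lambda>(t,x). fb t x) \<in> borel_measurable (lborel \<Otimes>\<^sub>M lborel)"
    and fb: "\<And>t. t \<ge> 0 \<Longrightarrow> rep \<Omega> (f t) (fb t)"
    and fc: "\<And>t0. t0 \<ge> 0 \<Longrightarrow> ((\<lambda>t. \<integral>x. \<bar>fb t x - fb t0 x\<bar> \<partial>lborel) \<longlongrightarrow> 0) (at t0 within {0..})"
    and Fb: "\<And>t. t \<ge> 0 \<Longrightarrow> rep \<Omega> (F t) (Fb t)"
    and Fbi: "\<And>s T. 0 \<le> s \<Longrightarrow> integrable (lborel \<Otimes>\<^sub>M lborel) (\<lambda>(t,x). indicator {s..T} t * Fb t x)"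
    and weak: "\<And>\<psi> s t. test_space \<Omega> \<psi> \<Longrightarrow> 0 \<le> s \<Longrightarrow> s \<le> t \<Longrightarrow> weak_identity \<Omega> f \<psi>
       (\<lambda>\<tau>. \<integral>x. F \<tau> x * \<psi> x \<partial>lebesgue_on \<Omega>) s t"
    and \<Phi>: "\<And>x. (\<Phi> has_real_derivative \<Phi>' x) (at x)" "\<And>x. (\<Phi>' has_real_derivative \<Phi>'' x) (at x)"
      "continuous_on UNIV \<Phi>''" "\<Phi> 0 = 0" "\<And>x. \<bar>\<Phi>' x\<bar> \<le> C" "\<And>x. 0 \<le> \<Phi>'' x" "\<And>x. \<Phi>'' x \<le> C"
    and sT: "0 \<le> s" "s \<le> T"
  shows "(\<integral>x. \<Phi> (fb T x) \<partial>lborel) - (\<integral>x. \<Phi> (fb s x) \<partial>lborel) \<le> (LINT t:{s..T}|lborel. \<integral>x. Fb t x * \<Phi>' (fb t x) \<partial>lborel)"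
proof -
  have c\<Phi>': "continuous_on UNIV \<Phi>'" using \<Phi>(2) by (intro continuous_at_imp_continuous_on ballI DERIV_isCont)
  have [measurable]: "\<Phi>' \<in> borel_measurable borel"
    using c\<Phi>' by (auto intro: borel_measurable_continuous_onI)
  note fbL2 = rep_Lp_2[OF \<Omega> f fb]
  \<comment> \<open>Fubini with a bounded weight in x: integrating the tested F over time is the
    same as testing the time integral of F.\<close>
  have swap: "set_integrable lborel {t..t'} (\<lambda>\<tau>. \<integral>x. Fb \<tau> x * \<psi> x \<partial>lborel)"
    "(LINT \<tau>:{t..t'}|lborel. \<integral>x. Fb \<tau> x * \<psi> x \<partial>lborel) = (\<integral>x. (\<integral>\<tau>. indicator {t..t'} \<tau> * Fb \<tau> x \<partial>lborel) * \<psi> x \<partial>lborel)"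
    "integrable lborel (\<lambda>x. (\<integral>\<tau>. indicator {t..t'} \<tau> * Fb \<tau> x \<partial>lborel) * \<psi> x)"
    if t: "0 \<le> t" and \<psi>m[measurable]: "\<psi> \<in> borel_measurable borel" and \<psi>: "\<And>x. \<bar>\<psi> x\<bar> \<le> K" for t t' K and \<psi> :: "'a \<Rightarrow> real"
  proof -
    have "integrable (lborel \<Otimes>\<^sub>M lborel) (\<lambda>p. \<psi> (snd p) * (case p of (t'',x) \<Rightarrow> indicator {t..t'} t'' * Fb t'' x))"
      by (rule integrable_bounded_mult[OF Fbi[OF t], where C=K]) (use \<psi> in auto)
    then have i: "integrable (lborel \<Otimes>\<^sub>M lborel) (\<lambda>(\<tau>,x). indicator {t..t'} \<tau> * (Fb \<tau> x * \<psi> x))"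
      by (simp add: split_beta' ac_simps)
    have "integrable lborel (\<lambda>\<tau>. \<integral>x. indicator {t..t'} \<tau> * (Fb \<tau> x * \<psi> x) \<partial>lborel)"
      using lborel_pair.integrable_fst'[OF i] by simp
    then show "set_integrable lborel {t..t'} (\<lambda>\<tau>. \<integral>x. Fb \<tau> x * \<psi> x \<partial>lborel)" by (simp add: set_integrable_def)
    have i2: "integrable (lborel \<Otimes>\<^sub>M lborel) (\<lambda>(x,\<tau>). indicator {t..t'} \<tau> * (Fb \<tau> x * \<psi> x))"
      using lborel_pair.integrable_product_swap[OF i] by (simp add: split_beta')
    have e: "(\<integral>\<tau>. indicator {t..t'} \<tau> * (Fb \<tau> x * \<psi> x) \<partial>lborel) = (\<integral>\<tau>. indicator {t..t'} \<tau> * Fb \<tau> x \<partial>lborel) * \<psi> x" for x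
      by (subst mult.assoc[symmetric]) simp
    show "integrable lborel (\<lambda>x. (\<integral>\<tau>. indicator {t..t'} \<tau> * Fb \<tau> x \<partial>lborel) * \<psi> x)"
      using lborel_pair.integrable_fst'[OF i2] by (simp add: e)
    show "(LINT \<tau>:{t..t'}|lborel. \<integral>x. Fb \<tau> x * \<psi> x \<partial>lborel) = (\<integral>x. (\<integral>\<tau>. indicator {t..t'} \<tau> * Fb \<tau> x \<partial>lborel) * \<psi> x \<partial>lborel)"
      using lborel_pair.Fubini_integral[OF i] by (simp add: set_lebesgue_integral_def e)
  qed
  \<comment> \<open>The null set of x depends on t and t', which is harmless because both times are
    fixed when the identity is integrated over x.\<close>
  have ode: "AE x in lborel. x \<in> \<Omega> \<longrightarrow> fb t' x - fb t x - (\<integral>\<tau>. indicator {t..t'} \<tau> * Fb \<tau> x \<partial>lborel) = 0"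
    if t: "0 \<le> t" "t \<le> t'" for t t'
  proof (rule fundamental_lemma[OF \<Omega>])
    have t': "0 \<le> t'" using t by simp
    note i = fbL2(2)[OF t' t'] fbL2(2)[OF t(1) t(1)]
    have i3: "integrable lborel (\<lambda>x. \<integral>\<tau>. indicator {t..t'} \<tau> * Fb \<tau> x \<partial>lborel)"
      using swap(3)[OF t(1), of "\<lambda>_. 1" 1 t'] by simp
    show "integrable lborel (\<lambda>x. fb t' x - fb t x - (\<integral>\<tau>. indicator {t..t'} \<tau> * Fb \<tau> x \<partial>lborel))"
      using i i3 by simp
    fix \<phi> assume \<phi>: "test_fun \<Omega> \<phi>"
    obtain K where K: "\<And>x. \<bar>\<phi> x\<bar> \<le> K" and m[measurable]: "\<phi> \<in> borel_measurable borel" using test_funE[OF \<phi>] by metis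
    note W = weak[OF test_space_test_fun[OF \<Omega> \<phi>] t, unfolded weak_identity_def]
    have e1: "(\<integral>x. f u x * \<phi> x \<partial>lebesgue_on \<Omega>) = (\<integral>x. fb u x * \<phi> x \<partial>lborel)" if "u \<ge> 0" for u
      by (rule rep_integral[OF \<Omega>(1) rep_mult_borel[OF fb[OF that] m]])
    have e2: "(\<integral>x. F \<tau> x * \<phi> x \<partial>lebesgue_on \<Omega>) = (\<integral>x. Fb \<tau> x * \<phi> x \<partial>lborel)" if "\<tau> \<ge> 0" for \<tau>
      by (rule rep_integral[OF \<Omega>(1) rep_mult_borel[OF Fb[OF that] m]])
    have "(LINT \<tau>:{t..t'}|lborel. \<integral>x. F \<tau> x * \<phi> x \<partial>lebesgue_on \<Omega>) = (LINT \<tau>:{t..t'}|lborel. \<integral>x. Fb \<tau> x * \<phi> x \<partial>lborel)"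
      unfolding set_lebesgue_integral_def using t e2 by (intro Bochner_Integration.integral_cong) (auto simp: indicator_def)
    then have "(\<integral>x. fb t' x * \<phi> x \<partial>lborel) - (\<integral>x. fb t x * \<phi> x \<partial>lborel) = (\<integral>x. (\<integral>\<tau>. indicator {t..t'} \<tau> * Fb \<tau> x \<partial>lborel) * \<phi> x \<partial>lborel)"
      using W e1[OF t'] e1[OF t(1)] swap(2)[OF t(1) m K, of t'] by simp
    moreover have "integrable lborel (\<lambda>x. fb u x * \<phi> x)" if "integrable lborel (fb u)" for u
      using integrable_bounded_mult[OF that, of \<phi> K] K by (simp add: mult.commute)
    ultimately show "(\<integral>x. (fb t' x - fb t x - (\<integral>\<tau>. indicator {t..t'} \<tau> * Fb \<tau> x \<partial>lborel)) * \<phi> x \<partial>lborel) = 0"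
      using i swap(3)[OF t(1) m K, of t'] by (simp add: left_diff_distrib)
  qed
  show ?thesis
  proof (rule energy_inequality[where D="\<lambda>_ _ _. 0" and \<eta>=0, OF sT(2) _ \<Phi> fbm _ _ Fbi[OF sT(1)]])
    show "integrable lborel (fb t)" if "t \<in> {s..T}" for t using that sT by (intro fbL2) auto
    show "((\<lambda>t. \<integral>x. \<bar>fb t x - fb t0 x\<bar> \<partial>lborel) \<longlongrightarrow> 0) (at t0 within {s..T})" if "t0 \<in> {s..T}" for t0
      using that sT by (intro tendsto_within_subset[OF fc]) auto
    have "set_integrable lborel {t..t'} (\<lambda>\<tau>. \<integral>x. Fb \<tau> x * \<Phi>' (fb t' x) \<partial>lborel) \<and>
        (\<integral>x. (fb t' x - fb t x) * \<Phi>' (fb t' x) \<partial>lborel) = (LINT \<tau>:{t..t'}|lborel. \<integral>x. Fb \<tau> x * \<Phi>' (fb t' x) \<partial>lborel)"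
      if t': "t' \<in> {s..T}" and t: "t \<in> {s..t'}" for t' t
    proof
      have t0: "0 \<le> t" "t \<le> t'" "0 \<le> t'" using t t' sT by auto
      have fbt: "fb u \<in> borel_measurable borel" for u using measurable_Pair2[OF fbm, of u] by simp
      note [measurable] = fbt[of t'] fbt[of t]
      have m: "(\<lambda>x. \<Phi>' (fb t' x)) \<in> borel_measurable borel" by measurable
      note sw = swap[OF t0(1) m \<Phi>(5), of t']
      show "set_integrable lborel {t..t'} (\<lambda>\<tau>. \<integral>x. Fb \<tau> x * \<Phi>' (fb t' x) \<partial>lborel)" by (rule sw(1))
      show "(\<integral>x. (fb t' x - fb t x) * \<Phi>' (fb t' x) \<partial>lborel) = (LINT \<tau>:{t..t'}|lborel. \<integral>x. Fb \<tau> x * \<Phi>' (fb t' x) \<partial>lborel)"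
        unfolding sw(2)
      proof (rule integral_cong_AE)
        show "(\<lambda>x. (\<integral>\<tau>. indicator {t..t'} \<tau> * Fb \<tau> x \<partial>lborel) * \<Phi>' (fb t' x)) \<in> borel_measurable lborel"
          using sw(3) by (rule borel_measurable_integrable)
        show "AE x in lborel. (fb t' x - fb t x) * \<Phi>' (fb t' x) = (\<integral>\<tau>. indicator {t..t'} \<tau> * Fb \<tau> x \<partial>lborel) * \<Phi>' (fb t' x)"
          using ode[OF t0(1,2)]
        proof eventually_elim
          case (elim x)
          show ?case
          proof (cases "x \<in> \<Omega>")
            case True then show ?thesis using elim by simp
          next
            case False
            have "(\<lambda>\<tau>. indicator {t..t'} \<tau> * Fb \<tau> x) = (\<lambda>_. 0)"
              using repD(3)[OF Fb False] t0(1) by (auto simp: indicator_def fun_eq_iff)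
            then have "(\<integral>\<tau>. indicator {t..t'} \<tau> * Fb \<tau> x \<partial>lborel) = 0" by simp
            then show ?thesis using repD(3)[OF fb[OF t0(1)] False] repD(3)[OF fb[OF t0(3)] False] by simp
          qed
        qed
      qed simp
    qed
    then show "AE t' in lborel. t' \<in> {s..T} \<longrightarrow> (\<forall>t\<in>{s..t'}.
        set_integrable lborel {t..t'} (\<lambda>\<tau>. - 0 * (\<Sum>b\<in>Basis. \<integral>x. 0 * (\<Phi>'' (fb t' x) * 0) \<partial>lborel) + (\<integral>x. Fb \<tau> x * \<Phi>' (fb t' x) \<partial>lborel)) \<and>
        (\<integral>x. (fb t' x - fb t x) * \<Phi>' (fb t' x) \<partial>lborel) =
          (LINT \<tau>:{t..t'}|lborel. - 0 * (\<Sum>b\<in>Basis. \<integral>x. 0 * (\<Phi>'' (fb t' x) * 0) \<partial>lborel) + (\<integral>x. Fb \<tau> x * \<Phi>' (fb t' x) \<partial>lborel)))"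
      by simp
  qed (simp_all add: split_beta')
qed

section \<open>Removing the truncation\<close>

definition loc_integrable :: "(real \<Rightarrow> 'a::euclidean_space \<Rightarrow> real) \<Rightarrow> bool" where
  "loc_integrable g \<longleftrightarrow> (\<forall>T. integrable (lborel \<Otimes>\<^sub>M lborel) (\<lambda>(t,x). indicator {0..T} t * g t x))"

definition joint_measurable :: "(real \<Rightarrow> 'a::euclidean_space \<Rightarrow> real) \<Rightarrow> bool" where
  "joint_measurable g \<longleftrightarrow> (\<lambda>(t,x). g t x) \<in> borel_measurable (lborel \<Otimes>\<^sub>M lborel)"

lemma joint_measurableD[measurable_dest]:
  "joint_measurable g \<Longrightarrow> (\<lambda>p. g (fst p) (snd p)) \<in> borel_measurable (lborel \<Otimes>\<^sub>M lborel)"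
  by (simp add: joint_measurable_def split_beta')

lemma joint_measurable_section:
  "joint_measurable g \<Longrightarrow> g t \<in> borel_measurable borel"
  unfolding joint_measurable_def using measurable_Pair2[of "\<lambda>(t,x). g t x" lborel lborel borel t] by simp

lemma loc_integrable_strip:
  assumes "loc_integrable g" "0 \<le> s"
  shows "integrable (lborel \<Otimes>\<^sub>M lborel) (\<lambda>(t,x). indicator {s..T} t * g t x)"
proof -
  have "integrable (lborel \<Otimes>\<^sub>M lborel) (\<lambda>p. indicator {s..T} (fst p) * (case p of (t,x) \<Rightarrow> indicator {0..T} t * g t x))"
    using assms(1) unfolding loc_integrable_def
    by (intro integrable_bounded_mult[of _ _ _ 1]) (auto simp: indicator_def)
  moreover have "(\<lambda>p. indicator {s..T} (fst p) * (case p of (t,x) \<Rightarrow> indicator {0..T} t * g t x)) = (\<lambda>(t,x). indicator {s..T} t * g t x)"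
    using assms(2) by (auto simp: indicator_def fun_eq_iff)
  ultimately show ?thesis by simp
qed

lemma loc_integrable_bound:
  assumes h: "loc_integrable h" and g: "joint_measurable g" and le: "\<And>t x. t \<ge> 0 \<Longrightarrow> \<bar>g t x\<bar> \<le> h t x"
  shows "loc_integrable g"
  unfolding loc_integrable_def
proof
  fix T
  show "integrable (lborel \<Otimes>\<^sub>M lborel) (\<lambda>(t,x). indicator {0..T} t * g t x)"
  proof (rule Bochner_Integration.integrable_bound[OF h[unfolded loc_integrable_def, rule_format, of T]])
    note [measurable] = joint_measurableD[OF g]
    show "(\<lambda>(t,x). indicator {0..T} t * g t x) \<in> borel_measurable (lborel \<Otimes>\<^sub>M lborel)"
      unfolding split_beta' by measurable
    have "\<bar>g t x\<bar> \<le> \<bar>h t x\<bar>" if "t \<ge> 0" for t x using le[OF that, of x] by linarith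
    then show "AE p in lborel \<Otimes>\<^sub>M lborel. norm (case p of (t,x) \<Rightarrow> indicator {0..T} t * g t x) \<le> norm (case p of (t,x) \<Rightarrow> indicator {0..T} t * h t x)"
      by (intro AE_I2) (auto simp: indicator_def)
  qed
qed

lemma loc_integrable_add: "loc_integrable g \<Longrightarrow> loc_integrable h \<Longrightarrow> loc_integrable (\<lambda>t x. g t x + h t x)"
  unfolding loc_integrable_def split_beta' by (auto simp: distrib_left)
lemma loc_integrable_cmult: "loc_integrable g \<Longrightarrow> loc_integrable (\<lambda>t x. c * g t x)"
  unfolding loc_integrable_def split_beta' by (auto simp: mult.left_commute)
lemma loc_integrable_diff: "loc_integrable g \<Longrightarrow> loc_integrable h \<Longrightarrow> loc_integrable (\<lambda>t x. g t x - h t x)"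
  unfolding loc_integrable_def split_beta' by (auto simp: right_diff_distrib)
lemma loc_integrable_sum: "(\<And>i. i \<in> I \<Longrightarrow> loc_integrable (g i)) \<Longrightarrow> loc_integrable (\<lambda>t x. \<Sum>i\<in>I. g i t x)"
  unfolding loc_integrable_def split_beta' by (auto simp: sum_distrib_left)

lemma loc_integrable_indicator:
  assumes \<Omega>: "open \<Omega>" "bounded \<Omega>"
  shows "loc_integrable (\<lambda>t x. indicator \<Omega> x :: real)"
  unfolding loc_integrable_def
proof
  fix T :: real
  have [measurable]: "\<Omega> \<in> sets borel" using \<Omega> by auto
  have "emeasure (lborel \<Otimes>\<^sub>M lborel) ({0..T} \<times> \<Omega>) = emeasure lborel {0..T} * emeasure lborel \<Omega>"
    by (rule lborel.emeasure_pair_measure_Times) auto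
  also have "\<dots> < \<infinity>" using emeasure_bounded_finite[OF \<Omega>(2)] by (auto simp: ennreal_mult_less_top emeasure_lborel_Icc_eq)
  finally have "integrable (lborel \<Otimes>\<^sub>M lborel) (indicator ({0..T} \<times> \<Omega>) :: _ \<Rightarrow> real)"
    by (intro integrable_real_indicator) auto
  moreover have "indicator ({0..T} \<times> \<Omega>) = (\<lambda>(t,x). indicator {0..T} t * indicator \<Omega> x :: real)"
    by (auto simp: indicator_def fun_eq_iff)
  ultimately show "integrable (lborel \<Otimes>\<^sub>M lborel) (\<lambda>(t,x). indicator {0..T} t * indicator \<Omega> x :: real)" by simp
qed

text \<open>The L^1 norm of f t is continuous in t, hence integrable over bounded time intervals,
  and Fubini's criterion gives integrability in space-time.\<close>

lemma loc_integrable_L1_continuous: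
  assumes m: "joint_measurable f" and i: "\<And>t. t \<ge> 0 \<Longrightarrow> integrable lborel (f t)"
    and c: "\<And>t0. t0 \<ge> 0 \<Longrightarrow> ((\<lambda>t. \<integral>x. \<bar>f t x - f t0 x\<bar> \<partial>lborel) \<longlongrightarrow> 0) (at t0 within {0..})"
  shows "loc_integrable f"
  unfolding loc_integrable_def
proof
  fix T
  note [measurable] = joint_measurableD[OF m]
  define H where "H t = (\<integral>x. \<bar>f t x\<bar> \<partial>lborel)" for t
  have "continuous_on {0..T} H"
    unfolding continuous_on_def
  proof
    fix t0 assume t0: "t0 \<in> {0..T}"
    have "((\<lambda>t. H t - H t0) \<longlongrightarrow> 0) (at t0 within {0..T})"
    proof (rule Lim_null_comparison)
      show "((\<lambda>t. \<integral>x. \<bar>f t x - f t0 x\<bar> \<partial>lborel) \<longlongrightarrow> 0) (at t0 within {0..T})"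
        using t0 by (intro tendsto_within_subset[OF c]) auto
      show "\<forall>\<^sub>F t in at t0 within {0..T}. norm (H t - H t0) \<le> (\<integral>x. \<bar>f t x - f t0 x\<bar> \<partial>lborel)"
      proof (unfold eventually_at_filter, intro always_eventually allI impI)
        fix t assume t: "t \<in> {0..T}"
        have ii: "integrable lborel (f t)" "integrable lborel (f t0)" using t t0 i by auto
        have "norm (H t - H t0) = norm (\<integral>x. \<bar>f t x\<bar> - \<bar>f t0 x\<bar> \<partial>lborel)"
          using ii by (simp add: H_def)
        also have "\<dots> \<le> (\<integral>x. norm (\<bar>f t x\<bar> - \<bar>f t0 x\<bar>) \<partial>lborel)" by (rule integral_norm_bound)
        also have "\<dots> \<le> (\<integral>x. \<bar>f t x - f t0 x\<bar> \<partial>lborel)"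
          using ii by (intro integral_mono) auto
        finally show "norm (H t - H t0) \<le> (\<integral>x. \<bar>f t x - f t0 x\<bar> \<partial>lborel)" .
      qed
    qed
    then show "(H \<longlongrightarrow> H t0) (at t0 within {0..T})" by (simp add: LIM_zero_iff)
  qed
  from borel_integrable_atLeastAtMost'[OF this] have Hi: "integrable lborel (\<lambda>t. indicator {0..T} t * H t)"
    by (simp add: set_integrable_def)
  show "integrable (lborel \<Otimes>\<^sub>M lborel) (\<lambda>(t,x). indicator {0..T} t * f t x)"
  proof (rule lborel_pair.Fubini_integrable)
    show "(\<lambda>(t,x). indicator {0..T} t * f t x) \<in> borel_measurable (lborel \<Otimes>\<^sub>M lborel)" unfolding split_beta' by measurable
    show "AE t in lborel. integrable lborel (\<lambda>x. case (t, x) of (t,x) \<Rightarrow> indicator {0..T} t * f t x)"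
      using i by (intro AE_I2) (auto simp: indicator_def)
    have "(\<integral>x. norm (indicator {0..T} t * f t x) \<partial>lborel) = indicator {0..T} t * H t" for t
      by (simp add: H_def abs_mult)
    then show "integrable lborel (\<lambda>t. \<integral>x. norm (case (t, x) of (t,x) \<Rightarrow> indicator {0..T} t * f t x) \<partial>lborel)"
      using Hi by simp
  qed
qed

section \<open>Integrals over space-time strips\<close>

text \<open>A double integral rather than an iterated one, so that linearity and monotonicity follow
  from \<open>loc_integrable\<close> without going through the slices.\<close>

definition strip_integral :: "real \<Rightarrow> real \<Rightarrow> (real \<Rightarrow> 'a::euclidean_space \<Rightarrow> real) \<Rightarrow> real" where
  "strip_integral s T g = (\<integral>p. (case p of (t,x) \<Rightarrow> indicator {s..T} t * g t x) \<partial>(lborel \<Otimes>\<^sub>M lborel))"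

lemma strip_integral_Fubini:
  assumes "loc_integrable g" "0 \<le> s"
  shows "strip_integral s T g = (LINT t:{s..T}|lborel. \<integral>x. g t x \<partial>lborel)"
  using lborel_pair.integral_fst'[OF loc_integrable_strip[OF assms, of T]]
  by (simp add: strip_integral_def set_lebesgue_integral_def)

lemma strip_integral_mono:
  assumes "loc_integrable g" "loc_integrable h" "0 \<le> s" and le: "\<And>t x. t \<ge> 0 \<Longrightarrow> g t x \<le> h t x"
  shows "strip_integral s T g \<le> strip_integral s T h"
  unfolding strip_integral_def
  by (rule integral_mono[OF loc_integrable_strip[OF assms(1,3)] loc_integrable_strip[OF assms(2,3)]])
    (use assms(3) le in \<open>auto simp: indicator_def\<close>)

lemma strip_integral_add:
  "loc_integrable g \<Longrightarrow> loc_integrable h \<Longrightarrow> 0 \<le> s \<Longrightarrow>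
    strip_integral s T (\<lambda>t x. g t x + h t x) = strip_integral s T g + strip_integral s T h"
  using loc_integrable_strip[of g s T] loc_integrable_strip[of h s T]
  unfolding strip_integral_def split_beta' by (simp add: distrib_left)

lemma strip_integral_cmult: "strip_integral s T (\<lambda>t x. c * g t x) = c * strip_integral s T g"
  unfolding strip_integral_def split_beta' by (simp add: mult.left_commute[of _ c])

lemma strip_integral_sum:
  assumes g: "\<And>i. i \<in> I \<Longrightarrow> loc_integrable (g i)" and s: "0 \<le> s"
  shows "strip_integral s T (\<lambda>t x. \<Sum>i\<in>I. g i t x) = (\<Sum>i\<in>I. strip_integral s T (g i))"
proof -
  have "strip_integral s T (\<lambda>t x. \<Sum>i\<in>I. g i t x) =
    (\<integral>p. (\<Sum>i\<in>I. indicator {s..T} (fst p) * g i (fst p) (snd p)) \<partial>(lborel \<Otimes>\<^sub>M lborel))"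
    unfolding strip_integral_def split_beta' by (simp add: sum_distrib_left)
  also have "\<dots> = (\<Sum>i\<in>I. \<integral>p. indicator {s..T} (fst p) * g i (fst p) (snd p) \<partial>(lborel \<Otimes>\<^sub>M lborel))"
    by (rule Bochner_Integration.integral_sum) (use loc_integrable_strip[OF g s, of _ T] in \<open>simp add: split_beta'\<close>)
  finally show ?thesis unfolding strip_integral_def split_beta' .
qed

section \<open>Admissible convex functions and the passage to the limit\<close>

text \<open>The bound on \<Phi>' makes \<Phi>'(f) a bounded test function, the bound on \<Phi>''
  keeps its gradient in L^2, and the normalisation at 0 makes both \<Phi>(f) and \<Phi>'(f) vanish
  outside \<Omega>.\<close>

definition convex_data :: "(real \<Rightarrow> real) \<Rightarrow> (real \<Rightarrow> real) \<Rightarrow> (real \<Rightarrow> real) \<Rightarrow> real \<Rightarrow> bool" where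
  "convex_data \<Phi> \<Phi>' \<Phi>'' C \<longleftrightarrow> (\<forall>x. (\<Phi> has_real_derivative \<Phi>' x) (at x)) \<and>
     (\<forall>x. (\<Phi>' has_real_derivative \<Phi>'' x) (at x)) \<and> continuous_on UNIV \<Phi>'' \<and> \<Phi> 0 = 0 \<and> \<Phi>' 0 = 0 \<and>
     (\<forall>x. \<bar>\<Phi>' x\<bar> \<le> C \<and> 0 \<le> \<Phi>'' x \<and> \<Phi>'' x \<le> C)"

definition smooth_convex :: "(real \<Rightarrow> real) \<Rightarrow> (real \<Rightarrow> real) \<Rightarrow> bool" where
  "smooth_convex \<Phi> \<Phi>' \<longleftrightarrow> (\<exists>\<Phi>'' C. convex_data \<Phi> \<Phi>' \<Phi>'' C)"

lemma convex_dataD: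
  assumes "convex_data \<Phi> \<Phi>' \<Phi>'' C"
  shows "\<And>x. (\<Phi> has_real_derivative \<Phi>' x) (at x)" "\<And>x. (\<Phi>' has_real_derivative \<Phi>'' x) (at x)"
    "continuous_on UNIV \<Phi>''" "\<Phi> 0 = 0" "\<And>x. \<bar>\<Phi>' x\<bar> \<le> C" "\<And>x. 0 \<le> \<Phi>'' x" "\<And>x. \<Phi>'' x \<le> C" "\<Phi>' 0 = 0"
  using assms by (simp_all add: convex_data_def)

lemma smooth_convexE:
  assumes "smooth_convex \<Phi> \<Phi>'"
  obtains \<Phi>'' C where "convex_data \<Phi> \<Phi>' \<Phi>'' C"
  using assms unfolding smooth_convex_def by blast

text \<open>The interface between the weak formulation and the estimates: gradients have disappeared
  and only the reaction term is left.\<close>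

definition energy :: "(real \<Rightarrow> 'a::euclidean_space \<Rightarrow> real) \<Rightarrow> (real \<Rightarrow> 'a \<Rightarrow> real) \<Rightarrow> bool" where
  "energy f F \<longleftrightarrow> (\<forall>\<Phi> \<Phi>' s T. smooth_convex \<Phi> \<Phi>' \<longrightarrow> 0 \<le> s \<longrightarrow> s \<le> T \<longrightarrow>
     (\<integral>x. \<Phi> (f T x) \<partial>lborel) - (\<integral>x. \<Phi> (f s x) \<partial>lborel) \<le> strip_integral s T (\<lambda>t x. F t x * \<Phi>' (f t x)))"

lemma smooth_convex_measurable:
  assumes "smooth_convex \<Phi> \<Phi>'"
  shows "\<Phi> \<in> borel_measurable borel" "\<Phi>' \<in> borel_measurable borel"
proof -
  obtain \<Phi>'' C where d: "convex_data \<Phi> \<Phi>' \<Phi>'' C" by (rule smooth_convexE[OF assms])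
  have "continuous_on UNIV \<Phi>" by (intro continuous_at_imp_continuous_on ballI DERIV_isCont[OF convex_dataD(1)[OF d]])
  moreover have "continuous_on UNIV \<Phi>'" by (intro continuous_at_imp_continuous_on ballI DERIV_isCont[OF convex_dataD(2)[OF d]])
  ultimately show "\<Phi> \<in> borel_measurable borel" "\<Phi>' \<in> borel_measurable borel"
    by (auto intro: borel_measurable_continuous_onI)
qed

lemma joint_measurable_compose:
  assumes "joint_measurable f" "h \<in> borel_measurable borel"
  shows "joint_measurable (\<lambda>t x. h (f t x))"
  using measurable_compose[OF joint_measurableD[OF assms(1)] assms(2)] by (simp add: joint_measurable_def split_beta')

lemma joint_measurable_mult: "joint_measurable f \<Longrightarrow> joint_measurable g \<Longrightarrow> joint_measurable (\<lambda>t x. f t x * g t x)"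
  unfolding joint_measurable_def split_beta' by (rule borel_measurable_times)
lemma joint_measurable_add: "joint_measurable f \<Longrightarrow> joint_measurable g \<Longrightarrow> joint_measurable (\<lambda>t x. f t x + g t x)"
  unfolding joint_measurable_def split_beta' by (rule borel_measurable_add)
lemma joint_measurable_diff: "joint_measurable f \<Longrightarrow> joint_measurable g \<Longrightarrow> joint_measurable (\<lambda>t x. f t x - g t x)"
  unfolding joint_measurable_def split_beta' by (rule borel_measurable_diff)
lemma joint_measurable_const: "joint_measurable (\<lambda>t x. c)"
  unfolding joint_measurable_def by simp
lemma joint_measurable_power: "joint_measurable f \<Longrightarrow> joint_measurable (\<lambda>t x. f t x ^ n)"
  unfolding joint_measurable_def split_beta' by (rule borel_measurable_power)
lemma joint_measurable_indicator: "open \<Omega> \<Longrightarrow> joint_measurable (\<lambda>t x. indicator \<Omega> x)"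
proof -
  assume "open \<Omega>"
  then have [measurable]: "\<Omega> \<in> sets borel" by auto
  show ?thesis unfolding joint_measurable_def split_beta' by measurable
qed
lemma joint_measurable_sum: "(\<And>i. i \<in> I \<Longrightarrow> joint_measurable (f i)) \<Longrightarrow> joint_measurable (\<lambda>t x. \<Sum>i\<in>I. f i t x)"
  by (induction I rule: infinite_finite_induct) (auto intro: joint_measurable_add joint_measurable_const)

lemma loc_integrable_bounded_mult:
  assumes F: "loc_integrable F" and P: "joint_measurable P" and C: "\<And>t x. \<bar>P t x\<bar> \<le> C"
  shows "loc_integrable (\<lambda>t x. F t x * P t x)"
  unfolding loc_integrable_def
proof
  fix T
  have "integrable (lborel \<Otimes>\<^sub>M lborel) (\<lambda>p. P (fst p) (snd p) * (case p of (t,x) \<Rightarrow> indicator {0..T} t * F t x))"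
    using F C joint_measurableD[OF P] unfolding loc_integrable_def
    by (intro integrable_bounded_mult[where C=C]) auto
  then show "integrable (lborel \<Otimes>\<^sub>M lborel) (\<lambda>(t,x). indicator {0..T} t * (F t x * P t x))"
    by (simp add: split_beta' ac_simps)
qed

lemma energyI:
  assumes F: "loc_integrable F" and f: "joint_measurable f"
    and en: "\<And>\<Phi> \<Phi>' s T. smooth_convex \<Phi> \<Phi>' \<Longrightarrow> 0 \<le> s \<Longrightarrow> s \<le> T \<Longrightarrow>
     (\<integral>x. \<Phi> (f T x) \<partial>lborel) - (\<integral>x. \<Phi> (f s x) \<partial>lborel) \<le> (LINT t:{s..T}|lborel. \<integral>x. F t x * \<Phi>' (f t x) \<partial>lborel)"
  shows "energy f F"
  unfolding energy_def
proof (intro allI impI)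
  fix \<Phi> \<Phi>' and s T :: real assume sc: "smooth_convex \<Phi> \<Phi>'" and sT: "0 \<le> s" "s \<le> T"
  obtain \<Phi>'' C where "convex_data \<Phi> \<Phi>' \<Phi>'' C" by (rule smooth_convexE[OF sc])
  note C = convex_dataD(5)[OF this]
  have "loc_integrable (\<lambda>t x. F t x * \<Phi>' (f t x))"
    by (rule loc_integrable_bounded_mult[OF F joint_measurable_compose[OF f smooth_convex_measurable(2)[OF sc]] C])
  from strip_integral_Fubini[OF this sT(1), of T] en[OF sc sT]
  show "(\<integral>x. \<Phi> (f T x) \<partial>lborel) - (\<integral>x. \<Phi> (f s x) \<partial>lborel) \<le> strip_integral s T (\<lambda>t x. F t x * \<Phi>' (f t x))" by simp
qed

text \<open>N is the degree of homogeneity of \<Psi>, for which x \<Psi>'(x) = N \<Psi>(x). The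
  bounds by the limit functions are the majorants for dominated convergence.\<close>

definition truncation :: "(real \<Rightarrow> real) \<Rightarrow> real \<Rightarrow> (nat \<Rightarrow> real \<Rightarrow> real) \<Rightarrow> (nat \<Rightarrow> real \<Rightarrow> real) \<Rightarrow> bool" where
  "truncation \<Psi> N \<Phi> \<Phi>' \<longleftrightarrow> (\<forall>n. smooth_convex (\<Phi> n) (\<Phi>' n)) \<and>
     (\<forall>n x. 0 \<le> \<Phi> n x \<and> \<Phi> n x \<le> \<Psi> x \<and> 0 \<le> x * \<Phi>' n x \<and> x * \<Phi>' n x \<le> N * \<Psi> x) \<and>
     (\<forall>x. (\<lambda>n. \<Phi> n x) \<longlonglongrightarrow> \<Psi> x \<and> (\<lambda>n. x * \<Phi>' n x) \<longlonglongrightarrow> N * \<Psi> x)"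

text \<open>From \<Phi> 0 = 0 and the bound on \<Phi>' one gets |\<Phi> a| <= C |a|.\<close>

lemma smooth_convex_integrable:
  assumes sc: "smooth_convex \<Phi> \<Phi>'" and f: "integrable lborel f"
  shows "integrable lborel (\<lambda>x. \<Phi> (f x))"
proof -
  obtain \<Phi>'' C where cd: "convex_data \<Phi> \<Phi>' \<Phi>'' C" by (rule smooth_convexE[OF sc])
  note d = convex_dataD(1)[OF cd] and C = convex_dataD(5)[OF cd] and 0 = convex_dataD(4)[OF cd]
  have "\<bar>\<Phi> a\<bar> \<le> C * \<bar>a\<bar>" for a
    using field_differentiable_bound[of UNIV \<Phi> \<Phi>' C a 0] d C 0 by simp
  note le = this
  have C0: "0 \<le> C" using C[of 0] by linarith
  show ?thesis
  proof (rule Bochner_Integration.integrable_bound)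
    show "integrable lborel (\<lambda>x. C * f x)" using f by simp
    show "(\<lambda>x. \<Phi> (f x)) \<in> borel_measurable lborel"
      by (rule measurable_compose[OF borel_measurable_integrable[OF f] smooth_convex_measurable(1)[OF sc]])
    show "AE x in lborel. norm (\<Phi> (f x)) \<le> norm (C * f x)"
    proof (rule AE_I2)
      fix x show "norm (\<Phi> (f x)) \<le> norm (C * f x)" using le[of "f x"] C0 by (simp add: abs_mult)
    qed
  qed
qed

text \<open>Fatou's lemma: a bound on the integrals that is uniform in n survives the pointwise
  limit.\<close>

lemma integrable_of_bounded_integrals:
  fixes h :: "'x \<Rightarrow> real"
  assumes hn: "\<And>n. integrable M (h' n)" "\<And>n x. 0 \<le> h' n x" and lim: "\<And>x. (\<lambda>n. h' n x) \<longlonglongrightarrow> h x"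
    and hm: "h \<in> borel_measurable M" and B: "\<And>n. (\<integral>x. h' n x \<partial>M) \<le> B"
  shows "integrable M h"
proof (rule integrableI_bounded)
  have h0: "0 \<le> h x" for x using lim hn(2) by (intro LIMSEQ_le_const[OF lim]) auto
  have "(\<integral>\<^sup>+x. ennreal (norm (h x)) \<partial>M) = (\<integral>\<^sup>+x. liminf (\<lambda>n. ennreal (h' n x)) \<partial>M)"
  proof (rule nn_integral_cong)
    fix x
    have "(\<lambda>n. ennreal (h' n x)) \<longlonglongrightarrow> ennreal (h x)" by (intro tendsto_ennrealI lim)
    then show "ennreal (norm (h x)) = liminf (\<lambda>n. ennreal (h' n x))" using h0[of x] by (simp add: lim_imp_Liminf)
  qed
  also have "\<dots> \<le> liminf (\<lambda>n. \<integral>\<^sup>+x. ennreal (h' n x) \<partial>M)"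
    using hn(1) by (intro nn_integral_liminf) auto
  also have "\<dots> \<le> ennreal B"
  proof (rule Liminf_le)
    have "(\<integral>\<^sup>+x. ennreal (h' n x) \<partial>M) \<le> ennreal B" for n
      using hn B[of n] by (subst nn_integral_eq_integral) (auto intro: ennreal_leI)
    then show "\<forall>\<^sub>F n in sequentially. (\<integral>\<^sup>+x. ennreal (h' n x) \<partial>M) \<le> ennreal B" by simp
  qed simp
  finally show "(\<integral>\<^sup>+x. ennreal (norm (h x)) \<partial>M) < \<infinity>" by (simp add: le_less_trans)
qed (rule hm)

text \<open>From time 0, where \<open>init\<close> is available, the truncated inequalities bound
  both the integral of \<Phi> n (f) at time T and the damping over the strip, uniformly in n. Fatou
  turns this into integrability of \<Psi>(f) at every time and in space-time, and that is the
  majorant with which n tends to infinity for arbitrary s. The sum over i is kept throughout because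
  the coupling has a sign only after summation.\<close>

lemma truncation_stage:
  fixes f F :: "'i \<Rightarrow> real \<Rightarrow> 'a::euclidean_space \<Rightarrow> real"
  assumes tr: "truncation \<Psi> N \<Phi> \<Phi>'" and N: "N > 0" and c: "c > 0" and I: "finite I"
    and en: "\<And>i. i \<in> I \<Longrightarrow> energy (f i) (F i)"
    and fm: "\<And>i. i \<in> I \<Longrightarrow> joint_measurable (f i)"
    and fi: "\<And>i t. i \<in> I \<Longrightarrow> t \<ge> 0 \<Longrightarrow> integrable lborel (f i t)"
    and fl: "\<And>i. i \<in> I \<Longrightarrow> loc_integrable (f i)"
    and Fl: "\<And>i. i \<in> I \<Longrightarrow> loc_integrable (F i)" and Gl: "loc_integrable G"
    and pw: "\<And>n t x. t \<ge> 0 \<Longrightarrow> (\<Sum>i\<in>I. F i t x * \<Phi>' n (f i t x)) \<le> G t x - c * (\<Sum>i\<in>I. f i t x * \<Phi>' n (f i t x))"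
    and init: "\<And>i. i \<in> I \<Longrightarrow> integrable lborel (\<lambda>x. \<Psi> (f i 0 x))"
    and \<Psi>m: "\<Psi> \<in> borel_measurable borel"
  shows "\<And>i t. i \<in> I \<Longrightarrow> t \<ge> 0 \<Longrightarrow> integrable lborel (\<lambda>x. \<Psi> (f i t x))"
    and "\<And>i. i \<in> I \<Longrightarrow> loc_integrable (\<lambda>t x. \<Psi> (f i t x))"
    and "\<And>s T. 0 \<le> s \<Longrightarrow> s \<le> T \<Longrightarrow> (\<Sum>i\<in>I. \<integral>x. \<Psi> (f i T x) \<partial>lborel) - (\<Sum>i\<in>I. \<integral>x. \<Psi> (f i s x) \<partial>lborel)
        \<le> strip_integral s T G - c * N * (\<Sum>i\<in>I. strip_integral s T (\<lambda>t x. \<Psi> (f i t x)))"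
proof -
  have sc: "smooth_convex (\<Phi> n) (\<Phi>' n)" for n using tr by (simp add: truncation_def)
  have b: "0 \<le> \<Phi> n x" "\<Phi> n x \<le> \<Psi> x" "0 \<le> x * \<Phi>' n x" "x * \<Phi>' n x \<le> N * \<Psi> x" for n x
    using tr by (simp_all add: truncation_def)
  have lim: "(\<lambda>n. \<Phi> n x) \<longlonglongrightarrow> \<Psi> x" "(\<lambda>n. x * \<Phi>' n x) \<longlonglongrightarrow> N * \<Psi> x" for x
    using tr by (simp_all add: truncation_def)
  have \<Psi>0: "0 \<le> \<Psi> x" for x using b(1,2)[of 0 x] by linarith
  have pl: "loc_integrable (\<lambda>t x. g t x * \<Phi>' n (f i t x))" if "i \<in> I" "loc_integrable g" for g i n
  proof -
    obtain \<Phi>'' C where "convex_data (\<Phi> n) (\<Phi>' n) \<Phi>'' C" by (rule smooth_convexE[OF sc[of n]])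
    note C = convex_dataD(5)[OF this]
    show ?thesis by (rule loc_integrable_bounded_mult[OF that(2) joint_measurable_compose[OF fm[OF that(1)] smooth_convex_measurable(2)[OF sc]] C])
  qed
  define H where "H n t = (\<Sum>i\<in>I. \<integral>x. \<Phi> n (f i t x) \<partial>lborel)" for n t
  define q where "q n i t x = f i t x * \<Phi>' n (f i t x)" for n i t x
  have ql: "loc_integrable (q n i)" if "i \<in> I" for n i unfolding q_def[abs_def] by (rule pl[OF that fl[OF that]])
  have step: "H n T - H n s \<le> strip_integral s T G - c * (\<Sum>i\<in>I. strip_integral s T (q n i))" if sT: "0 \<le> s" "s \<le> T" for n s T
  proof -
    have "H n T - H n s = (\<Sum>i\<in>I. (\<integral>x. \<Phi> n (f i T x) \<partial>lborel) - (\<integral>x. \<Phi> n (f i s x) \<partial>lborel))"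
      by (simp add: H_def sum_subtractf)
    also have "\<dots> \<le> (\<Sum>i\<in>I. strip_integral s T (\<lambda>t x. F i t x * \<Phi>' n (f i t x)))"
      using en sc sT unfolding energy_def by (intro sum_mono) blast
    also have "\<dots> = strip_integral s T (\<lambda>t x. \<Sum>i\<in>I. F i t x * \<Phi>' n (f i t x))"
      using pl Fl sT by (intro strip_integral_sum[symmetric]) auto
    also have "\<dots> \<le> strip_integral s T (\<lambda>t x. G t x + (- c) * (\<Sum>i\<in>I. q n i t x))"
    proof (rule strip_integral_mono)
      show "loc_integrable (\<lambda>t x. \<Sum>i\<in>I. F i t x * \<Phi>' n (f i t x))" using pl Fl by (intro loc_integrable_sum) auto
      show "loc_integrable (\<lambda>t x. G t x + (- c) * (\<Sum>i\<in>I. q n i t x))"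
        by (intro loc_integrable_add Gl loc_integrable_cmult loc_integrable_sum ql)
    qed (use sT pw in \<open>auto simp: q_def\<close>)
    also have "\<dots> = strip_integral s T G + (- c) * (\<Sum>i\<in>I. strip_integral s T (q n i))"
      using sT by (subst strip_integral_add[OF Gl])
        (simp_all only: strip_integral_cmult strip_integral_sum[OF ql] loc_integrable_cmult loc_integrable_sum[OF ql])
    finally show ?thesis by simp
  qed
  have q0: "0 \<le> strip_integral s T (q n i)" for n i s T
    unfolding strip_integral_def by (intro integral_nonneg_AE AE_I2) (auto simp: q_def b)
  have H0: "0 \<le> (\<integral>x. \<Phi> n (f i t x) \<partial>lborel)" for n i t by (simp add: b)
  \<comment> \<open>Initial energy plus total input up to time T: the bound that does not depend on
    n.\<close>
  define B where "B T = (\<Sum>i\<in>I. \<integral>x. \<Psi> (f i 0 x) \<partial>lborel) + strip_integral 0 T G" for T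
  have Hinit: "H n 0 \<le> (\<Sum>i\<in>I. \<integral>x. \<Psi> (f i 0 x) \<partial>lborel)" for n
    unfolding H_def using smooth_convex_integrable[OF sc fi] init b by (intro sum_mono integral_mono) auto
  have b1: "(\<integral>x. \<Phi> n (f i T x) \<partial>lborel) \<le> B T" if "i \<in> I" "T \<ge> 0" for n i T
  proof -
    have "(\<integral>x. \<Phi> n (f i T x) \<partial>lborel) \<le> H n T" unfolding H_def by (rule member_le_sum[OF that(1) H0 I])
    moreover have "0 \<le> c * (\<Sum>i\<in>I. strip_integral 0 T (q n i))" using c q0 by (simp add: sum_nonneg)
    ultimately show ?thesis using step[of 0 T n] Hinit[of n] that(2) unfolding B_def by linarith
  qed
  have b2: "strip_integral 0 T (q n i) \<le> B T / c" if "i \<in> I" "T \<ge> 0" for n i T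
  proof -
    have "strip_integral 0 T (q n i) \<le> (\<Sum>i\<in>I. strip_integral 0 T (q n i))" by (rule member_le_sum[OF that(1) q0 I])
    moreover have "0 \<le> H n T" unfolding H_def using H0 by (intro sum_nonneg) auto
    then have "c * (\<Sum>i\<in>I. strip_integral 0 T (q n i)) \<le> B T" using step[of 0 T n] Hinit[of n] that(2) unfolding B_def by linarith
    then have "(\<Sum>i\<in>I. strip_integral 0 T (q n i)) \<le> B T / c" using c by (simp add: field_simps)
    ultimately show ?thesis by linarith
  qed
  show r1: "integrable lborel (\<lambda>x. \<Psi> (f i t x))" if "i \<in> I" "t \<ge> 0" for i t
  proof (rule integrable_of_bounded_integrals[of _ "\<lambda>n x. \<Phi> n (f i t x)"])
    show "integrable lborel (\<lambda>x. \<Phi> n (f i t x))" for n by (rule smooth_convex_integrable[OF sc fi[OF that]])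
    show "(\<lambda>x. \<Psi> (f i t x)) \<in> borel_measurable lborel"
      using measurable_compose[OF joint_measurable_section[OF fm[OF that(1)]] \<Psi>m] by simp
    show "(\<integral>x. \<Phi> n (f i t x) \<partial>lborel) \<le> B t" for n by (rule b1[OF that])
  qed (auto simp: b lim)
  show r2: "loc_integrable (\<lambda>t x. \<Psi> (f i t x))" if i: "i \<in> I" for i
    unfolding loc_integrable_def
  proof
    fix T
    have \<Psi>j: "joint_measurable (\<lambda>t x. \<Psi> (f i t x))" by (rule joint_measurable_compose[OF fm[OF i] \<Psi>m])
    have "integrable (lborel \<Otimes>\<^sub>M lborel) (\<lambda>p. indicator {0..T} (fst p) * (N * \<Psi> (f i (fst p) (snd p))))"
    proof (cases "T \<ge> 0")
      case True
      show ?thesis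
      proof (rule integrable_of_bounded_integrals[of _ "\<lambda>n p. indicator {0..T} (fst p) * q n i (fst p) (snd p)"])
        show "integrable (lborel \<Otimes>\<^sub>M lborel) (\<lambda>p. indicator {0..T} (fst p) * q n i (fst p) (snd p))" for n
          using ql[OF i, of n] by (simp add: loc_integrable_def split_beta')
        show "(\<lambda>p. indicator {0..T} (fst p) * (N * \<Psi> (f i (fst p) (snd p)))) \<in> borel_measurable (lborel \<Otimes>\<^sub>M lborel)"
          using joint_measurableD[OF \<Psi>j] by measurable
        show "(\<integral>p. indicator {0..T} (fst p) * q n i (fst p) (snd p) \<partial>(lborel \<Otimes>\<^sub>M lborel)) \<le> B T / c" for n
          using b2[OF i True, of n] by (simp add: strip_integral_def split_beta')
      qed (auto simp: q_def b intro!: tendsto_intros lim)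
    next
      case False then show ?thesis by simp
    qed
    from integrable_mult_right[OF this, of "1/N"] show "integrable (lborel \<Otimes>\<^sub>M lborel) (\<lambda>(t,x). indicator {0..T} t * \<Psi> (f i t x))"
      using N by (simp add: split_beta')
  qed
  show "(\<Sum>i\<in>I. \<integral>x. \<Psi> (f i T x) \<partial>lborel) - (\<Sum>i\<in>I. \<integral>x. \<Psi> (f i s x) \<partial>lborel)
        \<le> strip_integral s T G - c * N * (\<Sum>i\<in>I. strip_integral s T (\<lambda>t x. \<Psi> (f i t x)))" if sT: "0 \<le> s" "s \<le> T" for s T
  proof -
    have lH: "(\<lambda>n. H n t) \<longlonglongrightarrow> (\<Sum>i\<in>I. \<integral>x. \<Psi> (f i t x) \<partial>lborel)" if "t \<ge> 0" for t
      unfolding H_def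
    proof (rule tendsto_sum)
      fix i assume i: "i \<in> I"
      show "(\<lambda>n. \<integral>x. \<Phi> n (f i t x) \<partial>lborel) \<longlonglongrightarrow> (\<integral>x. \<Psi> (f i t x) \<partial>lborel)"
      proof (rule integral_dominated_convergence[where w="\<lambda>x. \<Psi> (f i t x)"])
        show "(\<lambda>x. \<Phi> n (f i t x)) \<in> borel_measurable lborel" for n
          by (rule borel_measurable_integrable[OF smooth_convex_integrable[OF sc fi[OF i that]]])
      qed (use r1[OF i that] b lim in auto)
    qed
    have lq: "(\<lambda>n. strip_integral s T (q n i)) \<longlonglongrightarrow> N * strip_integral s T (\<lambda>t x. \<Psi> (f i t x))" if i: "i \<in> I" for i
      unfolding strip_integral_cmult[symmetric] unfolding strip_integral_def split_beta'
    proof (rule integral_dominated_convergence[where w="\<lambda>p. indicator {s..T} (fst p) * (N * \<Psi> (f i (fst p) (snd p)))"])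
      show w: "integrable (lborel \<Otimes>\<^sub>M lborel) (\<lambda>p. indicator {s..T} (fst p) * (N * \<Psi> (f i (fst p) (snd p))))"
        using loc_integrable_strip[OF loc_integrable_cmult[OF r2[OF i], of N] sT(1), of T] by (simp add: split_beta')
      show "(\<lambda>p. indicator {s..T} (fst p) * (N * \<Psi> (f i (fst p) (snd p)))) \<in> borel_measurable (lborel \<Otimes>\<^sub>M lborel)"
        using w by (rule borel_measurable_integrable)
      show "(\<lambda>p. indicator {s..T} (fst p) * q n i (fst p) (snd p)) \<in> borel_measurable (lborel \<Otimes>\<^sub>M lborel)" for n
        using borel_measurable_integrable[OF loc_integrable_strip[OF ql[OF i, of n] sT(1), of T]] by (simp add: split_beta')
      show "AE p in lborel \<Otimes>\<^sub>M lborel. (\<lambda>n. indicator {s..T} (fst p) * q n i (fst p) (snd p)) \<longlonglongrightarrow> indicator {s..T} (fst p) * (N * \<Psi> (f i (fst p) (snd p)))"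
        by (intro AE_I2 tendsto_intros) (simp add: q_def lim)
      show "AE p in lborel \<Otimes>\<^sub>M lborel. norm (indicator {s..T} (fst p) * q n i (fst p) (snd p)) \<le> indicator {s..T} (fst p) * (N * \<Psi> (f i (fst p) (snd p)))" for n
        by (intro AE_I2) (auto simp: q_def b indicator_def)
    qed
    have "(\<lambda>n. H n T - H n s) \<longlonglongrightarrow> (\<Sum>i\<in>I. \<integral>x. \<Psi> (f i T x) \<partial>lborel) - (\<Sum>i\<in>I. \<integral>x. \<Psi> (f i s x) \<partial>lborel)"
      using sT by (intro tendsto_intros lH) auto
    moreover have "(\<lambda>n. strip_integral s T G - c * (\<Sum>i\<in>I. strip_integral s T (q n i))) \<longlonglongrightarrow>
       strip_integral s T G - c * (\<Sum>i\<in>I. N * strip_integral s T (\<lambda>t x. \<Psi> (f i t x)))"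
      by (intro tendsto_intros lq)
    ultimately have "(\<Sum>i\<in>I. \<integral>x. \<Psi> (f i T x) \<partial>lborel) - (\<Sum>i\<in>I. \<integral>x. \<Psi> (f i s x) \<partial>lborel)
      \<le> strip_integral s T G - c * (\<Sum>i\<in>I. N * strip_integral s T (\<lambda>t x. \<Psi> (f i t x)))"
      by (rule LIMSEQ_le) (use step[OF sT] in auto)
    then show ?thesis by (simp add: sum_distrib_left mult.assoc)
  qed
qed

text \<open>The truncations have derivatives \<open>4 z\<^sup>3\<close> and \<open>2 z\<close> with \<open>z = soft_clip e x\<close>, a bounded smooth approximation of \<open>x\<close>.\<close>

definition soft_root :: "real \<Rightarrow> real \<Rightarrow> real" where "soft_root e x = sqrt (1 + e * x\<^sup>2)"
definition soft_clip :: "real \<Rightarrow> real \<Rightarrow> real" where "soft_clip e x = x / soft_root e x"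

lemma soft_root_square: "e > 0 \<Longrightarrow> (soft_root e x)\<^sup>2 = 1 + e * x\<^sup>2"
  by (simp add: soft_root_def add_nonneg_nonneg)

lemma soft_root_ge_1: "e > 0 \<Longrightarrow> 1 \<le> soft_root e x"
  by (simp add: soft_root_def)

lemma soft_root_deriv:
  assumes e: "e > 0"
  shows "(soft_root e has_real_derivative e * x / soft_root e x) (at x)"
proof -
  have "0 < 1 + e * x\<^sup>2" using e by (intro add_pos_nonneg) auto
  from DERIV_real_sqrt[OF this]
  have 1: "(sqrt has_real_derivative inverse (sqrt (1 + e * x\<^sup>2)) / 2) (at (1 + e * x\<^sup>2))" .
  have 2: "((\<lambda>x. 1 + e * x\<^sup>2) has_real_derivative 0 + e * (real 2 * x ^ (2 - Suc 0))) (at x)"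
    by (intro DERIV_add DERIV_const DERIV_cmult DERIV_pow)
  have 3: "((\<lambda>x. sqrt (1 + e * x\<^sup>2)) has_real_derivative
      inverse (sqrt (1 + e * x\<^sup>2)) / 2 * (0 + e * (real 2 * x ^ (2 - Suc 0)))) (at x)"
    by (rule DERIV_chain2[where g="\<lambda>x. 1 + e * x\<^sup>2" and f=sqrt and x=x, OF 1 2])
  have 4: "inverse (sqrt (1 + e * x\<^sup>2)) / 2 * (0 + e * (real 2 * x ^ (2 - Suc 0))) = e * x / soft_root e x"
    unfolding soft_root_def divide_inverse by simp
  have 5: "(\<lambda>x. sqrt (1 + e * x\<^sup>2)) = soft_root e" by (rule ext) (simp add: soft_root_def)
  from DERIV_cong[OF 3 4] show ?thesis unfolding 5 .
qed

lemma soft_clip_deriv: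
  assumes e: "e > 0"
  shows "(soft_clip e has_real_derivative 1 / (soft_root e x) ^ 3) (at x)"
proof -
  define r where "r = soft_root e x"
  have r: "r \<ge> 1" "r\<^sup>2 = 1 + e * x\<^sup>2" using soft_root_ge_1[OF e] soft_root_square[OF e] by (auto simp: r_def)
  have r0: "r \<noteq> 0" using r by auto
  have "((\<lambda>x. x / soft_root e x) has_real_derivative (1 * soft_root e x - x * (e * x / soft_root e x)) / (soft_root e x * soft_root e x)) (at x)"
    using r0 by (intro DERIV_divide DERIV_ident soft_root_deriv e) (simp add: r_def)
  \<comment> \<open>The identity r^2 = 1 + e x^2 cancels the dependence of the numerator on
    x.\<close>
  moreover have "(1 * r - x * (e * x / r)) / (r * r) = 1 / r ^ 3"
  proof -
    have "1 * r - x * (e * x / r) = (r\<^sup>2 - e * x\<^sup>2) / r" using r0 by (simp add: field_simps power2_eq_square)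
    also have "\<dots> = 1 / r" using r(2) by simp
    finally show ?thesis using r0 by (simp add: field_simps power3_eq_cube)
  qed
  ultimately show ?thesis unfolding soft_clip_def r_def by simp
qed

lemma soft_clip_abs_le: "e > 0 \<Longrightarrow> \<bar>soft_clip e x\<bar> \<le> \<bar>x\<bar>"
  using soft_root_ge_1[of e x] by (simp add: soft_clip_def abs_divide divide_le_eq mult_left_le) (simp add: mult_le_cancel_left1)

lemma soft_clip_sign: "e > 0 \<Longrightarrow> 0 \<le> x * soft_clip e x"
  using soft_root_ge_1[of e x] by (simp add: soft_clip_def)

text \<open>The sharp bound on the absolute value is 1 / \<open>sqrt e\<close>; the larger 1 / e,
  available because e <= 1, avoids the root.\<close>

lemma soft_clip_bounded:
  assumes e: "0 < e" "e \<le> 1"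
  shows "(soft_clip e x)\<^sup>2 \<le> 1 / e" "\<bar>soft_clip e x\<bar> \<le> 1 / e"
proof -
  have "(soft_clip e x)\<^sup>2 = x\<^sup>2 / (1 + e * x\<^sup>2)" using e by (simp add: soft_clip_def power_divide soft_root_square)
  also have "\<dots> \<le> 1 / e"
  proof -
    have "0 < 1 + e * x\<^sup>2" using e by (intro add_pos_nonneg) auto
    then show ?thesis using e by (simp add: field_simps)
  qed
  finally show 1: "(soft_clip e x)\<^sup>2 \<le> 1 / e" .
  also have "\<dots> \<le> (1 / e)\<^sup>2" using e by (simp add: power2_eq_square field_simps)
  finally show "\<bar>soft_clip e x\<bar> \<le> 1 / e" using e abs_le_square_iff[of "soft_clip e x" "1 / e"] by simp
qed

definition eps :: "nat \<Rightarrow> real" where "eps n = 1 / real (Suc n)"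

lemma eps: "0 < eps n" "eps n \<le> 1" by (auto simp: eps_def)

lemma soft_root_lim: "(\<lambda>n. soft_root (eps n) x) \<longlonglongrightarrow> 1"
proof -
  have "eps \<longlonglongrightarrow> 0" unfolding eps_def[abs_def] by (rule LIMSEQ_Suc[OF lim_1_over_n])
  then have "(\<lambda>n. sqrt (1 + eps n * x\<^sup>2)) \<longlonglongrightarrow> sqrt (1 + 0 * x\<^sup>2)" by (intro tendsto_intros)
  then show ?thesis by (simp add: soft_root_def)
qed

lemma soft_clip_lim: "(\<lambda>n. soft_clip (eps n) x) \<longlonglongrightarrow> x"
  using tendsto_divide[OF tendsto_const soft_root_lim, of x x] by (simp add: soft_clip_def)

text \<open>The primitives of 4 z^3 and 2 z that vanish at 0, for z = \<open>soft_clip\<close>, in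
  closed form. They result from r' = e x / r and e x^2 = r^2 - 1, with r =
  \<open>soft_root\<close>.\<close>

definition trunc4 :: "nat \<Rightarrow> real \<Rightarrow> real" where
  "trunc4 n x = 4 / (eps n)\<^sup>2 * (soft_root (eps n) x + 1 / soft_root (eps n) x - 2)"
definition trunc2 :: "nat \<Rightarrow> real \<Rightarrow> real" where
  "trunc2 n x = 2 / eps n * (soft_root (eps n) x - 1)"

text \<open>This form has no cancellation as \<open>eps n\<close> tends to 0: with r >= 1 it shows 0
  <= \<open>trunc4\<close> <= x^4, and with r tending to 1 it shows the limit x^4.\<close>

lemma trunc4_eq: "trunc4 n x = 4 * x ^ 4 / (soft_root (eps n) x * (soft_root (eps n) x + 1)\<^sup>2)"
proof -
  define r e where "r = soft_root (eps n) x" and "e = eps n"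
  have e: "e > 0" using eps by (simp add: e_def)
  have r: "r \<ge> 1" "r\<^sup>2 = 1 + e * x\<^sup>2" using soft_root_ge_1 soft_root_square eps by (auto simp: r_def e_def)
  have x2: "x\<^sup>2 = (r - 1) * (r + 1) / e" using r(2) e by (simp add: field_simps power2_eq_square)
  have "x ^ 4 = (x\<^sup>2)\<^sup>2" by simp
  also have "\<dots> = (r - 1)\<^sup>2 * (r + 1)\<^sup>2 / e\<^sup>2" unfolding x2 by (simp add: power_divide power_mult_distrib)
  finally have "4 * x ^ 4 / (r * (r + 1)\<^sup>2) = 4 / e\<^sup>2 * ((r - 1)\<^sup>2 / r)" using r(1) by simp
  also have "(r - 1)\<^sup>2 / r = r + 1 / r - 2" using r(1) by (simp add: field_simps power2_eq_square)
  finally show ?thesis by (simp add: trunc4_def r_def e_def)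
qed

lemma trunc2_eq: "trunc2 n x = 2 * x\<^sup>2 / (soft_root (eps n) x + 1)"
proof -
  define r e where "r = soft_root (eps n) x" and "e = eps n"
  have e: "e > 0" using eps by (simp add: e_def)
  have r: "r \<ge> 1" "r\<^sup>2 = 1 + e * x\<^sup>2" using soft_root_ge_1 soft_root_square eps by (auto simp: r_def e_def)
  have x2: "x\<^sup>2 = (r - 1) * (r + 1) / e" using r(2) e by (simp add: field_simps power2_eq_square)
  have 1: "2 * x\<^sup>2 = (2 / e * (r - 1)) * (r + 1)" unfolding x2 by simp
  have "2 * x\<^sup>2 / (r + 1) = 2 / e * (r - 1)" unfolding 1 using r(1) by (intro nonzero_mult_div_cancel_right) simp
  then show ?thesis by (simp add: trunc2_def r_def e_def)
qed

lemma smooth_convex_trunc4: "smooth_convex (trunc4 n) (\<lambda>x. 4 * (soft_clip (eps n) x) ^ 3)"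
proof -
  note e = eps[of n]
  define z where "z = soft_clip (eps n)"
  define r where "r = soft_root (eps n)"
  have r1: "1 \<le> r x" for x using soft_root_ge_1[OF e(1)] by (simp add: r_def)
  \<comment> \<open>For e = \<open>eps n\<close> <= 1 one has z^2 <= 1/e and |z|^3 <= (1/e)^2, so a
    single constant bounds both derivatives.\<close>
  have "convex_data (trunc4 n) (\<lambda>x. 4 * (z x) ^ 3) (\<lambda>x. 12 * (z x)\<^sup>2 / (r x) ^ 3) (12 * (1 / eps n)\<^sup>2)"
    unfolding convex_data_def
  proof (intro conjI allI)
    fix x
    have dr: "(r has_real_derivative eps n * x / r x) (at x)" unfolding r_def by (rule soft_root_deriv[OF e(1)])
    have rx: "r x \<noteq> 0" using r1[of x] by auto
    have "((\<lambda>x. 4 / (eps n)\<^sup>2 * (r x + 1 / r x - 2)) has_real_derivative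
       4 / (eps n)\<^sup>2 * (eps n * x / r x + (0 * r x - 1 * (eps n * x / r x)) / (r x * r x) - 0)) (at x)"
      by (intro DERIV_cmult DERIV_diff DERIV_add DERIV_divide DERIV_const dr rx)
    then have "((\<lambda>x. 4 / (eps n)\<^sup>2 * (r x + 1 / r x - 2)) has_real_derivative
       4 / (eps n)\<^sup>2 * (eps n * x / r x - (eps n * x / r x) / (r x)\<^sup>2)) (at x)"
      by (simp add: power2_eq_square)
    moreover have "4 / (eps n)\<^sup>2 * (eps n * x / r x - (eps n * x / r x) / (r x)\<^sup>2) = 4 * (z x) ^ 3"
    proof -
      have r2: "(r x)\<^sup>2 = 1 + eps n * x\<^sup>2" unfolding r_def by (rule soft_root_square[OF e(1)])
      have "eps n * x / r x - (eps n * x / r x) / (r x)\<^sup>2 = eps n * x * ((r x)\<^sup>2 - 1) / (r x) ^ 3"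
        using rx by (simp add: field_simps power3_eq_cube power2_eq_square)
      also have "\<dots> = (eps n)\<^sup>2 * (x / r x) ^ 3" unfolding r2 by (simp add: power_divide power3_eq_cube power2_eq_square)
      finally show ?thesis using e by (simp add: z_def soft_clip_def r_def)
    qed
    ultimately show "(trunc4 n has_real_derivative 4 * (z x) ^ 3) (at x)" by (simp add: trunc4_def[abs_def] r_def)
    have dz: "(z has_real_derivative 1 / (r x) ^ 3) (at x)" unfolding z_def r_def by (rule soft_clip_deriv[OF e(1)])
    show "((\<lambda>x. 4 * (z x) ^ 3) has_real_derivative 12 * (z x)\<^sup>2 / (r x) ^ 3) (at x)"
      by (auto intro!: derivative_eq_intros dz)
    have z2: "(z x)\<^sup>2 \<le> 1 / eps n" "\<bar>z x\<bar> \<le> 1 / eps n" using soft_clip_bounded[OF e] by (auto simp: z_def)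
    have e1: "1 \<le> 1 / eps n" using e by simp
    have "\<bar>z x\<bar> ^ 3 = \<bar>z x\<bar> * (z x)\<^sup>2" by (simp add: power3_eq_cube power2_eq_square abs_mult[symmetric])
    also have "\<dots> \<le> 1 / eps n * (1 / eps n)" using z2 e by (intro mult_mono) auto
    finally have "\<bar>z x\<bar> ^ 3 \<le> (1 / eps n)\<^sup>2" by (simp add: power2_eq_square)
    moreover have "0 \<le> (1 / eps n)\<^sup>2" by simp
    moreover have "\<bar>4 * (z x) ^ 3\<bar> = 4 * \<bar>z x\<bar> ^ 3" by (simp add: abs_mult power_abs)
    ultimately show "\<bar>4 * (z x) ^ 3\<bar> \<le> 12 * (1 / eps n)\<^sup>2" by linarith
    show "0 \<le> 12 * (z x)\<^sup>2 / (r x) ^ 3" using r1[of x] by simp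
    have "1 \<le> (r x) ^ 3" using r1 by (simp add: one_le_power)
    then have "12 * (z x)\<^sup>2 / (r x) ^ 3 \<le> 12 * (z x)\<^sup>2 / 1" using r1[of x] by (intro divide_left_mono) auto
    also have "\<dots> \<le> 12 * (1 / eps n)" using z2 by simp
    also have "\<dots> \<le> 12 * (1 / eps n)\<^sup>2" using e1 self_le_power[of "1 / eps n" 2] by simp
    finally show "12 * (z x)\<^sup>2 / (r x) ^ 3 \<le> 12 * (1 / eps n)\<^sup>2" .
  next
    have cz: "continuous_on UNIV z" unfolding z_def
      by (intro continuous_at_imp_continuous_on ballI DERIV_isCont[OF soft_clip_deriv[OF e(1)]])
    have cr: "continuous_on UNIV r" unfolding r_def
      by (intro continuous_at_imp_continuous_on ballI DERIV_isCont[OF soft_root_deriv[OF e(1)]])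
    show "continuous_on UNIV (\<lambda>x. 12 * (z x)\<^sup>2 / (r x) ^ 3)"
    proof (intro continuous_intros cz cr ballI)
      fix x show "r x ^ 3 \<noteq> 0" using r1[of x] by auto
    qed
  qed (simp_all add: trunc4_def z_def soft_clip_def soft_root_def)
  then show ?thesis unfolding smooth_convex_def z_def by blast
qed

lemma smooth_convex_trunc2: "smooth_convex (trunc2 n) (\<lambda>x. 2 * soft_clip (eps n) x)"
proof -
  note e = eps[of n]
  define z where "z = soft_clip (eps n)"
  define r where "r = soft_root (eps n)"
  have r1: "1 \<le> r x" for x using soft_root_ge_1[OF e(1)] by (simp add: r_def)
  have "convex_data (trunc2 n) (\<lambda>x. 2 * z x) (\<lambda>x. 2 / (r x) ^ 3) (2 * (1 / eps n))"
    unfolding convex_data_def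
  proof (intro conjI allI)
    fix x
    have dr: "(r has_real_derivative eps n * x / r x) (at x)" unfolding r_def by (rule soft_root_deriv[OF e(1)])
    have "((\<lambda>x. 2 / eps n * (r x - 1)) has_real_derivative 2 / eps n * (eps n * x / r x - 0)) (at x)"
      by (intro DERIV_cmult DERIV_diff dr DERIV_const)
    moreover have "2 / eps n * (eps n * x / r x - 0) = 2 * z x" using e by (simp add: z_def soft_clip_def r_def)
    ultimately show "(trunc2 n has_real_derivative 2 * z x) (at x)" by (simp add: trunc2_def[abs_def] r_def)
    have "(z has_real_derivative 1 / (r x) ^ 3) (at x)" unfolding z_def r_def by (rule soft_clip_deriv[OF e(1)])
    from DERIV_cmult[OF this, of 2] show "((\<lambda>x. 2 * z x) has_real_derivative 2 / (r x) ^ 3) (at x)" by simp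
    show "\<bar>2 * z x\<bar> \<le> 2 * (1 / eps n)" using soft_clip_bounded(2)[OF e, of x] by (simp add: z_def)
    show "0 \<le> 2 / (r x) ^ 3" using r1[of x] by simp
    have "1 \<le> (r x) ^ 3" using r1 by (simp add: one_le_power)
    then have "2 / (r x) ^ 3 \<le> 2 / 1" using r1[of x] by (intro divide_left_mono) auto
    also have "\<dots> \<le> 2 * (1 / eps n)"
    proof -
      have "1 \<le> 1 / eps n" using e by simp
      then show ?thesis by linarith
    qed
    finally show "2 / (r x) ^ 3 \<le> 2 * (1 / eps n)" .
  next
    have cr: "continuous_on UNIV r" unfolding r_def
      by (intro continuous_at_imp_continuous_on ballI DERIV_isCont[OF soft_root_deriv[OF e(1)]])
    show "continuous_on UNIV (\<lambda>x. 2 / (r x) ^ 3)"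
    proof (intro continuous_intros cr ballI)
      fix x show "r x ^ 3 \<noteq> 0" using r1[of x] by auto
    qed
  qed (simp_all add: trunc2_def z_def soft_clip_def soft_root_def)
  then show ?thesis unfolding smooth_convex_def z_def by blast
qed

lemma truncation_4: "truncation (\<lambda>x. x ^ 4) 4 trunc4 (\<lambda>n x. 4 * (soft_clip (eps n) x) ^ 3)"
  unfolding truncation_def
proof (intro conjI allI smooth_convex_trunc4)
  fix n x
  define r where "r = soft_root (eps n) x"
  have r: "1 \<le> r" using soft_root_ge_1[OF eps(1)] by (simp add: r_def)
  have q: "trunc4 n x = 4 * x ^ 4 / (r * (r + 1)\<^sup>2)" by (simp add: trunc4_eq r_def)
  show "0 \<le> trunc4 n x" unfolding q using r by simp
  have "2\<^sup>2 \<le> (r + 1)\<^sup>2" using r by (intro power_mono) auto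
  then have "1 * 4 \<le> r * (r + 1)\<^sup>2" using r by (intro mult_mono) auto
  then have "4 * x ^ 4 / (r * (r + 1)\<^sup>2) \<le> 4 * x ^ 4 / 4" using r by (intro divide_left_mono) auto
  then show "trunc4 n x \<le> x ^ 4" by (simp add: q)
  have q': "x * (4 * (soft_clip (eps n) x) ^ 3) = 4 * x ^ 4 / r ^ 3"
    by (simp add: soft_clip_def r_def power_divide power3_eq_cube power4_eq_xxxx)
  show "0 \<le> x * (4 * (soft_clip (eps n) x) ^ 3)" unfolding q' using r by simp
  have "1 \<le> r ^ 3" using r by (simp add: one_le_power)
  then have "4 * x ^ 4 / r ^ 3 \<le> 4 * x ^ 4 / 1" using r by (intro divide_left_mono) auto
  then show "x * (4 * (soft_clip (eps n) x) ^ 3) \<le> 4 * x ^ 4" unfolding q' by simp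
next
  fix x :: real
  have "(\<lambda>n. 4 * x ^ 4 / (soft_root (eps n) x * (soft_root (eps n) x + 1)\<^sup>2)) \<longlonglongrightarrow> 4 * x ^ 4 / (1 * (1 + 1)\<^sup>2)"
    by (intro tendsto_intros soft_root_lim) auto
  then show "(\<lambda>n. trunc4 n x) \<longlonglongrightarrow> x ^ 4" by (simp add: trunc4_eq)
  have "(\<lambda>n. x * (4 * (soft_clip (eps n) x) ^ 3)) \<longlonglongrightarrow> x * (4 * x ^ 3)"
    by (intro tendsto_intros soft_clip_lim)
  then show "(\<lambda>n. x * (4 * (soft_clip (eps n) x) ^ 3)) \<longlonglongrightarrow> 4 * x ^ 4"
    by (simp add: eval_nat_numeral mult_ac)
qed

lemma truncation_2: "truncation (\<lambda>x. x\<^sup>2) 2 trunc2 (\<lambda>n x. 2 * soft_clip (eps n) x)"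
  unfolding truncation_def
proof (intro conjI allI smooth_convex_trunc2)
  fix n x
  define r where "r = soft_root (eps n) x"
  have r: "1 \<le> r" using soft_root_ge_1[OF eps(1)] by (simp add: r_def)
  have q: "trunc2 n x = 2 * x\<^sup>2 / (r + 1)" by (simp add: trunc2_eq r_def)
  show "0 \<le> trunc2 n x" unfolding q using r by simp
  have "2 * x\<^sup>2 / (r + 1) \<le> 2 * x\<^sup>2 / 2" using r by (intro divide_left_mono) auto
  then show "trunc2 n x \<le> x\<^sup>2" by (simp add: q)
  have q': "x * (2 * soft_clip (eps n) x) = 2 * x\<^sup>2 / r"
    by (simp add: soft_clip_def r_def power2_eq_square)
  show "0 \<le> x * (2 * soft_clip (eps n) x)" unfolding q' using r by simp
  have "2 * x\<^sup>2 / r \<le> 2 * x\<^sup>2 / 1" using r by (intro divide_left_mono) auto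
  then show "x * (2 * soft_clip (eps n) x) \<le> 2 * x\<^sup>2" unfolding q' by simp
next
  fix x :: real
  have "(\<lambda>n. 2 * x\<^sup>2 / (soft_root (eps n) x + 1)) \<longlonglongrightarrow> 2 * x\<^sup>2 / (1 + 1)"
    by (intro tendsto_intros soft_root_lim) auto
  then show "(\<lambda>n. trunc2 n x) \<longlonglongrightarrow> x\<^sup>2" by (simp add: trunc2_eq)
  have "(\<lambda>n. x * (2 * soft_clip (eps n) x)) \<longlonglongrightarrow> x * (2 * x)"
    by (intro tendsto_intros soft_clip_lim)
  then show "(\<lambda>n. x * (2 * soft_clip (eps n) x)) \<longlonglongrightarrow> 2 * x\<^sup>2"
    by (simp add: power2_eq_square mult.left_commute)
qed

section \<open>Pointwise estimates of the reaction terms\<close>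

text \<open>Exchanging i and j and averaging turns the double sum into - c/2 times the sum of the
  products (y j - y i)(h j - h i). Coupling thus dissipates for every nondecreasing function h of
  y.\<close>

lemma coupling_nonpos:
  fixes y h :: "nat \<Rightarrow> real"
  assumes mono: "\<And>i j. (y j - y i) * (h j - h i) \<ge> 0" and c: "c \<ge> 0"
  shows "(\<Sum>i=1..m. (\<Sum>j=1..m. c * (y j - y i)) * h i) \<le> 0"
proof -
  define S where "S = (\<Sum>i=1..m. \<Sum>j=1..m. (y j - y i) * h i)"
  have "S = (\<Sum>i=1..m. \<Sum>j=1..m. (y i - y j) * h j)" unfolding S_def by (rule sum.swap)
  then have "S + S = (\<Sum>i=1..m. \<Sum>j=1..m. (y j - y i) * h i) + (\<Sum>i=1..m. \<Sum>j=1..m. (y i - y j) * h j)"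
    unfolding S_def by simp
  also have "\<dots> = (\<Sum>i=1..m. \<Sum>j=1..m. - ((y j - y i) * (h j - h i)))"
    by (simp add: sum.distrib[symmetric] algebra_simps)
  also have "\<dots> \<le> 0" using mono by (intro sum_nonpos) auto
  finally have "S \<le> 0" by simp
  moreover have "(\<Sum>i=1..m. (\<Sum>j=1..m. c * (y j - y i)) * h i) = c * S"
    unfolding S_def by (simp add: sum_distrib_left sum_distrib_right mult.assoc)
  ultimately show ?thesis using c by (simp add: mult_nonneg_nonpos)
qed

lemma clip_square_le:
  fixes z x :: real
  assumes "\<bar>z\<bar> \<le> \<bar>x\<bar>" "0 \<le> x * z" shows "z\<^sup>2 \<le> x * z"
proof -
  have "z\<^sup>2 = \<bar>z\<bar> * \<bar>z\<bar>" by (simp add: power2_eq_square)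
  also have "\<dots> \<le> \<bar>x\<bar> * \<bar>z\<bar>" using assms(1) by (rule mult_right_mono) simp
  also have "\<dots> = x * z" using assms(2) by (simp add: abs_mult[symmetric])
  finally show ?thesis .
qed

lemma young_square:
  fixes a b :: real
  assumes "c > 0" shows "2 * (a * b) \<le> c * a\<^sup>2 + b\<^sup>2 / c"
proof -
  have "0 \<le> (c * a - b)\<^sup>2 / c" using assms by simp
  also have "(c * a - b)\<^sup>2 / c = c * a\<^sup>2 + b\<^sup>2 / c - 2 * (a * b)"
    using assms by (simp add: power2_diff field_simps power2_eq_square)
  finally show ?thesis by simp
qed

text \<open>Here z stands for the truncated v, which lies between 0 and v, so z^2 <= v z. Each of
  the two source terms costs z^2 / 2 by Young; together they use half of the damping 2 v z, and half
  remains. The square of \<beta> u^2 is the origin of u^4.\<close>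

lemma point_v:
  fixes z v u :: real
  assumes z: "\<bar>z\<bar> \<le> \<bar>v\<bar>" "0 \<le> v * z"
  shows "(\<alpha> - \<beta> * u\<^sup>2 - v) * (2 * z) \<le> (2 * \<alpha>\<^sup>2 + 2 * \<beta>\<^sup>2) * (1 + u ^ 4) - 1/2 * (v * (2 * z))"
proof -
  have "2 * (z * \<alpha>) \<le> 1/2 * z\<^sup>2 + 2 * \<alpha>\<^sup>2" using young_square[of "1/2" z \<alpha>] by simp
  moreover have "2 * (z * (- \<beta> * u\<^sup>2)) \<le> 1/2 * z\<^sup>2 + 2 * (\<beta>\<^sup>2 * u ^ 4)"
    using young_square[of "1/2" z "- \<beta> * u\<^sup>2"] by (simp add: power_mult_distrib)
  moreover have "z\<^sup>2 \<le> v * z" by (rule clip_square_le[OF z])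
  moreover have "0 \<le> \<alpha>\<^sup>2 * u ^ 4" "0 \<le> \<beta>\<^sup>2" by simp_all
  moreover have "(\<alpha> - \<beta> * u\<^sup>2 - v) * (2 * z) = 2 * (z * \<alpha>) + 2 * (z * (- \<beta> * u\<^sup>2)) - 2 * (v * z)"
    by (simp add: algebra_simps)
  moreover have "(2 * \<alpha>\<^sup>2 + 2 * \<beta>\<^sup>2) * (1 + u ^ 4) - 1/2 * (v * (2 * z)) = 2 * \<alpha>\<^sup>2 + 2 * \<beta>\<^sup>2 + 2 * (\<alpha>\<^sup>2 * u ^ 4) + 2 * (\<beta>\<^sup>2 * u ^ 4) - v * z"
    by (simp add: algebra_simps)
  ultimately show ?thesis by linarith
qed

text \<open>As for v, with Young weights r/2 so that half of the damping survives; u^2 is raised to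
  1 + u^4 so that all inputs are measured in the same power of u.\<close>

lemma point_w:
  fixes z w u :: real
  assumes z: "\<bar>z\<bar> \<le> \<bar>w\<bar>" "0 \<le> w * z" and r: "r > 0"
  shows "(q * (u - ue) - r * w) * (2 * z) \<le> (2 * q\<^sup>2 / r * (1 + ue\<^sup>2)) * (1 + u ^ 4) - r/2 * (w * (2 * z))"
proof -
  have "2 * (z * (q * u)) \<le> r/2 * z\<^sup>2 + (q * u)\<^sup>2 / (r/2)" using r by (intro young_square) simp
  moreover have "2 * (z * (- q * ue)) \<le> r/2 * z\<^sup>2 + (- q * ue)\<^sup>2 / (r/2)" using r by (intro young_square) simp
  moreover have "r * z\<^sup>2 \<le> r * (w * z)" using clip_square_le[OF z] r by simp
  moreover have "(q * u)\<^sup>2 / (r/2) + (- q * ue)\<^sup>2 / (r/2) \<le> (2 * q\<^sup>2 / r * (1 + ue\<^sup>2)) * (1 + u ^ 4)"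
  proof -
    have "u\<^sup>2 \<le> 1 + u ^ 4" using abs_le_1_plus_square[of "u\<^sup>2"] by simp
    moreover have "0 \<le> ue\<^sup>2 * u ^ 4" by simp
    moreover have "(1 + ue\<^sup>2) * (1 + u ^ 4) = 1 + ue\<^sup>2 + u ^ 4 + ue\<^sup>2 * u ^ 4" by (simp add: algebra_simps)
    ultimately have "u\<^sup>2 + ue\<^sup>2 \<le> (1 + ue\<^sup>2) * (1 + u ^ 4)" by linarith
    then have "2 * q\<^sup>2 / r * (u\<^sup>2 + ue\<^sup>2) \<le> 2 * q\<^sup>2 / r * ((1 + ue\<^sup>2) * (1 + u ^ 4))" using r by (intro mult_left_mono) auto
    moreover have "(q * u)\<^sup>2 / (r/2) + (- q * ue)\<^sup>2 / (r/2) = 2 * q\<^sup>2 / r * (u\<^sup>2 + ue\<^sup>2)"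
      using r by (simp add: power_mult_distrib field_simps)
    ultimately show ?thesis by (simp only: mult.assoc)
  qed
  moreover have "(q * (u - ue) - r * w) * (2 * z) = 2 * (z * (q * u)) + 2 * (z * (- q * ue)) - 2 * (r * (w * z))"
    by (simp add: algebra_simps)
  moreover have "r/2 * (w * (2 * z)) = r * (w * z)" by simp
  ultimately show ?thesis by linarith
qed

text \<open>If |u| <= A |z| the first term dominates; otherwise |z| < |u| / A and the second
  does.\<close>

lemma young_4:
  fixes z u :: real
  assumes A: "A > 0" shows "z ^ 3 * u \<le> A * z ^ 4 + u ^ 4 / A ^ 3"
proof (cases "\<bar>u\<bar> \<le> A * \<bar>z\<bar>")
  case True
  have "z ^ 3 * u \<le> \<bar>z\<bar> ^ 3 * \<bar>u\<bar>" by (metis abs_ge_self abs_mult power_abs)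
  also have "\<dots> \<le> \<bar>z\<bar> ^ 3 * (A * \<bar>z\<bar>)" using True by (intro mult_left_mono) auto
  also have "\<dots> = A * \<bar>z\<bar> ^ 4" by (simp add: power3_eq_cube power4_eq_xxxx)
  also have "\<dots> = A * z ^ 4" by simp
  finally show ?thesis using A by (simp add: add_increasing2)
next
  case False
  then have "\<bar>z\<bar> \<le> \<bar>u\<bar> / A" using A by (simp add: field_simps)
  then have "\<bar>z\<bar> ^ 3 \<le> (\<bar>u\<bar> / A) ^ 3" by (intro power_mono) auto
  then have "\<bar>z\<bar> ^ 3 * \<bar>u\<bar> \<le> (\<bar>u\<bar> / A) ^ 3 * \<bar>u\<bar>" by (intro mult_right_mono) auto
  also have "\<dots> = \<bar>u\<bar> ^ 4 / A ^ 3" by (simp add: power_divide power3_eq_cube power4_eq_xxxx)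
  also have "\<dots> = u ^ 4 / A ^ 3" by simp
  finally have "\<bar>z\<bar> ^ 3 * \<bar>u\<bar> \<le> u ^ 4 / A ^ 3" .
  moreover have "z ^ 3 * u \<le> \<bar>z\<bar> ^ 3 * \<bar>u\<bar>" by (metis abs_ge_self abs_mult power_abs)
  moreover have "0 \<le> A * z ^ 4" using A by simp
  ultimately show ?thesis by linarith
qed

text \<open>z has the sign of x, so odd powers combine into absolute values.\<close>

lemma clip_cube: 
  fixes z x :: real
  assumes "\<bar>z\<bar> \<le> \<bar>x\<bar>" "0 \<le> x * z"
  shows "x * z ^ 3 = \<bar>x\<bar> * \<bar>z\<bar> ^ 3"
proof -
  have "x * z ^ 3 = (x * z) * z\<^sup>2" by (simp add: power3_eq_cube power2_eq_square)
  also have "\<dots> = \<bar>x * z\<bar> * z\<^sup>2" using assms(2) by simp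
  also have "\<dots> = \<bar>x\<bar> * \<bar>z\<bar> ^ 3" by (simp add: abs_mult power3_eq_cube power2_eq_square)
  finally show ?thesis .
qed

text \<open>Young with A = k/2 spends half of the damping. It produces (2/k)^3 = 8 / k^3, and the
  factor 4 of the derivative gives 32 / k^3.\<close>

lemma point_rho:
  fixes z \<rho> u :: real
  assumes z: "\<bar>z\<bar> \<le> \<bar>\<rho>\<bar>" "0 \<le> \<rho> * z" and k: "k > 0"
  shows "(u - k * \<rho>) * (4 * z ^ 3) \<le> 32 / k ^ 3 * u ^ 4 - k/2 * (\<rho> * (4 * z ^ 3))"
proof -
  have "z ^ 3 * u \<le> k/2 * z ^ 4 + u ^ 4 / (k/2) ^ 3" using k by (intro young_4) simp
  moreover have "u ^ 4 / (k/2) ^ 3 = 8 / k ^ 3 * u ^ 4" by (simp add: power_divide)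
  moreover have "z ^ 4 \<le> \<rho> * z ^ 3"
  proof -
    have "z ^ 4 = z\<^sup>2 * z\<^sup>2" by (simp add: power4_eq_xxxx power2_eq_square)
    also have "\<dots> \<le> (\<rho> * z) * z\<^sup>2" using clip_square_le[OF z] by (intro mult_right_mono) auto
    finally show ?thesis by (simp add: power3_eq_cube power2_eq_square mult.assoc)
  qed
  then have "k/2 * z ^ 4 \<le> k/2 * (\<rho> * z ^ 3)" using k by (intro mult_left_mono) auto
  moreover have "(u - k * \<rho>) * (4 * z ^ 3) = 4 * (z ^ 3 * u) - 4 * (k * (\<rho> * z ^ 3))" by (simp add: algebra_simps)
  moreover have "k/2 * (\<rho> * (4 * z ^ 3)) = 2 * (k * (\<rho> * z ^ 3))" by simp
  ultimately show ?thesis by linarith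
qed

text \<open>The cubic term offers the damping 4 b |u|^3 |z|^3. The terms in v and w take a quarter
  of it each. The remaining half beats every term of lower order, including the demanded damping L,
  once |u| is large; for smaller |u| those terms are bounded by C0. The coefficient 4 / b does not
  involve L.\<close>

lemma point_u:
  fixes a b J k1 \<delta> \<gamma> c L :: real
  assumes pos: "a > 0" "b > 0" "J > 0" "k1 > 0" "\<delta> > 0" "L > 0"
  shows "\<exists>C0\<ge>0. \<forall>z u v w \<rho>. \<bar>z\<bar> \<le> \<bar>u\<bar> \<longrightarrow> 0 \<le> u * z \<longrightarrow>
    (a * u\<^sup>2 - b * u ^ 3 + v - w + J - k1 * (c + \<gamma> * \<rho> + \<delta> * \<rho>\<^sup>2) * u) * (4 * z ^ 3)
      \<le> C0 + 4 / b * (v\<^sup>2 + w\<^sup>2) - L * (u * (4 * z ^ 3))"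
proof -
  \<comment> \<open>The minimum of \<gamma> \<rho> + \<delta> \<rho>^2 is - \<gamma>^2 / (4
    \<delta>), so the memristive coefficient is at least - \<kappa> whatever \<rho> is.\<close>
  define \<kappa> where "\<kappa> = \<bar>c\<bar> + \<gamma>\<^sup>2 / (4 * \<delta>)"
  \<comment> \<open>The total coefficient of |u| |z|^3: the worst memristive growth and the damping
    L that is to be produced.\<close>
  define M where "M = 4 * k1 * \<kappa> + 4 * L"
  \<comment> \<open>Chosen so that 2 b (R - 1) is the sum of all lower-order coefficients; for |u|
    >= R >= 1 the term 2 b |u|^3 dominates them.\<close>
  define R where "R = 1 + (4 * a + 4 * J + M) / (2 * b)"
  have \<kappa>0: "\<kappa> \<ge> 0" using pos by (simp add: \<kappa>_def)
  have M0: "M \<ge> 0" using pos \<kappa>0 by (simp add: M_def)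
  have R1: "R \<ge> 1" using pos M0 by (simp add: R_def)
  define C0 where "C0 = R ^ 3 * (4 * a * R\<^sup>2 + 4 * J + M * R)"
  have C0: "C0 \<ge> 0" using R1 pos M0 by (simp add: C0_def)
  have main: "(a * u\<^sup>2 - b * u ^ 3 + v - w + J - k1 * (c + \<gamma> * \<rho> + \<delta> * \<rho>\<^sup>2) * u) * (4 * z ^ 3)
      \<le> C0 + 4 / b * (v\<^sup>2 + w\<^sup>2) - L * (u * (4 * z ^ 3))"
    if z: "\<bar>z\<bar> \<le> \<bar>u\<bar>" "0 \<le> u * z" for z u v w \<rho> :: real
  proof -
    define y s where "y = \<bar>u\<bar>" and "s = \<bar>z\<bar> ^ 3"
    have y0: "0 \<le> y" "0 \<le> s" by (auto simp: y_def s_def)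
    have uz: "u * z ^ 3 = y * s" using clip_cube[OF z] by (simp add: y_def s_def)
    have uz3: "u ^ 3 * z ^ 3 = y ^ 3 * s"
    proof -
      have "u ^ 3 * z ^ 3 = u\<^sup>2 * (u * z ^ 3)" by (simp add: power3_eq_cube power2_eq_square)
      also have "\<dots> = y\<^sup>2 * (y * s)" unfolding uz by (simp add: y_def)
      finally show ?thesis by (simp add: power3_eq_cube power2_eq_square)
    qed
    have zs: "z ^ 3 \<le> s" "- (z ^ 3) \<le> s" unfolding s_def by (simp_all add: power_abs[symmetric])
    have t1: "a * u\<^sup>2 * z ^ 3 \<le> a * y\<^sup>2 * s"
    proof -
      have "a * u\<^sup>2 * z ^ 3 \<le> a * u\<^sup>2 * s" using zs(1) pos by (intro mult_left_mono) auto
      then show ?thesis by (simp add: y_def)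
    qed
    have s2: "s\<^sup>2 \<le> y ^ 3 * s"
    proof -
      have "s \<le> y ^ 3" unfolding s_def y_def using z(1) by (intro power_mono) auto
      then have "s * s \<le> y ^ 3 * s" using y0 by (intro mult_right_mono) auto
      then show ?thesis by (simp add: power2_eq_square)
    qed
    have vv: "4 * (z ^ 3 * v) \<le> b * (y ^ 3 * s) + 4 / b * v\<^sup>2" for v
    proof -
      have "4 * (z ^ 3 * v) = 2 * (z ^ 3 * (2 * v))" by simp
      also have "\<dots> \<le> b * (z ^ 3)\<^sup>2 + (2 * v)\<^sup>2 / b" by (rule young_square[OF pos(2)])
      also have "(z ^ 3)\<^sup>2 = s\<^sup>2" by (simp add: s_def power_abs[symmetric])
      also have "b * s\<^sup>2 + (2 * v)\<^sup>2 / b \<le> b * (y ^ 3 * s) + 4 / b * v\<^sup>2"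
        using s2 pos by (simp add: power_mult_distrib)
      finally show ?thesis .
    qed
    have tk: "- (k1 * (c + \<gamma> * \<rho> + \<delta> * \<rho>\<^sup>2) * u * z ^ 3) \<le> k1 * \<kappa> * (y * s)"
    proof -
      have "0 \<le> (\<delta> * \<rho> + \<gamma> / 2)\<^sup>2 / \<delta>" using pos by simp
      also have "\<dots> = \<delta> * \<rho>\<^sup>2 + \<gamma> * \<rho> + \<gamma>\<^sup>2 / (4 * \<delta>)"
        using pos by (simp add: power2_sum power_mult_distrib power_divide field_simps power2_eq_square)
      finally have "- (c + \<gamma> * \<rho> + \<delta> * \<rho>\<^sup>2) \<le> \<kappa>" unfolding \<kappa>_def by linarith
      then have "k1 * (y * s) * - (c + \<gamma> * \<rho> + \<delta> * \<rho>\<^sup>2) \<le> k1 * (y * s) * \<kappa>" using y0 pos by (intro mult_left_mono) auto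
      then show ?thesis unfolding uz[symmetric] by (simp add: algebra_simps)
    qed
    have tJ: "J * z ^ 3 \<le> J * s" using zs pos by (intro mult_left_mono) auto
    have poly: "s * (4 * a * y\<^sup>2 + 4 * J + M * y) - 2 * b * (y ^ 3 * s) \<le> C0"
    proof (cases "y \<ge> R")
      case True
      then have y1: "1 \<le> y" using R1 by simp
      have yy: "y \<le> y\<^sup>2" "1 \<le> y\<^sup>2" using y1 self_le_power[of y 2] one_le_power[of y 2] by auto
      have "4 * a * y\<^sup>2 + 4 * J + M * y \<le> 4 * a * y\<^sup>2 + 4 * J * y\<^sup>2 + M * y\<^sup>2"
        using yy pos M0 by (intro add_mono mult_left_mono) auto
      also have "\<dots> = (2 * b * (R - 1)) * y\<^sup>2" using pos by (simp add: R_def field_simps)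
      also have "\<dots> \<le> (2 * b * y) * y\<^sup>2" using True pos by (intro mult_right_mono mult_left_mono) auto
      also have "\<dots> = 2 * b * y ^ 3" by (simp add: power3_eq_cube power2_eq_square)
      finally have "s * (4 * a * y\<^sup>2 + 4 * J + M * y) \<le> s * (2 * b * y ^ 3)" using y0 by (intro mult_left_mono)
      then show ?thesis using C0 by (simp add: algebra_simps)
    next
      case False
      then have yR: "y \<le> R" by simp
      have "s \<le> R ^ 3"
      proof -
        have "\<bar>z\<bar> \<le> R" using z(1) yR by (simp add: y_def)
        then show ?thesis unfolding s_def by (intro power_mono) auto
      qed
      moreover have "4 * a * y\<^sup>2 + 4 * J + M * y \<le> 4 * a * R\<^sup>2 + 4 * J + M * R"
        using yR y0 pos M0 by (intro add_mono mult_left_mono power_mono) auto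
      ultimately have "s * (4 * a * y\<^sup>2 + 4 * J + M * y) \<le> C0" unfolding C0_def
        using y0 pos M0 R1 by (intro mult_mono) auto
      moreover have "0 \<le> 2 * b * (y ^ 3 * s)" using y0 pos by simp
      ultimately show ?thesis by linarith
    qed
    have e: "(a * u\<^sup>2 - b * u ^ 3 + v - w + J - k1 * (c + \<gamma> * \<rho> + \<delta> * \<rho>\<^sup>2) * u) * (4 * z ^ 3)
      = 4 * (a * u\<^sup>2 * z ^ 3) - 4 * b * (u ^ 3 * z ^ 3) + 4 * (z ^ 3 * v) + 4 * (z ^ 3 * (- w)) + 4 * (J * z ^ 3)
        + 4 * (- (k1 * (c + \<gamma> * \<rho> + \<delta> * \<rho>\<^sup>2) * u * z ^ 3))"
      by (simp add: algebra_simps)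
    have "\<dots> \<le> 4 * (a * y\<^sup>2 * s) - 4 * b * (y ^ 3 * s) + (b * (y ^ 3 * s) + 4 / b * v\<^sup>2) + (b * (y ^ 3 * s) + 4 / b * w\<^sup>2)
        + 4 * (J * s) + 4 * (k1 * \<kappa> * (y * s))"
      unfolding uz3 using t1 vv[of v] vv[of "- w", unfolded power2_minus] tJ tk by linarith
    also have "\<dots> = (s * (4 * a * y\<^sup>2 + 4 * J + M * y) - 2 * b * (y ^ 3 * s)) + 4 / b * (v\<^sup>2 + w\<^sup>2) - L * (4 * (y * s))"
      unfolding M_def by (simp add: algebra_simps add_divide_distrib)
    also have "\<dots> \<le> C0 + 4 / b * (v\<^sup>2 + w\<^sup>2) - L * (4 * (y * s))" using poly by simp
    also have "4 * (y * s) = u * (4 * z ^ 3)" using uz by simp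
    finally show ?thesis unfolding e .
  qed
  show ?thesis using C0 main by blast
qed

section \<open>The Lyapunov estimate\<close>

text \<open>fb is a joint Borel version of f, continuous in time with values in L^1; every component
  of the solution is handled through this one interface.\<close>

definition track :: "'a::euclidean_space set \<Rightarrow> (real \<Rightarrow> 'a \<Rightarrow> real) \<Rightarrow> (real \<Rightarrow> 'a \<Rightarrow> real) \<Rightarrow> bool" where
  "track \<Omega> f fb \<longleftrightarrow> joint_measurable fb \<and> (\<forall>t x. x \<notin> \<Omega> \<longrightarrow> fb t x = 0) \<and>
     (\<forall>t\<ge>0. Lp \<Omega> 2 (f t) \<and> rep \<Omega> (f t) (fb t)) \<and>
     (\<forall>t0\<ge>0. ((\<lambda>t. \<integral>x. \<bar>fb t x - fb t0 x\<bar> \<partial>lborel) \<longlongrightarrow> 0) (at t0 within {0..}))"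

lemma trackD:
  assumes "track \<Omega> f fb"
  shows "joint_measurable fb" "\<And>t x. x \<notin> \<Omega> \<Longrightarrow> fb t x = 0" "\<And>t. t \<ge> 0 \<Longrightarrow> Lp \<Omega> 2 (f t)"
    "\<And>t. t \<ge> 0 \<Longrightarrow> rep \<Omega> (f t) (fb t)"
    "\<And>t0. t0 \<ge> 0 \<Longrightarrow> ((\<lambda>t. \<integral>x. \<bar>fb t x - fb t0 x\<bar> \<partial>lborel) \<longlongrightarrow> 0) (at t0 within {0..})"
  using assms by (auto simp: track_def)

lemma track_ex:
  fixes f :: "real \<Rightarrow> 'a::euclidean_space \<Rightarrow> real"
  assumes \<Omega>: "open \<Omega>" "bounded \<Omega>" and L2: "\<And>t. t \<ge> 0 \<Longrightarrow> Lp \<Omega> 2 (f t)"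
    and cont: "\<And>t0. t0 \<ge> 0 \<Longrightarrow> ((\<lambda>t. L2_dist \<Omega> (f t) (f t0)) \<longlongrightarrow> 0) (at t0 within {0..})"
  shows "\<exists>fb. track \<Omega> f fb"
proof (rule joint_version[where f=f, OF \<Omega> L2 cont])
  fix F :: "real \<Rightarrow> 'a \<Rightarrow> real"
  assume F: "(\<lambda>(t,x). F t x) \<in> borel_measurable (lborel \<Otimes>\<^sub>M lborel)"
    "\<And>t x. x \<notin> \<Omega> \<Longrightarrow> F t x = 0" "\<And>t. t \<ge> 0 \<Longrightarrow> rep \<Omega> (f t) (F t)"
    "\<And>t0. t0 \<ge> 0 \<Longrightarrow> ((\<lambda>t. \<integral>x. \<bar>F t x - F t0 x\<bar> \<partial>lborel) \<longlongrightarrow> 0) (at t0 within {0..})"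
  have "track \<Omega> f F" unfolding track_def joint_measurable_def using F L2 by simp
  then show "\<exists>fb. track \<Omega> f fb" by blast
qed

lemma track_integrable:
  assumes \<Omega>: "open \<Omega>" "bounded \<Omega>" and tr: "track \<Omega> f fb"
  shows "\<And>t. t \<ge> 0 \<Longrightarrow> integrable lborel (fb t)" "\<And>t. t \<ge> 0 \<Longrightarrow> integrable lborel (\<lambda>x. (fb t x)\<^sup>2)"
    "loc_integrable fb"
proof -
  show i: "integrable lborel (fb t)" if "t \<ge> 0" for t by (rule rep_Lp_2(2)[OF \<Omega> trackD(3)[OF tr that] trackD(4)[OF tr that]])
  show "integrable lborel (\<lambda>x. (fb t x)\<^sup>2)" if "t \<ge> 0" for t by (rule rep_Lp_2(1)[OF \<Omega> trackD(3)[OF tr that] trackD(4)[OF tr that]])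
  show "loc_integrable fb" by (rule loc_integrable_L1_continuous[OF trackD(1)[OF tr] i trackD(5)[OF tr]])
qed

lemma track_energy_parabolic:
  assumes \<Omega>: "open \<Omega>" "bounded \<Omega>" and \<eta>: "\<eta> \<ge> 0" and tr: "track \<Omega> f fb"
    and h1: "\<And>T. T > 0 \<Longrightarrow> AE t in lebesgue_on {0..T}. H1 \<Omega> (f t)"
    and grad: "\<And>T. T > 0 \<Longrightarrow> set_integrable lborel {0..T} (\<lambda>t. \<integral>x. (norm (wgrad \<Omega> (f t) x))\<^sup>2 \<partial>lebesgue_on \<Omega>)"
    and Fb: "\<And>t. t \<ge> 0 \<Longrightarrow> rep \<Omega> (F t) (Fb t)" and Fl: "loc_integrable Fb" and Fm: "joint_measurable Fb"
    and weak: "\<And>\<psi> s t. test_space \<Omega> \<psi> \<Longrightarrow> 0 \<le> s \<Longrightarrow> s \<le> t \<Longrightarrow> weak_identity \<Omega> f \<psi>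
       (\<lambda>\<tau>. - \<eta> * (\<integral>x. wgrad \<Omega> (f \<tau>) x \<bullet> wgrad \<Omega> \<psi> x \<partial>lebesgue_on \<Omega>) + (\<integral>x. F \<tau> x * \<psi> x \<partial>lebesgue_on \<Omega>)) s t"
  shows "energy fb Fb"
proof (rule energyI[OF Fl trackD(1)[OF tr]])
  fix \<Phi> \<Phi>' and s T :: real assume sc: "smooth_convex \<Phi> \<Phi>'" and sT: "0 \<le> s" "s \<le> T"
  obtain \<Phi>'' C where cd: "convex_data \<Phi> \<Phi>' \<Phi>'' C" by (rule smooth_convexE[OF sc])
  show "(\<integral>x. \<Phi> (fb T x) \<partial>lborel) - (\<integral>x. \<Phi> (fb s x) \<partial>lborel) \<le> (LINT t:{s..T}|lborel. \<integral>x. Fb t x * \<Phi>' (fb t x) \<partial>lborel)"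
    by (rule parabolic_energy[OF \<Omega> \<eta> trackD(3)[OF tr] trackD(1)[OF tr, unfolded joint_measurable_def] trackD(4,5)[OF tr] h1 grad
          Fb loc_integrable_strip[OF Fl] Fm[unfolded joint_measurable_def] weak convex_dataD[OF cd] sT])
qed

lemma track_energy_ode:
  assumes \<Omega>: "open \<Omega>" "bounded \<Omega>" and tr: "track \<Omega> f fb"
    and Fb: "\<And>t. t \<ge> 0 \<Longrightarrow> rep \<Omega> (F t) (Fb t)" and Fl: "loc_integrable Fb"
    and weak: "\<And>\<psi> s t. test_space \<Omega> \<psi> \<Longrightarrow> 0 \<le> s \<Longrightarrow> s \<le> t \<Longrightarrow> weak_identity \<Omega> f \<psi>
       (\<lambda>\<tau>. \<integral>x. F \<tau> x * \<psi> x \<partial>lebesgue_on \<Omega>) s t"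
  shows "energy fb Fb"
proof (rule energyI[OF Fl trackD(1)[OF tr]])
  fix \<Phi> \<Phi>' and s T :: real assume sc: "smooth_convex \<Phi> \<Phi>'" and sT: "0 \<le> s" "s \<le> T"
  obtain \<Phi>'' C where cd: "convex_data \<Phi> \<Phi>' \<Phi>'' C" by (rule smooth_convexE[OF sc])
  show "(\<integral>x. \<Phi> (fb T x) \<partial>lborel) - (\<integral>x. \<Phi> (fb s x) \<partial>lborel) \<le> (LINT t:{s..T}|lborel. \<integral>x. Fb t x * \<Phi>' (fb t x) \<partial>lborel)"
    by (rule ode_energy[OF \<Omega> trackD(3)[OF tr] trackD(1)[OF tr, unfolded joint_measurable_def] trackD(4,5)[OF tr]
          Fb loc_integrable_strip[OF Fl] weak convex_dataD(1-7)[OF cd] sT])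
qed

text \<open>The monotonicity that \<open>coupling_nonpos\<close> asks of the test function.\<close>

lemma smooth_convex_mono:
  assumes "smooth_convex \<Phi> \<Phi>'" shows "(a - b) * (\<Phi>' a - \<Phi>' b) \<ge> 0"
proof -
  obtain \<Phi>'' C where cd: "convex_data \<Phi> \<Phi>' \<Phi>'' C" by (rule smooth_convexE[OF assms])
  have m: "\<Phi>' x \<le> \<Phi>' y" if "x \<le> y" for x y
    by (rule DERIV_nonneg_imp_nondecreasing[OF that]) (use convex_dataD(2,6)[OF cd] in blast)
  show ?thesis
  proof (cases "a \<le> b")
    case True
    then show ?thesis using m[OF True] by (intro mult_nonpos_nonpos) auto
  next
    case False
    then show ?thesis using m[of b a] by (intro mult_nonneg_nonneg) auto
  qed
qed

text \<open>A solution takes its initial value only up to a null set. The version at time 0 thus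
  also represents the prescribed datum, and so inherits the integrability of the datum.\<close>

lemma rep_L2_dist_0:
  assumes \<Omega>: "open \<Omega>" and f: "Lp \<Omega> 2 f" and g: "Lp \<Omega> 2 g" "rep \<Omega> g g'" and d: "L2_dist \<Omega> g f = 0"
  shows "rep \<Omega> f g'"
proof -
  have fm: "f \<in> borel_measurable (lebesgue_on \<Omega>)" using f by (simp add: Lp_2)
  obtain f' where f': "rep \<Omega> f f'" using rep_ex[OF \<Omega> fm] by blast
  have gi: "integrable (lebesgue_on \<Omega>) (\<lambda>x. (g x - f x)\<^sup>2)"
  proof (rule Bochner_Integration.integrable_bound)
    show "integrable (lebesgue_on \<Omega>) (\<lambda>x. 2 * (g x)\<^sup>2 + 2 * (f x)\<^sup>2)" using f g by (simp add: Lp_2)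
    note [measurable] = fm repD(1)[OF g(2)]
    show "(\<lambda>x. (g x - f x)\<^sup>2) \<in> borel_measurable (lebesgue_on \<Omega>)" by measurable
    have "(u - v)\<^sup>2 \<le> 2 * u\<^sup>2 + 2 * v\<^sup>2" for u v :: real
      using zero_le_power2[of "u + v"] by (simp add: power2_sum power2_diff)
    then show "AE x in lebesgue_on \<Omega>. norm ((g x - f x)\<^sup>2) \<le> norm (2 * (g x)\<^sup>2 + 2 * (f x)\<^sup>2)" by (intro AE_I2) simp
  qed
  have "(\<integral>x. (g x - f x)\<^sup>2 \<partial>lebesgue_on \<Omega>) = 0" using L2_dist_square[of \<Omega> g f] d by simp
  then have "AE x in lebesgue_on \<Omega>. (g x - f x)\<^sup>2 = 0" using gi by (subst (asm) integral_nonneg_eq_0_iff_AE) auto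
  then have "AE x in lborel. x \<in> \<Omega> \<longrightarrow> g x = f x" by (simp add: AE_lebesgue_on_open[OF \<Omega>])
  with repD(4)[OF g(2)] have "AE x in lborel. x \<in> \<Omega> \<longrightarrow> f x = g' x" by eventually_elim auto
  then show ?thesis using fm repD(2,3)[OF g(2)] by (simp add: rep_def)
qed

lemma Lp_4_imp_Lp_2:
  assumes \<Omega>: "open \<Omega>" "bounded \<Omega>" and f: "Lp \<Omega> 4 f" shows "Lp \<Omega> 2 f"
proof -
  interpret finite_measure "lebesgue_on \<Omega>" by (rule finite_measure_lebesgue_on_bounded[OF \<Omega>])
  have "integrable (lebesgue_on \<Omega>) (\<lambda>x. (f x)\<^sup>2)"
  proof (rule Bochner_Integration.integrable_bound)
    show "integrable (lebesgue_on \<Omega>) (\<lambda>x. 1 + f x ^ 4)" using f by (simp add: Lp_4)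
    have [measurable]: "f \<in> borel_measurable (lebesgue_on \<Omega>)" using f by (simp add: Lp_4)
    show "(\<lambda>x. (f x)\<^sup>2) \<in> borel_measurable (lebesgue_on \<Omega>)" by measurable
    have "(f x)\<^sup>2 \<le> 1 + f x ^ 4" for x using abs_le_1_plus_square[of "(f x)\<^sup>2"] by simp
    then show "AE x in lebesgue_on \<Omega>. norm ((f x)\<^sup>2) \<le> norm (1 + f x ^ 4)" by (intro AE_I2) simp
  qed
  then show ?thesis using f by (simp add: Lp_2 Lp_4)
qed

lemma in_G_imp_in_E: "open \<Omega> \<Longrightarrow> bounded \<Omega> \<Longrightarrow> in_G \<Omega> m g \<Longrightarrow> in_E \<Omega> m g"
  unfolding in_G_def in_E_def using Lp_4_imp_Lp_2 by blast

text \<open>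
  An integral form of Gronwall's lemma that needs no continuity of \<open>Y\<close>: before time \<open>C/M + 1\<close> the
  function must drop to \<open>2M/\<mu>\<close>, and after the last time it was that small it can only have decreased.
\<close>

lemma absorbing_bound:
  fixes Y :: "real \<Rightarrow> real"
  assumes int: "\<And>s t. 0 \<le> s \<Longrightarrow> s \<le> t \<Longrightarrow> set_integrable lborel {s..t} Y"
    and ineq: "\<And>s t. 0 \<le> s \<Longrightarrow> s \<le> t \<Longrightarrow> Y t - Y s \<le> (LINT \<tau>:{s..t}|lborel. M - \<mu> * Y \<tau>)"
    and Y0: "\<And>t. t \<ge> 0 \<Longrightarrow> 0 \<le> Y t" and M: "M > 0" and \<mu>: "\<mu> > 0" and C: "Y 0 \<le> C" and t: "t \<ge> C / M + 1"
  shows "Y t \<le> 2 * M / \<mu> + M"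
proof -
  \<comment> \<open>Above the level l the integrand M - \<mu> Y is at most - M.\<close>
  define l where "l = 2 * M / \<mu>"
  \<comment> \<open>If Y stayed above l on [0, T], then Y T would be at most C - M T = - M,
    contradicting Y >= 0.\<close>
  define T where "T = C / M + 1"
  have C0: "0 \<le> C" using Y0[of 0] C by simp
  have T: "T > 0" using C0 M by (simp add: T_def add_nonneg_pos)
  have cst: "set_integrable lborel {s..t} (\<lambda>_. c)" for s t c :: real
    using integrable_real_indicator[of "{s..t}" lborel] by (simp add: set_integrable_def emeasure_lborel_Icc_eq)
  have ri: "set_integrable lborel {s..t} (\<lambda>\<tau>. M - \<mu> * Y \<tau>)" if "0 \<le> s" "s \<le> t" for s t
    by (intro set_integral_diff(1) cst set_integrable_mult_right int that)
  have big: "M - \<mu> * Y \<tau> \<le> - M" if "Y \<tau> > l" for \<tau>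
  proof -
    have "2 * M < \<mu> * Y \<tau>" using that \<mu> by (simp add: l_def field_simps)
    then show ?thesis by simp
  qed
  have "\<exists>s0\<in>{0..T}. Y s0 \<le> l"
  proof (rule ccontr)
    assume "\<not> ?thesis"
    then have a: "Y \<tau> > l" if "\<tau> \<in> {0..T}" for \<tau> using that by force
    have "Y T - Y 0 \<le> (LINT \<tau>:{0..T}|lborel. M - \<mu> * Y \<tau>)" using T by (intro ineq) auto
    also have "\<dots> \<le> (LINT \<tau>:{0..T}|lborel. - M)"
    proof (rule set_integral_mono[OF ri cst])
      fix \<tau> assume "\<tau> \<in> {0..T}"
      from big[OF a[OF this]] show "M - \<mu> * Y \<tau> \<le> - M" .
    qed (use T in auto)
    also have "\<dots> = - (M * T)" using T by (simp add: set_lebesgue_integral_def mult.commute)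
    also have "M * T = C + M" using M by (simp add: T_def field_simps)
    finally show False using Y0[of T] C T M by simp
  qed
  then obtain s0 where s0: "0 \<le> s0" "s0 \<le> T" "Y s0 \<le> l" by auto
  \<comment> \<open>The supremum of these times need not be attained.\<close>
  define A where "A = {s\<in>{s0..t}. Y s \<le> l}"
  have tT: "T \<le> t" using t by (simp add: T_def)
  have A: "s0 \<in> A" "bdd_above A" using s0 tT by (auto simp: A_def intro!: bdd_aboveI[of _ t])
  define s1 where "s1 = Sup A"
  have s1: "s1 \<le> t" unfolding s1_def using A by (intro cSup_least) (auto simp: A_def)
  have le_s1: "a \<le> s1" if "a \<in> A" for a unfolding s1_def by (rule cSup_upper[OF that A(2)])
  \<comment> \<open>A time of A within distance 1 of the supremum: between s' and s1 the function
    gains at most M, the second summand of the bound.\<close>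
  obtain s' where s': "s' \<in> A" "s1 - 1 < s'" using less_cSupE[of "s1 - 1" A] A(1) unfolding s1_def by auto
  have s'0: "0 \<le> s'" "s' \<le> t" "Y s' \<le> l" "s' \<le> s1" using s' s0 le_s1 by (auto simp: A_def)
  have "Y t - Y s' \<le> (LINT \<tau>:{s'..t}|lborel. M - \<mu> * Y \<tau>)" by (rule ineq[OF s'0(1,2)])
  also have "\<dots> \<le> (LINT \<tau>:{s'..t}|lborel. indicator {s'..s1} \<tau> * M)"
  proof (rule set_integral_mono[OF ri[OF s'0(1,2)]])
    have "(\<lambda>\<tau>. indicator {s'..t} \<tau> *\<^sub>R (indicator {s'..s1} \<tau> * M)) = (\<lambda>\<tau>. indicator {s'..s1} \<tau> *\<^sub>R M)"
      using s1 by (auto simp: indicator_def fun_eq_iff)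
    then show "set_integrable lborel {s'..t} (\<lambda>\<tau>. indicator {s'..s1} \<tau> * M)"
      using cst[of s' s1 M] by (simp add: set_integrable_def)
    fix \<tau> assume \<tau>: "\<tau> \<in> {s'..t}"
    show "M - \<mu> * Y \<tau> \<le> indicator {s'..s1} \<tau> * M"
    proof (cases "\<tau> \<le> s1")
      case True
      have "0 \<le> \<mu> * Y \<tau>" using Y0[of \<tau>] \<mu> \<tau> s'0 by simp
      then show ?thesis using True \<tau> by simp
    next
      case False
      then have "\<tau> \<notin> A" using le_s1 by force
      moreover have "s0 \<le> s'" using s' by (simp add: A_def)
      ultimately have "Y \<tau> > l" using \<tau> by (simp add: A_def)
      from big[OF this] show ?thesis using False M by simp
    qed
  qed
  also have "\<dots> = (LINT \<tau>:{s'..s1}|lborel. M)"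
    unfolding set_lebesgue_integral_def using s1 by (intro Bochner_Integration.integral_cong) (auto simp: indicator_def)
  also have "\<dots> = M * (s1 - s')" using s'0 by (simp add: set_lebesgue_integral_def mult.commute)
  also have "\<dots> \<le> M * 1" using s'(2) M by (intro mult_left_mono) auto
  finally show ?thesis using s'0(3) by (simp add: l_def)
qed

text \<open>The weight K sits on the components without diffusion: it lets their damping outweigh
  the (4/b)(v^2 + w^2) that the u equation produces.\<close>

definition lyap :: "'a::euclidean_space set \<Rightarrow> nat \<Rightarrow> real \<Rightarrow> 'a hr_state \<Rightarrow> real" where
  "lyap \<Omega> m K g = (\<Sum>i=1..m. \<integral>x. (U g i x) ^ 4 \<partial>lebesgue_on \<Omega>)
     + K * ((\<Sum>i=1..m. \<integral>x. (V g i x)\<^sup>2 \<partial>lebesgue_on \<Omega>) + (\<Sum>i=1..m. \<integral>x. (W g i x)\<^sup>2 \<partial>lebesgue_on \<Omega>))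
     + (\<Sum>i=1..m. \<integral>x. (Rh g i x) ^ 4 \<partial>lebesgue_on \<Omega>)"

lemma strip_integral_nonneg: "(\<And>t x. 0 \<le> g t x) \<Longrightarrow> 0 \<le> strip_integral s T g"
  unfolding strip_integral_def by (intro integral_nonneg_AE AE_I2) (auto split: prod.split)

lemma strip_integral_indicator:
  assumes \<Omega>: "open \<Omega>" "bounded \<Omega>" and s: "0 \<le> s" "s \<le> T"
  shows "strip_integral s T (\<lambda>t x. indicator \<Omega> x) = (T - s) * measure lborel \<Omega>"
  using s \<Omega> by (subst strip_integral_Fubini[OF loc_integrable_indicator[OF \<Omega>] s(1)])
    (simp add: set_lebesgue_integral_def)

text \<open>
  The order of the stages matters: \<open>v\<close> and \<open>w\<close> are driven by \<open>u\<^sup>2\<close> only; \<open>\<rho> \<in> L\<^sup>4\<close> uses \<open>u \<in> L\<^sup>4\<close> of space-time;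
  and only then is the term \<open>\<rho>\<^sup>2 u\<close> known to be integrable, so that the equation for \<open>u\<close> can be tested.
\<close>

lemma hr_estimate:
  fixes \<Omega> :: "'a::euclidean_space set"
  assumes \<Omega>: "open \<Omega>" "bounded \<Omega>" and params: "hr_params_ok p"
  shows "\<exists>K>0. \<exists>M>0. \<exists>\<mu>>0. \<forall>g0 g. in_G \<Omega> m g0 \<longrightarrow> hr_weak_solution \<Omega> p m g0 g \<longrightarrow>
    (\<exists>Y. Y 0 = lyap \<Omega> m K g0 \<and> (\<forall>t\<ge>0. in_G \<Omega> m (g t) \<and> Y t = lyap \<Omega> m K (g t)) \<and>
      (\<forall>s t. 0 \<le> s \<longrightarrow> s \<le> t \<longrightarrow> set_integrable lborel {s..t} Y \<and> Y t - Y s \<le> (LINT \<tau>:{s..t}|lborel. M - \<mu> * Y \<tau>)))"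
proof -
  define a b \<eta>1 \<eta>2 \<alpha> \<beta> q r where "a = hr_a p" and "b = hr_b p" and "\<eta>1 = hr_eta1 p" and "\<eta>2 = hr_eta2 p"
    and "\<alpha> = hr_alpha p" and "\<beta> = hr_beta p" and "q = hr_q p" and "r = hr_r p"
  define \<delta> k1 k2 P Q J ue c \<gamma> where "\<delta> = hr_delta p" and "k1 = hr_k1 p" and "k2 = hr_k2 p" and "P = hr_P p"
    and "Q = hr_Q p" and "J = hr_Je p" and "ue = hr_ue p" and "c = hr_c p" and "\<gamma> = hr_gamma p"
  note pdefs = a_def b_def \<eta>1_def \<eta>2_def \<alpha>_def \<beta>_def q_def r_def \<delta>_def k1_def k2_def P_def Q_def J_def ue_def c_def \<gamma>_def
  have pos: "a > 0" "b > 0" "\<eta>1 > 0" "\<eta>2 > 0" "r > 0" "\<delta> > 0" "k1 > 0" "k2 > 0" "P > 0" "Q > 0" "J > 0"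
    using params by (simp_all add: hr_params_ok_def pdefs)
  define Cv where "Cv = 2 * \<alpha>\<^sup>2 + 2 * \<beta>\<^sup>2"
  define Cw where "Cw = 2 * q\<^sup>2 / r * (1 + ue\<^sup>2)"
  define Cr where "Cr = 32 / k2 ^ 3"
  \<comment> \<open>The two summands make both K and K r at least 4 / b + 1: v^2 and w^2 are damped
    at rates 1 and r, and each weighted rate must exceed 4 / b by 1.\<close>
  define K where "K = (4 / b + 1) + (4 / b + 1) / r"
  \<comment> \<open>Everything that the equations for v, w and \<rho> charge to u^4, plus a surplus
    of 1.\<close>
  define L where "L = K * (Cv + Cw) + Cr + 1"
  have C0: "0 \<le> Cv" "0 \<le> Cw" "0 \<le> Cr" using pos by (simp_all add: Cv_def Cw_def Cr_def)
  have K0: "K > 0" using pos by (simp add: K_def add_pos_pos)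
  have L1: "L \<ge> 1" using C0 K0 by (simp add: L_def)
  have K1: "4 / b - K \<le> - 1" "4 / b - K * r \<le> - 1"
  proof -
    have "0 \<le> (4 / b + 1) / r" "0 \<le> (4 / b + 1) * r" using pos by (auto intro!: mult_nonneg_nonneg add_nonneg_nonneg)
    moreover have "K * r = (4 / b + 1) * r + (4 / b + 1)" using pos by (simp add: K_def field_simps)
    ultimately show "4 / b - K \<le> - 1" "4 / b - K * r \<le> - 1" unfolding K_def by linarith+
  qed
  obtain Cu where Cu: "Cu \<ge> 0" and pu: "\<And>z u v w \<rho>. \<bar>z\<bar> \<le> \<bar>u\<bar> \<Longrightarrow> 0 \<le> u * z \<Longrightarrow>
    (a * u\<^sup>2 - b * u ^ 3 + v - w + J - k1 * (c + \<gamma> * \<rho> + \<delta> * \<rho>\<^sup>2) * u) * (4 * z ^ 3)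
      \<le> Cu + 4 / b * (v\<^sup>2 + w\<^sup>2) - L * (u * (4 * z ^ 3))"
    using point_u[of a b J k1 \<delta> L c \<gamma>] pos L1 by auto
  \<comment> \<open>The constant inputs of all m neurons integrated over \<Omega>; the leading 1
    makes M positive in every case.\<close>
  define M where "M = 1 + real m * (Cu + K * (Cv + Cw)) * measure lborel \<Omega>"
  \<comment> \<open>The rates left over are 1 for u^4, v^2 and w^2, and 2 k2 for \<rho>^4; dividing
    by the weight K of v^2 and w^2 gives 1 / K.\<close>
  define \<mu> where "\<mu> = min 1 (min (1 / K) (2 * k2))"
  have M0: "M > 0" unfolding M_def using Cu C0 K0 by (intro add_pos_nonneg mult_nonneg_nonneg) auto
  have \<mu>0: "\<mu> > 0" using K0 pos by (simp add: \<mu>_def)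
  have main: "\<exists>Y. Y 0 = lyap \<Omega> m K g0 \<and> (\<forall>t\<ge>0. in_G \<Omega> m (g t) \<and> Y t = lyap \<Omega> m K (g t)) \<and>
      (\<forall>s t. 0 \<le> s \<longrightarrow> s \<le> t \<longrightarrow> set_integrable lborel {s..t} Y \<and> Y t - Y s \<le> (LINT \<tau>:{s..t}|lborel. M - \<mu> * Y \<tau>))"
    if g0: "in_G \<Omega> m g0" and sol: "hr_weak_solution \<Omega> p m g0 g" for g0 g
  proof -
    define I where "I = {1..m}"
    have finI: "finite I" by (simp add: I_def)
    have init: "L2_dist \<Omega> (U (g 0) i) (U g0 i) = 0" "L2_dist \<Omega> (V (g 0) i) (V g0 i) = 0"
      "L2_dist \<Omega> (W (g 0) i) (W g0 i) = 0" "L2_dist \<Omega> (Rh (g 0) i) (Rh g0 i) = 0" if "i \<in> I" for i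
      using sol that unfolding hr_weak_solution_def I_def by blast+
    have E: "in_E \<Omega> m (g t)" if "t \<ge> 0" for t using sol that unfolding hr_weak_solution_def by blast
    have L2: "Lp \<Omega> 2 (U (g t) i)" "Lp \<Omega> 2 (V (g t) i)" "Lp \<Omega> 2 (W (g t) i)" "Lp \<Omega> 2 (Rh (g t) i)" if "i \<in> I" "t \<ge> 0" for i t
      using E[OF that(2)] that(1) unfolding in_E_def I_def by blast+
    have cont: "((\<lambda>t. L2_dist \<Omega> (U (g t) i) (U (g t0) i)) \<longlongrightarrow> 0) (at t0 within {0..})"
      "((\<lambda>t. L2_dist \<Omega> (V (g t) i) (V (g t0) i)) \<longlongrightarrow> 0) (at t0 within {0..})"
      "((\<lambda>t. L2_dist \<Omega> (W (g t) i) (W (g t0) i)) \<longlongrightarrow> 0) (at t0 within {0..})"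
      "((\<lambda>t. L2_dist \<Omega> (Rh (g t) i) (Rh (g t0) i)) \<longlongrightarrow> 0) (at t0 within {0..})" if "i \<in> I" "t0 \<ge> 0" for i t0
      using sol that unfolding hr_weak_solution_def I_def by blast+
    have reg: "AE t in lebesgue_on {0..T}. H1 \<Omega> (U (g t) i) \<and> H1 \<Omega> (Rh (g t) i) \<and> Lp \<Omega> 4 (U (g t) i)"
      "set_integrable lborel {0..T} (\<lambda>t. \<integral>x. (norm (wgrad \<Omega> (U (g t) i) x))\<^sup>2 \<partial>lebesgue_on \<Omega>)"
      "set_integrable lborel {0..T} (\<lambda>t. \<integral>x. (norm (wgrad \<Omega> (Rh (g t) i) x))\<^sup>2 \<partial>lebesgue_on \<Omega>)"
      "set_integrable lborel {0..T} (\<lambda>t. \<integral>x. (U (g t) i x) ^ 4 \<partial>lebesgue_on \<Omega>)" if "i \<in> I" "T > 0" for i T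
      using sol that unfolding hr_weak_solution_def I_def by blast+
    have weak: "weak_identity \<Omega> (\<lambda>\<tau>. U (g \<tau>) i) \<psi>
          (\<lambda>\<tau>. - hr_eta1 p * (\<integral>x. wgrad \<Omega> (U (g \<tau>) i) x \<bullet> wgrad \<Omega> \<psi> x \<partial>lebesgue_on \<Omega>)
                + (\<integral>x. F_u p m (g \<tau>) i x * \<psi> x \<partial>lebesgue_on \<Omega>)) s t"
      "weak_identity \<Omega> (\<lambda>\<tau>. V (g \<tau>) i) \<psi> (\<lambda>\<tau>. \<integral>x. F_v p (g \<tau>) i x * \<psi> x \<partial>lebesgue_on \<Omega>) s t"
      "weak_identity \<Omega> (\<lambda>\<tau>. W (g \<tau>) i) \<psi> (\<lambda>\<tau>. \<integral>x. F_w p (g \<tau>) i x * \<psi> x \<partial>lebesgue_on \<Omega>) s t"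
      "weak_identity \<Omega> (\<lambda>\<tau>. Rh (g \<tau>) i) \<psi>
          (\<lambda>\<tau>. - hr_eta2 p * (\<integral>x. wgrad \<Omega> (Rh (g \<tau>) i) x \<bullet> wgrad \<Omega> \<psi> x \<partial>lebesgue_on \<Omega>)
                + (\<integral>x. F_rho p m (g \<tau>) i x * \<psi> x \<partial>lebesgue_on \<Omega>)) s t"
      if "i \<in> I" "test_space \<Omega> \<psi>" "0 \<le> s" "s \<le> t" for i \<psi> s t
      using sol that unfolding hr_weak_solution_def I_def by blast+
    have "\<exists>f. track \<Omega> (\<lambda>t. U (g t) i) f" if i: "i \<in> I" for i
      using L2(1)[OF i] cont(1)[OF i] by (intro track_ex[OF \<Omega>])
    then obtain u where u: "\<And>i. i \<in> I \<Longrightarrow> track \<Omega> (\<lambda>t. U (g t) i) (u i)" by metis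
    have "\<exists>f. track \<Omega> (\<lambda>t. V (g t) i) f" if i: "i \<in> I" for i
      using L2(2)[OF i] cont(2)[OF i] by (intro track_ex[OF \<Omega>])
    then obtain v where v: "\<And>i. i \<in> I \<Longrightarrow> track \<Omega> (\<lambda>t. V (g t) i) (v i)" by metis
    have "\<exists>f. track \<Omega> (\<lambda>t. W (g t) i) f" if i: "i \<in> I" for i
      using L2(3)[OF i] cont(3)[OF i] by (intro track_ex[OF \<Omega>])
    then obtain w where w: "\<And>i. i \<in> I \<Longrightarrow> track \<Omega> (\<lambda>t. W (g t) i) (w i)" by metis
    have "\<exists>f. track \<Omega> (\<lambda>t. Rh (g t) i) f" if i: "i \<in> I" for i
      using L2(4)[OF i] cont(4)[OF i] by (intro track_ex[OF \<Omega>])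
    then obtain \<rho> where \<rho>: "\<And>i. i \<in> I \<Longrightarrow> track \<Omega> (\<lambda>t. Rh (g t) i) (\<rho> i)" by metis
    note jm = trackD(1)[OF u] trackD(1)[OF v] trackD(1)[OF w] trackD(1)[OF \<rho>]
    note zero = trackD(2)[OF u] trackD(2)[OF v] trackD(2)[OF w] trackD(2)[OF \<rho>]
    note ru = trackD(4)[OF u] and rv = trackD(4)[OF v] and rw = trackD(4)[OF w] and r\<rho> = trackD(4)[OF \<rho>]
    note tiu = track_integrable[OF \<Omega> u] and tiv = track_integrable[OF \<Omega> v]
      and tiw = track_integrable[OF \<Omega> w] and ti\<rho> = track_integrable[OF \<Omega> \<rho>]
    \<comment> \<open>Constants in the equations become multiples of the indicator, because versions
      vanish outside \<Omega>.\<close>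
    define one where "one t x = (indicator \<Omega> x :: real)" for t :: real and x
    have onel: "loc_integrable one" unfolding one_def by (rule loc_integrable_indicator[OF \<Omega>])
    have onem: "joint_measurable one" unfolding one_def by (rule joint_measurable_indicator[OF \<Omega>(1)])
    have one1: "x \<in> \<Omega> \<Longrightarrow> one t x = 1" and one0: "x \<notin> \<Omega> \<Longrightarrow> one t x = 0" for t x by (auto simp: one_def)
    \<comment> \<open>The notion of solution gives L^4 slice by slice and a time integral of the
      fourth powers; on the joint version u Fubini's criterion combines the two.\<close>
    have u4: "loc_integrable (\<lambda>t x. u i t x ^ 4)" if i: "i \<in> I" for i
      unfolding loc_integrable_def
    proof
      fix T :: real
      \<comment> \<open>The regularity assumptions are stated for T > 0 only.\<close>
      define T' where "T' = max T 1"
      have T': "T' > 0" "T \<le> T'" by (auto simp: T'_def)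
      note [measurable] = joint_measurableD[OF jm(1)[OF i]]
      have eq: "(\<integral>x. (U (g t) i x) ^ 4 \<partial>lebesgue_on \<Omega>) = (\<integral>x. u i t x ^ 4 \<partial>lborel)" if "t \<ge> 0" for t
        by (rule rep_integral[OF \<Omega>(1) rep_power[OF ru[OF i that]]]) simp
      have ii: "integrable lborel (\<lambda>x. u i t x ^ 4)" if "t \<ge> 0" "Lp \<Omega> 4 (U (g t) i)" for t
        using that(2) rep_integrable[OF \<Omega>(1) rep_power[OF ru[OF i that(1)], of 4]] by (simp add: Lp_4)
      show "integrable (lborel \<Otimes>\<^sub>M lborel) (\<lambda>(t,x). indicator {0..T} t * u i t x ^ 4)"
      proof (rule lborel_pair.Fubini_integrable)
        show "(\<lambda>(t,x). indicator {0..T} t * u i t x ^ 4) \<in> borel_measurable (lborel \<Otimes>\<^sub>M lborel)" unfolding split_beta' by measurable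
        show "AE t in lborel. integrable lborel (\<lambda>x. case (t, x) of (t,x) \<Rightarrow> indicator {0..T} t * u i t x ^ 4)"
          using reg(1)[OF i T'(1)] unfolding AE_lebesgue_on_Icc
        proof eventually_elim
          case (elim t)
          show ?case
          proof (cases "t \<in> {0..T}")
            case True
            then show ?thesis using elim ii[of t] T' by simp
          qed simp
        qed
        show "integrable lborel (\<lambda>t. \<integral>x. norm (case (t, x) of (t,x) \<Rightarrow> indicator {0..T} t * u i t x ^ 4) \<partial>lborel)"
        proof (rule Bochner_Integration.integrable_bound[OF reg(4)[OF i T'(1), unfolded set_integrable_def]])
          show "(\<lambda>t. \<integral>x. norm (case (t, x) of (t,x) \<Rightarrow> indicator {0..T} t * u i t x ^ 4) \<partial>lborel) \<in> borel_measurable lborel" by measurable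
          show "AE t in lborel. norm (\<integral>x. norm (case (t, x) of (t,x) \<Rightarrow> indicator {0..T} t * u i t x ^ 4) \<partial>lborel)
            \<le> norm (indicator {0..T'} t *\<^sub>R (\<integral>x. (U (g t) i x) ^ 4 \<partial>lebesgue_on \<Omega>))"
          proof (rule AE_I2)
            fix t
            show "norm (\<integral>x. norm (case (t, x) of (t,x) \<Rightarrow> indicator {0..T} t * u i t x ^ 4) \<partial>lborel)
              \<le> norm (indicator {0..T'} t *\<^sub>R (\<integral>x. (U (g t) i x) ^ 4 \<partial>lebesgue_on \<Omega>))"
            proof (cases "t \<in> {0..T}")
              case True
              then show ?thesis using eq[of t] T' by simp
            qed simp
          qed
        qed
      qed
    qed
    have pw2: "\<bar>y\<^sup>2\<bar> \<le> 1 + y ^ 4" for y :: real using abs_le_1_plus_square[of "y\<^sup>2"] by simp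
    have pw3: "\<bar>y ^ 3\<bar> \<le> 1 + y ^ 4" for y :: real
    proof (cases "\<bar>y\<bar> \<le> 1")
      case True
      then have "\<bar>y ^ 3\<bar> \<le> 1" by (simp add: power_abs power_le_one)
      moreover have "0 \<le> y ^ 4" by simp
      ultimately show ?thesis by linarith
    next
      case False
      then have "\<bar>y\<bar> ^ 3 \<le> \<bar>y\<bar> ^ 4" by (intro power_increasing) auto
      then show ?thesis by (simp add: power_abs)
    qed
    have u2: "loc_integrable (\<lambda>t x. (u i t x)\<^sup>2)" if i: "i \<in> I" for i
    proof (rule loc_integrable_bound[OF loc_integrable_add[OF onel u4[OF i]]])
      show "joint_measurable (\<lambda>t x. (u i t x)\<^sup>2)" by (rule joint_measurable_power[OF jm(1)[OF i]])
      show "\<bar>(u i t x)\<^sup>2\<bar> \<le> one t x + u i t x ^ 4" for t x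
        using pw2[of "u i t x"] one1[of x t] zero(1)[OF i, of x t] one0[of x t] by (cases "x \<in> \<Omega>") auto
    qed
    have u3: "loc_integrable (\<lambda>t x. u i t x ^ 3)" if i: "i \<in> I" for i
    proof (rule loc_integrable_bound[OF loc_integrable_add[OF onel u4[OF i]]])
      show "joint_measurable (\<lambda>t x. u i t x ^ 3)" by (rule joint_measurable_power[OF jm(1)[OF i]])
      show "\<bar>u i t x ^ 3\<bar> \<le> one t x + u i t x ^ 4" for t x
        using pw3[of "u i t x"] one1[of x t] zero(1)[OF i, of x t] one0[of x t] by (cases "x \<in> \<Omega>") auto
    qed
    note jmc = joint_measurable_mult[OF joint_measurable_const]
    have e1: "0 < eps n" for n by (rule eps(1))
    note clip = soft_clip_abs_le[OF e1] soft_clip_sign[OF e1]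
    have clip0: "soft_clip e 0 = 0" for e by (simp add: soft_clip_def)
    define Fv where "Fv i t x = \<alpha> * one t x - \<beta> * (u i t x)\<^sup>2 - v i t x" for i t x
    have Fvl: "loc_integrable (Fv i)" if i: "i \<in> I" for i
      unfolding Fv_def by (intro loc_integrable_diff loc_integrable_cmult onel u2[OF i] tiv(3)[OF i])
    have Fvr: "rep \<Omega> (F_v p (g t) i) (Fv i t)" if i: "i \<in> I" and t: "t \<ge> 0" for i t
      unfolding F_v_def Fv_def one_def \<alpha>_def \<beta>_def
      by (rule rep_diff[OF rep_diff[OF rep_const[OF \<Omega>(1)] rep_cmult[OF rep_power[OF ru[OF i t]]]] rv[OF i t]]) simp
    have env: "energy (v i) (Fv i)" if i: "i \<in> I" for i
      by (rule track_energy_ode[where F="\<lambda>t. F_v p (g t) i", OF \<Omega> v[OF i] Fvr[OF i] Fvl[OF i] weak(2)[OF i]])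
    define Gv where "Gv t x = (\<Sum>i\<in>I. Cv * (one t x + u i t x ^ 4))" for t x
    have Gvl: "loc_integrable Gv" unfolding Gv_def by (intro loc_integrable_sum loc_integrable_cmult loc_integrable_add onel u4)
    have pwv: "(\<Sum>i\<in>I. Fv i t x * (2 * soft_clip (eps n) (v i t x))) \<le> Gv t x - 1/2 * (\<Sum>i\<in>I. v i t x * (2 * soft_clip (eps n) (v i t x)))" for n t x
      unfolding Gv_def sum_distrib_left sum_subtractf[symmetric]
    proof (rule sum_mono)
      fix i assume i: "i \<in> I"
      show "Fv i t x * (2 * soft_clip (eps n) (v i t x)) \<le> Cv * (one t x + u i t x ^ 4) - 1/2 * (v i t x * (2 * soft_clip (eps n) (v i t x)))"
      proof (cases "x \<in> \<Omega>")
        case True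
        then show ?thesis using point_v[OF clip, where \<alpha>=\<alpha> and \<beta>=\<beta> and u="u i t x"] by (simp only: Fv_def Cv_def one1 mult_1_right)
      next
        case False
        then show ?thesis using zero[OF i] one0 by (simp add: clip0)
      qed
    qed
    \<comment> \<open>Square integrability of v at each time is already known; the gain is
      integrability of v^2 in space-time and the decay inequality.\<close>
    note SV = truncation_stage[where f=v and F=Fv and G=Gv and I=I and c="1/2", OF truncation_2 _ _ finI env jm(2) tiv(1) tiv(3) Fvl Gvl pwv]
    have v2i: "integrable lborel (\<lambda>x. (v i 0 x)\<^sup>2)" if "i \<in> I" for i by (rule tiv(2)[OF that]) simp
    have v2l: "loc_integrable (\<lambda>t x. (v i t x)\<^sup>2)" if "i \<in> I" for i by (rule SV(2)) (use v2i that in auto)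
    have Vineq: "(\<Sum>i\<in>I. \<integral>x. (v i T x)\<^sup>2 \<partial>lborel) - (\<Sum>i\<in>I. \<integral>x. (v i s x)\<^sup>2 \<partial>lborel)
        \<le> strip_integral s T Gv - 1/2 * 2 * (\<Sum>i\<in>I. strip_integral s T (\<lambda>t x. (v i t x)\<^sup>2))" if "0 \<le> s" "s \<le> T" for s T
      by (rule SV(3)) (use v2i that in auto)
    define Fw where "Fw i t x = q * (u i t x - ue * one t x) - r * w i t x" for i t x
    have Fwl: "loc_integrable (Fw i)" if i: "i \<in> I" for i
      unfolding Fw_def by (intro loc_integrable_diff loc_integrable_cmult onel tiu(3)[OF i] tiw(3)[OF i])
    have Fwr: "rep \<Omega> (F_w p (g t) i) (Fw i t)" if i: "i \<in> I" and t: "t \<ge> 0" for i t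
      unfolding F_w_def Fw_def one_def q_def r_def ue_def
      by (rule rep_diff[OF rep_cmult[OF rep_diff[OF ru[OF i t] rep_const[OF \<Omega>(1)]]] rep_cmult[OF rw[OF i t]]])
    have enw: "energy (w i) (Fw i)" if i: "i \<in> I" for i
      by (rule track_energy_ode[where F="\<lambda>t. F_w p (g t) i", OF \<Omega> w[OF i] Fwr[OF i] Fwl[OF i] weak(3)[OF i]])
    define Gw where "Gw t x = (\<Sum>i\<in>I. Cw * (one t x + u i t x ^ 4))" for t x
    have Gwl: "loc_integrable Gw" unfolding Gw_def by (intro loc_integrable_sum loc_integrable_cmult loc_integrable_add onel u4)
    have pww: "(\<Sum>i\<in>I. Fw i t x * (2 * soft_clip (eps n) (w i t x))) \<le> Gw t x - r/2 * (\<Sum>i\<in>I. w i t x * (2 * soft_clip (eps n) (w i t x)))" for n t x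
      unfolding Gw_def sum_distrib_left sum_subtractf[symmetric]
    proof (rule sum_mono)
      fix i assume i: "i \<in> I"
      show "Fw i t x * (2 * soft_clip (eps n) (w i t x)) \<le> Cw * (one t x + u i t x ^ 4) - r/2 * (w i t x * (2 * soft_clip (eps n) (w i t x)))"
      proof (cases "x \<in> \<Omega>")
        case True
        then show ?thesis using point_w[OF clip pos(5), where q=q and ue=ue and u="u i t x"] by (simp only: Fw_def Cw_def one1 mult_1_right)
      next
        case False
        then show ?thesis using zero[OF i] one0 by (simp add: clip0)
      qed
    qed
    note SW = truncation_stage[where f=w and F=Fw and G=Gw and I=I and c="r/2", OF truncation_2 _ _ finI enw jm(3) tiw(1) tiw(3) Fwl Gwl pww]
    have w2i: "integrable lborel (\<lambda>x. (w i 0 x)\<^sup>2)" if "i \<in> I" for i by (rule tiw(2)[OF that]) simp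
    have w2l: "loc_integrable (\<lambda>t x. (w i t x)\<^sup>2)" if "i \<in> I" for i by (rule SW(2)) (use w2i that pos in auto)
    have Wineq: "(\<Sum>i\<in>I. \<integral>x. (w i T x)\<^sup>2 \<partial>lborel) - (\<Sum>i\<in>I. \<integral>x. (w i s x)\<^sup>2 \<partial>lborel)
        \<le> strip_integral s T Gw - r/2 * 2 * (\<Sum>i\<in>I. strip_integral s T (\<lambda>t x. (w i t x)\<^sup>2))" if "0 \<le> s" "s \<le> T" for s T
      by (rule SW(3)) (use w2i that pos in auto)
    have r0: "rep \<Omega> (U g0 i) (u i 0)" "rep \<Omega> (V g0 i) (v i 0)" "rep \<Omega> (W g0 i) (w i 0)" "rep \<Omega> (Rh g0 i) (\<rho> i 0)" if i: "i \<in> I" for i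
    proof -
      have e0: "in_E \<Omega> m g0" by (rule in_G_imp_in_E[OF \<Omega> g0])
      have L: "Lp \<Omega> 2 (U g0 i)" "Lp \<Omega> 2 (V g0 i)" "Lp \<Omega> 2 (W g0 i)" "Lp \<Omega> 2 (Rh g0 i)"
        using e0 i unfolding in_E_def I_def by blast+
      show "rep \<Omega> (U g0 i) (u i 0)" using rep_L2_dist_0[OF \<Omega>(1) L(1) trackD(3,4)[OF u[OF i]] init(1)[OF i]] by simp
      show "rep \<Omega> (V g0 i) (v i 0)" using rep_L2_dist_0[OF \<Omega>(1) L(2) trackD(3,4)[OF v[OF i]] init(2)[OF i]] by simp
      show "rep \<Omega> (W g0 i) (w i 0)" using rep_L2_dist_0[OF \<Omega>(1) L(3) trackD(3,4)[OF w[OF i]] init(3)[OF i]] by simp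
      show "rep \<Omega> (Rh g0 i) (\<rho> i 0)" using rep_L2_dist_0[OF \<Omega>(1) L(4) trackD(3,4)[OF \<rho>[OF i]] init(4)[OF i]] by simp
    qed
    \<comment> \<open>The one use of the datum lying in G rather than merely in E: L^4 at time 0
      starts the truncation argument for u and \<rho>.\<close>
    have u4i: "integrable lborel (\<lambda>x. u i 0 x ^ 4)" and \<rho>4i: "integrable lborel (\<lambda>x. \<rho> i 0 x ^ 4)" if i: "i \<in> I" for i
    proof -
      have "Lp \<Omega> 4 (U g0 i)" "Lp \<Omega> 4 (Rh g0 i)" using g0 i unfolding in_G_def I_def by blast+
      then show "integrable lborel (\<lambda>x. u i 0 x ^ 4)" "integrable lborel (\<lambda>x. \<rho> i 0 x ^ 4)"
        using rep_integrable[OF \<Omega>(1) rep_power[OF r0(1)[OF i], of 4]] rep_integrable[OF \<Omega>(1) rep_power[OF r0(4)[OF i], of 4]]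
        by (simp_all add: Lp_4)
    qed
    define Fr where "Fr i t x = u i t x - k2 * \<rho> i t x + (\<Sum>j\<in>I. Q * (\<rho> j t x - \<rho> i t x))" for i t x
    have Frl: "loc_integrable (Fr i)" if i: "i \<in> I" for i
      unfolding Fr_def by (intro loc_integrable_add loc_integrable_diff loc_integrable_cmult loc_integrable_sum tiu(3) ti\<rho>(3) i)
    have Frm: "joint_measurable (Fr i)" if i: "i \<in> I" for i
      unfolding Fr_def by (intro joint_measurable_add joint_measurable_diff joint_measurable_sum jmc jm i)
    have Frr: "rep \<Omega> (F_rho p m (g t) i) (Fr i t)" if i: "i \<in> I" and t: "t \<ge> 0" for i t
      unfolding F_rho_def Fr_def Q_def k2_def I_def
      by (rule rep_add[OF rep_diff[OF ru[OF i t] rep_cmult[OF r\<rho>[OF i t]]] rep_sum[OF rep_cmult[OF rep_diff[OF r\<rho>[OF _ t] r\<rho>[OF i t]]]]])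
        (simp add: I_def)
    have enr: "energy (\<rho> i) (Fr i)" if i: "i \<in> I" for i
    proof (rule track_energy_parabolic[where F="\<lambda>t. F_rho p m (g t) i" and \<eta>=\<eta>2, OF \<Omega> _ \<rho>[OF i] _ _ Frr[OF i] Frl[OF i] Frm[OF i]])
      show "AE t in lebesgue_on {0..T}. H1 \<Omega> (Rh (g t) i)" if "T > 0" for T
        using reg(1)[OF i that] by eventually_elim simp
    qed (use reg(3)[OF i] weak(4)[OF i] pos in \<open>simp_all add: \<eta>2_def\<close>)
    define Gr where "Gr t x = (\<Sum>i\<in>I. Cr * u i t x ^ 4)" for t x
    have Grl: "loc_integrable Gr" unfolding Gr_def by (intro loc_integrable_sum loc_integrable_cmult u4)
    \<comment> \<open>The clipped cubes are derivatives of the convex functions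
      \<open>trunc4\<close>, hence nondecreasing.\<close>
    have coup: "(\<Sum>i\<in>I. (\<Sum>j\<in>I. C * (y j - y i)) * (4 * soft_clip (eps n) (y i) ^ 3)) \<le> 0" if "C \<ge> 0" for C y n
      unfolding I_def by (rule coupling_nonpos[OF smooth_convex_mono[OF smooth_convex_trunc4] that])
    have pwr: "(\<Sum>i\<in>I. Fr i t x * (4 * soft_clip (eps n) (\<rho> i t x) ^ 3)) \<le> Gr t x - k2/2 * (\<Sum>i\<in>I. \<rho> i t x * (4 * soft_clip (eps n) (\<rho> i t x) ^ 3))" for n t x
    proof -
      have "(\<Sum>i\<in>I. Fr i t x * (4 * soft_clip (eps n) (\<rho> i t x) ^ 3)) =
         (\<Sum>i\<in>I. (u i t x - k2 * \<rho> i t x) * (4 * soft_clip (eps n) (\<rho> i t x) ^ 3)) +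
         (\<Sum>i\<in>I. (\<Sum>j\<in>I. Q * (\<rho> j t x - \<rho> i t x)) * (4 * soft_clip (eps n) (\<rho> i t x) ^ 3))"
        unfolding Fr_def distrib_right by (rule sum.distrib)
      also have "\<dots> \<le> (\<Sum>i\<in>I. (u i t x - k2 * \<rho> i t x) * (4 * soft_clip (eps n) (\<rho> i t x) ^ 3))"
        using coup[of Q "\<lambda>i. \<rho> i t x" n] pos by simp
      also have "\<dots> \<le> (\<Sum>i\<in>I. Cr * u i t x ^ 4 - k2/2 * (\<rho> i t x * (4 * soft_clip (eps n) (\<rho> i t x) ^ 3)))"
        unfolding Cr_def by (intro sum_mono point_rho clip pos)
      also have "\<dots> = Gr t x - k2/2 * (\<Sum>i\<in>I. \<rho> i t x * (4 * soft_clip (eps n) (\<rho> i t x) ^ 3))"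
        unfolding Gr_def sum_distrib_left sum_subtractf ..
      finally show ?thesis .
    qed
    note SR = truncation_stage[where f=\<rho> and F=Fr and G=Gr and I=I and c="k2/2", OF truncation_4 _ _ finI enr jm(4) ti\<rho>(1) ti\<rho>(3) Frl Grl pwr \<rho>4i]
    have \<rho>4t: "integrable lborel (\<lambda>x. \<rho> i t x ^ 4)" if "i \<in> I" "t \<ge> 0" for i t by (rule SR(1)) (use that pos in auto)
    have \<rho>4l: "loc_integrable (\<lambda>t x. \<rho> i t x ^ 4)" if "i \<in> I" for i by (rule SR(2)) (use that pos in auto)
    have Rineq: "(\<Sum>i\<in>I. \<integral>x. \<rho> i T x ^ 4 \<partial>lborel) - (\<Sum>i\<in>I. \<integral>x. \<rho> i s x ^ 4 \<partial>lborel)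
        \<le> strip_integral s T Gr - k2/2 * 4 * (\<Sum>i\<in>I. strip_integral s T (\<lambda>t x. \<rho> i t x ^ 4))" if "0 \<le> s" "s \<le> T" for s T
      by (rule SR(3)) (use that pos in auto)
    have \<rho>2: "loc_integrable (\<lambda>t x. (\<rho> i t x)\<^sup>2)" if i: "i \<in> I" for i
    proof (rule loc_integrable_bound[OF loc_integrable_add[OF onel \<rho>4l[OF i]]])
      show "joint_measurable (\<lambda>t x. (\<rho> i t x)\<^sup>2)" by (rule joint_measurable_power[OF jm(4)[OF i]])
      show "\<bar>(\<rho> i t x)\<^sup>2\<bar> \<le> one t x + \<rho> i t x ^ 4" for t x
        using pw2[of "\<rho> i t x"] one1[of x t] zero(4)[OF i, of x t] one0[of x t] by (cases "x \<in> \<Omega>") auto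
    qed
    have prod2: "\<bar>y * y'\<bar> \<le> y\<^sup>2 + y'\<^sup>2" for y y' :: real
    proof -
      have "2 * (\<bar>y\<bar> * \<bar>y'\<bar>) \<le> y\<^sup>2 + y'\<^sup>2" using zero_le_power2[of "\<bar>y\<bar> - \<bar>y'\<bar>"] by (simp add: power2_diff)
      moreover have "0 \<le> \<bar>y\<bar> * \<bar>y'\<bar>" by simp
      ultimately show ?thesis unfolding abs_mult by linarith
    qed
    have \<rho>u: "loc_integrable (\<lambda>t x. \<rho> i t x * u i t x)" if i: "i \<in> I" for i
      by (rule loc_integrable_bound[OF loc_integrable_add[OF \<rho>2[OF i] u2[OF i]] joint_measurable_mult[OF jm(4)[OF i] jm(1)[OF i]] prod2])
    \<comment> \<open>Young splits the product into \<rho>^4 and u^2; the first is integrable thanks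
      to the stage just completed.\<close>
    have \<rho>\<rho>u: "loc_integrable (\<lambda>t x. (\<rho> i t x)\<^sup>2 * u i t x)" if i: "i \<in> I" for i
    proof (rule loc_integrable_bound[OF loc_integrable_add[OF \<rho>4l[OF i] u2[OF i]] joint_measurable_mult[OF joint_measurable_power[OF jm(4)[OF i]] jm(1)[OF i]]])
      show "\<bar>(\<rho> i t x)\<^sup>2 * u i t x\<bar> \<le> \<rho> i t x ^ 4 + (u i t x)\<^sup>2" for t x
        using prod2[of "(\<rho> i t x)\<^sup>2" "u i t x"] by simp
    qed
    define Fu where "Fu i t x = a * (u i t x)\<^sup>2 - b * u i t x ^ 3 + v i t x - w i t x + J * one t x
       - k1 * (c * one t x + \<gamma> * \<rho> i t x + \<delta> * (\<rho> i t x)\<^sup>2) * u i t x + (\<Sum>j\<in>I. P * (u j t x - u i t x))" for i t x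
    \<comment> \<open>Since u vanishes outside \<Omega>, the cut-off on the constant c disappears in
      the product with u.\<close>
    have mid: "loc_integrable (\<lambda>t x. k1 * (c * one t x + \<gamma> * \<rho> i t x + \<delta> * (\<rho> i t x)\<^sup>2) * u i t x)" if i: "i \<in> I" for i
    proof -
      have "k1 * (c * one t x + \<gamma> * \<rho> i t x + \<delta> * (\<rho> i t x)\<^sup>2) * u i t x
        = k1 * (c * u i t x + \<gamma> * (\<rho> i t x * u i t x) + \<delta> * ((\<rho> i t x)\<^sup>2 * u i t x))" for t x
        using one1[of x t] zero(1)[OF i, of x t] by (cases "x \<in> \<Omega>") (simp_all add: algebra_simps)
      moreover have "loc_integrable (\<lambda>t x. k1 * (c * u i t x + \<gamma> * (\<rho> i t x * u i t x) + \<delta> * ((\<rho> i t x)\<^sup>2 * u i t x)))"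
        by (intro loc_integrable_cmult loc_integrable_add tiu(3) \<rho>u \<rho>\<rho>u i)
      ultimately show ?thesis by (simp only:)
    qed
    have Ful: "loc_integrable (Fu i)" if i: "i \<in> I" for i
      unfolding Fu_def
      by (intro loc_integrable_add loc_integrable_diff mid[OF i] loc_integrable_cmult loc_integrable_sum u2 u3 onel tiu(3) tiv(3) tiw(3) i)
    have Fum: "joint_measurable (Fu i)" if i: "i \<in> I" for i
      unfolding Fu_def by (intro joint_measurable_add joint_measurable_diff joint_measurable_sum joint_measurable_mult
        joint_measurable_const joint_measurable_power onem jm i)
    have Fur: "rep \<Omega> (F_u p m (g t) i) (Fu i t)" if i: "i \<in> I" and t: "t \<ge> 0" for i t
    proof -
      have 1: "rep \<Omega> (\<lambda>x. hr_a p * (U (g t) i x)^2) (\<lambda>x. a * (u i t x)\<^sup>2)" unfolding a_def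
        by (rule rep_cmult[OF rep_power[OF ru[OF i t]]]) simp
      have 2: "rep \<Omega> (\<lambda>x. hr_b p * (U (g t) i x)^3) (\<lambda>x. b * u i t x ^ 3)" unfolding b_def
        by (rule rep_cmult[OF rep_power[OF ru[OF i t]]]) simp
      have 3: "rep \<Omega> (\<lambda>x. hr_Je p) (\<lambda>x. J * one t x)" unfolding J_def one_def by (rule rep_const[OF \<Omega>(1)])
      have 4: "rep \<Omega> (\<lambda>x. hr_c p) (\<lambda>x. c * one t x)" unfolding c_def one_def by (rule rep_const[OF \<Omega>(1)])
      have 5: "rep \<Omega> (\<lambda>x. hr_delta p * (Rh (g t) i x)^2) (\<lambda>x. \<delta> * (\<rho> i t x)\<^sup>2)" unfolding \<delta>_def
        by (rule rep_cmult[OF rep_power[OF r\<rho>[OF i t]]]) simp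
      have 6: "rep \<Omega> (\<lambda>x. hr_gamma p * Rh (g t) i x) (\<lambda>x. \<gamma> * \<rho> i t x)" unfolding \<gamma>_def
        by (rule rep_cmult[OF r\<rho>[OF i t]])
      have 7: "rep \<Omega> (\<lambda>x. hr_k1 p * (hr_c p + hr_gamma p * Rh (g t) i x + hr_delta p * (Rh (g t) i x)^2))
         (\<lambda>x. k1 * (c * one t x + \<gamma> * \<rho> i t x + \<delta> * (\<rho> i t x)\<^sup>2))" unfolding k1_def
        by (rule rep_cmult[OF rep_add[OF rep_add[OF 4 6] 5]])
      have 8: "rep \<Omega> (\<lambda>x. \<Sum>j=1..m. hr_P p * (U (g t) j x - U (g t) i x)) (\<lambda>x. \<Sum>j\<in>I. P * (u j t x - u i t x))"
        unfolding P_def I_def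
        by (rule rep_sum[OF rep_cmult[OF rep_diff[OF ru[OF _ t] ru[OF i t]]]]) (simp add: I_def)
      show ?thesis unfolding F_u_def Fu_def
        by (rule rep_add[OF rep_diff[OF rep_add[OF rep_diff[OF rep_add[OF rep_diff[OF 1 2] rv[OF i t]] rw[OF i t]] 3] rep_mult[OF 7 ru[OF i t]]] 8])
    qed
    have enu: "energy (u i) (Fu i)" if i: "i \<in> I" for i
    proof (rule track_energy_parabolic[where F="\<lambda>t. F_u p m (g t) i" and \<eta>=\<eta>1, OF \<Omega> _ u[OF i] _ _ Fur[OF i] Ful[OF i] Fum[OF i]])
      show "AE t in lebesgue_on {0..T}. H1 \<Omega> (U (g t) i)" if "T > 0" for T
        using reg(1)[OF i that] by eventually_elim simp
    qed (use reg(2)[OF i] weak(1)[OF i] pos in \<open>simp_all add: \<eta>1_def\<close>)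
    define Gu where "Gu t x = (\<Sum>i\<in>I. Cu * one t x + 4 / b * ((v i t x)\<^sup>2 + (w i t x)\<^sup>2))" for t x
    have Gul: "loc_integrable Gu" unfolding Gu_def
      by (intro loc_integrable_sum loc_integrable_add loc_integrable_cmult onel v2l w2l)
    have pwu: "(\<Sum>i\<in>I. Fu i t x * (4 * soft_clip (eps n) (u i t x) ^ 3)) \<le> Gu t x - L * (\<Sum>i\<in>I. u i t x * (4 * soft_clip (eps n) (u i t x) ^ 3))" for n t x
    proof -
      \<comment> \<open>The reaction without coupling: \<open>point_u\<close> applies to each i
        separately, and the coupling is dropped by its sign after summation.\<close>
      define B where "B i = a * (u i t x)\<^sup>2 - b * u i t x ^ 3 + v i t x - w i t x + J * one t x
       - k1 * (c * one t x + \<gamma> * \<rho> i t x + \<delta> * (\<rho> i t x)\<^sup>2) * u i t x" for i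
      have "(\<Sum>i\<in>I. Fu i t x * (4 * soft_clip (eps n) (u i t x) ^ 3)) =
         (\<Sum>i\<in>I. B i * (4 * soft_clip (eps n) (u i t x) ^ 3)) +
         (\<Sum>i\<in>I. (\<Sum>j\<in>I. P * (u j t x - u i t x)) * (4 * soft_clip (eps n) (u i t x) ^ 3))"
        unfolding Fu_def B_def[symmetric] distrib_right by (rule sum.distrib)
      also have "\<dots> \<le> (\<Sum>i\<in>I. B i * (4 * soft_clip (eps n) (u i t x) ^ 3))"
        using coup[of P "\<lambda>i. u i t x" n] pos by simp
      also have "\<dots> \<le> (\<Sum>i\<in>I. (Cu * one t x + 4 / b * ((v i t x)\<^sup>2 + (w i t x)\<^sup>2)) - L * (u i t x * (4 * soft_clip (eps n) (u i t x) ^ 3)))"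
      proof (rule sum_mono)
        fix i assume i: "i \<in> I"
        show "B i * (4 * soft_clip (eps n) (u i t x) ^ 3) \<le> (Cu * one t x + 4 / b * ((v i t x)\<^sup>2 + (w i t x)\<^sup>2)) - L * (u i t x * (4 * soft_clip (eps n) (u i t x) ^ 3))"
        proof (cases "x \<in> \<Omega>")
          case True
          show ?thesis using pu[OF clip, where u="u i t x" and v="v i t x" and w="w i t x" and \<rho>="\<rho> i t x"] one1[OF True]
            by (simp only: B_def mult_1_right)
        next
          case False
          then show ?thesis using zero[OF i] one0 by (simp add: clip0)
        qed
      qed
      also have "\<dots> = Gu t x - L * (\<Sum>i\<in>I. u i t x * (4 * soft_clip (eps n) (u i t x) ^ 3))"
        unfolding Gu_def sum_distrib_left sum_subtractf ..
      finally show ?thesis .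
    qed
    note SU = truncation_stage[where f=u and F=Fu and G=Gu and I=I and c=L, OF truncation_4 _ _ finI enu jm(1) tiu(1) tiu(3) Ful Gul pwu u4i]
    have u4t: "integrable lborel (\<lambda>x. u i t x ^ 4)" if "i \<in> I" "t \<ge> 0" for i t by (rule SU(1)) (use that L1 in auto)
    have Uineq: "(\<Sum>i\<in>I. \<integral>x. u i T x ^ 4 \<partial>lborel) - (\<Sum>i\<in>I. \<integral>x. u i s x ^ 4 \<partial>lborel)
        \<le> strip_integral s T Gu - L * 4 * (\<Sum>i\<in>I. strip_integral s T (\<lambda>t x. u i t x ^ 4))" if "0 \<le> s" "s \<le> T" for s T
      by (rule SU(3)) (use that L1 in auto)
    \<comment> \<open>The integrand of \<open>lyap\<close>, so that Y and its time integral both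
      come from one function on space-time.\<close>
    define y where "y t x = (\<Sum>i\<in>I. u i t x ^ 4) + K * ((\<Sum>i\<in>I. (v i t x)\<^sup>2) + (\<Sum>i\<in>I. (w i t x)\<^sup>2)) + (\<Sum>i\<in>I. \<rho> i t x ^ 4)" for t x
    have yl: "loc_integrable y" unfolding y_def
      by (intro loc_integrable_add loc_integrable_cmult loc_integrable_sum u4 v2l w2l \<rho>4l)
    define Y where "Y t = (\<integral>x. y t x \<partial>lborel)" for t
    have Yeq: "Y t = (\<Sum>i\<in>I. \<integral>x. u i t x ^ 4 \<partial>lborel) + K * ((\<Sum>i\<in>I. \<integral>x. (v i t x)\<^sup>2 \<partial>lborel) + (\<Sum>i\<in>I. \<integral>x. (w i t x)\<^sup>2 \<partial>lborel))
        + (\<Sum>i\<in>I. \<integral>x. \<rho> i t x ^ 4 \<partial>lborel)" if t: "t \<ge> 0" for t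
      unfolding Y_def y_def using u4t[OF _ t] tiv(2)[OF _ t] tiw(2)[OF _ t] \<rho>4t[OF _ t]
      by simp
    \<comment> \<open>Stated for any state represented by the versions at time t: it is applied to g
      t, and at time 0 also to the datum g0.\<close>
    have Ylyap: "Y t = lyap \<Omega> m K h" if t: "t \<ge> 0"
      and rh: "\<And>i. i \<in> I \<Longrightarrow> rep \<Omega> (U h i) (u i t)" "\<And>i. i \<in> I \<Longrightarrow> rep \<Omega> (V h i) (v i t)"
        "\<And>i. i \<in> I \<Longrightarrow> rep \<Omega> (W h i) (w i t)" "\<And>i. i \<in> I \<Longrightarrow> rep \<Omega> (Rh h i) (\<rho> i t)" for t h
    proof -
      have "(\<integral>x. (U h i x) ^ 4 \<partial>lebesgue_on \<Omega>) = (\<integral>x. u i t x ^ 4 \<partial>lborel)"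
        "(\<integral>x. (V h i x)\<^sup>2 \<partial>lebesgue_on \<Omega>) = (\<integral>x. (v i t x)\<^sup>2 \<partial>lborel)"
        "(\<integral>x. (W h i x)\<^sup>2 \<partial>lebesgue_on \<Omega>) = (\<integral>x. (w i t x)\<^sup>2 \<partial>lborel)"
        "(\<integral>x. (Rh h i x) ^ 4 \<partial>lebesgue_on \<Omega>) = (\<integral>x. \<rho> i t x ^ 4 \<partial>lborel)" if "i \<in> I" for i
        by (rule rep_integral[OF \<Omega>(1) rep_power[OF rh(1)[OF that]]], simp,
            rule rep_integral[OF \<Omega>(1) rep_power[OF rh(2)[OF that]]], simp,
            rule rep_integral[OF \<Omega>(1) rep_power[OF rh(3)[OF that]]], simp,
            rule rep_integral[OF \<Omega>(1) rep_power[OF rh(4)[OF that]]], simp)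
      then show ?thesis unfolding Yeq[OF t] lyap_def I_def[symmetric] by (simp cong: sum.cong)
    qed
    have G: "in_G \<Omega> m (g t)" if t: "t \<ge> 0" for t
      unfolding in_G_def I_def[symmetric]
    proof (intro ballI conjI)
      fix i assume i: "i \<in> I"
      show "Lp \<Omega> 4 (U (g t) i)" using repD(1)[OF ru[OF i t]] rep_integrable[OF \<Omega>(1) rep_power[OF ru[OF i t], of 4]] u4t[OF i t] by (simp add: Lp_4)
      show "Lp \<Omega> 4 (Rh (g t) i)" using repD(1)[OF r\<rho>[OF i t]] rep_integrable[OF \<Omega>(1) rep_power[OF r\<rho>[OF i t], of 4]] \<rho>4t[OF i t] by (simp add: Lp_4)
      show "Lp \<Omega> 2 (V (g t) i)" by (rule trackD(3)[OF v[OF i] t])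
      show "Lp \<Omega> 2 (W (g t) i)" by (rule trackD(3)[OF w[OF i] t])
    qed
    have Yint: "set_integrable lborel {s..t} Y" if "0 \<le> s" for s t
      using lborel_pair.integrable_fst'[OF loc_integrable_strip[OF yl that, of t]]
      by (simp add: set_integrable_def Y_def)
    have Yineq: "Y t - Y s \<le> (LINT \<tau>:{s..t}|lborel. M - \<mu> * Y \<tau>)" if s: "0 \<le> s" "s \<le> t" for s t
    proof -
      \<comment> \<open>A, Bv, Bw and R are the space-time integrals of the four parts of the
        functional and D is the space-time volume; the inequalities below are linear in
        them.\<close>
      define A where "A = (\<Sum>i\<in>I. strip_integral s t (\<lambda>t x. u i t x ^ 4))"
      define Bv where "Bv = (\<Sum>i\<in>I. strip_integral s t (\<lambda>t x. (v i t x)\<^sup>2))"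
      define Bw where "Bw = (\<Sum>i\<in>I. strip_integral s t (\<lambda>t x. (w i t x)\<^sup>2))"
      define R where "R = (\<Sum>i\<in>I. strip_integral s t (\<lambda>t x. \<rho> i t x ^ 4))"
      define D where "D = strip_integral s t one"
      have nn: "0 \<le> A" "0 \<le> Bv" "0 \<le> Bw" "0 \<le> R"
        unfolding A_def Bv_def Bw_def R_def by (auto intro!: sum_nonneg strip_integral_nonneg)
      have De: "D = (t - s) * measure lborel \<Omega>" unfolding D_def one_def by (rule strip_integral_indicator[OF \<Omega> s])
      have card: "card I = m" by (simp add: I_def)
      have eGv: "strip_integral s t Gv = Cv * (real m * D + A)"
      proof -
        have "strip_integral s t Gv = (\<Sum>i\<in>I. strip_integral s t (\<lambda>t x. Cv * (one t x + u i t x ^ 4)))"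
          unfolding Gv_def by (intro strip_integral_sum loc_integrable_cmult loc_integrable_add onel u4 s)
        also have "\<dots> = (\<Sum>i\<in>I. Cv * (D + strip_integral s t (\<lambda>t x. u i t x ^ 4)))"
          unfolding strip_integral_cmult D_def using strip_integral_add[OF onel u4 s(1)] by (intro sum.cong) auto
        finally show ?thesis unfolding A_def sum_distrib_left[symmetric] sum.distrib by (simp add: card)
      qed
      have eGw: "strip_integral s t Gw = Cw * (real m * D + A)"
      proof -
        have "strip_integral s t Gw = (\<Sum>i\<in>I. strip_integral s t (\<lambda>t x. Cw * (one t x + u i t x ^ 4)))"
          unfolding Gw_def by (intro strip_integral_sum loc_integrable_cmult loc_integrable_add onel u4 s)
        also have "\<dots> = (\<Sum>i\<in>I. Cw * (D + strip_integral s t (\<lambda>t x. u i t x ^ 4)))"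
          unfolding strip_integral_cmult D_def using strip_integral_add[OF onel u4 s(1)] by (intro sum.cong) auto
        finally show ?thesis unfolding A_def sum_distrib_left[symmetric] sum.distrib by (simp add: card)
      qed
      have eGr: "strip_integral s t Gr = Cr * A"
      proof -
        have "strip_integral s t Gr = (\<Sum>i\<in>I. strip_integral s t (\<lambda>t x. Cr * u i t x ^ 4))"
          unfolding Gr_def by (intro strip_integral_sum loc_integrable_cmult u4 s)
        then show ?thesis unfolding strip_integral_cmult A_def sum_distrib_left .
      qed
      have eGu: "strip_integral s t Gu = real m * (Cu * D) + 4 / b * (Bv + Bw)"
      proof -
        have "strip_integral s t Gu = (\<Sum>i\<in>I. strip_integral s t (\<lambda>t x. Cu * one t x + 4 / b * ((v i t x)\<^sup>2 + (w i t x)\<^sup>2)))"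
          unfolding Gu_def by (intro strip_integral_sum loc_integrable_cmult loc_integrable_add onel v2l w2l s)
        also have "\<dots> = (\<Sum>i\<in>I. Cu * D + 4 / b * (strip_integral s t (\<lambda>t x. (v i t x)\<^sup>2) + strip_integral s t (\<lambda>t x. (w i t x)\<^sup>2)))"
        proof (rule sum.cong[OF refl])
          fix i assume i: "i \<in> I"
          show "strip_integral s t (\<lambda>t x. Cu * one t x + 4 / b * ((v i t x)\<^sup>2 + (w i t x)\<^sup>2)) =
             Cu * D + 4 / b * (strip_integral s t (\<lambda>t x. (v i t x)\<^sup>2) + strip_integral s t (\<lambda>t x. (w i t x)\<^sup>2))"
            unfolding strip_integral_add[OF loc_integrable_cmult[OF onel] loc_integrable_cmult[OF loc_integrable_add[OF v2l[OF i] w2l[OF i]]] s(1)]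
              strip_integral_cmult strip_integral_add[OF v2l[OF i] w2l[OF i] s(1)] D_def ..
        qed
        also have "\<dots> = real m * (Cu * D) + 4 / b * (Bv + Bw)"
          unfolding Bv_def Bw_def by (simp only: sum.distrib sum_constant card sum_distrib_left[symmetric])
        finally show ?thesis .
      qed
      have eY: "strip_integral s t y = A + K * (Bv + Bw) + R"
      proof -
        have sl: "loc_integrable (\<lambda>t x. \<Sum>i\<in>I. u i t x ^ 4)" "loc_integrable (\<lambda>t x. \<Sum>i\<in>I. (v i t x)\<^sup>2)"
          "loc_integrable (\<lambda>t x. \<Sum>i\<in>I. (w i t x)\<^sup>2)" "loc_integrable (\<lambda>t x. \<Sum>i\<in>I. \<rho> i t x ^ 4)"
          by (intro loc_integrable_sum u4 v2l w2l \<rho>4l; assumption)+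
        have sums: "strip_integral s t (\<lambda>t x. \<Sum>i\<in>I. u i t x ^ 4) = (\<Sum>i\<in>I. strip_integral s t (\<lambda>t x. u i t x ^ 4))"
          "strip_integral s t (\<lambda>t x. \<Sum>i\<in>I. (v i t x)\<^sup>2) = (\<Sum>i\<in>I. strip_integral s t (\<lambda>t x. (v i t x)\<^sup>2))"
          "strip_integral s t (\<lambda>t x. \<Sum>i\<in>I. (w i t x)\<^sup>2) = (\<Sum>i\<in>I. strip_integral s t (\<lambda>t x. (w i t x)\<^sup>2))"
          "strip_integral s t (\<lambda>t x. \<Sum>i\<in>I. \<rho> i t x ^ 4) = (\<Sum>i\<in>I. strip_integral s t (\<lambda>t x. \<rho> i t x ^ 4))"
          by (intro strip_integral_sum u4 v2l w2l \<rho>4l s; assumption)+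
        note vw = loc_integrable_cmult[OF loc_integrable_add[OF sl(2,3)], of K]
        show ?thesis unfolding y_def A_def Bv_def Bw_def R_def
          unfolding strip_integral_add[OF loc_integrable_add[OF sl(1) vw] sl(4) s(1)] strip_integral_add[OF sl(1) vw s(1)]
            strip_integral_cmult strip_integral_add[OF sl(2,3) s(1)] sums ..
      qed
      define Xu where "Xu t = (\<Sum>i\<in>I. \<integral>x. u i t x ^ 4 \<partial>lborel)" for t
      define Xv where "Xv t = (\<Sum>i\<in>I. \<integral>x. (v i t x)\<^sup>2 \<partial>lborel)" for t
      define Xw where "Xw t = (\<Sum>i\<in>I. \<integral>x. (w i t x)\<^sup>2 \<partial>lborel)" for t
      define Xr where "Xr t = (\<Sum>i\<in>I. \<integral>x. \<rho> i t x ^ 4 \<partial>lborel)" for t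
      have i1: "Xu t - Xu s \<le> real m * (Cu * D) + 4 / b * (Bv + Bw) - L * 4 * A"
        using Uineq[OF s] unfolding eGu A_def[symmetric] Xu_def .
      have i2: "Xv t - Xv s \<le> Cv * (real m * D + A) - Bv"
        using Vineq[OF s] unfolding eGv Bv_def[symmetric] Xv_def by simp
      have i3: "Xw t - Xw s \<le> Cw * (real m * D + A) - r * Bw"
        using Wineq[OF s] unfolding eGw Bw_def[symmetric] Xw_def by simp
      have i4: "Xr t - Xr s \<le> Cr * A - 2 * k2 * R"
        using Rineq[OF s] unfolding eGr R_def[symmetric] Xr_def by simp
      have t0: "0 \<le> t" using s by simp
      have "Y t - Y s = (Xu t - Xu s) + K * ((Xv t - Xv s) + (Xw t - Xw s)) + (Xr t - Xr s)"
        unfolding Yeq[OF t0] Yeq[OF s(1)] Xu_def Xv_def Xw_def Xr_def by (simp add: algebra_simps)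
      also have "\<dots> \<le> (real m * (Cu * D) + 4 / b * (Bv + Bw) - L * 4 * A) +
          K * ((Cv * (real m * D + A) - Bv) + (Cw * (real m * D + A) - r * Bw)) + (Cr * A - 2 * k2 * R)"
        using i1 i2 i3 i4 K0 by (intro add_mono mult_left_mono) auto
      also have "\<dots> = real m * (Cu + K * (Cv + Cw)) * D + (4 / b - K) * Bv + (4 / b - K * r) * Bw
          + (K * (Cv + Cw) + Cr - 4 * L) * A - 2 * k2 * R"
        by (simp add: algebra_simps add_divide_distrib)
      \<comment> \<open>The choices of K and L enter here: the coefficients of Bv, Bw and A are all
        at most - 1.\<close>
      also have "\<dots> \<le> real m * (Cu + K * (Cv + Cw)) * D + (- 1) * Bv + (- 1) * Bw + (- 1) * A - 2 * k2 * R"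
      proof -
        have "K * (Cv + Cw) + Cr - 4 * L \<le> - 1"
        proof -
          have "K * (Cv + Cw) + Cr = L - 1" by (simp add: L_def)
          then show ?thesis using L1 by linarith
        qed
        then show ?thesis using K1 nn by (intro add_mono diff_right_mono mult_right_mono order_refl)
      qed
      also have "\<dots> \<le> real m * (Cu + K * (Cv + Cw)) * D - \<mu> * (A + K * (Bv + Bw) + R)"
      proof -
        have "\<mu> \<le> 1" "\<mu> \<le> 2 * k2" by (auto simp: \<mu>_def)
        from mult_right_mono[OF this(1) nn(1)] mult_right_mono[OF this(2) nn(4)]
        have "\<mu> * A \<le> 1 * A" "\<mu> * R \<le> 2 * k2 * R" .
        have "\<mu> * K \<le> 1 / K * K" using K0 by (intro mult_right_mono) (auto simp: \<mu>_def)
        then have "\<mu> * K \<le> 1" using K0 by simp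
        then have "\<mu> * K * (Bv + Bw) \<le> 1 * (Bv + Bw)" using nn by (intro mult_right_mono) auto
        with \<open>\<mu> * A \<le> 1 * A\<close> \<open>\<mu> * R \<le> 2 * k2 * R\<close>
        have "\<mu> * A + \<mu> * K * (Bv + Bw) + \<mu> * R \<le> 1 * A + 1 * (Bv + Bw) + 2 * k2 * R"
          by (intro add_mono)
        then have "\<mu> * (A + K * (Bv + Bw) + R) \<le> A + (Bv + Bw) + 2 * k2 * R"
          by (simp add: distrib_left mult.assoc)
        moreover have "z + (- 1) * bv + (- 1) * bw + (- 1) * x - e \<le> z - y" if "y \<le> x + (bv + bw) + e" for z bv bw x y e :: real
          using that by simp
        ultimately show ?thesis by blast
      qed
      also have "\<dots> \<le> M * (t - s) - \<mu> * (A + K * (Bv + Bw) + R)"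
        using s unfolding De M_def by (simp add: algebra_simps)
      also have "\<dots> = (LINT \<tau>:{s..t}|lborel. M - \<mu> * Y \<tau>)"
      proof -
        have "(LINT \<tau>:{s..t}|lborel. Y \<tau>) = A + K * (Bv + Bw) + R"
          using strip_integral_Fubini[OF yl s(1), of t] eY by (simp add: Y_def)
        moreover have Mc: "set_integrable lborel {s..t} (\<lambda>_. M)"
          using integrable_real_indicator[of "{s..t}" lborel] by (simp add: set_integrable_def emeasure_lborel_Icc_eq)
        moreover have "(LINT \<tau>:{s..t}|lborel. M) = M * (t - s)" using s by (simp add: set_lebesgue_integral_def mult.commute)
        ultimately show ?thesis
          using set_integral_diff(2)[OF Mc set_integrable_mult_right[OF Yint[OF s(1), of t], of \<mu>]]
          by simp
      qed
      finally show ?thesis .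
    qed
    have "Y 0 = lyap \<Omega> m K g0" by (rule Ylyap[OF _ r0]) simp
    moreover have "Y t = lyap \<Omega> m K (g t)" if "t \<ge> 0" for t by (rule Ylyap[OF that ru[OF _ that] rv[OF _ that] rw[OF _ that] r\<rho>[OF _ that]])
    ultimately show ?thesis using G Yint Yineq by (intro exI[of _ Y]) auto
  qed
  show ?thesis using K0 M0 \<mu>0 main by blast
qed

section \<open>Comparison of the functional with the norm of G\<close>

lemma Lp_norm_4_power: "(Lp_norm \<Omega> 4 f) ^ 4 = (\<integral>x. f x ^ 4 \<partial>lebesgue_on \<Omega>)"
proof -
  define A where "A = (\<integral>x. f x ^ 4 \<partial>lebesgue_on \<Omega>)"
  have A: "0 \<le> A" by (simp add: A_def)
  have "(A powr (1/4)) ^ 4 = A"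
  proof (cases "A = 0")
    case False
    then have "(A powr (1/4)) ^ 4 = (A powr (1/4)) powr (real 4)" using A by (subst powr_realpow) auto
    then show ?thesis using A by (simp add: powr_powr)
  qed simp
  then show ?thesis by (simp add: Lp_norm_def abs_powr_4 A_def)
qed

lemma Lp_norm_2_power: "(Lp_norm \<Omega> 2 f)\<^sup>2 = (\<integral>x. (f x)\<^sup>2 \<partial>lebesgue_on \<Omega>)"
  using L2_dist_square[of \<Omega> f "\<lambda>_. 0"] by (simp add: L2_dist_def)

lemma Lp_norm_nonneg: "0 \<le> Lp_norm \<Omega> r f"
  by (simp add: Lp_norm_def)

lemma Lp_norm_le_G_norm:
  assumes "i \<in> {1..m}"
  shows "Lp_norm \<Omega> 4 (U g i) \<le> G_norm \<Omega> m g" "Lp_norm \<Omega> 2 (V g i) \<le> G_norm \<Omega> m g"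
    "Lp_norm \<Omega> 2 (W g i) \<le> G_norm \<Omega> m g" "Lp_norm \<Omega> 4 (Rh g i) \<le> G_norm \<Omega> m g"
proof -
  define N where "N i = Lp_norm \<Omega> 4 (U g i) + Lp_norm \<Omega> 2 (V g i) + Lp_norm \<Omega> 2 (W g i) + Lp_norm \<Omega> 4 (Rh g i)" for i
  note n = Lp_norm_nonneg[of \<Omega> 4 "U g i"] Lp_norm_nonneg[of \<Omega> 2 "V g i"] Lp_norm_nonneg[of \<Omega> 2 "W g i"] Lp_norm_nonneg[of \<Omega> 4 "Rh g i"]
  have "N i \<le> (\<Sum>i=1..m. N i)" using assms by (intro member_le_sum) (auto simp: N_def Lp_norm_nonneg)
  then have "N i \<le> G_norm \<Omega> m g" by (simp add: G_norm_def N_def)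
  then show "Lp_norm \<Omega> 4 (U g i) \<le> G_norm \<Omega> m g" "Lp_norm \<Omega> 2 (V g i) \<le> G_norm \<Omega> m g"
    "Lp_norm \<Omega> 2 (W g i) \<le> G_norm \<Omega> m g" "Lp_norm \<Omega> 4 (Rh g i) \<le> G_norm \<Omega> m g"
    using n unfolding N_def by linarith+
qed

text \<open>Bounds the initial functional by the radius of B alone, so that one entry time serves
  all of B.\<close>

lemma lyap_le:
  assumes K: "K \<ge> 0" and G: "G_norm \<Omega> m g \<le> C"
  shows "lyap \<Omega> m K g \<le> real m * (C ^ 4 + K * (C\<^sup>2 + C\<^sup>2) + C ^ 4)"
proof -
  note le = order_trans[OF Lp_norm_le_G_norm(1) G] order_trans[OF Lp_norm_le_G_norm(2) G]
    order_trans[OF Lp_norm_le_G_norm(3) G] order_trans[OF Lp_norm_le_G_norm(4) G]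
  have u: "(\<Sum>i=1..m. \<integral>x. (U g i x) ^ 4 \<partial>lebesgue_on \<Omega>) \<le> real m * C ^ 4"
    using sum_bounded_above[of "{1..m}" "\<lambda>i. \<integral>x. (U g i x) ^ 4 \<partial>lebesgue_on \<Omega>" "C ^ 4"]
      power_mono[OF le(1) Lp_norm_nonneg, of _ 4] by (simp add: Lp_norm_4_power)
  have v: "(\<Sum>i=1..m. \<integral>x. (V g i x)\<^sup>2 \<partial>lebesgue_on \<Omega>) \<le> real m * C\<^sup>2"
    using sum_bounded_above[of "{1..m}" "\<lambda>i. \<integral>x. (V g i x)\<^sup>2 \<partial>lebesgue_on \<Omega>" "C\<^sup>2"]
      power_mono[OF le(2) Lp_norm_nonneg, of _ 2] by (simp add: Lp_norm_2_power)
  have w: "(\<Sum>i=1..m. \<integral>x. (W g i x)\<^sup>2 \<partial>lebesgue_on \<Omega>) \<le> real m * C\<^sup>2"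
    using sum_bounded_above[of "{1..m}" "\<lambda>i. \<integral>x. (W g i x)\<^sup>2 \<partial>lebesgue_on \<Omega>" "C\<^sup>2"]
      power_mono[OF le(3) Lp_norm_nonneg, of _ 2] by (simp add: Lp_norm_2_power)
  have r: "(\<Sum>i=1..m. \<integral>x. (Rh g i x) ^ 4 \<partial>lebesgue_on \<Omega>) \<le> real m * C ^ 4"
    using sum_bounded_above[of "{1..m}" "\<lambda>i. \<integral>x. (Rh g i x) ^ 4 \<partial>lebesgue_on \<Omega>" "C ^ 4"]
      power_mono[OF le(4) Lp_norm_nonneg, of _ 4] by (simp add: Lp_norm_4_power)
  have "lyap \<Omega> m K g \<le> real m * C ^ 4 + K * (real m * C\<^sup>2 + real m * C\<^sup>2) + real m * C ^ 4"
    unfolding lyap_def using u v w r K by (intro add_mono mult_left_mono) auto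
  then show ?thesis by (simp add: algebra_simps)
qed

text \<open>Each norm y satisfies y <= 1 + y^4 and y <= 1 + y^2, which avoids roots; the division by
  K undoes the weight of v^2 and w^2. Hence sublevel sets of the functional are bounded in
  G.\<close>

lemma G_norm_le:
  assumes K: "K > 0" and D: "lyap \<Omega> m K g \<le> D"
  shows "G_norm \<Omega> m g \<le> real m * (2 * (1 + D) + 2 * (1 + D / K))"
proof -
  define su sv sw sr where "su = (\<Sum>i=1..m. \<integral>x. (U g i x) ^ 4 \<partial>lebesgue_on \<Omega>)"
    and "sv = (\<Sum>i=1..m. \<integral>x. (V g i x)\<^sup>2 \<partial>lebesgue_on \<Omega>)"
    and "sw = (\<Sum>i=1..m. \<integral>x. (W g i x)\<^sup>2 \<partial>lebesgue_on \<Omega>)"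
    and "sr = (\<Sum>i=1..m. \<integral>x. (Rh g i x) ^ 4 \<partial>lebesgue_on \<Omega>)"
  have nn: "0 \<le> su" "0 \<le> sv" "0 \<le> sw" "0 \<le> sr" unfolding su_def sv_def sw_def sr_def by (auto intro!: sum_nonneg)
  have s: "su + K * (sv + sw) + sr \<le> D" using D unfolding lyap_def su_def sv_def sw_def sr_def .
  have Kn: "0 \<le> K * (sv + sw)" using nn K by simp
  have b: "su \<le> D" "sr \<le> D" using s nn Kn by linarith+
  have "K * (sv + sw) \<le> D" using s nn by linarith
  then have "sv + sw \<le> D / K" using K by (simp add: field_simps)
  then have b': "sv \<le> D / K" "sw \<le> D / K" using nn by linarith+
  have p4: "y \<le> 1 + y ^ 4" and p2: "y \<le> 1 + y\<^sup>2" for y :: real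
  proof -
    show "y \<le> 1 + y\<^sup>2" using abs_le_1_plus_square[of y] by linarith
    have "0 \<le> (y\<^sup>2 - 1/2)\<^sup>2" by simp
    then have "y\<^sup>2 - 1/2 \<le> y ^ 4" by (simp add: power2_diff power_divide)
    moreover have "y \<le> 1/4 + y\<^sup>2" using zero_le_power2[of "y - 1/2"] by (simp add: power2_diff power_divide)
    ultimately show "y \<le> 1 + y ^ 4" by linarith
  qed
  have "G_norm \<Omega> m g \<le> (\<Sum>i=1..m. (1 + D) + (1 + D / K) + (1 + D / K) + (1 + D))"
    unfolding G_norm_def
  proof (rule sum_mono)
    fix i assume i: "i \<in> {1..m}"
    have "(\<integral>x. (U g i x) ^ 4 \<partial>lebesgue_on \<Omega>) \<le> su" unfolding su_def using i by (intro member_le_sum) auto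
    then have 1: "Lp_norm \<Omega> 4 (U g i) \<le> 1 + D" using p4[of "Lp_norm \<Omega> 4 (U g i)"] b unfolding Lp_norm_4_power by linarith
    have "(\<integral>x. (V g i x)\<^sup>2 \<partial>lebesgue_on \<Omega>) \<le> sv" unfolding sv_def using i by (intro member_le_sum) auto
    then have 2: "Lp_norm \<Omega> 2 (V g i) \<le> 1 + D / K" using p2[of "Lp_norm \<Omega> 2 (V g i)"] b' unfolding Lp_norm_2_power by linarith
    have "(\<integral>x. (W g i x)\<^sup>2 \<partial>lebesgue_on \<Omega>) \<le> sw" unfolding sw_def using i by (intro member_le_sum) auto
    then have 3: "Lp_norm \<Omega> 2 (W g i) \<le> 1 + D / K" using p2[of "Lp_norm \<Omega> 2 (W g i)"] b' unfolding Lp_norm_2_power by linarith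
    have "(\<integral>x. (Rh g i x) ^ 4 \<partial>lebesgue_on \<Omega>) \<le> sr" unfolding sr_def using i by (intro member_le_sum) auto
    then have 4: "Lp_norm \<Omega> 4 (Rh g i) \<le> 1 + D" using p4[of "Lp_norm \<Omega> 4 (Rh g i)"] b unfolding Lp_norm_4_power by linarith
    show "Lp_norm \<Omega> 4 (U g i) + Lp_norm \<Omega> 2 (V g i) + Lp_norm \<Omega> 2 (W g i) + Lp_norm \<Omega> 4 (Rh g i)
      \<le> (1 + D) + (1 + D / K) + (1 + D / K) + (1 + D)"
      by (intro add_mono 1 2 3 4)
  qed
  then show ?thesis by (simp add: algebra_simps)
qed

lemma lyap_nonneg:
  assumes "K \<ge> 0" shows "0 \<le> lyap \<Omega> m K g"
    and "(\<Sum>i=1..m. \<integral>x. (U g i x) ^ 4 \<partial>lebesgue_on \<Omega>) \<le> lyap \<Omega> m K g"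
proof -
  have "0 \<le> (\<Sum>i=1..m. \<integral>x. (U g i x) ^ 4 \<partial>lebesgue_on \<Omega>)" "0 \<le> (\<Sum>i=1..m. \<integral>x. (Rh g i x) ^ 4 \<partial>lebesgue_on \<Omega>)"
    "0 \<le> K * ((\<Sum>i=1..m. \<integral>x. (V g i x)\<^sup>2 \<partial>lebesgue_on \<Omega>) + (\<Sum>i=1..m. \<integral>x. (W g i x)\<^sup>2 \<partial>lebesgue_on \<Omega>))"
    using assms by (auto intro!: sum_nonneg mult_nonneg_nonneg add_nonneg_nonneg)
  then show "0 \<le> lyap \<Omega> m K g" "(\<Sum>i=1..m. \<integral>x. (U g i x) ^ 4 \<partial>lebesgue_on \<Omega>) \<le> lyap \<Omega> m K g"
    unfolding lyap_def by linarith+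
qed

theorem theorem3p3:
  fixes \<Omega> :: "'a::euclidean_space set"
    and p :: hr_params
    and m :: nat
    and S :: "real \<Rightarrow> 'a hr_state \<Rightarrow> 'a hr_state"
  assumes dim: "DIM('a) \<le> 3"
    and m2: "m \<ge> 2"
    and dom: "open \<Omega>" "connected \<Omega>" "bounded \<Omega>" "\<Omega> \<noteq> {}"
    and lip: "lipschitz_boundary \<Omega>"
    and params: "hr_params_ok p"
    and semiflow: "\<And>g0. in_E \<Omega> m g0 \<Longrightarrow> hr_weak_solution \<Omega> p m g0 (\<lambda>t. S t g0)"
  shows "(\<exists>D>0. \<forall>B. bounded_in_G \<Omega> m B \<longrightarrow>
            (\<exists>TB>1. \<forall>t>TB. \<forall>g0\<in>B.
               (\<forall>i\<in>{1..m}. Lp \<Omega> 4 (U (S t g0) i)) \<and>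
               (\<Sum>i=1..m. \<integral>x. (U (S t g0) i x)^4 \<partial>lebesgue_on \<Omega>) \<le> D))
       \<and> (\<exists>Bh. absorbing_in_G \<Omega> m S Bh)"
proof -
  obtain K M \<mu> where K: "K > 0" and M: "M > 0" and \<mu>: "\<mu> > 0" and est: "\<forall>g0 g. in_G \<Omega> m g0 \<longrightarrow> hr_weak_solution \<Omega> p m g0 g \<longrightarrow>
    (\<exists>Y. Y 0 = lyap \<Omega> m K g0 \<and> (\<forall>t\<ge>0. in_G \<Omega> m (g t) \<and> Y t = lyap \<Omega> m K (g t)) \<and>
      (\<forall>s t. 0 \<le> s \<longrightarrow> s \<le> t \<longrightarrow> set_integrable lborel {s..t} Y \<and> Y t - Y s \<le> (LINT \<tau>:{s..t}|lborel. M - \<mu> * Y \<tau>)))"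
    using hr_estimate[OF dom(1,3) params, of m] by blast
  \<comment> \<open>The level delivered by \<open>absorbing_bound\<close>, which does not mention
    the initial state.\<close>
  define D where "D = 2 * M / \<mu> + M"
  have D: "D > 0" using M \<mu> by (simp add: D_def add_pos_pos)
  have absorb: "\<exists>TB>1. \<forall>t>TB. \<forall>g0\<in>B. in_G \<Omega> m (S t g0) \<and> lyap \<Omega> m K (S t g0) \<le> D" if B: "bounded_in_G \<Omega> m B" for B
  proof -
    obtain C where C: "\<And>g. g \<in> B \<Longrightarrow> G_norm \<Omega> m g \<le> C" and inG: "\<And>g. g \<in> B \<Longrightarrow> in_G \<Omega> m g"
      using B unfolding bounded_in_G_def by blast
    define C' where "C' = real m * (C ^ 4 + K * (C\<^sup>2 + C\<^sup>2) + C ^ 4)"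
    have C': "C' \<ge> 0" using K by (simp add: C'_def)
    \<comment> \<open>The entry time C' / M + 2 exceeds both the C' / M + 1 of
      \<open>absorbing_bound\<close> and the 1 that the statement demands of TB.\<close>
    have "in_G \<Omega> m (S t g0) \<and> lyap \<Omega> m K (S t g0) \<le> D" if t: "t > C' / M + 2" and g0: "g0 \<in> B" for t g0
    proof -
      have "hr_weak_solution \<Omega> p m g0 (\<lambda>t. S t g0)" by (rule semiflow[OF in_G_imp_in_E[OF dom(1,3) inG[OF g0]]])
      then obtain Y where Y0: "Y 0 = lyap \<Omega> m K g0" and Yt: "\<And>t. t \<ge> 0 \<Longrightarrow> in_G \<Omega> m (S t g0) \<and> Y t = lyap \<Omega> m K (S t g0)"
        and Y: "\<And>s t. 0 \<le> s \<Longrightarrow> s \<le> t \<Longrightarrow> set_integrable lborel {s..t} Y \<and> Y t - Y s \<le> (LINT \<tau>:{s..t}|lborel. M - \<mu> * Y \<tau>)"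
        using est inG[OF g0] by blast
      have t0: "t \<ge> 0" using t C' M by (smt (verit) divide_nonneg_pos)
      have "Y t \<le> 2 * M / \<mu> + M"
      proof (rule absorbing_bound[where Y=Y and C=C' and t=t])
        show "Y 0 \<le> C'" unfolding Y0 C'_def using K C[OF g0] by (intro lyap_le) auto
        show "0 \<le> Y \<tau>" if "0 \<le> \<tau>" for \<tau> using Yt[OF that] lyap_nonneg(1)[where K=K and \<Omega>=\<Omega> and m=m] K by simp
      qed (use Y M \<mu> t in auto)
      then show ?thesis using Yt[OF t0] by (simp add: D_def)
    qed
    moreover have "C' / M + 2 > 1" using C' M by (smt (verit) divide_nonneg_pos)
    ultimately show ?thesis by blast
  qed
  have "\<exists>D>0. \<forall>B. bounded_in_G \<Omega> m B \<longrightarrow>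
            (\<exists>TB>1. \<forall>t>TB. \<forall>g0\<in>B.
               (\<forall>i\<in>{1..m}. Lp \<Omega> 4 (U (S t g0) i)) \<and>
               (\<Sum>i=1..m. \<integral>x. (U (S t g0) i x)^4 \<partial>lebesgue_on \<Omega>) \<le> D)"
  proof (rule exI[where x=D], rule conjI[OF D], intro allI impI)
    fix B assume "bounded_in_G \<Omega> m B"
    from absorb[OF this] obtain TB where TB: "TB > 1" "\<And>t g0. t > TB \<Longrightarrow> g0 \<in> B \<Longrightarrow> in_G \<Omega> m (S t g0) \<and> lyap \<Omega> m K (S t g0) \<le> D"
      by blast
    have "(\<forall>i\<in>{1..m}. Lp \<Omega> 4 (U (S t g0) i)) \<and> (\<Sum>i=1..m. \<integral>x. (U (S t g0) i x)^4 \<partial>lebesgue_on \<Omega>) \<le> D"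
      if "t > TB" "g0 \<in> B" for t g0
      using TB(2)[OF that] lyap_nonneg(2)[where K=K and \<Omega>=\<Omega> and m=m and g="S t g0"] K unfolding in_G_def by auto
    then show "\<exists>TB>1. \<forall>t>TB. \<forall>g0\<in>B. (\<forall>i\<in>{1..m}. Lp \<Omega> 4 (U (S t g0) i)) \<and>
               (\<Sum>i=1..m. \<integral>x. (U (S t g0) i x)^4 \<partial>lebesgue_on \<Omega>) \<le> D" using TB(1) by blast
  qed
  \<comment> \<open>A sublevel set of the functional is absorbing: \<open>absorb\<close> shows that
    it is entered, and \<open>G_norm_le\<close> that it is bounded.\<close>
  moreover have "absorbing_in_G \<Omega> m S {g. in_G \<Omega> m g \<and> lyap \<Omega> m K g \<le> D}"
    unfolding absorbing_in_G_def
  proof (intro conjI allI impI)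
    show "bounded_in_G \<Omega> m {g. in_G \<Omega> m g \<and> lyap \<Omega> m K g \<le> D}"
      unfolding bounded_in_G_def using G_norm_le[OF K] by blast
    fix B assume "bounded_in_G \<Omega> m B"
    from absorb[OF this] obtain TB where TB: "TB > 1" "\<And>t g0. t > TB \<Longrightarrow> g0 \<in> B \<Longrightarrow> in_G \<Omega> m (S t g0) \<and> lyap \<Omega> m K (S t g0) \<le> D"
      by blast
    then show "\<exists>T\<ge>0. \<forall>t>T. \<forall>g\<in>B. S t g \<in> {g. in_G \<Omega> m g \<and> lyap \<Omega> m K g \<le> D}"
      by (intro exI[of _ TB]) auto
  qed
  ultimately show ?thesis by blast
qed

end
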